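(* Let $\mathbb{K}$ be a commutative ring with unit and let $P$ be an operadic poset species, with structure morphisms $a$, $\varphi_x$, $\psi_x$. For every finite set $S$ and every partition $\pi\in\Pi(S)$, let $$\rho_\pi: h^{\bullet}(P(\pi)) \otimes \bigotimes_{T\in\pi} h^{\bullet}(P(T)) \longrightarrow h^{\bullet}(P(S))$$ be the composition of $\mathrm{id}\otimes\kappa$, where $\kappa:\bigotimes_{T\in \pi}h^{\bullet}(P(T))\to h^{\bullet}(\prod_{T\in\pi}P(T))$ is the Künneth morphism, with the sum over all $x\in P(S)$ such that $a(x)=\pi$ of the morphisms $$h^{\bullet}(P(\pi))\otimes h^{\bullet}\Big(\prod_{T\in \pi}P(T)\Big) \xrightarrow{\varphi_x^*\otimes\psi_x^*} h^{\bullet}(P_{\leq x}(S))\otimes h^{\bullet}(P_{\geq x}(S)) \xrightarrow{\mu_x} h^\bullet(P(S)).$$ Then the morphisms $\rho_\pi$ give the graded linear species $h^\bullet(P):S\mapsto h^\bullet(P(S))$ the structure of a graded operad of $\mathbb{K}$-modules.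
   Context: Conventions. All posets are finite, all finite sets $S$ are non-empty. Graded $\mathbb{K}$-modules carry the Koszul sign symmetry. A graded operad is a graded linear species $F$ (functor from finite sets and bijections to graded $\mathbb{K}$-modules) with maps $\rho_\pi:F(\pi)\otimes\bigotimes_{T\in\pi}F(T)\to F(S)$ for all partitions $\pi$ of $S$ (viewed as the set of its blocks), equivariant under bijections, unital with respect to distinguished elements $1_s\in F(\{s\})$, and associative for all pairs of partitions $\pi\le\pi'$. Poset cohomology. For a poset $P$, $c^n(P)$ is the free $\mathbb{K}$-module on symbols $[x_0<\cdots<x_n]$ where $x_0<\dots<x_n$ is a chain with $x_0$ a minimal element and $x_n$ a maximal element of $P$; the differential is $d[x_0<\cdots<x_n]=\sum_{i=1}^n(-1)^i\sum_{x_{i-1}<y<x_i}[x_0<\cdots<x_{i-1}<y<x_i<\cdots<x_n]$; $h^\bullet(P)$ is the cohomology of $c^\bullet(P)$. For a morphism of posets $f:P\to Q$ with $f^{-1}(\min Q)\subset\min P$ and $f^{-1}(\max Q)\subset\max P$ (where $\min$, $\max$ denote the sets of minimal and maximal elements), the pullback $f^*$ is induced by $f^*[y_0<\cdots<y_n]=\sum_{f(x_i)=y_i}[x_0<\cdots<x_n]$ (sum over chains $x_0<\dots<x_n$). The Künneth morphism $h^\bullet(P)\otimes h^\bullet(Q)\to h^\bullet(P\times Q)$ is induced by $[x_0<\cdots<x_m]\otimes[y_0<\cdots<y_n]\mapsto[(x_0,y_0)<\cdots<(x_m,y_0)<(x_m,y_1)<\cdots<(x_m,y_n)]$ (symmetric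 and associative in cohomology, hence defined for finite products). For $x\in P$ the concatenation morphism $\mu_x:h^\bullet(P_{\le x})\otimes h^\bullet(P_{\ge x})\to h^\bullet(P)$ is induced by $[x_0<\cdots<x_m=x]\otimes[x=x_m<\cdots<x_{m+n}]\mapsto[x_0<\cdots<x_{m+n}]$. Partitions. $\Pi(S)$ is the poset of partitions of $S$, with $\alpha\le\beta$ iff $\alpha$ is obtained by merging blocks of $\beta$. For $T\subset S$, $\pi_{|T}$ is the set of blocks of $\pi$ contained in $T$. There are isomorphisms $\varphi_\pi:\Pi_{\le\pi}(S)\to\Pi(\pi)$, $\alpha\mapsto\{\pi_{|T},T\in\alpha\}$, and $\psi_\pi:\Pi_{\ge\pi}(S)\to\prod_{T\in\pi}\Pi(T)$, $\beta\mapsto(\beta_{|T})_{T\in\pi}$. Operadic poset species. A poset species is a functor from finite sets and bijections to posets. An operadic poset species is a poset species $P$ with a morphism of poset species $a:P\to\Pi$ such that $a^{-1}(\min\Pi(S))=\min P(S)$ and $a^{-1}(\max\Pi(S))=\max P(S)$ for all $S$, and, for all $S$ and $x\in P(S)$ with $a(x)=\pi$, morphisms of posets $\varphi_x:P_{\le x}(S)\to P(\pi)$ and $\psi_x:P_{\ge x}(S)\to\prod_{T\in\pi}P(T)$ with $a\circ\varphi_x=\varphi_\pi\circ a$ and $a\circ\psi_x=\psi_\pi\circ a$, satisfying: (Equivariance) For a bijection $f:S\to S'$, $x\in P(S)$, $x'=P(f)(x)$, $\pi=a(x)$, $\pi'=a(x')$, and the induced bijections $f:\pi\to\pi'$ and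 $f_{|T}:T\to f(T)$: $P(f)\circ\varphi_x=\varphi_{x'}\circ P(f)$ and $(P(f_{|T}))_{T\in\pi}\circ\psi_x=\psi_{x'}\circ P(f)$. (Unitality) $P(\{s\})$ is a singleton for every singleton $\{s\}$. (Associativity) Let $x\le x'$ in $P(S)$, $\pi=a(x)$, $\pi'=a(x')$, $\underline{x}=\varphi_{x'}(x)\in P(\pi')$, $(x'_{|T})_{T\in\pi}=\psi_x(x')$; identify $\pi$ with the partition $\{\pi'_{|T},T\in\pi\}$ of $\pi'$. Then $\varphi_{\underline{x}}\circ\varphi_{x'}=\varphi_x$ on $P_{\le x}(S)$; $(\psi_{x'_{|T}})_{T\in\pi}\circ\psi_x=\psi_{x'}$ on $P_{\ge x'}(S)$; and $\psi_{\underline{x}}\circ\varphi_{x'}=(\varphi_{x'_{|T}})_{T\in\pi}\circ\psi_x$ as maps $P_{[x,x']}(S)\to\prod_{T\in\pi}P(\pi'_{|T})$. The condition on $a^{-1}(\min)$ and $a^{-1}(\max)$ implies that all $\varphi_x$, $\psi_x$ satisfy the conditions needed for pullbacks.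
   Formalization: Assumes additionally that φ_x is the inclusion P_{≤x}(S)→P(S)≅P(a(x)) for x maximal and ψ_x is the inclusion P_{≥x}(S)→P(S) for x minimal (otherwise the unit laws can fail), and takes as a hypothesis that all φ_x, ψ_x satisfy the pullback conditions. *)

theory Defs
  imports "HOL-Algebra.Module" "HOL-Library.Poly_Mapping" "HOL-Library.Disjoint_Sets"
    "HOL-Library.FuncSet" "HOL-Library.FSet"
begin

section \<open>Finite sets and partitions\<close>

text \<open>
  The blocks of a partition of a finite set have to be elements of a finite set again. We
  therefore work with finite sets of hereditarily finite sets over an arbitrary type of atoms;
  a finite set \<open>T\<close> is itself the element \<open>blk T\<close> of this universe, and \<open>blk\<close> is injective on
  finite sets. A partition \<open>\<pi>\<close>, viewed as the finite set of its blocks, is \<open>blk ` \<pi>\<close>.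
\<close>

datatype 'a hfs = Atom 'a | Coll "'a hfs fset"

definition blk :: "'a hfs set \<Rightarrow> 'a hfs" where
  "blk T = Coll (Abs_fset T)"

primrec elts :: "'a hfs \<Rightarrow> 'a hfs set" where
  "elts (Atom a) = {}"
| "elts (Coll A) = fset A"

definition fin_obj :: "'a set \<Rightarrow> bool" where
  "fin_obj S \<longleftrightarrow> finite S \<and> S \<noteq> {}"

text \<open>\<open>restr \<pi> T\<close> is the set of blocks of \<open>\<pi>\<close> contained in \<open>T\<close>.\<close>

definition restr :: "'a set set \<Rightarrow> 'a set \<Rightarrow> 'a set set" where
  "restr \<pi> T = {U \<in> \<pi>. U \<subseteq> T}"

text \<open>
  Three canonical bijections: the map on blocks induced by a bijection \<open>f\<close>; the map
  \<open>T \<mapsto> {blocks of \<pi>' inside T}\<close>, for \<open>\<pi>'\<close> finer than \<open>\<pi>\<close>, which identifies \<open>\<pi>\<close> with a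
  partition of \<open>\<pi>'\<close>; and the map \<open>s \<mapsto> {s}\<close> from \<open>S\<close> to its partition into singletons.
\<close>

definition blk_map :: "('a hfs \<Rightarrow> 'a hfs) \<Rightarrow> 'a hfs \<Rightarrow> 'a hfs" where
  "blk_map f u = blk (f ` elts u)"

definition blk_restr :: "'a hfs set set \<Rightarrow> 'a hfs \<Rightarrow> 'a hfs" where
  "blk_restr \<pi>' u = blk (blk ` restr \<pi>' (elts u))"

definition blk_sing :: "'a hfs \<Rightarrow> 'a hfs" where
  "blk_sing s = blk {s}"


section \<open>Posets\<close>

text \<open>A poset is given by its (reflexive) order relation; the underlying set is the field.\<close>

definition finite_poset :: "'p rel \<Rightarrow> bool" where
  "finite_poset r \<longleftrightarrow> finite (Field r) \<and> Partial_order r"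

definition poset_hom :: "'p rel \<Rightarrow> 'q rel \<Rightarrow> ('p \<Rightarrow> 'q) \<Rightarrow> bool" where
  "poset_hom r s f \<longleftrightarrow> (\<forall>(x, y) \<in> r. (f x, f y) \<in> s)"

definition min_elems :: "'p rel \<Rightarrow> 'p set" where
  "min_elems r = {x \<in> Field r. \<forall>y. (y, x) \<in> r \<longrightarrow> y = x}"

definition max_elems :: "'p rel \<Rightarrow> 'p set" where
  "max_elems r = {x \<in> Field r. \<forall>y. (x, y) \<in> r \<longrightarrow> y = x}"

definition down_rel :: "'p rel \<Rightarrow> 'p \<Rightarrow> 'p rel" where
  "down_rel r x = Restr r {y. (y, x) \<in> r}"

definition up_rel :: "'p rel \<Rightarrow> 'p \<Rightarrow> 'p rel" where
  "up_rel r x = Restr r {y. (x, y) \<in> r}"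

definition prod_rel2 :: "'p rel \<Rightarrow> 'q rel \<Rightarrow> ('p \<times> 'q) rel" where
  "prod_rel2 r s = {((x, y), (x', y')). (x, x') \<in> r \<and> (y, y') \<in> s}"

text \<open>The product of a finite family, with underlying set the extensional functions.\<close>

definition prod_family :: "('i \<Rightarrow> 'p rel) \<Rightarrow> 'i set \<Rightarrow> ('i \<Rightarrow> 'p) rel" where
  "prod_family r I = {(g, h). g \<in> (\<Pi>\<^sub>E i\<in>I. Field (r i)) \<and> h \<in> (\<Pi>\<^sub>E i\<in>I. Field (r i)) \<and>
                              (\<forall>i\<in>I. (g i, h i) \<in> r i)}"

text \<open>\<open>\<alpha> \<le> \<beta>\<close> iff \<open>\<alpha>\<close> is obtained by merging blocks of \<open>\<beta>\<close>.\<close>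

definition partition_poset :: "'a set \<Rightarrow> 'a set set rel" where
  "partition_poset S = {(\<alpha>, \<beta>). refines S \<beta> \<alpha>}"

definition phi_part :: "'a hfs set set \<Rightarrow> 'a hfs set set \<Rightarrow> 'a hfs set set" where
  "phi_part \<pi> \<alpha> = (\<lambda>T. blk ` restr \<pi> T) ` \<alpha>"

definition psi_part :: "'a set set \<Rightarrow> 'a set set \<Rightarrow> 'a set \<Rightarrow> 'a set set" where
  "psi_part \<pi> \<beta> = (\<lambda>T\<in>\<pi>. restr \<beta> T)"

definition pullback_admissible :: "'p rel \<Rightarrow> 'q rel \<Rightarrow> ('p \<Rightarrow> 'q) \<Rightarrow> bool" where
  "pullback_admissible r s f \<longleftrightarrow> poset_hom r s f \<and>
     {x \<in> Field r. f x \<in> min_elems s} \<subseteq> min_elems r \<and>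
     {x \<in> Field r. f x \<in> max_elems s} \<subseteq> max_elems r"


section \<open>Operadic poset species\<close>

text \<open>
  A bijection \<open>f : S \<rightarrow> S'\<close> is represented by a function that is injective on \<open>S\<close>, with
  \<open>S' = f ` S\<close>; \<open>pmap S f\<close> is \<open>P(f) : P(S) \<rightarrow> P(f ` S)\<close> and may depend only on \<open>f\<close> on \<open>S\<close>.
\<close>

locale poset_species =
  fixes P :: "'a hfs set \<Rightarrow> 'p rel"
    and pmap :: "'a hfs set \<Rightarrow> ('a hfs \<Rightarrow> 'a hfs) \<Rightarrow> 'p \<Rightarrow> 'p"
  assumes P_poset: "fin_obj S \<Longrightarrow> finite_poset (P S)"
    and pmap_hom: "\<lbrakk>fin_obj S; inj_on f S\<rbrakk> \<Longrightarrow> poset_hom (P S) (P (f ` S)) (pmap S f)"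
    and pmap_cong: "\<lbrakk>fin_obj S; inj_on f S; \<And>s. s \<in> S \<Longrightarrow> f s = g s; x \<in> Field (P S)\<rbrakk>
        \<Longrightarrow> pmap S f x = pmap S g x"
    and pmap_id: "\<lbrakk>fin_obj S; x \<in> Field (P S)\<rbrakk> \<Longrightarrow> pmap S (\<lambda>s. s) x = x"
    and pmap_comp: "\<lbrakk>fin_obj S; inj_on f S; inj_on g (f ` S); x \<in> Field (P S)\<rbrakk>
        \<Longrightarrow> pmap S (g \<circ> f) x = pmap (f ` S) g (pmap S f x)"

text \<open>
  For \<open>x \<in> P(S)\<close>, the maps \<open>\<phi>\<^sub>x\<close> and \<open>\<psi>\<^sub>x\<close> are \<open>phi S x\<close> and \<open>psi S x\<close>. In \<open>assoc_phi\<close> the target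
  \<open>P(\<pi>)\<close> of \<open>\<phi>\<^sub>x\<close> is transported along the identification of \<open>\<pi>\<close> with a partition of \<open>\<pi>'\<close>; in
  \<open>assoc_phi_psi\<close> the block of that partition corresponding to \<open>T \<in> \<pi>\<close> is \<open>blk ` restr \<pi>' T\<close>.
\<close>

locale operadic_poset_species = poset_species P pmap
  for P :: "'a hfs set \<Rightarrow> 'p rel"
    and pmap :: "'a hfs set \<Rightarrow> ('a hfs \<Rightarrow> 'a hfs) \<Rightarrow> 'p \<Rightarrow> 'p" +
  fixes a :: "'a hfs set \<Rightarrow> 'p \<Rightarrow> 'a hfs set set"
    and phi :: "'a hfs set \<Rightarrow> 'p \<Rightarrow> 'p \<Rightarrow> 'p"
    and psi :: "'a hfs set \<Rightarrow> 'p \<Rightarrow> 'p \<Rightarrow> ('a hfs set \<Rightarrow> 'p)"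
  assumes a_hom: "fin_obj S \<Longrightarrow> poset_hom (P S) (partition_poset S) (a S)"
    and a_natural: "\<lbrakk>fin_obj S; inj_on f S; x \<in> Field (P S)\<rbrakk>
        \<Longrightarrow> a (f ` S) (pmap S f x) = (`) f ` a S x"
    and a_min: "fin_obj S \<Longrightarrow>
        {x \<in> Field (P S). a S x \<in> min_elems (partition_poset S)} = min_elems (P S)"
    and a_max: "fin_obj S \<Longrightarrow>
        {x \<in> Field (P S). a S x \<in> max_elems (partition_poset S)} = max_elems (P S)"
    and phi_hom: "\<lbrakk>fin_obj S; x \<in> Field (P S)\<rbrakk>
        \<Longrightarrow> poset_hom (down_rel (P S) x) (P (blk ` a S x)) (phi S x)"
    and psi_hom: "\<lbrakk>fin_obj S; x \<in> Field (P S)\<rbrakk>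
        \<Longrightarrow> poset_hom (up_rel (P S) x) (prod_family P (a S x)) (psi S x)"
    and a_phi: "\<lbrakk>fin_obj S; (y, x) \<in> P S\<rbrakk>
        \<Longrightarrow> a (blk ` a S x) (phi S x y) = phi_part (a S x) (a S y)"
    and a_psi: "\<lbrakk>fin_obj S; (x, y) \<in> P S\<rbrakk>
        \<Longrightarrow> (\<lambda>T\<in>a S x. a T (psi S x y T)) = psi_part (a S x) (a S y)"
    and equivariance_phi: "\<lbrakk>fin_obj S; inj_on f S; (y, x) \<in> P S\<rbrakk>
        \<Longrightarrow> pmap (blk ` a S x) (blk_map f) (phi S x y) =
            phi (f ` S) (pmap S f x) (pmap S f y)"
    and equivariance_psi: "\<lbrakk>fin_obj S; inj_on f S; (x, y) \<in> P S; T \<in> a S x\<rbrakk>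
        \<Longrightarrow> pmap T f (psi S x y T) = psi (f ` S) (pmap S f x) (pmap S f y) (f ` T)"
    and unitality: "\<exists>z. Field (P {s}) = {z}"
    and assoc_phi: "\<lbrakk>fin_obj S; (x, x') \<in> P S; (y, x) \<in> P S\<rbrakk>
        \<Longrightarrow> phi (blk ` a S x') (phi S x' x) (phi S x' y) =
            pmap (blk ` a S x) (blk_restr (a S x')) (phi S x y)"
    and assoc_psi: "\<lbrakk>fin_obj S; (x, x') \<in> P S; (x', y) \<in> P S; T \<in> a S x; U \<in> restr (a S x') T\<rbrakk>
        \<Longrightarrow> psi T (psi S x x' T) (psi S x y T) U = psi S x' y U"
    and assoc_phi_psi: "\<lbrakk>fin_obj S; (x, y) \<in> P S; (y, x') \<in> P S; T \<in> a S x\<rbrakk>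
        \<Longrightarrow> psi (blk ` a S x') (phi S x' x) (phi S x' y) (blk ` restr (a S x') T) =
            phi T (psi S x x' T) (psi S x y T)"

text \<open>
  The conditions under which \<open>\<phi>\<^sub>x\<^sup>*\<close> and \<open>\<psi>\<^sub>x\<^sup>*\<close> exist. Given the axioms above, they say that
  \<open>x < y\<close> implies \<open>a(x) \<noteq> a(y)\<close>: otherwise \<open>\<psi>\<^sub>x(y)\<close> is minimal although \<open>y\<close> is not minimal in
  \<open>P\<^sub>\<ge>\<^sub>x(S)\<close>. The axioms on \<open>a\<close> exclude this only when \<open>a(x)\<close> is minimal or maximal.
\<close>

definition pullbacks_defined ::
  "('a hfs set \<Rightarrow> 'p rel) \<Rightarrow> ('a hfs set \<Rightarrow> 'p \<Rightarrow> 'a hfs set set) \<Rightarrow>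
   ('a hfs set \<Rightarrow> 'p \<Rightarrow> 'p \<Rightarrow> 'p) \<Rightarrow> ('a hfs set \<Rightarrow> 'p \<Rightarrow> 'p \<Rightarrow> ('a hfs set \<Rightarrow> 'p)) \<Rightarrow> bool" where
  "pullbacks_defined P a phi psi \<longleftrightarrow> (\<forall>S x. fin_obj S \<longrightarrow> x \<in> Field (P S) \<longrightarrow>
     pullback_admissible (down_rel (P S) x) (P (blk ` a S x)) (phi S x) \<and>
     pullback_admissible (up_rel (P S) x) (prod_family P (a S x)) (psi S x))"

text \<open>
  If \<open>x\<close> is maximal then \<open>a(x)\<close> is the partition into singletons, and \<open>\<phi>\<^sub>x\<close> is the inclusion of
  \<open>P\<^sub>\<le>\<^sub>x(S)\<close> into \<open>P(S) \<cong> P(a(x))\<close>. If \<open>x\<close> is minimal then \<open>a(x) = {S}\<close>, and \<open>\<psi>\<^sub>x\<close> is the inclusion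
  of \<open>P\<^sub>\<ge>\<^sub>x(S)\<close> into \<open>P(S)\<close>. The unit laws of the operad depend on this, and it does not follow from
  the axioms above. For example, let \<open>P(S)\<close> be a point for \<open>|S| = 1\<close>, let it have elements \<open>0 < 1\<close>
  and \<open>0 < 1'\<close> for \<open>|S| = 2\<close>, and let it be empty otherwise. For \<open>|S| = 2\<close>, let \<open>\<psi>\<^sub>0\<close> be the
  identity and let \<open>\<phi>\<^sub>1\<close> and \<open>\<phi>\<^bsub>1'\<^esub>\<close> send \<open>0\<close> to \<open>0\<close> and \<open>1, 1'\<close> to \<open>1\<close>. Inserting units then kills the
  class of \<open>[0 < 1']\<close>.
\<close>

definition unit_normalised ::
  "('a hfs set \<Rightarrow> 'p rel) \<Rightarrow> ('a hfs set \<Rightarrow> ('a hfs \<Rightarrow> 'a hfs) \<Rightarrow> 'p \<Rightarrow> 'p) \<Rightarrow>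
   ('a hfs set \<Rightarrow> 'p \<Rightarrow> 'p \<Rightarrow> 'p) \<Rightarrow> ('a hfs set \<Rightarrow> 'p \<Rightarrow> 'p \<Rightarrow> ('a hfs set \<Rightarrow> 'p)) \<Rightarrow> bool" where
  "unit_normalised P pmap phi psi \<longleftrightarrow> (\<forall>S. fin_obj S \<longrightarrow>
     (\<forall>x \<in> max_elems (P S). \<forall>y. (y, x) \<in> P S \<longrightarrow> phi S x y = pmap S blk_sing y) \<and>
     (\<forall>x \<in> min_elems (P S). \<forall>y. (x, y) \<in> P S \<longrightarrow> psi S x y S = y))"


section \<open>Modules and graded operads\<close>

text \<open>
  The coefficient ring \<open>\<K>\<close> is a type of sort \<open>{comm_ring,comm_monoid_mult}\<close>: a commutative ring with
  unit, where (unlike in \<open>comm_ring_1\<close>) the zero ring is allowed.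
\<close>

definition coeff_ring :: "'k::{comm_ring,comm_monoid_mult} ring" where
  "coeff_ring = \<lparr>carrier = UNIV, mult = (*), one = 1, zero = 0, add = (+)\<rparr>"

definition mod_hom ::
  "('k::{comm_ring,comm_monoid_mult}, 'm) module \<Rightarrow> ('k, 'n) module \<Rightarrow> ('m \<Rightarrow> 'n) set" where
  "mod_hom M N = {f \<in> carrier M \<rightarrow> carrier N.
     (\<forall>x\<in>carrier M. \<forall>y\<in>carrier M. f (x \<oplus>\<^bsub>M\<^esub> y) = f x \<oplus>\<^bsub>N\<^esub> f y) \<and>
     (\<forall>k. \<forall>x\<in>carrier M. f (k \<odot>\<^bsub>M\<^esub> x) = k \<odot>\<^bsub>N\<^esub> f x)}"

text \<open>
  \<open>F S n\<close> is the degree \<open>n\<close> part of \<open>F(S)\<close>; all graded modules here are concentrated in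
  non-negative degrees. \<open>act S f n\<close> is the degree \<open>n\<close> part of \<open>F(f) : F(S) \<rightarrow> F(f ` S)\<close>.
\<close>

locale graded_linear_species =
  fixes F :: "'a hfs set \<Rightarrow> nat \<Rightarrow> ('k::{comm_ring,comm_monoid_mult}, 'm) module"
    and act :: "'a hfs set \<Rightarrow> ('a hfs \<Rightarrow> 'a hfs) \<Rightarrow> nat \<Rightarrow> 'm \<Rightarrow> 'm"
  assumes F_module: "fin_obj S \<Longrightarrow> module coeff_ring (F S n)"
    and act_hom: "\<lbrakk>fin_obj S; inj_on f S\<rbrakk> \<Longrightarrow> act S f n \<in> mod_hom (F S n) (F (f ` S) n)"
    and act_cong: "\<lbrakk>fin_obj S; inj_on f S; \<And>s. s \<in> S \<Longrightarrow> f s = g s; x \<in> carrier (F S n)\<rbrakk>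
        \<Longrightarrow> act S f n x = act S g n x"
    and act_id: "\<lbrakk>fin_obj S; x \<in> carrier (F S n)\<rbrakk> \<Longrightarrow> act S (\<lambda>s. s) n x = x"
    and act_comp: "\<lbrakk>fin_obj S; inj_on f S; inj_on g (f ` S); x \<in> carrier (F S n)\<rbrakk>
        \<Longrightarrow> act S (g \<circ> f) n x = act (f ` S) g n (act S f n x)"

text \<open>
  A homogeneous pure tensor in \<open>\<Otimes>\<^bsub>T\<in>\<pi>\<^esub> F(T)\<close> is written, for a chosen ordering of the blocks, as the
  list of triples (block, degree, element) of its factors.
\<close>

definition deg :: "('t \<times> nat \<times> 'm) list \<Rightarrow> nat" where
  "deg zs = (\<Sum>(T, d, y)\<leftarrow>zs. d)"

definition is_tensor :: "('t \<Rightarrow> nat \<Rightarrow> ('k, 'm) module) \<Rightarrow> 't set \<Rightarrow> ('t \<times> nat \<times> 'm) list \<Rightarrow> bool"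
  where "is_tensor F \<pi> zs \<longleftrightarrow> distinct (map fst zs) \<and> set (map fst zs) = \<pi> \<and>
     (\<forall>(T, d, y) \<in> set zs. y \<in> carrier (F T d))"

text \<open>
  A degree-preserving linear map \<open>\<rho>\<^sub>\<pi> : F(\<pi>) \<otimes> \<Otimes>\<^bsub>T\<in>\<pi>\<^esub> F(T) \<rightarrow> F(S)\<close> is given by its values
  \<open>\<rho> S m p zs\<close> on pure tensors \<open>p \<otimes> y\<^sub>1 \<otimes> \<dots> \<otimes> y\<^sub>k\<close> with \<open>p\<close> of degree \<open>m\<close> and \<open>zs\<close> listing the factors
  \<open>y\<^sub>i\<close> (so \<open>\<pi>\<close> is the set of blocks occurring in \<open>zs\<close>): they must be multilinear
  (\<open>rho_linear_left\<close>, \<open>rho_linear_right\<close>) and, the tensor product over \<open>T \<in> \<pi>\<close> being unordered,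
  compatible with the Koszul sign rule under reordering (\<open>rho_symmetric\<close>, for adjacent factors).

  In \<open>rho_assoc\<close>, \<open>\<pi>'\<close> refines \<open>\<pi>\<close> and the list \<open>L\<close> has an entry \<open>(T, n, q, us)\<close> for every
  \<open>T \<in> \<pi>\<close>, with \<open>q \<in> F(\<pi>'\<^bsub>|T\<^esub>)\<close> of degree \<open>n\<close> and \<open>us\<close> a pure tensor over the blocks of \<open>\<pi>'\<^bsub>|T\<^esub>\<close>.
  The sign comes from moving the \<open>q\<close>'s past the \<open>us\<close> of the preceding entries.
\<close>

locale graded_operad = graded_linear_species F act
  for F :: "'a hfs set \<Rightarrow> nat \<Rightarrow> ('k::{comm_ring,comm_monoid_mult}, 'm) module"
    and act :: "'a hfs set \<Rightarrow> ('a hfs \<Rightarrow> 'a hfs) \<Rightarrow> nat \<Rightarrow> 'm \<Rightarrow> 'm" +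
  fixes \<rho> :: "'a hfs set \<Rightarrow> nat \<Rightarrow> 'm \<Rightarrow> ('a hfs set \<times> nat \<times> 'm) list \<Rightarrow> 'm"
    and unit_elem :: "'a hfs \<Rightarrow> 'm"
  assumes rho_linear_left: "\<lbrakk>fin_obj S; partition_on S \<pi>; is_tensor F \<pi> zs\<rbrakk>
        \<Longrightarrow> (\<lambda>p. \<rho> S m p zs) \<in> mod_hom (F (blk ` \<pi>) m) (F S (m + deg zs))"
    and rho_linear_right: "\<lbrakk>fin_obj S; partition_on S \<pi>; p \<in> carrier (F (blk ` \<pi>) m);
          is_tensor F \<pi> (zs @ (T, d, y) # ws)\<rbrakk>
        \<Longrightarrow> (\<lambda>y. \<rho> S m p (zs @ (T, d, y) # ws))
              \<in> mod_hom (F T d) (F S (m + deg (zs @ (T, d, y) # ws)))"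
    and rho_symmetric: "\<lbrakk>fin_obj S; partition_on S \<pi>; p \<in> carrier (F (blk ` \<pi>) m);
          is_tensor F \<pi> (zs @ (T, d, y) # (U, e, z) # ws)\<rbrakk>
        \<Longrightarrow> \<rho> S m p (zs @ (U, e, z) # (T, d, y) # ws) =
            (- 1) ^ (d * e) \<odot>\<^bsub>F S (m + deg (zs @ (T, d, y) # (U, e, z) # ws))\<^esub>
              \<rho> S m p (zs @ (T, d, y) # (U, e, z) # ws)"
    and rho_equivariant: "\<lbrakk>fin_obj S; inj_on f S; partition_on S \<pi>; p \<in> carrier (F (blk ` \<pi>) m);
          is_tensor F \<pi> zs\<rbrakk>
        \<Longrightarrow> act S f (m + deg zs) (\<rho> S m p zs) =
            \<rho> (f ` S) m (act (blk ` \<pi>) (blk_map f) m p)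
              (map (\<lambda>(T, d, y). (f ` T, d, act T f d y)) zs)"
    and unit_closed: "unit_elem s \<in> carrier (F {s} 0)"
    and unit_equivariant: "act {s} f 0 (unit_elem s) = unit_elem (f s)"
    and unit_left: "\<lbrakk>fin_obj S; y \<in> carrier (F S d)\<rbrakk>
        \<Longrightarrow> \<rho> S 0 (unit_elem (blk S)) [(S, d, y)] = y"
    and unit_right: "\<lbrakk>fin_obj S; p \<in> carrier (F S m); distinct ss; set ss = S\<rbrakk>
        \<Longrightarrow> \<rho> S m (act S blk_sing m p) (map (\<lambda>s. ({s}, 0, unit_elem s)) ss) = p"
    and rho_assoc: "\<lbrakk>fin_obj S; (\<pi>, \<pi>') \<in> partition_poset S; p \<in> carrier (F (blk ` \<pi>) m);
          distinct (map fst L); set (map fst L) = \<pi>;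
          \<And>T n q us. (T, n, q, us) \<in> set L \<Longrightarrow>
            q \<in> carrier (F (blk ` restr \<pi>' T) n) \<and> is_tensor F (restr \<pi>' T) us\<rbrakk>
        \<Longrightarrow> \<rho> S m p (map (\<lambda>(T, n, q, us). (T, n + deg us, \<rho> T n q us)) L) =
            (- 1) ^ (\<Sum>j<length L. \<Sum>i<j. fst (snd (L ! j)) * deg (snd (snd (snd (L ! i)))))
            \<odot>\<^bsub>F S (m + (\<Sum>(T, n, q, us)\<leftarrow>L. n + deg us))\<^esub>
            \<rho> S (m + (\<Sum>(T, n, q, us)\<leftarrow>L. n))
              (\<rho> (blk ` \<pi>') m (act (blk ` \<pi>) (blk_restr \<pi>') m p)
                 (map (\<lambda>(T, n, q, us). (blk ` restr \<pi>' T, n, q)) L))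
              (concat (map (\<lambda>(T, n, q, us). us) L))"


section \<open>Poset cohomology\<close>

text \<open>
  The free module on a set of symbols consists of the finitely supported functions on symbols; the
  symbol \<open>[x\<^sub>0 < \<dots> < x\<^sub>n]\<close> is \<open>Poly_Mapping.single [x\<^sub>0, \<dots>, x\<^sub>n] 1\<close>.
\<close>

definition scale ::
  "'k::{comm_ring,comm_monoid_mult} \<Rightarrow> ('s \<Rightarrow>\<^sub>0 'k) \<Rightarrow> ('s \<Rightarrow>\<^sub>0 'k)" where
  "scale k c = Poly_Mapping.map ((*) k) c"

definition lin_ext ::
  "('s \<Rightarrow> ('t \<Rightarrow>\<^sub>0 'k)) \<Rightarrow> ('s \<Rightarrow>\<^sub>0 'k::{comm_ring,comm_monoid_mult}) \<Rightarrow> ('t \<Rightarrow>\<^sub>0 'k)" where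
  "lin_ext g c = (\<Sum>s\<in>Poly_Mapping.keys c. scale (Poly_Mapping.lookup c s) (g s))"

definition bilin_ext ::
  "('s \<Rightarrow> 't \<Rightarrow> ('u \<Rightarrow>\<^sub>0 'k)) \<Rightarrow> ('s \<Rightarrow>\<^sub>0 'k::{comm_ring,comm_monoid_mult}) \<Rightarrow> ('t \<Rightarrow>\<^sub>0 'k)
     \<Rightarrow> ('u \<Rightarrow>\<^sub>0 'k)" where
  "bilin_ext g c e = lin_ext (\<lambda>s. lin_ext (g s) e) c"

text \<open>
  Chains starting at a minimal and ending at a maximal element; consecutive elements need not be
  covering pairs.
\<close>

definition end_chains :: "'p rel \<Rightarrow> 'p list set" where
  "end_chains r = {xs. xs \<noteq> [] \<and> set xs \<subseteq> Field r \<and>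
     sorted_wrt (\<lambda>x y. (x, y) \<in> r \<and> x \<noteq> y) xs \<and>
     hd xs \<in> min_elems r \<and> last xs \<in> max_elems r}"

definition cochains :: "'p rel \<Rightarrow> nat \<Rightarrow> ('p list \<Rightarrow>\<^sub>0 'k::{comm_ring,comm_monoid_mult}) set" where
  "cochains r n = {c. Poly_Mapping.keys c \<subseteq> {xs \<in> end_chains r. length xs = Suc n}}"

definition cobdry ::
  "'p rel \<Rightarrow> ('p list \<Rightarrow>\<^sub>0 'k::{comm_ring,comm_monoid_mult}) \<Rightarrow> ('p list \<Rightarrow>\<^sub>0 'k)" where
  "cobdry r = lin_ext (\<lambda>xs. \<Sum>i\<in>{1..<length xs}.
     \<Sum>y | (xs ! (i - 1), y) \<in> r \<and> xs ! (i - 1) \<noteq> y \<and> (y, xs ! i) \<in> r \<and> y \<noteq> xs ! i.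
       Poly_Mapping.single (take i xs @ y # drop i xs) ((- 1) ^ i))"

definition cocycles :: "'p rel \<Rightarrow> nat \<Rightarrow> ('p list \<Rightarrow>\<^sub>0 'k::{comm_ring,comm_monoid_mult}) set" where
  "cocycles r n = {c \<in> cochains r n. cobdry r c = 0}"

definition coboundaries :: "'p rel \<Rightarrow> nat \<Rightarrow> ('p list \<Rightarrow>\<^sub>0 'k::{comm_ring,comm_monoid_mult}) set"
  where "coboundaries r n = (case n of 0 \<Rightarrow> {0} | Suc m \<Rightarrow> cobdry r ` cochains r m)"

definition coh_class ::
  "'p rel \<Rightarrow> nat \<Rightarrow> ('p list \<Rightarrow>\<^sub>0 'k::{comm_ring,comm_monoid_mult}) \<Rightarrow> ('p list \<Rightarrow>\<^sub>0 'k) set" where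
  "coh_class r n c = {c + b | b. b \<in> coboundaries r n}"

text \<open>
  \<open>h\<^sup>n(P)\<close> as a module of cosets. The fields \<open>mult\<close> and \<open>one\<close> of the record are irrelevant for a
  module.
\<close>

definition cohom ::
  "'p rel \<Rightarrow> nat \<Rightarrow> ('k::{comm_ring,comm_monoid_mult}, ('p list \<Rightarrow>\<^sub>0 'k) set) module" where
  "cohom r n = \<lparr>carrier = coh_class r n ` cocycles r n,
     mult = undefined, one = undefined,
     zero = coh_class r n 0,
     add = (\<lambda>X Y. {c + e | c e. c \<in> X \<and> e \<in> Y}),
     smult = (\<lambda>k X. {scale k c + b | c b. c \<in> X \<and> b \<in> coboundaries r n})\<rparr>"

text \<open>
  The map induced in cohomology by a (bi)linear map \<open>g\<close> on cochains sends the class of \<open>c\<close> to the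
  class of \<open>g c\<close>; on cosets this is the coset generated by the image.
\<close>

definition induced ::
  "'q rel \<Rightarrow> nat \<Rightarrow> (('p list \<Rightarrow>\<^sub>0 'k) \<Rightarrow> ('q list \<Rightarrow>\<^sub>0 'k)) \<Rightarrow> ('p list \<Rightarrow>\<^sub>0 'k) set
     \<Rightarrow> ('q list \<Rightarrow>\<^sub>0 'k::{comm_ring,comm_monoid_mult}) set" where
  "induced s n g X = {g c + b | c b. c \<in> X \<and> b \<in> coboundaries s n}"

definition induced2 ::
  "'q rel \<Rightarrow> nat \<Rightarrow> (('p list \<Rightarrow>\<^sub>0 'k) \<Rightarrow> ('r list \<Rightarrow>\<^sub>0 'k) \<Rightarrow> ('q list \<Rightarrow>\<^sub>0 'k))
     \<Rightarrow> ('p list \<Rightarrow>\<^sub>0 'k) set \<Rightarrow> ('r list \<Rightarrow>\<^sub>0 'k) set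
     \<Rightarrow> ('q list \<Rightarrow>\<^sub>0 'k::{comm_ring,comm_monoid_mult}) set" where
  "induced2 s n g X Y = {g c e + b | c e b. c \<in> X \<and> e \<in> Y \<and> b \<in> coboundaries s n}"

text \<open>\<open>pullback r f n\<close> is \<open>f\<^sup>* : h\<^sup>n(Q) \<rightarrow> h\<^sup>n(P)\<close> for a morphism \<open>f : P \<rightarrow> Q\<close> with source \<open>r\<close>.\<close>

definition pullback ::
  "'p rel \<Rightarrow> ('p \<Rightarrow> 'q) \<Rightarrow> nat \<Rightarrow> ('q list \<Rightarrow>\<^sub>0 'k::{comm_ring,comm_monoid_mult}) set
     \<Rightarrow> ('p list \<Rightarrow>\<^sub>0 'k) set" where
  "pullback r f n = induced r n
     (lin_ext (\<lambda>ys. \<Sum>xs | xs \<in> end_chains r \<and> map f xs = ys. Poly_Mapping.single xs 1))"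

definition kunneth2 ::
  "'p rel \<Rightarrow> 'q rel \<Rightarrow> nat \<Rightarrow> nat \<Rightarrow> ('p list \<Rightarrow>\<^sub>0 'k::{comm_ring,comm_monoid_mult}) set
     \<Rightarrow> ('q list \<Rightarrow>\<^sub>0 'k) set \<Rightarrow> (('p \<times> 'q) list \<Rightarrow>\<^sub>0 'k) set" where
  "kunneth2 r s m n = induced2 (prod_rel2 r s) (m + n)
     (bilin_ext (\<lambda>xs ys. Poly_Mapping.single
        (map (\<lambda>x. (x, hd ys)) xs @ map (\<lambda>y. (last xs, y)) (tl ys)) 1))"

text \<open>
  The Kuenneth morphism of a finite product, iterating the binary one along the ordering of the
  factors: \<open>\<Prod>\<^bsub>T\<in>I\<union>{T\<^sub>0}\<^esub> P(T)\<close> is identified with \<open>P(T\<^sub>0) \<times> \<Prod>\<^bsub>T\<in>I\<^esub> P(T)\<close>. For the empty product, a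
  point, it is the unit of \<open>h\<^sup>0\<close>.
\<close>

fun kunneth ::
  "('t \<Rightarrow> 'p rel) \<Rightarrow> ('t \<times> nat \<times> ('p list \<Rightarrow>\<^sub>0 'k::{comm_ring,comm_monoid_mult}) set) list
     \<Rightarrow> (('t \<Rightarrow> 'p) list \<Rightarrow>\<^sub>0 'k) set" where
  "kunneth P [] = coh_class (prod_family P {}) 0 (Poly_Mapping.single [\<lambda>t. undefined] 1)"
| "kunneth P ((T, d, Y) # zs) =
     (let I = set (map fst zs) in
       pullback (prod_family P (insert T I)) (\<lambda>g. (g T, restrict g I)) (d + deg zs)
         (kunneth2 (P T) (prod_family P I) d (deg zs) Y (kunneth P zs)))"

text \<open>The concatenation morphism \<open>h\<^sup>m(P\<^sub>\<le>\<^sub>x) \<otimes> h\<^sup>n(P\<^sub>\<ge>\<^sub>x) \<rightarrow> h\<^sup>m\<^sup>+\<^sup>n(P)\<close>; its formula does not mention \<open>x\<close>.\<close>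

definition concat_mor ::
  "'p rel \<Rightarrow> nat \<Rightarrow> nat \<Rightarrow> ('p list \<Rightarrow>\<^sub>0 'k::{comm_ring,comm_monoid_mult}) set
     \<Rightarrow> ('p list \<Rightarrow>\<^sub>0 'k) set \<Rightarrow> ('p list \<Rightarrow>\<^sub>0 'k) set" where
  "concat_mor r m n = induced2 r (m + n)
     (bilin_ext (\<lambda>xs ys. Poly_Mapping.single (xs @ tl ys) 1))"


section \<open>The operad structure on the cohomology of an operadic poset species\<close>

definition coh_species ::
  "('a hfs set \<Rightarrow> 'p rel) \<Rightarrow> 'a hfs set \<Rightarrow> nat
     \<Rightarrow> ('k::{comm_ring,comm_monoid_mult}, ('p list \<Rightarrow>\<^sub>0 'k) set) module" where
  "coh_species P S n = cohom (P S) n"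

text \<open>\<open>h\<^sup>\<bullet>\<close> being contravariant, \<open>f\<close> acts by the pullback along \<open>P(f\<^sup>-\<^sup>1) : P(f ` S) \<rightarrow> P(S)\<close>.\<close>

definition coh_act ::
  "('a hfs set \<Rightarrow> 'p rel) \<Rightarrow> ('a hfs set \<Rightarrow> ('a hfs \<Rightarrow> 'a hfs) \<Rightarrow> 'p \<Rightarrow> 'p)
     \<Rightarrow> 'a hfs set \<Rightarrow> ('a hfs \<Rightarrow> 'a hfs) \<Rightarrow> nat
     \<Rightarrow> ('p list \<Rightarrow>\<^sub>0 'k::{comm_ring,comm_monoid_mult}) set \<Rightarrow> ('p list \<Rightarrow>\<^sub>0 'k) set" where
  "coh_act P pmap S f n = pullback (P (f ` S)) (pmap (f ` S) (inv_into S f)) n"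

definition coh_rho ::
  "('a hfs set \<Rightarrow> 'p rel) \<Rightarrow> ('a hfs set \<Rightarrow> 'p \<Rightarrow> 'a hfs set set)
     \<Rightarrow> ('a hfs set \<Rightarrow> 'p \<Rightarrow> 'p \<Rightarrow> 'p) \<Rightarrow> ('a hfs set \<Rightarrow> 'p \<Rightarrow> 'p \<Rightarrow> ('a hfs set \<Rightarrow> 'p))
     \<Rightarrow> 'a hfs set \<Rightarrow> nat \<Rightarrow> ('p list \<Rightarrow>\<^sub>0 'k::{comm_ring,comm_monoid_mult}) set
     \<Rightarrow> ('a hfs set \<times> nat \<times> ('p list \<Rightarrow>\<^sub>0 'k) set) list \<Rightarrow> ('p list \<Rightarrow>\<^sub>0 'k) set" where
  "coh_rho P a phi psi S m p zs =
     finsum (cohom (P S) (m + deg zs))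
       (\<lambda>x. concat_mor (P S) m (deg zs)
              (pullback (down_rel (P S) x) (phi S x) m p)
              (pullback (up_rel (P S) x) (psi S x) (deg zs) (kunneth P zs)))
       {x \<in> Field (P S). a S x = set (map fst zs)}"

definition coh_unit ::
  "('a hfs set \<Rightarrow> 'p rel) \<Rightarrow> 'a hfs \<Rightarrow> ('p list \<Rightarrow>\<^sub>0 'k::{comm_ring,comm_monoid_mult}) set" where
  "coh_unit P s = coh_class (P {s}) 0 (Poly_Mapping.single [THE z. z \<in> Field (P {s})] 1)"

end

theory Submission
  imports Defs
begin

text \<open>
  Every map involved has an explicit formula on cochains, and on functions on lists of elements the
  Kuenneth and concatenation maps and \<open>\<rho>\<^sub>\<pi>\<close> all become cup products. With these representatives
  linearity, equivariance and the unit laws hold chain by chain. In the associativity law both sides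
  are supported on the chains through some \<open>x \<le> x'\<close> with \<open>a x = \<pi>\<close> and \<open>a x' = \<pi>'\<close>, where they are
  given by the same factors; but on \<open>\<Prod>\<^bsub>T\<in>\<pi>\<^esub> P(T)\<close> the two factors belonging to each \<open>T\<close> are adjacent on one
  side, while on the other side all those below \<open>x'\<close> precede all those above. Moving a factor past
  another one changes a cup product by a Koszul sign and a coboundary, by Steenrod's \<open>\<union>\<^sub>1\<close>-product.
  The same homotopy gives the symmetry of \<open>\<rho>\<^sub>\<pi>\<close>.
\<close>

section \<open>Cup products of functions on lists\<close>

text \<open>The obstacle is that the factors of the split product are not cocycles. A lower factor
  of \<rho> evaluates \<open>phi\<close> at the last entry of its list, so its coboundary vanishes
  only when that entry lies below an element of the right fibre of \<open>a\<close>; upper factors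
  behave dually. This is still enough because a chain meets a fibre of \<open>a\<close> at most
  once, a consequence of the admissibility of the pullback along \<open>psi\<close>. Each coboundary
  in a Leibniz expansion is multiplied by a neighbouring factor, and the nonvanishing of that
  neighbour puts the cut point where the coboundary is zero. Closedness of the rearranged product
  cannot be checked factor by factor; it is inherited through the interchange. Weakly increasing
  lists are forced in for two reasons: the coordinates of a strict chain in a product may stand
  still, and a \<open>cup1\<close> whose second factor has degree 0 repeats an entry. The Koszul
  signs all arise on the product over the blocks, before \<open>phi\<close> and \<open>psi\<close>
  enter. On chains of \<open>P S\<close> itself associativity is an identity of functions without
  sign.\<close>

definition omit :: "nat \<Rightarrow> 'z list \<Rightarrow> 'z list" where
  "omit k zs = take k zs @ drop (Suc k) zs"

definition bd :: "('z list \<Rightarrow> 'k::{comm_ring,comm_monoid_mult}) \<Rightarrow> 'z list \<Rightarrow> 'k" where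
  "bd f zs = (\<Sum>k<length zs. (- 1) ^ k * f (omit k zs))"

definition cup :: "nat \<Rightarrow> ('z list \<Rightarrow> 'k) \<Rightarrow> ('z list \<Rightarrow> 'k) \<Rightarrow> 'z list \<Rightarrow> 'k::{comm_ring,comm_monoid_mult}"
  where "cup m f g zs = f (take (Suc m) zs) * g (drop m zs)"

text \<open>In the \<open>i\<close>-th summand \<open>f\<close> jumps over the window of
  \<open>e + 1\<close> entries on which \<open>g\<close> is evaluated. The exponent is chosen so
  that the summands telescope under \<open>bd\<close>. For \<open>e = 0\<close> the argument of
  \<open>f\<close> contains entry \<open>i\<close> twice.\<close>

definition cup1 ::
  "nat \<Rightarrow> nat \<Rightarrow> ('z list \<Rightarrow> 'k) \<Rightarrow> ('z list \<Rightarrow> 'k) \<Rightarrow> 'z list \<Rightarrow> 'k::{comm_ring,comm_monoid_mult}"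
  where "cup1 d e f g zs =
    (\<Sum>i<d. (- 1) ^ (i * Suc e) * (f (take (Suc i) zs @ drop (i + e) zs) * g (take (Suc e) (drop i zs))))"

lemma minus_one_double: "(- 1) ^ (n + n) = (1::'k::{comm_ring,comm_monoid_mult})"
  by (induction n) auto

text \<open>The coefficient ring may be the zero ring, so signs are compared using only that -1
  squares to 1.\<close>

lemma minus_one_parity:
  "even n = even m \<Longrightarrow> (- 1) ^ n = ((- 1) ^ m::'k::{comm_ring,comm_monoid_mult})"
proof -
  have ev: "(- 1) ^ k = (1::'k)" if "even k" for k
    using that minus_one_double by (metis evenE mult_2)
  have od: "(- 1) ^ k = (- 1::'k)" if "odd k" for k
    using that ev by (metis (no_types, lifting) oddE mult_1 mult_minus_left power_Suc Suc_eq_plus1 even_mult_iff even_numeral)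
  show "even n = even m \<Longrightarrow> (- 1) ^ n = ((- 1) ^ m::'k)"
    using ev od by metis
qed

lemma minus_one_cancel: "(- 1) ^ n * ((- 1) ^ n * x) = (x::'k::{comm_ring,comm_monoid_mult})"
  by (metis minus_one_double mult.assoc mult_1 power_add)

lemma sum_lessThan_add:
  fixes f :: "nat \<Rightarrow> 'a::comm_monoid_add"
  shows "(\<Sum>k<p + q. f k) = (\<Sum>k<p. f k) + (\<Sum>j<q. f (p + j))"
  by (induction q) (auto simp: add.assoc)

section \<open>Faces of a list and the alternating coboundary\<close>

lemma length_omit: "k < length zs \<Longrightarrow> length (omit k zs) = length zs - 1"
  by (auto simp: omit_def)

lemma map_omit: "map h (omit k zs) = omit k (map h zs)"
  by (simp add: omit_def take_map drop_map)

lemma nth_omit: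
  "\<lbrakk>k < length zs; i < length zs - 1\<rbrakk> \<Longrightarrow> omit k zs ! i = (if i < k then zs ! i else zs ! Suc i)"
  by (auto simp: omit_def nth_append min_def)

lemma bd_map: "bd (\<lambda>ws. f (map h ws)) zs = bd f (map h zs)"
  by (simp add: bd_def map_omit)

lemma bd_add: "bd (\<lambda>ws. f ws + g ws) zs = bd f zs + bd g zs"
  by (simp add: bd_def sum.distrib algebra_simps)

lemma bd_scale: "bd (\<lambda>ws. k * f ws) zs = k * bd f zs"
  by (simp add: bd_def sum_distrib_left algebra_simps)

lemma bd_diff: "bd (\<lambda>ws. f ws - g ws) zs = bd f zs - bd g zs"
  by (simp add: bd_def sum_subtractf algebra_simps)

lemma bd_cong: "(\<And>k. k < length zs \<Longrightarrow> f (omit k zs) = g (omit k zs)) \<Longrightarrow> bd f zs = bd g zs"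
  by (simp add: bd_def)

lemma bd_zero: "(\<And>k. k < length zs \<Longrightarrow> f (omit k zs) = 0) \<Longrightarrow> bd f zs = 0"
  by (simp add: bd_def)

lemma omit_omit:
  assumes "l < k" "k < length zs"
  shows "omit l (omit k zs) = omit (k - 1) (omit l zs)"
  using assms by (intro nth_equalityI) (auto simp: nth_omit length_omit)

lemma bd_bd: "bd (bd f) zs = (0::'k::{comm_ring,comm_monoid_mult})"
proof -
  let ?n = "length zs"
  let ?t = "\<lambda>(k, l). (- 1) ^ (k + l) * f (omit l (omit k zs))"
  let ?A = "{(k, l). k < ?n \<and> l < ?n - 1 \<and> l < k}"
  let ?B = "{(k, l). k < ?n \<and> l < ?n - 1 \<and> k \<le> l}"
  have fin: "finite ?A" "finite ?B"
    by (rule finite_subset[of _ "{..<?n} \<times> {..<?n}"]; auto)+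
  have "bd (bd f) zs = (\<Sum>k<?n. \<Sum>l<?n - 1. ?t (k, l))"
    unfolding bd_def
    by (intro sum.cong refl) (auto simp: length_omit sum_distrib_left power_add mult.assoc)
  also have "\<dots> = (\<Sum>x\<in>{..<?n} \<times> {..<?n - 1}. ?t x)"
    by (simp add: sum.cartesian_product)
  also have "{..<?n} \<times> {..<?n - 1} = ?A \<union> ?B" by auto
  also have "sum ?t (?A \<union> ?B) = sum ?t ?A + sum ?t ?B"
    using fin by (intro sum.union_disjoint) auto
  \<comment> \<open>Deleting \<open>k\<close> and then some \<open>l < k\<close> leaves the same
    list as deleting \<open>l\<close> and then \<open>k - 1\<close>. The exponents
    \<open>k + l\<close> and \<open>l + (k - 1)\<close> differ by one, so the two halves
    cancel.\<close>
  also have "sum ?t ?A = (\<Sum>x\<in>?B. - ?t x)"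
  proof (rule sum.reindex_bij_witness[where i = "\<lambda>(k, l). (Suc l, k)" and j = "\<lambda>(k, l). (l, k - 1)"], goal_cases)
    case (5 x)
    then obtain k l where x: "x = (k, l)" "k < ?n" "l < ?n - 1" "l < k" by auto
    then obtain k' where k: "k = Suc k'" by (cases k) auto
    show ?case using x k omit_omit[of l k zs] by (auto simp: add.commute)
  qed auto
  also have "\<dots> + sum ?t ?B = 0" by (simp add: sum_negf)
  finally show ?thesis .
qed

text \<open>Leibniz rule. The last face of the front part and the first face of the rear part give
  the same product, the front \<open>m + 1\<close> entries against the entries after position
  \<open>m\<close>, with opposite signs. All other faces on the right are faces of
  \<open>zs\<close>.\<close>

lemma bd_cup:
  fixes f g :: "'z list \<Rightarrow> 'k::{comm_ring,comm_monoid_mult}"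
  assumes "length zs \<ge> m + 2"
  shows "bd (cup m f g) zs =
    bd f (take (m + 2) zs) * g (drop (m + 1) zs) + (- 1) ^ m * (f (take (m + 1) zs) * bd g (drop m zs))"
proof -
  obtain n where n: "length zs = Suc m + Suc n"
    using assms by (metis Suc_eq_plus1 add_2_eq_Suc' add_Suc_right add_Suc_shift le_iff_add)
  let ?F = "\<Sum>k<Suc m. (- 1) ^ k * f (omit k (take (m + 2) zs))"
  let ?G = "\<Sum>j<Suc n. (- 1) ^ Suc j * g (omit (Suc j) (drop m zs))"
  have A: "cup m f g (omit k zs) = f (omit k (take (m + 2) zs)) * g (drop (m + 1) zs)" if "k < Suc m" for k
  proof -
    have "take (Suc m) (omit k zs) = omit k (take (m + 2) zs)" "drop m (omit k zs) = drop (m + 1) zs"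
      using that n by (auto intro!: nth_equalityI simp: nth_omit length_omit)
    then show ?thesis by (simp add: cup_def)
  qed
  have B: "cup m f g (omit (Suc m + j) zs) = f (take (m + 1) zs) * g (omit (Suc j) (drop m zs))"
    if "j < Suc n" for j
  proof -
    have "take (Suc m) (omit (Suc m + j) zs) = take (m + 1) zs"
      "drop m (omit (Suc m + j) zs) = omit (Suc j) (drop m zs)"
      using that n by (auto intro!: nth_equalityI simp: nth_omit length_omit)
    then show ?thesis by (simp add: cup_def)
  qed
  have 1: "bd (cup m f g) zs = ?F * g (drop (m + 1) zs) + (- 1) ^ m * (f (take (m + 1) zs) * ?G)"
    unfolding bd_def n sum_lessThan_add using A B
    by (simp add: sum_distrib_left sum_distrib_right power_add mult_ac del: sum.lessThan_Suc)
  have 2: "bd f (take (m + 2) zs) = ?F - (- 1) ^ m * f (take (m + 1) zs)"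
  proof -
    have "length (take (m + 2) zs) = Suc (Suc m)" using n by simp
    moreover have "omit (Suc m) (take (m + 2) zs) = take (m + 1) zs"
      using n by (auto intro!: nth_equalityI simp: nth_omit length_omit)
    ultimately show ?thesis unfolding bd_def by simp
  qed
  have 3: "bd g (drop m zs) = g (drop (m + 1) zs) + ?G"
  proof -
    have "length (drop m zs) = Suc (Suc n)" using n by simp
    moreover have "omit 0 (drop m zs) = drop (m + 1) zs" by (simp add: omit_def)
    ultimately show ?thesis unfolding bd_def by (simp add: sum.lessThan_Suc_shift del: sum.lessThan_Suc)
  qed
  show ?thesis unfolding 1 2 3 by (simp add: algebra_simps del: sum.lessThan_Suc)
qed

text \<open>Steenrod's homotopy between the two orders of a cup product of cocycles.\<close>

lemma bd_cup1:
  fixes f g :: "'z list \<Rightarrow> 'k::{comm_ring,comm_monoid_mult}"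
  assumes len: "length zs = Suc (d + e)"
    and f: "\<And>j. j \<le> d \<Longrightarrow> bd f (take (Suc j) zs @ drop (j + e) zs) = 0"
    and g: "\<And>i. i < d \<Longrightarrow> bd g (take (e + 2) (drop i zs)) = 0"
  shows "bd (cup1 d e f g) zs =
    (- 1) ^ (d * e + e + 1) * (cup d f g zs - (- 1) ^ (d * e) * cup e g f zs)"
proof -
  \<comment> \<open>\<open>L j\<close> is \<open>zs\<close> without the entries strictly between
    positions \<open>j\<close> and \<open>j + e\<close> (with entry \<open>j\<close> repeated if
    \<open>e = 0\<close>), and \<open>B j\<close> is \<open>g\<close> on the window from
    \<open>j\<close> to \<open>j + e\<close>. \<open>X j\<close> is the part of the alternating sum
    of \<open>f\<close> over \<open>L j\<close> that deletes a position at most \<open>j\<close>.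
    The \<open>i\<close>-th summand of \<open>cup1\<close> will contribute
    \<open>t (Suc i) - t i\<close>.\<close>
  define L where "L = (\<lambda>j. take (Suc j) zs @ drop (j + e) zs)"
  define B where "B = (\<lambda>j. g (take (Suc e) (drop j zs)))"
  define s :: "nat \<Rightarrow> 'k" where "s = (\<lambda>i. (- 1) ^ (i * Suc e))"
  define \<alpha> where "\<alpha> = (\<lambda>j l. (- 1) ^ l * f (omit l (L j)))"
  define X where "X = (\<lambda>j. \<Sum>l<Suc j. \<alpha> j l)"
  define t where "t = (\<lambda>j. s (Suc j) * (X j * B j))"
  have lenL: "length (L j) = d + 2" if "j \<le> d" for j
    using that len by (simp add: L_def)
  \<comment> \<open>Closedness of \<open>f\<close> on \<open>L j\<close> trades the deletions beyond
    position \<open>j\<close> for minus those up to \<open>j\<close>.\<close>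
  have Y: "(\<Sum>l<Suc d - j. \<alpha> j (Suc j + l)) = - X j" if "j \<le> d" for j
  proof -
    have "Suc j + (Suc d - j) = d + 2" using that by simp
    then have "bd f (L j) = X j + (\<Sum>l<Suc d - j. \<alpha> j (Suc j + l))"
      using sum_lessThan_add[of "\<alpha> j" "Suc j" "Suc d - j"] lenL[OF that]
      by (simp add: bd_def X_def \<alpha>_def del: sum.lessThan_Suc)
    then have "X j + (\<Sum>l<Suc d - j. \<alpha> j (Suc j + l)) = 0"
      using f[OF that] by (simp add: L_def)
    then show ?thesis by (metis add.commute add_eq_0_iff)
  qed
  \<comment> \<open>Closedness of \<open>g\<close> on \<open>e + 2\<close> consecutive entries
    expresses its inner faces by the two outer ones.\<close>
  have G: "(\<Sum>l<e. (- 1) ^ Suc l * g (omit (Suc l) (take (e + 2) (drop i zs)))) = - B (Suc i) + (- 1) ^ e * B i"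
    if "i < d" for i
  proof -
    let ?M = "take (e + 2) (drop i zs)"
    have l: "length ?M = Suc (Suc e)" using that len by simp
    have "omit 0 ?M = take (Suc e) (drop (Suc i) zs)" "omit (Suc e) ?M = take (Suc e) (drop i zs)"
      using that len by (auto intro!: nth_equalityI simp: nth_omit length_omit)
    then have "bd g ?M = B (Suc i) + (\<Sum>l<e. (- 1) ^ Suc l * g (omit (Suc l) ?M)) - (- 1) ^ e * B i"
      unfolding bd_def l by (subst sum.lessThan_Suc, subst sum.lessThan_Suc_shift) (simp add: B_def)
    then show ?thesis using g[OF that] by (simp add: algebra_simps add_eq_0_iff)
  qed
  have step: "(\<Sum>k<length zs. (- 1) ^ k * (s i * (f (take (Suc i) (omit k zs) @ drop (i + e) (omit k zs))
      * g (take (Suc e) (drop i (omit k zs)))))) = t (Suc i) - t i" (is "(\<Sum>k<_. ?T k) = _") if i: "i < d" for i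
  proof -
    have n: "length zs = Suc i + (e + (d - i))" using i len by simp
    have 1: "?T k = s i * (\<alpha> (Suc i) k * B (Suc i))" if "k < Suc i" for k
    proof -
      have "take (Suc i) (omit k zs) @ drop (i + e) (omit k zs) = omit k (L (Suc i))"
        using that i len by (auto intro!: nth_equalityI simp: L_def nth_omit length_omit nth_append)
      moreover have "take (Suc e) (drop i (omit k zs)) = take (Suc e) (drop (Suc i) zs)"
        using that i len by (auto intro!: nth_equalityI simp: L_def nth_omit length_omit nth_append)
      ultimately show ?thesis by (simp add: \<alpha>_def B_def mult_ac)
    qed
    \<comment> \<open>At position \<open>i + 1\<close> the two lists have the same face. This lets
      the outer faces of \<open>g\<close>, obtained from \<open>G\<close>, complete the partial sums
      of \<open>f\<close> over \<open>L (Suc i)\<close> and over \<open>L i\<close>.\<close>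
    have L': "omit (Suc i) (L (Suc i)) = omit (Suc i) (L i)"
      using i len by (auto intro!: nth_equalityI simp: L_def nth_omit length_omit nth_append)
    have 2: "?T (Suc i + l) = s i * (- \<alpha> (Suc i) (Suc i) * ((- 1) ^ Suc l * g (omit (Suc l) (take (e + 2) (drop i zs)))))"
      if "l < e" for l
    proof -
      have "take (Suc i) (omit (Suc i + l) zs) @ drop (i + e) (omit (Suc i + l) zs) = omit (Suc i) (L i)"
        using that i len by (auto intro!: nth_equalityI simp: L_def nth_omit length_omit nth_append)
      moreover have "take (Suc e) (drop i (omit (Suc i + l) zs)) = omit (Suc l) (take (e + 2) (drop i zs))"
        using that i len by (auto intro!: nth_equalityI simp: L_def nth_omit length_omit nth_append)
      ultimately show ?thesis by (simp add: \<alpha>_def L' power_add mult_ac)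
    qed
    have 3: "?T (Suc i + (e + l)) = s i * ((- 1) ^ Suc e * (\<alpha> i (Suc i + Suc l) * B i))" if "l < d - i" for l
    proof -
      have "take (Suc i) (omit (Suc i + (e + l)) zs) @ drop (i + e) (omit (Suc i + (e + l)) zs)
          = omit (Suc i + Suc l) (L i)"
        using that i len by (auto intro!: nth_equalityI simp: L_def nth_omit length_omit nth_append)
      moreover have "take (Suc e) (drop i (omit (Suc i + (e + l)) zs)) = take (Suc e) (drop i zs)"
        using that i len by (auto intro!: nth_equalityI simp: L_def nth_omit length_omit nth_append)
      ultimately show ?thesis by (simp add: \<alpha>_def B_def power_add mult_ac)
    qed
    have "(\<Sum>k<length zs. ?T k) = s i * ((\<Sum>k<Suc i. \<alpha> (Suc i) k) * B (Suc i)
        + - \<alpha> (Suc i) (Suc i) * (\<Sum>l<e. (- 1) ^ Suc l * g (omit (Suc l) (take (e + 2) (drop i zs))))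
        + (- 1) ^ Suc e * ((\<Sum>l<d - i. \<alpha> i (Suc i + Suc l)) * B i))"
      unfolding n sum_lessThan_add using 1 2 3
      by (simp add: sum_distrib_left sum_distrib_right distrib_left add.assoc del: sum.lessThan_Suc power_Suc)
    also have "\<dots> = s i * (((\<Sum>k<Suc i. \<alpha> (Suc i) k) + \<alpha> (Suc i) (Suc i)) * B (Suc i)
        + (- 1) ^ Suc e * ((\<alpha> i (Suc i) + (\<Sum>l<d - i. \<alpha> i (Suc i + Suc l))) * B i))"
      unfolding G[OF i] by (simp add: algebra_simps \<alpha>_def L' del: sum.lessThan_Suc)
    also have "(\<Sum>k<Suc i. \<alpha> (Suc i) k) + \<alpha> (Suc i) (Suc i) = X (Suc i)" by (simp add: X_def)
    also have "\<alpha> i (Suc i) + (\<Sum>l<d - i. \<alpha> i (Suc i + Suc l)) = - X i"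
    proof -
      have "Suc d - i = Suc (d - i)" using i by simp
      then show ?thesis using Y[of i] i by (simp add: sum.lessThan_Suc_shift del: sum.lessThan_Suc)
    qed
    also have "s i * (X (Suc i) * B (Suc i) + (- 1) ^ Suc e * (- X i * B i)) = t (Suc i) - t i"
    proof -
      have "s (Suc (Suc i)) = s i" unfolding s_def by (rule minus_one_parity) auto
      moreover have "s (Suc i) = s i * (- 1) ^ Suc e" by (simp add: s_def power_add mult_ac)
      ultimately show ?thesis unfolding t_def by (simp add: algebra_simps)
    qed
    finally show ?thesis .
  qed
  have "bd (cup1 d e f g) zs = (\<Sum>i<d. \<Sum>k<length zs. (- 1) ^ k * (s i * (f (take (Suc i) (omit k zs) @ drop (i + e) (omit k zs))
      * g (take (Suc e) (drop i (omit k zs))))))"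
    unfolding bd_def cup1_def sum_distrib_left s_def by (rule sum.swap)
  also have "\<dots> = (\<Sum>i<d. t (Suc i) - t i)" using step by simp
  also have "\<dots> = t d - t 0" by (rule sum_lessThan_telescope)
  also have "t d = (- 1) ^ (d * e + e + 1) * cup d f g zs"
  proof -
    have "omit (Suc d) (L d) = take (Suc d) zs"
      using len by (auto intro!: nth_equalityI simp: L_def nth_omit length_omit nth_append)
    then have X: "X d = (- 1) ^ d * f (take (Suc d) zs)"
      using Y[of d] by (simp add: \<alpha>_def minus_equation_iff[of _ "X d"] eq_commute)
    \<comment> \<open>The numbers (d + 1)(e + 1) + d and d e + e + 1 have the same parity; this is
      the origin of the exponent in the statement.\<close>
    have "s (Suc d) * (- 1) ^ d = (- 1) ^ (d * e + e + 1)"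
      unfolding s_def power_add[symmetric] by (rule minus_one_parity) auto
    moreover have "take (Suc e) (drop d zs) = drop d zs" using len by simp
    ultimately show ?thesis unfolding t_def X B_def cup_def by (metis mult.assoc)
  qed
  also have "t 0 = (- 1) ^ (d * e + e + 1) * ((- 1) ^ (d * e) * cup e g f zs)"
  proof -
    have "omit 0 (L 0) = drop e zs"
      using len by (auto intro!: nth_equalityI simp: L_def nth_omit length_omit nth_append)
    then have X: "X 0 = f (drop e zs)" by (simp add: X_def \<alpha>_def)
    have "s (Suc 0) = (- 1) ^ (d * e + e + 1) * (- 1) ^ (d * e)"
      unfolding s_def power_add[symmetric] by (rule minus_one_parity) auto
    then show ?thesis unfolding t_def X B_def cup_def by (simp add: mult_ac)
  qed
  finally show ?thesis by (simp add: right_diff_distrib)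
qed

section \<open>Cocycles on weakly increasing lists\<close>

lemma fp_refl: "finite_poset r \<Longrightarrow> x \<in> Field r \<Longrightarrow> (x, x) \<in> r"
  by (auto simp: finite_poset_def partial_order_on_def preorder_on_def refl_on_def)

lemma fp_trans: "finite_poset r \<Longrightarrow> (x, y) \<in> r \<Longrightarrow> (y, z) \<in> r \<Longrightarrow> (x, z) \<in> r"
  by (auto simp: finite_poset_def partial_order_on_def preorder_on_def dest: transD)

lemma fp_antisym: "finite_poset r \<Longrightarrow> (x, y) \<in> r \<Longrightarrow> (y, x) \<in> r \<Longrightarrow> x = y"
  by (auto simp: finite_poset_def partial_order_on_def dest: antisymD)

lemma fp_finite: "finite_poset r \<Longrightarrow> finite (Field r)"
  by (simp add: finite_poset_def)

definition wchain :: "'p rel \<Rightarrow> 'p list \<Rightarrow> bool" where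
  "wchain r zs \<longleftrightarrow> set zs \<subseteq> Field r \<and> sorted_wrt (\<lambda>x y. (x, y) \<in> r) zs"

lemma wchain_nth: "\<lbrakk>finite_poset r; wchain r zs; i \<le> j; j < length zs\<rbrakk> \<Longrightarrow> (zs ! i, zs ! j) \<in> r"
  using sorted_wrt_nth_less[of "\<lambda>x y. (x, y) \<in> r" zs i j] nth_mem[of j zs] fp_refl[of r "zs ! j"]
  by (cases "i = j") (auto simp: wchain_def subset_iff)

lemma wchain_take: "wchain r zs \<Longrightarrow> wchain r (take n zs)"
  by (auto simp: wchain_def sorted_wrt_take dest: in_set_takeD)

lemma wchain_drop: "wchain r zs \<Longrightarrow> wchain r (drop n zs)"
  by (auto simp: wchain_def sorted_wrt_drop dest: in_set_dropD)

text \<open>The bound \<open>Suc m\<close> allows the last entry kept on the left to recur on the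
  right, as happens in \<open>cup1\<close> for a second factor of degree 0.\<close>

lemma wchain_take_drop:
  assumes "finite_poset r" "wchain r zs" "n \<le> Suc m"
  shows "wchain r (take n zs @ drop m zs)"
proof -
  have "(x, y) \<in> r" if x: "x \<in> set (take n zs)" and y: "y \<in> set (drop m zs)" for x y
  proof -
    obtain i where i: "i < length (take n zs)" "x = take n zs ! i"
      using x unfolding in_set_conv_nth by blast
    obtain j where j: "j < length (drop m zs)" "y = drop m zs ! j"
      using y unfolding in_set_conv_nth by blast
    have "x = zs ! i" "y = zs ! (m + j)" "i \<le> m + j" "m + j < length zs" using i j assms(3) by auto
    then show ?thesis using wchain_nth[OF assms(1,2), of i "m + j"] by simp
  qed
  then show ?thesis using wchain_take[OF assms(2), of n] wchain_drop[OF assms(2), of m]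
    by (simp add: wchain_def sorted_wrt_append)
qed

lemma wchain_omit: "finite_poset r \<Longrightarrow> wchain r zs \<Longrightarrow> wchain r (omit k zs)"
  unfolding omit_def by (rule wchain_take_drop) auto

lemma wchain_map:
  assumes "wchain r zs" "\<And>x y. x \<in> set zs \<Longrightarrow> y \<in> set zs \<Longrightarrow> (x, y) \<in> r \<Longrightarrow> (h x, h y) \<in> s"
    "finite_poset r"
  shows "wchain s (map h zs)"
proof -
  have "h x \<in> Field s" if "x \<in> set zs" for x
    using assms(2)[OF that that] fp_refl[OF assms(3)] that assms(1) by (auto simp: wchain_def subset_iff intro: FieldI1)
  moreover have "sorted_wrt (\<lambda>x y. (h x, h y) \<in> s) zs"
    using assms(1,2) by (auto simp: wchain_def intro: sorted_wrt_mono_rel[of zs "\<lambda>x y. (x, y) \<in> r"])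
  ultimately show ?thesis by (auto simp: wchain_def sorted_wrt_map)
qed

lemma wchain_hd: "\<lbrakk>finite_poset r; wchain r zs; z \<in> set zs\<rbrakk> \<Longrightarrow> (hd zs, z) \<in> r"
  by (metis gr_implies_not0 hd_conv_nth in_set_conv_nth le0 length_0_conv wchain_nth)

lemma wchain_last:
  assumes "finite_poset r" "wchain r zs" "z \<in> set zs"
  shows "(z, last zs) \<in> r"
proof -
  obtain i where "i < length zs" "z = zs ! i" using assms(3) by (auto simp: in_set_conv_nth)
  then show ?thesis using wchain_nth[OF assms(1,2), of i "length zs - 1"]
    by (cases "zs = []") (auto simp: last_conv_nth)
qed

lemma sorted_wrt_distinct_iff:
  "sorted_wrt (\<lambda>x y. P x y \<and> x \<noteq> y) zs \<longleftrightarrow> sorted_wrt P zs \<and> distinct zs"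
  by (induction zs) auto

lemma end_chains_iff:
  "zs \<in> end_chains r \<longleftrightarrow>
     zs \<noteq> [] \<and> wchain r zs \<and> distinct zs \<and> hd zs \<in> min_elems r \<and> last zs \<in> max_elems r"
  by (auto simp: end_chains_def wchain_def sorted_wrt_distinct_iff)

lemma omit_end_chains:
  assumes "finite_poset r" "zs \<in> end_chains r" "0 < k" "Suc k < length zs"
  shows "omit k zs \<in> end_chains r"
proof -
  have "distinct (omit k zs)" using assms(2)
    by (auto simp: omit_def end_chains_iff dest: set_take_disj_set_drop_if_distinct[where i=k and j = "Suc k"])
  moreover have "hd (omit k zs) = hd zs" "last (omit k zs) = last zs" "omit k zs \<noteq> []"
    using assms(3,4) by (auto simp: omit_def hd_append take_eq_Nil)
  ultimately show ?thesis using assms(1,2) wchain_omit by (auto simp: end_chains_iff)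
qed

lemma min_elemsD: "\<lbrakk>y \<in> min_elems r; (x, y) \<in> r\<rbrakk> \<Longrightarrow> x = y"
  by (auto simp: min_elems_def)

lemma max_elemsD: "\<lbrakk>x \<in> max_elems r; (x, y) \<in> r\<rbrakk> \<Longrightarrow> x = y"
  by (auto simp: max_elems_def)

lemma min_elems_Field: "x \<in> min_elems r \<Longrightarrow> x \<in> Field r"
  by (auto simp: min_elems_def)

text \<open>
  Cochains are modelled by arbitrary functions on lists; only their values on increasing lists of
  one length matter. The full alternating sum \<open>bd\<close>, over all deletions and on all weakly increasing
  lists, then agrees with the differential of \<open>c\<^sup>\<bullet>\<close>, which only involves inner deletions.
\<close>

definition supported :: "'p rel \<Rightarrow> nat \<Rightarrow> ('p list \<Rightarrow> 'k::zero) \<Rightarrow> bool" where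
  "supported r N f \<longleftrightarrow> (\<forall>zs. wchain r zs \<longrightarrow> length zs = N \<longrightarrow> f zs \<noteq> 0 \<longrightarrow> zs \<in> end_chains r)"

definition cocycle :: "'p rel \<Rightarrow> nat \<Rightarrow> ('p list \<Rightarrow> 'k::{comm_ring,comm_monoid_mult}) \<Rightarrow> bool" where
  "cocycle r n f \<longleftrightarrow> supported r (Suc n) f \<and> (\<forall>zs. wchain r zs \<longrightarrow> length zs = n + 2 \<longrightarrow> bd f zs = 0)"

text \<open>The primitive lives on lists of length \<open>n\<close>, one shorter than the cochains.
  This includes degree 0: a supported function vanishes on the empty list, so there the coboundary
  term is zero.\<close>

definition cohomologous :: "'p rel \<Rightarrow> nat \<Rightarrow> ('p list \<Rightarrow> 'k) \<Rightarrow> ('p list \<Rightarrow> 'k::{comm_ring,comm_monoid_mult}) \<Rightarrow> bool"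
  where "cohomologous r n f g \<longleftrightarrow> (\<exists>h. supported r n h \<and>
    (\<forall>zs\<in>end_chains r. length zs = Suc n \<longrightarrow> f zs = g zs + bd h zs))"

section \<open>Degenerate lists and outer faces\<close>

lemma omit_0: "omit 0 zs = tl zs"
  by (simp add: omit_def drop_Suc)

lemma omit_last: "omit (length zs - 1) zs = butlast zs"
  by (cases zs rule: rev_cases) (auto simp: omit_def)

text \<open>By antisymmetry a repetition in a weakly increasing list occurs at adjacent positions.
  Deleting either copy gives the same list with opposite signs, and every other deletion leaves a
  repetition, where a supported function vanishes.\<close>

lemma bd_supported_nondistinct:
  fixes f :: "'p list \<Rightarrow> 'k::{comm_ring,comm_monoid_mult}"
  assumes r: "finite_poset r" and f: "supported r N f" and zs: "wchain r zs" "length zs = Suc N" "\<not> distinct zs"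
  shows "bd f zs = 0"
proof -
  obtain i j where ij: "i < j" "j < length zs" "zs ! i = zs ! j"
    using zs(3) by (metis distinct_conv_nth linorder_neqE_nat)
  then have "(zs ! i, zs ! Suc i) \<in> r" "(zs ! Suc i, zs ! i) \<in> r"
    using wchain_nth[OF r zs(1), of i "Suc i"] wchain_nth[OF r zs(1), of "Suc i" j] by auto
  then have eq: "zs ! i = zs ! Suc i" using fp_antisym[OF r] by blast
  have i: "Suc i < length zs" using ij by simp
  have z: "f (omit k zs) = 0" if "k < length zs" "k \<noteq> i" "k \<noteq> Suc i" for k
  proof (rule ccontr)
    assume "f (omit k zs) \<noteq> 0"
    then have d: "distinct (omit k zs)"
      using f wchain_omit[OF r zs(1)] zs(2) that by (auto simp: supported_def length_omit end_chains_iff)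
    show False
    proof (cases "k < i")
      case True
      then obtain i' where i': "i = Suc i'" by (cases i) auto
      have "omit k zs ! i' = omit k zs ! i" using True i' i that eq by (simp add: nth_omit)
      moreover have "length (omit k zs) = length zs - 1" "i < length zs - 1" using i that by (auto simp: length_omit)
      ultimately show False using nth_eq_iff_index_eq[OF d, of i' i] i' by simp
    next
      case False
      then have k: "Suc i < k" using that by simp
      then have "omit k zs ! i = omit k zs ! Suc i" using i that eq by (simp add: nth_omit)
      moreover have "length (omit k zs) = length zs - 1" "Suc i < length zs - 1" using k i that by (auto simp: length_omit)
      ultimately show False using nth_eq_iff_index_eq[OF d, of i "Suc i"] by simp
    qed
  qed
  have "bd f zs = (\<Sum>k\<in>{i, Suc i}. (- 1) ^ k * f (omit k zs))"
    unfolding bd_def using i z by (intro sum.mono_neutral_right) auto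
  moreover have "omit i zs = omit (Suc i) zs"
    using i eq by (intro nth_equalityI) (auto simp: nth_omit length_omit less_Suc_eq)
  ultimately show ?thesis by simp
qed

text \<open>In a strict chain the second entry has something below it and the last but one has
  something above it, so neither can serve as an end of an end chain.\<close>

lemma supported_ends:
  assumes f: "supported r N f" and zs: "wchain r zs" "length zs = Suc N" "distinct zs"
  shows "f (tl zs) = 0" "f (butlast zs) = 0"
proof -
  have d: "wchain r (tl zs)" "wchain r (butlast zs)"
    using wchain_drop[OF zs(1), of 1] wchain_take[OF zs(1), of N] zs(2)
    by (auto simp: drop_Suc butlast_conv_take)
  show "f (tl zs) = 0"
  proof (rule ccontr)
    assume "f (tl zs) \<noteq> 0"
    then have "tl zs \<in> end_chains r" using f d zs by (auto simp: supported_def)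
    then obtain x y ys where "zs = x # y # ys" "y \<in> min_elems r"
      by (cases zs; cases "tl zs") (auto simp: end_chains_iff)
    then show False using zs min_elemsD[of y r x] by (auto simp: wchain_def)
  qed
  show "f (butlast zs) = 0"
  proof (rule ccontr)
    assume "f (butlast zs) \<noteq> 0"
    then have "butlast zs \<in> end_chains r" using f d zs by (auto simp: supported_def)
    then obtain x y ys where "zs = ys @ [x, y]" "x \<in> max_elems r"
      by (cases zs rule: rev_cases; cases "butlast zs" rule: rev_cases) (auto simp: end_chains_iff)
    then show False using zs max_elemsD[of x r y] by (auto simp: wchain_def sorted_wrt_append)
  qed
qed

lemma supported_bd:
  assumes r: "finite_poset r" and f: "supported r N f"
  shows "supported r (Suc N) (bd f)"
  unfolding supported_def
proof (intro allI impI, rule ccontr)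
  fix zs assume zs: "wchain r zs" "length zs = Suc N" and n: "bd f zs \<noteq> 0" "zs \<notin> end_chains r"
  have d: "distinct zs" using bd_supported_nondistinct[OF r f zs] n by blast
  have "f (omit k zs) = 0" if k: "k < length zs" for k
  proof -
    consider "k = 0" | "k = length zs - 1" | "0 < k" "Suc k < length zs" using k by linarith
    then show ?thesis
    proof cases
      case 3
      then have "hd (omit k zs) = hd zs" "last (omit k zs) = last zs"
        by (auto simp: omit_def hd_append take_eq_Nil)
      moreover have "omit k zs \<notin> end_chains r"
        using n(2) zs d calculation by (auto simp: end_chains_iff)
      ultimately show ?thesis using f wchain_omit[OF r zs(1), of k] zs(2) k length_omit[OF k]
        by (auto simp: supported_def)
    qed (auto simp: omit_0 omit_last supported_ends[OF f zs d] simp del: One_nat_def)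
  qed
  then show False using n(1) bd_zero[of zs f] by blast
qed

lemma bd_supported_inner:
  assumes f: "supported r N f" and zs: "zs \<in> end_chains r" "length zs = Suc N"
  shows "bd f zs = (\<Sum>k\<in>{1..<N}. (- 1) ^ k * f (omit k zs))"
proof -
  have w: "wchain r zs" "distinct zs" using zs by (auto simp: end_chains_iff)
  have 0: "f (omit 0 zs) = 0" "f (omit N zs) = 0"
    using supported_ends[OF f w(1) zs(2) w(2)] omit_last[of zs] zs(2) by (auto simp: omit_0)
  have z: "k = 0 \<or> k = N" if "k \<in> {..<length zs} - {1..<N}" for k
    using that zs(2) by auto
  show ?thesis unfolding bd_def
    by (rule sum.mono_neutral_right) (use zs(2) z 0 in force)+
qed

text \<open>The primitive need not be supported. Inner faces of end chains are end chains again and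
  the outer faces are required to give zero, so cutting \<open>h\<close> down to end chains does not
  change the relevant values of \<open>bd h\<close>. The homotopies below are only known in this
  weaker form.\<close>

lemma cohomologousI:
  assumes r: "finite_poset r"
    and h: "\<And>zs. zs \<in> end_chains r \<Longrightarrow> length zs = Suc n \<Longrightarrow>
      f zs = g zs + bd h zs \<and> h (tl zs) = 0 \<and> h (butlast zs) = 0"
  shows "cohomologous r n f g"
proof -
  let ?h = "\<lambda>zs. if zs \<in> end_chains r then h zs else 0"
  have "f zs = g zs + bd ?h zs" if zs: "zs \<in> end_chains r" "length zs = Suc n" for zs
  proof -
    have "bd h zs = bd ?h zs"
    proof (rule bd_cong)
      fix k assume "k < length zs"
      then consider "k = 0" | "k = length zs - 1" | "0 < k" "Suc k < length zs" by linarith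
      then show "h (omit k zs) = ?h (omit k zs)"
        by cases (use h[OF zs] omit_end_chains[OF r zs(1)] in
          \<open>auto simp: omit_0 omit_last simp del: One_nat_def\<close>)
    qed
    then show ?thesis using h[OF zs] by simp
  qed
  then show ?thesis unfolding cohomologous_def by (intro exI[of _ ?h]) (auto simp: supported_def)
qed

text \<open>A repetition would occur at adjacent positions, and since the two parts share entry
  \<open>m\<close>, any two adjacent positions lie in one of them.\<close>

lemma wchain_cup_distinct:
  assumes r: "finite_poset r" and zs: "wchain r zs" and d: "distinct (take (Suc m) zs)" "distinct (drop m zs)"
  shows "distinct zs"
proof (rule ccontr)
  assume "\<not> distinct zs"
  then obtain i j where ij: "i < j" "j < length zs" "zs ! i = zs ! j"
    by (metis distinct_conv_nth linorder_neqE_nat)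
  then have "(zs ! i, zs ! Suc i) \<in> r" "(zs ! Suc i, zs ! i) \<in> r"
    using wchain_nth[OF r zs, of i "Suc i"] wchain_nth[OF r zs, of "Suc i" j] by auto
  then have eq: "zs ! i = zs ! Suc i" using fp_antisym[OF r] by blast
  show False
  proof (cases "i < m")
    case True
    then have "take (Suc m) zs ! i = take (Suc m) zs ! Suc i" using eq by simp
    then show False using nth_eq_iff_index_eq[OF d(1), of i "Suc i"] True ij by simp
  next
    case False
    have "drop m zs ! (i - m) = drop m zs ! Suc (i - m)" using False eq ij by simp
    moreover have "Suc (i - m) < length (drop m zs)" using False ij by simp
    ultimately show False using nth_eq_iff_index_eq[OF d(2), of "i - m" "Suc (i - m)"] by simp
  qed
qed

text \<open>\<open>Y\<close> is the set of admissible cut points. Neither factor has to be closed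
  everywhere: in the Leibniz rule the coboundary of one factor is multiplied by the other, whose
  nonvanishing puts the common entry into \<open>Y\<close>.\<close>

lemma cocycle_cup:
  fixes f g :: "'p list \<Rightarrow> 'k::{comm_ring,comm_monoid_mult}"
  assumes r: "finite_poset r"
    and f: "\<And>ws. wchain r ws \<Longrightarrow> length ws = Suc m \<Longrightarrow> f ws \<noteq> 0 \<Longrightarrow>
        distinct ws \<and> hd ws \<in> min_elems r \<and> last ws \<in> Y"
    and g: "\<And>ws. wchain r ws \<Longrightarrow> length ws = Suc n \<Longrightarrow> g ws \<noteq> 0 \<Longrightarrow>
        distinct ws \<and> hd ws \<in> Y \<and> last ws \<in> max_elems r"
  shows "supported r (Suc (m + n)) (cup m f g)"
    and "\<lbrakk>\<And>ws. wchain r ws \<Longrightarrow> length ws = m + 2 \<Longrightarrow> last ws \<in> Y \<Longrightarrow> bd f ws = 0;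
          \<And>ws. wchain r ws \<Longrightarrow> length ws = n + 2 \<Longrightarrow> hd ws \<in> Y \<Longrightarrow> bd g ws = 0\<rbrakk>
        \<Longrightarrow> cocycle r (m + n) (cup m f g)"
proof -
  show 1: "supported r (Suc (m + n)) (cup m f g)"
    unfolding supported_def
  proof (intro allI impI)
    fix zs assume zs: "wchain r zs" "length zs = Suc (m + n)" "cup m f g zs \<noteq> 0"
    have nz: "f (take (Suc m) zs) \<noteq> 0" "g (drop m zs) \<noteq> 0" using zs(3) by (auto simp: cup_def)
    have F: "distinct (take (Suc m) zs)" "hd (take (Suc m) zs) \<in> min_elems r"
      using f[OF wchain_take[OF zs(1)] _ nz(1)] zs(2) by auto
    have G: "distinct (drop m zs)" "last (drop m zs) \<in> max_elems r"
      using g[OF wchain_drop[OF zs(1)] _ nz(2)] zs(2) by auto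
    have "distinct zs" by (rule wchain_cup_distinct[OF r zs(1) F(1) G(1)])
    then show "zs \<in> end_chains r" using zs F(2) G(2) by (cases zs) (auto simp: end_chains_iff)
  qed
  assume fb: "\<And>ws. wchain r ws \<Longrightarrow> length ws = m + 2 \<Longrightarrow> last ws \<in> Y \<Longrightarrow> bd f ws = 0"
    and gb: "\<And>ws. wchain r ws \<Longrightarrow> length ws = n + 2 \<Longrightarrow> hd ws \<in> Y \<Longrightarrow> bd g ws = 0"
  have "bd (cup m f g) zs = 0" if zs: "wchain r zs" "length zs = m + n + 2" for zs
  proof -
    have "bd f (take (m + 2) zs) * g (drop (m + 1) zs) = 0"
    proof (cases "g (drop (m + 1) zs) = 0")
      case False
      then have "hd (drop (m + 1) zs) \<in> Y" using g[OF wchain_drop[OF zs(1)] _ False] zs(2) by auto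
      then have "last (take (m + 2) zs) \<in> Y" using zs(2) by (simp add: hd_drop_conv_nth take_Suc_conv_app_nth)
      then show ?thesis using fb[OF wchain_take[OF zs(1)]] zs(2) by auto
    qed simp
    moreover have "f (take (m + 1) zs) * bd g (drop m zs) = 0"
    proof (cases "f (take (m + 1) zs) = 0")
      case False
      then have "last (take (m + 1) zs) \<in> Y" using f[OF wchain_take[OF zs(1)] _ False] zs(2) by auto
      then have "hd (drop m zs) \<in> Y" using zs(2) by (simp add: hd_drop_conv_nth take_Suc_conv_app_nth)
      then show ?thesis using gb[OF wchain_drop[OF zs(1)]] zs(2) by auto
    qed simp
    ultimately show ?thesis using bd_cup[of m zs f g] zs(2) by simp
  qed
  then show "cocycle r (m + n) (cup m f g)" using 1 by (simp add: cocycle_def)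
qed

section \<open>Iterated cup products and the interchange of factors\<close>

fun mcup :: "(nat \<times> ('z list \<Rightarrow> 'k)) list \<Rightarrow> 'z list \<Rightarrow> 'k::{comm_ring,comm_monoid_mult}" where
  "mcup [] zs = 1"
| "mcup ((n, f) # fs) zs = f (take (Suc n) zs) * mcup fs (drop n zs)"

definition tdeg :: "(nat \<times> 'b) list \<Rightarrow> nat" where
  "tdeg fs = sum_list (map fst fs)"

lemma tdeg_simps [simp]: "tdeg [] = 0" "tdeg ((n, f) # fs) = n + tdeg fs" "tdeg (fs @ gs) = tdeg fs + tdeg gs"
  by (auto simp: tdeg_def)

lemma mcup_append: "mcup (fs @ gs) = cup (tdeg fs) (mcup fs) (mcup gs)"
proof
  show "mcup (fs @ gs) zs = cup (tdeg fs) (mcup fs) (mcup gs) zs" for zs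
    by (induction fs arbitrary: zs) (auto simp: cup_def drop_take mult.assoc add.commute)
qed

lemma mcup_Cons: "mcup ((n, f) # fs) = cup n f (mcup fs)"
  by (auto simp: cup_def)

text \<open>The factors are evaluated on consecutive windows, so closedness is needed only on a
  family \<open>C\<close> stable under initial and final segments, for instance the windows of one
  fixed list. The empty product is the constant 1, whose two faces on a list of length 2
  cancel.\<close>

lemma bd_mcup:
  assumes "\<And>n f zs. (n, f) \<in> set fs \<Longrightarrow> zs \<in> C \<Longrightarrow> length zs = n + 2 \<Longrightarrow> bd f zs = 0"
    and "\<And>zs n. zs \<in> C \<Longrightarrow> take n zs \<in> C \<and> drop n zs \<in> C"
    and "zs \<in> C" "length zs = tdeg fs + 2"
  shows "bd (mcup fs) zs = 0"
  using assms(1,3,4)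
proof (induction fs arbitrary: zs)
  case Nil
  then show ?case by (simp add: bd_def numeral_2_eq_2)
next
  case (Cons x fs)
  obtain n f where x: "x = (n, f)" by (cases x)
  have C: "take (n + 2) zs \<in> C" "drop n zs \<in> C" using assms(2)[OF Cons.prems(2)] by blast+
  have "bd f (take (n + 2) zs) = 0"
    using Cons.prems(3) x by (intro Cons.prems(1)[OF _ C(1)]) auto
  moreover have "bd (mcup fs) (drop n zs) = 0"
    using Cons.prems(1,3) x by (intro Cons.IH C(2)) auto
  ultimately show ?case using Cons.prems(3) x bd_cup[of n zs f "mcup fs"] by (simp add: mcup_Cons)
qed

lemma mcup_slice:
  assumes "mcup fs zs \<noteq> 0" "length zs = Suc (tdeg fs)" "(n, f) \<in> set fs"
  shows "\<exists>i. i + n < length zs \<and> f (take (Suc n) (drop i zs)) \<noteq> 0"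
  using assms
proof (induction fs arbitrary: zs)
  case (Cons x fs)
  obtain k g where x: "x = (k, g)" by (cases x)
  have nz: "g (take (Suc k) zs) \<noteq> 0" "mcup fs (drop k zs) \<noteq> 0" using Cons.prems x by auto
  show ?case
  proof (cases "(n, f) = x")
    case True
    then show ?thesis using nz(1) Cons.prems x by (intro exI[of _ 0]) auto
  next
    case False
    then have "\<exists>i. i + n < length (drop k zs) \<and> f (take (Suc n) (drop i (drop k zs))) \<noteq> 0"
      using Cons.prems x nz by (intro Cons.IH) auto
    then obtain i where "i + n < length (drop k zs)" "f (take (Suc n) (drop i (drop k zs))) \<noteq> 0" by blast
    then show ?thesis by (intro exI[of _ "i + k"]) auto
  qed
qed simp

lemma last_slice: "i + n < length zs \<Longrightarrow> last (take (Suc n) (drop i zs)) = zs ! (i + n)"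
  by (simp add: take_Suc_conv_app_nth)

text \<open>
  Interchange of two adjacent factors \<open>A\<close> and \<open>B\<close> of a cup product. The factors need not be cocycles
  on their own, only next to their neighbours: \<open>LA\<close> and \<open>UA\<close> (\<open>LB\<close> and \<open>UB\<close>) stand for the elements below
  and above the places where \<open>A\<close> may start (where \<open>B\<close> may end).
\<close>

lemma cup_swap:
  fixes q A B s :: "'p list \<Rightarrow> 'k::{comm_ring,comm_monoid_mult}"
  assumes r: "finite_poset r"
    and q_bd: "\<And>ws. wchain r ws \<Longrightarrow> length ws = n + 2 \<Longrightarrow> last ws \<in> LA \<Longrightarrow> bd q ws = 0"
    and q_UA: "\<And>ws. wchain r ws \<Longrightarrow> length ws = Suc n \<Longrightarrow> q ws \<noteq> 0 \<Longrightarrow> last ws \<in> UA"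
    and A_LA: "\<And>ws. wchain r ws \<Longrightarrow> length ws = Suc d \<Longrightarrow> A ws \<noteq> 0 \<Longrightarrow> hd ws \<in> LA"
    and A_bd: "\<And>ws. wchain r ws \<Longrightarrow> length ws = d + 2 \<Longrightarrow> hd ws \<in> UA \<Longrightarrow> bd A ws = 0"
    and B_UB: "\<And>ws. wchain r ws \<Longrightarrow> length ws = Suc e \<Longrightarrow> B ws \<noteq> 0 \<Longrightarrow> last ws \<in> UB"
    and B_bd: "\<And>ws. wchain r ws \<Longrightarrow> length ws = e + 2 \<Longrightarrow> last ws \<in> LB \<Longrightarrow> bd B ws = 0"
    and s_LB: "\<And>ws. wchain r ws \<Longrightarrow> length ws = Suc k \<Longrightarrow> s ws \<noteq> 0 \<Longrightarrow> hd ws \<in> LB"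
    and s_bd: "\<And>ws. wchain r ws \<Longrightarrow> length ws = k + 2 \<Longrightarrow> hd ws \<in> UB \<Longrightarrow> bd s ws = 0"
    and LB_down: "\<And>x y. (x, y) \<in> r \<Longrightarrow> y \<in> LB \<Longrightarrow> x \<in> LB"
    and UB_up: "\<And>x y. (x, y) \<in> r \<Longrightarrow> x \<in> UB \<Longrightarrow> y \<in> UB"
    and mn: "\<And>w1 w2 w3 w4. \<lbrakk>wchain r w1; length w1 = Suc n; q w1 \<noteq> 0; wchain r w2; length w2 = Suc d; A w2 \<noteq> 0;
        wchain r w3; length w3 = Suc e; B w3 \<noteq> 0; wchain r w4; length w4 = Suc k; s w4 \<noteq> 0;
        (hd w1, hd w2) \<in> r; (hd w1, hd w3) \<in> r; (hd w1, hd w4) \<in> r\<rbrakk> \<Longrightarrow> hd w1 \<in> min_elems r"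
    and mx: "\<And>w1 w2 w3 w4. \<lbrakk>wchain r w1; length w1 = Suc n; q w1 \<noteq> 0; wchain r w2; length w2 = Suc d; A w2 \<noteq> 0;
        wchain r w3; length w3 = Suc e; B w3 \<noteq> 0; wchain r w4; length w4 = Suc k; s w4 \<noteq> 0;
        (last w1, last w4) \<in> r; (last w2, last w4) \<in> r; (last w3, last w4) \<in> r\<rbrakk> \<Longrightarrow> last w4 \<in> max_elems r"
  shows "cohomologous r (n + d + e + k) (cup n q (cup d A (cup e B s)))
    (\<lambda>zs. (- 1) ^ (d * e) * cup n q (cup e B (cup d A s)) zs)"
proof -
  \<comment> \<open>The first sign is the one of \<open>bd_cup1\<close>; the second comes from
    moving \<open>bd\<close> past \<open>q\<close>, a factor of degree \<open>n\<close>.\<close>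
  define c :: 'k where "c = (- 1) ^ (d * e + e + 1) * (- 1) ^ n"
  define M where "M = cup1 d e A B"
  define H where "H = cup n q (cup (d + e - 1) M s)"
  \<comment> \<open>For \<open>d = 0\<close> the sum \<open>cup1\<close> is empty and a closed
    \<open>A\<close> is constant along the list, so the two orders agree already. The case is
    separated because \<open>d + e - 1\<close> would be truncated when \<open>e = 0\<close> as
    well.\<close>
  define h where "h = (\<lambda>ws. if d = 0 then 0 else c * H ws)"
  have Mnz: "\<exists>i<d. A (take (Suc i) ws @ drop (i + e) ws) \<noteq> 0 \<and> B (take (Suc e) (drop i ws)) \<noteq> 0"
    if "M ws \<noteq> 0" for ws
  proof -
    obtain i where "i \<in> {..<d}"
      "(- 1) ^ (i * Suc e) * (A (take (Suc i) ws @ drop (i + e) ws) * B (take (Suc e) (drop i ws))) \<noteq> 0"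
      using \<open>M ws \<noteq> 0\<close> unfolding M_def cup1_def by (meson sum.not_neutral_contains_not_neutral)
    then show ?thesis by (intro exI[of _ i]) auto
  qed
  \<comment> \<open>A nonzero value of \<open>H\<close> exhibits a nonzero value of each of the four
    factors: \<open>q\<close> at the front, \<open>s\<close> at the rear, and \<open>A\<close> and
    \<open>B\<close> on the two sublists occurring in one summand of \<open>cup1\<close>. All heads
    lie above the head of \<open>ws\<close> and all last entries below its last entry, so
    \<open>mn\<close> and \<open>mx\<close> apply.\<close>
  have Hends: "hd ws \<in> min_elems r \<and> last ws \<in> max_elems r"
    if ws: "wchain r ws" "length ws = n + d + e + k" and d: "d \<noteq> 0" and H: "H ws \<noteq> 0" for ws
  proof -
    let ?w = "take (d + e) (drop n ws)"
    note le = wchain_nth[OF r ws(1)]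
    have len: "length ?w = d + e" using ws by simp
    have wc: "wchain r ?w" using ws by (intro wchain_take wchain_drop)
    have nz: "q (take (Suc n) ws) \<noteq> 0" "M ?w \<noteq> 0" "s (drop (n + d + e - 1) ws) \<noteq> 0"
      using H d by (auto simp: H_def cup_def add.commute add.left_commute)
    obtain i where i: "i < d" "A (take (Suc i) ?w @ drop (i + e) ?w) \<noteq> 0" "B (take (Suc e) (drop i ?w)) \<noteq> 0"
      using Mnz[OF nz(2)] by blast
    define w1 where "w1 = take (Suc n) ws"
    define w2 where "w2 = take (Suc i) ?w @ drop (i + e) ?w"
    define w3 where "w3 = take (Suc e) (drop i ?w)"
    define w4 where "w4 = drop (n + d + e - 1) ws"
    have 1: "wchain r w1" "length w1 = Suc n" "q w1 \<noteq> 0" "hd w1 = ws ! 0" "last w1 = ws ! n"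
    proof -
      have "ws \<noteq> []" "n < length ws" using ws d by auto
      then show "wchain r w1" "length w1 = Suc n" "q w1 \<noteq> 0" "hd w1 = ws ! 0" "last w1 = ws ! n"
        using ws nz last_slice[of 0 n ws] by (auto simp: w1_def wchain_take hd_conv_nth)
    qed
    have "wchain r w2" unfolding w2_def by (intro wchain_take_drop[OF r wc]) auto
    moreover have "length w2 = Suc d" using i(1) len by (auto simp: w2_def)
    ultimately have 2: "wchain r w2" "length w2 = Suc d" "A w2 \<noteq> 0" "hd w2 = ws ! n" "last w2 = ws ! (n + (d + e - 1))"
      using i ws by (auto simp: w2_def hd_append last_append hd_drop_conv_nth last_conv_nth add.commute[of e d])
    have "wchain r w3" unfolding w3_def by (intro wchain_take wchain_drop wc)
    moreover have "length w3 = Suc e" using i(1) len by (auto simp: w3_def)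
    ultimately have 3: "wchain r w3" "length w3 = Suc e" "B w3 \<noteq> 0" "hd w3 = ws ! (n + i)" "last w3 = ws ! (n + (i + e))"
      using i ws by (auto simp: w3_def hd_drop_conv_nth last_conv_nth add.commute add.left_commute)
    have 4: "wchain r w4" "length w4 = Suc k" "s w4 \<noteq> 0" "hd w4 = ws ! (n + d + e - 1)" "last w4 = ws ! (n + d + e + k - 1)"
      using ws d nz by (auto simp: w4_def wchain_drop last_conv_nth hd_drop_conv_nth)
    have "hd w1 \<in> min_elems r"
      by (rule mn[OF 1(1-3) 2(1-3) 3(1-3) 4(1-3)]) (use ws(2) d i(1) in \<open>auto simp: 1 2 3 4 intro!: le\<close>)
    moreover have "last w4 \<in> max_elems r"
      by (rule mx[OF 1(1-3) 2(1-3) 3(1-3) 4(1-3)]) (use ws(2) d i(1) in \<open>auto simp: 1 2 3 4 intro!: le\<close>)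
    moreover have "ws \<noteq> []" using ws d by auto
    ultimately show ?thesis using ws d by (simp add: 1 4 hd_conv_nth last_conv_nth)
  qed
  show ?thesis
  proof (rule cohomologousI[OF r, where h = h], intro conjI)
    fix zs assume zs: "zs \<in> end_chains r" "length zs = Suc (n + d + e + k)"
    then have w: "wchain r zs" by (simp add: end_chains_iff)
    have nh: "h ws = 0" if "ws = tl zs \<or> ws = butlast zs" for ws
    proof (rule ccontr)
      assume "h ws \<noteq> 0"
      then have *: "d \<noteq> 0" "H ws \<noteq> 0" by (auto simp: h_def split: if_splits)
      have "wchain r ws" using that w wchain_drop[of r zs 1] wchain_take[of r zs "length zs - 1"]
        by (auto simp: drop_Suc butlast_conv_take)
      moreover have "length ws = n + d + e + k" using that zs by auto
      ultimately have e: "hd ws \<in> min_elems r \<and> last ws \<in> max_elems r" using Hends * by blast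
      \<comment> \<open>The indicator function of lists with extremal ends and no repetition is
        supported, so \<open>supported_ends\<close> applies to it. It follows that an outer face of
        an end chain never has both ends extremal.\<close>
      have "supported r (n + d + e + k) (\<lambda>zs. if hd zs \<in> min_elems r \<and> last zs \<in> max_elems r \<and> distinct zs then 1 else (0::int))"
        using zs * by (auto simp: supported_def end_chains_iff)
      from supported_ends[OF this w zs(2)] zs that e show False
        by (auto simp: end_chains_iff distinct_tl distinct_butlast)
    qed
    show "h (tl zs) = 0" "h (butlast zs) = 0" using nh by auto
    let ?w = "take (Suc (d + e)) (drop n zs)"
    let ?w1 = "take (Suc n) zs" and ?w4 = "drop (n + d + e) zs"
    have W: "wchain r ?w" "wchain r ?w1" "wchain r ?w4" using w by (intro wchain_take wchain_drop; simp)+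
    \<comment> \<open>The homotopy formula is needed only where the outer factors do not vanish.
      Then the window starts in \<open>UA\<close> and ends in \<open>LB\<close>, which makes
      \<open>A\<close> and \<open>B\<close> closed on all the sublists concerned.\<close>
    have key: "bd M ?w = (- 1) ^ (d * e + e + 1) * (cup d A B ?w - (- 1) ^ (d * e) * cup e B A ?w)"
      if nz: "q ?w1 \<noteq> 0" "s ?w4 \<noteq> 0"
      unfolding M_def
    proof (rule bd_cup1)
      show "length ?w = Suc (d + e)" using zs by simp
      have "hd ?w = last ?w1" using zs last_slice[of 0 n zs] by (simp add: hd_drop_conv_nth)
      then have U: "hd ?w \<in> UA" using q_UA[OF W(2) _ nz(1)] zs by simp
      have L: "zs ! (n + d + e) \<in> LB" using s_LB[OF W(3) _ nz(2)] zs by (simp add: hd_drop_conv_nth)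
      fix j
      {
        assume j: "j \<le> d"
        have "hd (take (Suc j) ?w @ drop (j + e) ?w) \<in> UA" using U zs by (simp add: hd_append)
        then show "bd A (take (Suc j) ?w @ drop (j + e) ?w) = 0"
          using j zs by (intro A_bd wchain_take_drop[OF r W(1)]) auto
      }
      {
        assume j: "j < d"
        have "last (take (e + 2) (drop j ?w)) = zs ! (n + (j + e + 1))" using j zs by (simp add: last_conv_nth add.commute add.left_commute)
        moreover have "(zs ! (n + (j + e + 1)), zs ! (n + d + e)) \<in> r" using j zs by (intro wchain_nth[OF r w]) auto
        ultimately have "last (take (e + 2) (drop j ?w)) \<in> LB" using LB_down[OF _ L] by simp
        then show "bd B (take (e + 2) (drop j ?w)) = 0"
          using j zs by (intro B_bd wchain_take wchain_drop w) auto
      }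
    qed
    have expand: "cup n q (cup d A (cup e B s)) zs = q ?w1 * (cup d A B ?w * s ?w4)"
      "cup n q (cup e B (cup d A s)) zs = q ?w1 * (cup e B A ?w * s ?w4)"
      using zs by (auto simp: cup_def drop_take mult.assoc add.commute add.left_commute min_def)
    have bdh: "bd h zs = q ?w1 * ((- 1) ^ (d * e + e + 1) * bd M ?w) * s ?w4"
    proof (cases "d = 0")
      case True
      then show ?thesis by (simp add: h_def M_def cup1_def bd_def)
    next
      case d: False
      \<comment> \<open>The remaining Leibniz terms vanish: a nonzero \<open>M\<close> contains a
        value of \<open>A\<close> starting at the last entry of the list under \<open>q\<close>,
        which is then in \<open>LA\<close>. The term with \<open>bd s\<close> is treated in the same
        way through the end of \<open>B\<close>, moved up to the cut by
        \<open>UB_up\<close>.\<close>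
      have 1: "bd q (take (n + 2) zs) * cup (d + e - 1) M s (drop (n + 1) zs) = 0"
      proof (cases "cup (d + e - 1) M s (drop (n + 1) zs) = 0")
        case False
        let ?v = "take (d + e) (drop (n + 1) zs)"
        have "M ?v \<noteq> 0" using False d by (auto simp: cup_def)
        then obtain i where i: "i < d" "A (take (Suc i) ?v @ drop (i + e) ?v) \<noteq> 0" using Mnz by blast
        have "wchain r ?v" using w by (intro wchain_take wchain_drop)
        then have "hd (take (Suc i) ?v @ drop (i + e) ?v) \<in> LA"
          using i zs d by (intro A_LA wchain_take_drop[OF r]) auto
        moreover have "hd (take (Suc i) ?v @ drop (i + e) ?v) = last (take (n + 2) zs)"
          using zs d last_slice[of 0 "Suc n" zs] by (auto simp: hd_append hd_drop_conv_nth)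
        ultimately have "bd q (take (n + 2) zs) = 0" using zs d by (intro q_bd wchain_take w) auto
        then show ?thesis by simp
      qed simp
      have 2: "M (take (d + e) (drop n zs)) * bd s (drop (d + e - 1) (drop n zs)) = 0"
      proof (cases "M (take (d + e) (drop n zs)) = 0")
        case False
        let ?v = "take (d + e) (drop n zs)"
        obtain i where i: "i < d" "B (take (Suc e) (drop i ?v)) \<noteq> 0" using Mnz[OF False] by blast
        have "last (take (Suc e) (drop i ?v)) \<in> UB"
          using i zs by (intro B_UB wchain_take wchain_drop w) auto
        moreover have "last (take (Suc e) (drop i ?v)) = zs ! (n + (i + e))"
          using zs i by (simp add: last_conv_nth add.commute add.left_commute)
        moreover have "(zs ! (n + (i + e)), zs ! (n + (d + e - 1))) \<in> r" using i zs by (intro wchain_nth[OF r w]) auto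
        moreover have "hd (drop (d + e - 1) (drop n zs)) = zs ! (n + (d + e - 1))"
          using zs d by (simp add: hd_drop_conv_nth add.commute)
        ultimately have "bd s (drop (d + e - 1) (drop n zs)) = 0"
          using zs d UB_up by (intro s_bd wchain_drop w) auto
        then show ?thesis by simp
      qed simp
      have "bd (cup (d + e - 1) M s) (drop n zs) = bd M ?w * s ?w4"
        using bd_cup[of "d + e - 1" "drop n zs" M s] zs d 2 by (simp add: add.commute add.left_commute)
      moreover have "bd H zs = (- 1) ^ n * (q ?w1 * bd (cup (d + e - 1) M s) (drop n zs))"
        unfolding H_def using bd_cup[of n zs q] zs d 1 by simp
      moreover have "bd h zs = c * bd H zs" using d by (simp add: h_def bd_scale)
      ultimately show ?thesis
        by (simp add: c_def mult_ac minus_one_cancel)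
    qed
    show "cup n q (cup d A (cup e B s)) zs = (- 1) ^ (d * e) * cup n q (cup e B (cup d A s)) zs + bd h zs"
    proof (cases "q ?w1 = 0 \<or> s ?w4 = 0")
      case True
      then show ?thesis by (auto simp: expand bdh)
    next
      case False
      then have K: "(- 1) ^ (d * e + e + 1) * bd M ?w = cup d A B ?w - (- 1) ^ (d * e) * cup e B A ?w"
        using key minus_one_cancel by metis
      show ?thesis unfolding expand bdh K by (simp add: algebra_simps)
    qed
  qed
qed

section \<open>Cohomology classes represented by functions\<close>

text \<open>Values off the end chains of the right length are discarded. This makes the support
  finite, so an arbitrary function may represent a cochain.\<close>

definition coch :: "'p rel \<Rightarrow> nat \<Rightarrow> ('p list \<Rightarrow> 'k) \<Rightarrow> ('p list \<Rightarrow>\<^sub>0 'k::{comm_ring,comm_monoid_mult})" where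
  "coch r n f = Abs_poly_mapping (\<lambda>xs. if xs \<in> end_chains r \<and> length xs = Suc n then f xs else 0)"

definition cls :: "'p rel \<Rightarrow> nat \<Rightarrow> ('p list \<Rightarrow> 'k) \<Rightarrow> ('p list \<Rightarrow>\<^sub>0 'k::{comm_ring,comm_monoid_mult}) set" where
  "cls r n f = coh_class r n (coch r n f)"

lemma finite_end_chains:
  assumes "finite_poset r" shows "finite {xs \<in> end_chains r. length xs = N}"
  by (rule finite_subset[OF _ finite_lists_length_eq[OF fp_finite[OF assms], of N]])
    (auto simp: end_chains_iff wchain_def)

lemma lookup_coch:
  assumes "finite_poset r"
  shows "Poly_Mapping.lookup (coch r n f) xs = (if xs \<in> end_chains r \<and> length xs = Suc n then f xs else 0)"
proof -
  have "finite {xs. (if xs \<in> end_chains r \<and> length xs = Suc n then f xs else 0) \<noteq> 0}"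
    by (rule finite_subset[OF _ finite_end_chains[OF assms, of "Suc n"]]) (auto split: if_splits)
  then show ?thesis by (simp add: coch_def)
qed

lemma lookup_scale: "Poly_Mapping.lookup (scale k c) x = k * Poly_Mapping.lookup c x"
  by (simp add: scale_def map.rep_eq when_def)

lemma lookup_lin_ext:
  "Poly_Mapping.lookup (lin_ext g c) t =
     (\<Sum>s\<in>Poly_Mapping.keys c. Poly_Mapping.lookup c s * Poly_Mapping.lookup (g s) t)"
  by (simp add: lin_ext_def lookup_sum lookup_scale)

lemma coch_cong:
  assumes "\<And>xs. xs \<in> end_chains r \<Longrightarrow> length xs = Suc n \<Longrightarrow> f xs = g xs"
  shows "coch r n f = coch r n g"
  unfolding coch_def using assms by (intro arg_cong[where f = Abs_poly_mapping]) auto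

lemma coch_add: "finite_poset r \<Longrightarrow> coch r n f + coch r n g = coch r n (\<lambda>xs. f xs + g xs)"
  by (rule poly_mapping_eqI) (simp add: lookup_add lookup_coch)

lemma coch_scale: "finite_poset r \<Longrightarrow> scale k (coch r n f) = coch r n (\<lambda>xs. k * f xs)"
  by (rule poly_mapping_eqI) (simp add: lookup_scale lookup_coch)

lemma coch_0: "coch r n (\<lambda>xs. 0) = 0"
  by (simp add: coch_def)

lemma keys_coch: "finite_poset r \<Longrightarrow> Poly_Mapping.keys (coch r n f) \<subseteq> {xs \<in> end_chains r. length xs = Suc n}"
  by (auto simp: in_keys_iff lookup_coch split: if_splits)

lemma coch_cochains: "finite_poset r \<Longrightarrow> coch r n f \<in> cochains r n"
  using keys_coch by (auto simp: cochains_def)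

lemma cochains_coch:
  assumes "finite_poset r" "c \<in> cochains r n"
  shows "c = coch r n (Poly_Mapping.lookup c)" "supported r (Suc n) (Poly_Mapping.lookup c)"
proof -
  have *: "xs \<in> end_chains r \<and> length xs = Suc n" if "Poly_Mapping.lookup c xs \<noteq> 0" for xs
    using assms(2) that by (auto simp: cochains_def in_keys_iff)
  show "c = coch r n (Poly_Mapping.lookup c)"
    by (rule poly_mapping_eqI) (use * in \<open>auto simp: lookup_coch[OF assms(1)]\<close>)
  show "supported r (Suc n) (Poly_Mapping.lookup c)" using * by (auto simp: supported_def)
qed

lemma lookup_coch_supported:
  assumes "finite_poset r" "supported r (Suc n) f" "wchain r ws" "length ws = Suc n"
  shows "Poly_Mapping.lookup (coch r n f) ws = f ws"
  using assms by (auto simp: lookup_coch supported_def)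

section \<open>Comparison with the differential of the poset complex\<close>

lemma insert_end_chains:
  assumes r: "finite_poset r" and xs: "xs \<in> end_chains r" and i: "0 < i" "i < length xs"
    and y: "(xs ! (i - 1), y) \<in> r" "xs ! (i - 1) \<noteq> y" "(y, xs ! i) \<in> r" "y \<noteq> xs ! i"
  shows "take i xs @ y # drop i xs \<in> end_chains r"
proof -
  note T = fp_trans[OF r] and A = fp_antisym[OF r]
  have w: "wchain r xs" "distinct xs" using xs by (auto simp: end_chains_iff)
  have le: "(x, y) \<in> r \<and> x \<noteq> y" if "x \<in> set (take i xs)" for x
  proof -
    obtain j where "j < length (take i xs)" "x = take i xs ! j" using \<open>x \<in> set (take i xs)\<close>
      unfolding in_set_conv_nth by blast
    then have "(x, xs ! (i - 1)) \<in> r" using i wchain_nth[OF r w(1), of j "i - 1"] by simp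
    then show ?thesis using y T A by blast
  qed
  have ge: "(y, x) \<in> r \<and> x \<noteq> y" if "x \<in> set (drop i xs)" for x
  proof -
    obtain j where "j < length (drop i xs)" "x = drop i xs ! j" using \<open>x \<in> set (drop i xs)\<close>
      unfolding in_set_conv_nth by blast
    then have "(xs ! i, x) \<in> r" using i wchain_nth[OF r w(1), of i "i + j"] by simp
    then show ?thesis using y T A by blast
  qed
  have "wchain r (take i xs @ y # drop i xs)"
  proof -
    have "y \<in> Field r" using y(1) by (rule FieldI2)
    moreover have "sorted_wrt (\<lambda>x y. (x, y) \<in> r) (take i xs @ drop i xs)" using w(1) by (simp add: wchain_def)
    moreover have "set (take i xs) \<subseteq> Field r" "set (drop i xs) \<subseteq> Field r"
      using w(1) set_take_subset[of i xs] set_drop_subset[of i xs] by (auto simp: wchain_def)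
    ultimately show ?thesis using le ge unfolding sorted_wrt_append wchain_def by auto
  qed
  moreover have "distinct (take i xs @ y # drop i xs)"
    using le ge w(2) by (auto dest: set_take_disj_set_drop_if_distinct[where i=i and j = i])
  moreover have "hd (take i xs @ y # drop i xs) = hd xs" "last (take i xs @ y # drop i xs) = last xs"
    using i by (auto simp: hd_append take_eq_Nil last_append)
  ultimately show ?thesis using xs by (auto simp: end_chains_iff)
qed

text \<open>The differential inserts elements, whereas \<open>bd\<close> deletes them. For each
  inner position of \<open>zs\<close> there is exactly one chain from which \<open>zs\<close> arises
  by insertion there, namely its face, and the inserted element is the deleted entry. The outer
  faces that \<open>bd\<close> also contains vanish on end chains by the support of
  \<open>f\<close>.\<close>

lemma cobdry_coch:
  fixes f :: "'p list \<Rightarrow> 'k::{comm_ring,comm_monoid_mult}"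
  assumes r: "finite_poset r" and f: "supported r (Suc n) f"
  shows "cobdry r (coch r n f) = coch r (Suc n) (bd f)"
proof (rule poly_mapping_eqI)
  fix zs
  let ?c = "coch r n f"
  let ?K = "Poly_Mapping.keys ?c"
  let ?btw = "\<lambda>xs i. {y. (xs ! (i - 1), y) \<in> r \<and> xs ! (i - 1) \<noteq> y \<and> (y, xs ! i) \<in> r \<and> y \<noteq> xs ! i}"
  have K: "xs \<in> end_chains r \<and> length xs = Suc n" if "xs \<in> ?K" for xs
    using keys_coch[OF r] that by blast
  have fin: "finite (?btw xs i)" for xs i
    by (rule finite_subset[OF _ fp_finite[OF r]]) (auto intro: FieldI2)
  have inner: "(\<Sum>y\<in>?btw xs i. Poly_Mapping.lookup (Poly_Mapping.single (take i xs @ y # drop i xs) ((- 1) ^ i)) zs)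
      = (if zs \<in> end_chains r \<and> length zs = Suc (Suc n) \<and> omit i zs = xs then (- 1) ^ i else (0::'k))"
    if xs: "xs \<in> ?K" and i: "i \<in> {1..<Suc n}" for xs i
  proof -
    have xs': "xs \<in> end_chains r" "length xs = Suc n" using K xs by auto
    have iff: "take i xs @ y # drop i xs = zs \<longleftrightarrow> y = zs ! i \<and> zs \<in> end_chains r \<and> length zs = Suc (Suc n) \<and> omit i zs = xs"
      if y: "y \<in> ?btw xs i" for y
    proof
      assume z: "take i xs @ y # drop i xs = zs"
      have "zs \<in> end_chains r" using insert_end_chains[OF r xs'(1), of i y] y i xs'(2) z by auto
      moreover have "zs ! i = y" "length zs = Suc (Suc n)" "omit i zs = xs"
        using z[symmetric] i xs'(2) by (auto simp: nth_append omit_def)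
      ultimately show "y = zs ! i \<and> zs \<in> end_chains r \<and> length zs = Suc (Suc n) \<and> omit i zs = xs" by auto
    next
      assume "y = zs ! i \<and> zs \<in> end_chains r \<and> length zs = Suc (Suc n) \<and> omit i zs = xs"
      then have z: "y = zs ! i" "length zs = Suc (Suc n)" "xs = omit i zs" by auto
      show "take i xs @ y # drop i xs = zs"
        using z(2) i unfolding z(1,3) by (auto simp: omit_def id_take_nth_drop[symmetric])
    qed
    show ?thesis
    proof (cases "zs \<in> end_chains r \<and> length zs = Suc (Suc n) \<and> omit i zs = xs")
      case True
      have lt: "i - 1 < i" "i < Suc i" "Suc i < length zs" using i True by auto
      have w: "wchain r zs" "distinct zs" using True by (auto simp: end_chains_iff)
      have "xs ! (i - 1) = zs ! (i - 1)" "xs ! i = zs ! Suc i"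
        using True i by (auto simp: nth_omit)
      moreover have "zs ! (i - 1) \<noteq> zs ! i" "zs ! i \<noteq> zs ! Suc i"
        using lt w(2) by (auto simp: nth_eq_iff_index_eq)
      ultimately have "zs ! i \<in> ?btw xs i"
        using lt wchain_nth[OF r w(1), of "i - 1" i] wchain_nth[OF r w(1), of i "Suc i"] by auto
      then have "(\<Sum>y\<in>?btw xs i. Poly_Mapping.lookup (Poly_Mapping.single (take i xs @ y # drop i xs) ((- 1) ^ i)) zs)
        = (\<Sum>y\<in>{zs ! i}. (- 1) ^ i)"
        using fin iff True by (intro sum.mono_neutral_cong_right) (auto simp: lookup_single when_def)
      then show ?thesis using True by simp
    next
      case False
      then show ?thesis using iff by (auto simp: lookup_single when_def intro!: sum.neutral)
    qed
  qed
  have "Poly_Mapping.lookup (cobdry r ?c) zs = (\<Sum>xs\<in>?K. Poly_Mapping.lookup ?c xs *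
      (\<Sum>i\<in>{1..<Suc n}. \<Sum>y\<in>?btw xs i. Poly_Mapping.lookup (Poly_Mapping.single (take i xs @ y # drop i xs) ((- 1) ^ i)) zs))"
    unfolding cobdry_def lookup_lin_ext lookup_sum using K by (intro sum.cong) auto
  also have "\<dots> = (\<Sum>xs\<in>?K. \<Sum>i\<in>{1..<Suc n}. Poly_Mapping.lookup ?c xs *
      (if zs \<in> end_chains r \<and> length zs = Suc (Suc n) \<and> omit i zs = xs then (- 1) ^ i else 0))"
    using inner by (intro sum.cong refl) (simp only: sum_distrib_left cong: sum.cong)
  also have "\<dots> = (\<Sum>i\<in>{1..<Suc n}. \<Sum>xs\<in>?K. Poly_Mapping.lookup ?c xs *
      (if zs \<in> end_chains r \<and> length zs = Suc (Suc n) \<and> omit i zs = xs then (- 1) ^ i else 0))"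
    by (rule sum.swap)
  also have "\<dots> = (\<Sum>i\<in>{1..<Suc n}. if zs \<in> end_chains r \<and> length zs = Suc (Suc n)
      then (- 1) ^ i * Poly_Mapping.lookup ?c (omit i zs) else 0)"
  proof (intro sum.cong refl)
    fix i
    have "(\<Sum>xs\<in>?K. Poly_Mapping.lookup ?c xs * (if omit i zs = xs then (- 1) ^ i else 0))
        = (\<Sum>xs\<in>?K. if omit i zs = xs then (- 1) ^ i * Poly_Mapping.lookup ?c xs else 0)"
      by (intro sum.cong) (auto simp: mult.commute)
    also have "\<dots> = (- 1) ^ i * Poly_Mapping.lookup ?c (omit i zs)"
      by (simp add: in_keys_iff)
    finally show "(\<Sum>xs\<in>?K. Poly_Mapping.lookup ?c xs *
      (if zs \<in> end_chains r \<and> length zs = Suc (Suc n) \<and> omit i zs = xs then (- 1) ^ i else 0)) =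
      (if zs \<in> end_chains r \<and> length zs = Suc (Suc n) then (- 1) ^ i * Poly_Mapping.lookup ?c (omit i zs) else 0)"
      by auto
  qed
  also have "\<dots> = Poly_Mapping.lookup (coch r (Suc n) (bd f)) zs"
  proof (cases "zs \<in> end_chains r \<and> length zs = Suc (Suc n)")
    case True
    then have "Poly_Mapping.lookup ?c (omit i zs) = f (omit i zs)" if "i \<in> {1..<Suc n}" for i
      using that omit_end_chains[OF r, of zs i] by (simp add: lookup_coch[OF r] length_omit)
    then show ?thesis using True bd_supported_inner[OF f, of zs] by (simp add: lookup_coch[OF r])
  qed (auto simp: lookup_coch[OF r])
  finally show "Poly_Mapping.lookup (cobdry r ?c) zs = Poly_Mapping.lookup (coch r (Suc n) (bd f)) zs" .
qed

lemma coboundaries_eq: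
  fixes r :: "'p rel"
  assumes r: "finite_poset r"
  shows "(coboundaries r n :: ('p list \<Rightarrow>\<^sub>0 'k::{comm_ring,comm_monoid_mult}) set) = {coch r n (bd h) | h. supported r n h}"
proof (cases n)
  case 0
  have "coch r 0 (bd h) = 0" if "supported r 0 h" for h :: "'p list \<Rightarrow> 'k"
  proof -
    have "h [] = 0" using that by (auto simp: supported_def wchain_def end_chains_iff)
    then have "bd h zs = 0" if "length zs = Suc 0" for zs using that by (auto simp: bd_def omit_def length_Suc_conv)
    then show ?thesis using coch_cong[of r 0 "bd h" "\<lambda>_. 0"] by (simp add: coch_0)
  qed
  moreover have "supported r 0 (\<lambda>_. 0::'k)" by (simp add: supported_def)
  ultimately show ?thesis using 0 by (auto simp: coboundaries_def) (metis)
next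
  case (Suc m)
  have "cobdry r ` cochains r m = {coch r n (bd h) | h. supported r n (h :: 'p list \<Rightarrow> 'k)}"
  proof (intro equalityI subsetI)
    fix b assume "b \<in> cobdry r ` cochains r m"
    then obtain c where c: "c \<in> cochains r m" "b = cobdry r c" by blast
    then have "b = coch r n (bd (Poly_Mapping.lookup c))"
      using cochains_coch[OF r c(1)] cobdry_coch[OF r] Suc by metis
    then show "b \<in> {coch r n (bd h) | h. supported r n h}" using cochains_coch(2)[OF r c(1)] Suc by auto
  next
    fix b assume "b \<in> {coch r n (bd h) | h. supported r n (h :: 'p list \<Rightarrow> 'k)}"
    then obtain h where h: "supported r n h" "b = coch r n (bd h)" by blast
    then have "b = cobdry r (coch r m h)" using cobdry_coch[OF r] Suc by metis
    then show "b \<in> cobdry r ` cochains r m" using coch_cochains[OF r] by blast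
  qed
  then show ?thesis using Suc by (simp add: coboundaries_def)
qed

text \<open>The differential of the complex only tests end chains. On all other weakly increasing
  lists \<open>bd\<close> of a supported function is zero anyway, by
  \<open>supported_bd\<close>.\<close>

lemma cocycles_iff:
  assumes r: "finite_poset r"
  shows "c \<in> cocycles r n \<longleftrightarrow> (\<exists>f. cocycle r n f \<and> c = coch r n f)"
proof
  assume c: "c \<in> cocycles r n"
  then have "c \<in> cochains r n" and 0: "cobdry r c = 0" by (auto simp: cocycles_def)
  note f = cochains_coch[OF r this(1)]
  let ?f = "Poly_Mapping.lookup c"
  have z: "coch r (Suc n) (bd ?f) = 0" using cobdry_coch[OF r f(2)] f(1) 0 by simp
  have "bd ?f zs = 0" if zs: "wchain r zs" "length zs = n + 2" for zs
  proof (rule ccontr)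
    assume nz: "bd ?f zs \<noteq> 0"
    then have "zs \<in> end_chains r" using supported_bd[OF r f(2)] zs by (simp add: supported_def)
    then have "Poly_Mapping.lookup (coch r (Suc n) (bd ?f)) zs = bd ?f zs" using zs by (simp add: lookup_coch[OF r])
    then show False using z nz by simp
  qed
  then show "\<exists>f. cocycle r n f \<and> c = coch r n f" using f by (auto simp: cocycle_def)
next
  assume "\<exists>f. cocycle r n f \<and> c = coch r n f"
  then obtain f where f: "cocycle r n f" "c = coch r n f" by blast
  have "cobdry r c = coch r (Suc n) (bd f)" unfolding f(2) using f(1) by (intro cobdry_coch[OF r]) (simp add: cocycle_def)
  also have "\<dots> = coch r (Suc n) (\<lambda>_. 0)"
    using f by (intro coch_cong) (auto simp: cocycle_def end_chains_iff)
  finally show "c \<in> cocycles r n" using f coch_cochains[OF r] by (simp add: cocycles_def coch_0)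
qed

lemma supported_add: "supported r n f \<Longrightarrow> supported r n g \<Longrightarrow> supported r n (\<lambda>xs. f xs + (g xs :: 'k::monoid_add))"
  unfolding supported_def by (metis add_0_left)

lemma supported_diff: "supported r n f \<Longrightarrow> supported r n g \<Longrightarrow> supported r n (\<lambda>xs. f xs - (g xs :: 'k::ab_group_add))"
  unfolding supported_def by (metis diff_self)

lemma supported_scale: "supported r n f \<Longrightarrow> supported r n (\<lambda>xs. (k::'k::mult_zero) * f xs)"
  unfolding supported_def by (metis mult_zero_right)

lemma cocycle_add: "cocycle r n f \<Longrightarrow> cocycle r n g \<Longrightarrow> cocycle r n (\<lambda>xs. f xs + g xs)"
  by (simp add: cocycle_def supported_add bd_add)

lemma cocycle_scale: "cocycle r n f \<Longrightarrow> cocycle r n (\<lambda>xs. k * f xs)"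
  by (simp add: cocycle_def supported_scale bd_scale)

lemma cocycle_0: "cocycle r n (\<lambda>xs. 0)"
  by (simp add: cocycle_def supported_def bd_def)

lemma cocycle_bd: "finite_poset r \<Longrightarrow> supported r n h \<Longrightarrow> cocycle r n (bd h)"
  using supported_bd[of r n h] by (simp add: cocycle_def bd_bd)

section \<open>The cohomology module in terms of representing functions\<close>

context
  fixes r :: "'p rel" and n :: nat
  assumes r: "finite_poset r"
begin

lemma cls_mem:
  "c \<in> cls r n (f :: 'p list \<Rightarrow> 'k::{comm_ring,comm_monoid_mult}) \<longleftrightarrow>
     (\<exists>h. supported r n h \<and> c = coch r n (\<lambda>xs. f xs + bd h xs))"
  unfolding cls_def coh_class_def coboundaries_eq[OF r] by (auto simp: coch_add[OF r, symmetric])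

lemma cls_eqI:
  fixes f g :: "'p list \<Rightarrow> 'k::{comm_ring,comm_monoid_mult}"
  assumes "cohomologous r n f g"
  shows "cls r n f = cls r n g"
proof -
  obtain h where h: "supported r n h" "\<And>zs. zs \<in> end_chains r \<Longrightarrow> length zs = Suc n \<Longrightarrow> f zs = g zs + bd h zs"
    using assms by (auto simp: cohomologous_def)
  have 1: "coch r n (\<lambda>xs. f xs + bd h' xs) = coch r n (\<lambda>xs. g xs + bd (\<lambda>xs. h xs + h' xs) xs)" for h'
    by (rule coch_cong) (simp add: h bd_add)
  have 2: "coch r n (\<lambda>xs. g xs + bd h' xs) = coch r n (\<lambda>xs. f xs + bd (\<lambda>xs. h' xs - h xs) xs)" for h'
    by (rule coch_cong) (simp add: h bd_diff)
  show ?thesis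
  proof (intro equalityI subsetI)
    fix c assume "c \<in> cls r n f"
    then obtain h' where "supported r n h'" "c = coch r n (\<lambda>xs. f xs + bd h' xs)" by (auto simp: cls_mem)
    then show "c \<in> cls r n g" unfolding cls_mem 1 using supported_add[OF h(1)] by blast
  next
    fix c assume "c \<in> cls r n g"
    then obtain h' where "supported r n h'" "c = coch r n (\<lambda>xs. g xs + bd h' xs)" by (auto simp: cls_mem)
    then show "c \<in> cls r n f" unfolding cls_mem 2 using supported_diff[OF _ h(1)] by blast
  qed
qed

lemma cls_cong:
  assumes "\<And>xs. xs \<in> end_chains r \<Longrightarrow> length xs = Suc n \<Longrightarrow> f xs = g xs"
  shows "cls r n f = cls r n g"
  unfolding cls_def by (subst coch_cong[of r n f g]) (use assms in auto)

lemma carrier_cohom_iff: "X \<in> carrier (cohom r n) \<longleftrightarrow> (\<exists>f. cocycle r n f \<and> X = cls r n f)"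
  using cocycles_iff[OF r] by (auto simp: cohom_def cls_def)

lemma cls_carrier: "cocycle r n f \<Longrightarrow> cls r n f \<in> carrier (cohom r n)"
  using carrier_cohom_iff by blast

lemma cls_add:
  fixes f g :: "'p list \<Rightarrow> 'k::{comm_ring,comm_monoid_mult}"
  shows "cls r n f \<oplus>\<^bsub>cohom r n\<^esub> cls r n g = cls r n (\<lambda>xs. f xs + g xs)"
proof -
  have 1: "coch r n (\<lambda>xs. f xs + bd h xs) + coch r n (\<lambda>xs. g xs + bd h' xs)
      = coch r n (\<lambda>xs. (f xs + g xs) + bd (\<lambda>xs. h xs + h' xs) xs)" for h h'
    unfolding coch_add[OF r] by (rule coch_cong) (simp add: bd_add algebra_simps)
  have 2: "coch r n (\<lambda>xs. (f xs + g xs) + bd h xs)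
      = coch r n (\<lambda>xs. f xs + bd h xs) + coch r n (\<lambda>xs. g xs + bd (\<lambda>_. 0) xs)" for h
    unfolding coch_add[OF r] by (rule coch_cong) (simp add: bd_zero algebra_simps)
  have 3: "supported r n (\<lambda>_. 0::'k)" by (simp add: supported_def)
  show ?thesis unfolding cohom_def ring.simps
  proof (intro equalityI subsetI)
    fix c assume "c \<in> {c + e |c e. c \<in> cls r n f \<and> e \<in> cls r n g}"
    then obtain h h' where "supported r n h" "supported r n h'"
      "c = coch r n (\<lambda>xs. f xs + bd h xs) + coch r n (\<lambda>xs. g xs + bd h' xs)" by (auto simp: cls_mem)
    then show "c \<in> cls r n (\<lambda>xs. f xs + g xs)" unfolding cls_mem 1 using supported_add by blast
  next
    fix c assume "c \<in> cls r n (\<lambda>xs. f xs + g xs)"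
    then obtain h where h: "supported r n h" "c = coch r n (\<lambda>xs. (f xs + g xs) + bd h xs)" by (auto simp: cls_mem)
    then show "c \<in> {c + e |c e. c \<in> cls r n f \<and> e \<in> cls r n g}" unfolding 2 cls_mem using 3 by blast
  qed
qed

lemma cls_smult:
  fixes f :: "'p list \<Rightarrow> 'k::{comm_ring,comm_monoid_mult}"
  shows "k \<odot>\<^bsub>cohom r n\<^esub> cls r n f = cls r n (\<lambda>xs. k * f xs)"
proof -
  have 1: "scale k (coch r n (\<lambda>xs. f xs + bd h xs)) + coch r n (bd h')
      = coch r n (\<lambda>xs. k * f xs + bd (\<lambda>xs. k * h xs + h' xs) xs)" for h h'
    unfolding coch_add[OF r] coch_scale[OF r] by (rule coch_cong) (simp add: bd_add bd_scale algebra_simps)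
  have 2: "coch r n (\<lambda>xs. k * f xs + bd h xs)
      = scale k (coch r n (\<lambda>xs. f xs + bd (\<lambda>_. 0) xs)) + coch r n (bd h)" for h
    unfolding coch_add[OF r] coch_scale[OF r] by (rule coch_cong) (simp add: bd_zero algebra_simps)
  have 3: "supported r n (\<lambda>_. 0::'k)" by (simp add: supported_def)
  show ?thesis unfolding cohom_def module.simps coboundaries_eq[OF r]
  proof (intro equalityI subsetI)
    fix c assume "c \<in> {scale k c + b |c b. c \<in> cls r n f \<and> b \<in> {coch r n (bd h) |h. supported r n h}}"
    then obtain h h' where "supported r n h" "supported r n h'"
      "c = scale k (coch r n (\<lambda>xs. f xs + bd h xs)) + coch r n (bd h')" by (auto simp: cls_mem)
    then show "c \<in> cls r n (\<lambda>xs. k * f xs)" unfolding cls_mem 1 using supported_add[OF supported_scale] by blast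
  next
    fix c assume "c \<in> cls r n (\<lambda>xs. k * f xs)"
    then obtain h where h: "supported r n h" "c = coch r n (\<lambda>xs. k * f xs + bd h xs)" by (auto simp: cls_mem)
    then show "c \<in> {scale k c + b |c b. c \<in> cls r n f \<and> b \<in> {coch r n (bd h) |h. supported r n h}}"
      unfolding 2 cls_mem using 3 by blast
  qed
qed

lemma cls_zero: "\<zero>\<^bsub>cohom r n\<^esub> = cls r n (\<lambda>_. 0)"
  by (simp add: cohom_def cls_def coch_0)

lemma cohom_module: "module coeff_ring (cohom r n :: ('k::{comm_ring,comm_monoid_mult}, ('p list \<Rightarrow>\<^sub>0 'k) set) module)"
proof (rule moduleI)
  show "cring (coeff_ring :: 'k ring)"
  proof (rule cringI)
    show "abelian_group (coeff_ring :: 'k ring)"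
      by (rule abelian_groupI) (auto simp: coeff_ring_def algebra_simps intro: exI[of _ "- _"] left_minus)
    show "Group.comm_monoid (coeff_ring :: 'k ring)"
      by (rule comm_monoidI) (auto simp: coeff_ring_def algebra_simps)
  qed (simp add: coeff_ring_def algebra_simps)
  let ?M = "cohom r n :: ('k, ('p list \<Rightarrow>\<^sub>0 'k) set) module"
  show "abelian_group ?M"
  proof (rule abelian_groupI)
    fix X assume "X \<in> carrier ?M"
    then obtain f where "cocycle r n f" "X = cls r n f" using carrier_cohom_iff by blast
    then show "\<exists>Y\<in>carrier ?M. Y \<oplus>\<^bsub>?M\<^esub> X = \<zero>\<^bsub>?M\<^esub>"
      using cls_carrier[OF cocycle_scale[of r n f "- 1"]]
      by (intro bexI[of _ "cls r n (\<lambda>xs. - 1 * f xs)"]) (auto simp: cls_add cls_zero)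
  next
    fix X Y assume "X \<in> carrier ?M" "Y \<in> carrier ?M"
    then obtain f g where fg: "cocycle r n f" "X = cls r n f" "cocycle r n g" "Y = cls r n g" by (auto simp: carrier_cohom_iff)
    show "X \<oplus>\<^bsub>?M\<^esub> Y \<in> carrier ?M" unfolding fg cls_add by (intro cls_carrier cocycle_add fg)
    show "X \<oplus>\<^bsub>?M\<^esub> Y = Y \<oplus>\<^bsub>?M\<^esub> X" unfolding fg cls_add by (simp add: add.commute)
    fix Z assume "Z \<in> carrier ?M"
    then obtain h where h: "cocycle r n h" "Z = cls r n h" by (auto simp: carrier_cohom_iff)
    show "X \<oplus>\<^bsub>?M\<^esub> Y \<oplus>\<^bsub>?M\<^esub> Z = X \<oplus>\<^bsub>?M\<^esub> (Y \<oplus>\<^bsub>?M\<^esub> Z)" unfolding fg h cls_add by (simp add: add.assoc)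
  next
    show "\<zero>\<^bsub>?M\<^esub> \<in> carrier ?M" unfolding cls_zero by (intro cls_carrier cocycle_0)
  next
    fix X assume "X \<in> carrier ?M"
    then obtain f where fg: "cocycle r n f" "X = cls r n f" by (auto simp: carrier_cohom_iff)
    show "\<zero>\<^bsub>?M\<^esub> \<oplus>\<^bsub>?M\<^esub> X = X" unfolding fg cls_zero cls_add by simp
  qed
next
  fix k l :: 'k and X Y :: "('p list \<Rightarrow>\<^sub>0 'k) set"
  let ?M = "cohom r n :: ('k, ('p list \<Rightarrow>\<^sub>0 'k) set) module"
  assume X: "X \<in> carrier ?M"
  then obtain f where f: "cocycle r n f" "X = cls r n f" by (auto simp: carrier_cohom_iff)
  show "k \<odot>\<^bsub>?M\<^esub> X \<in> carrier ?M" unfolding f cls_smult by (intro cls_carrier cocycle_scale f)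
  show "(k \<oplus>\<^bsub>coeff_ring\<^esub> l) \<odot>\<^bsub>?M\<^esub> X = k \<odot>\<^bsub>?M\<^esub> X \<oplus>\<^bsub>?M\<^esub> l \<odot>\<^bsub>?M\<^esub> X"
    unfolding f cls_smult cls_add by (simp add: coeff_ring_def distrib_right)
  show "(k \<otimes>\<^bsub>coeff_ring\<^esub> l) \<odot>\<^bsub>?M\<^esub> X = k \<odot>\<^bsub>?M\<^esub> (l \<odot>\<^bsub>?M\<^esub> X)"
    unfolding f cls_smult by (simp add: coeff_ring_def mult.assoc)
  show "\<one>\<^bsub>coeff_ring\<^esub> \<odot>\<^bsub>?M\<^esub> X = X"
    unfolding f cls_smult by (simp add: coeff_ring_def)
  assume "Y \<in> carrier ?M"
  then obtain g where g: "cocycle r n g" "Y = cls r n g" by (auto simp: carrier_cohom_iff)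
  show "k \<odot>\<^bsub>?M\<^esub> (X \<oplus>\<^bsub>?M\<^esub> Y) = k \<odot>\<^bsub>?M\<^esub> X \<oplus>\<^bsub>?M\<^esub> k \<odot>\<^bsub>?M\<^esub> Y"
    unfolding f g cls_smult cls_add by (simp add: distrib_left)
qed

lemma finsum_cls:
  fixes F :: "'i \<Rightarrow> 'p list \<Rightarrow> 'k::{comm_ring,comm_monoid_mult}"
  assumes "finite A" "\<And>x. x \<in> A \<Longrightarrow> cocycle r n (F x)"
  shows "finsum (cohom r n) (\<lambda>x. cls r n (F x)) A = cls r n (\<lambda>zs. \<Sum>x\<in>A. F x zs)"
proof -
  interpret M: module coeff_ring "cohom r n :: ('k, ('p list \<Rightarrow>\<^sub>0 'k) set) module" by (rule cohom_module)
  show ?thesis using assms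
  proof (induction A)
    case empty
    then show ?case by (simp add: cls_zero)
  next
    case (insert x A)
    then show ?case by (subst M.finsum_insert) (auto simp: cls_add cls_carrier)
  qed
qed

end

section \<open>Induced maps\<close>

text \<open>This is where admissibility enters: if the image list has extremal ends, so does the
  list itself.\<close>

lemma supported_pullback:
  assumes r: "finite_poset r" and adm: "pullback_admissible r s h" and f: "supported s N f"
  shows "supported r N (\<lambda>ws. f (map h ws))"
  unfolding supported_def
proof (intro allI impI)
  fix ws assume ws: "wchain r ws" "length ws = N" "f (map h ws) \<noteq> 0"
  have "wchain s (map h ws)"
    using adm by (intro wchain_map[OF ws(1) _ r]) (auto simp: pullback_admissible_def poset_hom_def)
  then have e: "map h ws \<in> end_chains s" using f ws by (auto simp: supported_def)
  then have "ws \<noteq> []" by (auto simp: end_chains_iff)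
  then have "hd ws \<in> Field r" "last ws \<in> Field r" using ws(1) by (auto simp: wchain_def)
  then show "ws \<in> end_chains r"
    using e adm ws(1) \<open>ws \<noteq> []\<close>
    by (auto simp: end_chains_iff pullback_admissible_def hd_map last_map distinct_map)
qed

lemma cocycle_pullback:
  assumes "finite_poset r" "pullback_admissible r s h" "cocycle s n f"
  shows "cocycle r n (\<lambda>ws. f (map h ws))"
proof -
  have "wchain s (map h zs)" if "wchain r zs" for zs
    using assms(2) by (intro wchain_map[OF that _ assms(1)]) (auto simp: pullback_admissible_def poset_hom_def)
  then show ?thesis using assms supported_pullback[OF assms(1,2)] by (auto simp: cocycle_def bd_map)
qed

text \<open>The sum over chains mapping to a given chain is dual to composition with
  \<open>map h\<close>. A chain whose image repeats an entry occurs in no such sum, and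
  correspondingly a supported function is zero on that image.\<close>

lemma pullback_cls:
  fixes f :: "'q list \<Rightarrow> 'k::{comm_ring,comm_monoid_mult}"
  assumes r: "finite_poset r" and s: "finite_poset s" and adm: "pullback_admissible r s h" and f: "cocycle s n f"
  shows "pullback r h n (cls s n f) = cls r n (\<lambda>ws. f (map h ws))"
proof -
  define g :: "('q list \<Rightarrow>\<^sub>0 'k) \<Rightarrow> ('a list \<Rightarrow>\<^sub>0 'k)" where
    "g = lin_ext (\<lambda>ys. \<Sum>xs | xs \<in> end_chains r \<and> map h xs = ys. Poly_Mapping.single xs 1)"
  have g: "g (coch s n u) = coch r n (\<lambda>ws. u (map h ws))" if u: "supported s (Suc n) u" for u
  proof (rule poly_mapping_eqI)
    fix zs
    let ?c = "coch s n u"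
    have wc: "wchain s (map h zs)" if "zs \<in> end_chains r"
      using that adm by (intro wchain_map[OF _ _ r]) (auto simp: end_chains_iff pullback_admissible_def poset_hom_def)
    have fin: "finite {xs. xs \<in> end_chains r \<and> map h xs = ys}" for ys
      by (rule finite_subset[OF _ finite_end_chains[OF r, of "length ys"]]) auto
    have "Poly_Mapping.lookup (\<Sum>xs | xs \<in> end_chains r \<and> map h xs = ys. Poly_Mapping.single xs 1) zs
        = (if ys = map h zs then if zs \<in> end_chains r then 1 else 0 else (0::'k))" for ys
      using fin[of ys] by (auto simp: lookup_sum lookup_single when_def)
    then have "Poly_Mapping.lookup (g ?c) zs = (\<Sum>ys\<in>Poly_Mapping.keys ?c.
        if ys = map h zs then Poly_Mapping.lookup ?c ys * (if zs \<in> end_chains r then 1 else 0) else 0)"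
      unfolding g_def lookup_lin_ext by (intro sum.cong) auto
    also have "\<dots> = Poly_Mapping.lookup ?c (map h zs) * (if zs \<in> end_chains r then 1 else 0)"
      by (simp add: in_keys_iff)
    also have "\<dots> = Poly_Mapping.lookup (coch r n (\<lambda>ws. u (map h ws))) zs"
      using u wc by (auto simp: lookup_coch[OF r] lookup_coch[OF s] supported_def)
    finally show "Poly_Mapping.lookup (g ?c) zs = \<dots>" .
  qed
  have f1: "supported s (Suc n) f" using f by (simp add: cocycle_def)
  note su = supported_add[OF f1 supported_bd[OF s]]
  have eq: "coch r n (\<lambda>ws. f (map h ws) + bd u (map h ws)) + coch r n (bd v)
      = coch r n (\<lambda>ws. f (map h ws) + bd (\<lambda>ws. u (map h ws) + v ws) ws)" for u v
    unfolding coch_add[OF r] by (rule coch_cong) (simp add: bd_add bd_map add.assoc)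
  show ?thesis
  proof (intro equalityI subsetI)
    fix c assume "c \<in> pullback r h n (cls s n f)"
    then obtain u v where uv: "supported s n u" "supported r n v" "c = g (coch s n (\<lambda>xs. f xs + bd u xs)) + coch r n (bd v)"
      by (auto simp: pullback_def induced_def g_def[symmetric] coboundaries_eq[OF r] cls_mem[OF s])
    then have "c = coch r n (\<lambda>ws. f (map h ws) + bd (\<lambda>ws. u (map h ws) + v ws) ws)"
      unfolding uv(3) g[OF su[OF uv(1)]] eq by simp
    then show "c \<in> cls r n (\<lambda>ws. f (map h ws))"
      unfolding cls_mem[OF r] using supported_add[OF supported_pullback[OF r adm uv(1)] uv(2)] by blast
  next
    fix c assume "c \<in> cls r n (\<lambda>ws. f (map h ws))"
    then obtain v where v: "supported r n v" "c = coch r n (\<lambda>ws. f (map h ws) + bd v ws)" by (auto simp: cls_mem[OF r])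
    have "c = g (coch s n f) + coch r n (bd v)" unfolding v(2) g[OF f1] coch_add[OF r] ..
    moreover have "coch s n f \<in> cls s n f" unfolding cls_mem[OF s]
      by (intro exI[of _ "\<lambda>_. 0"] conjI coch_cong) (auto simp: supported_def bd_zero)
    ultimately show "c \<in> pullback r h n (cls s n f)"
      using v(1) by (auto simp: pullback_def induced_def g_def[symmetric] coboundaries_eq[OF r])
  qed
qed

section \<open>Bilinear maps given by cutting a chain\<close>

lemma bilin_single:
  assumes "\<And>s t. s \<in> Poly_Mapping.keys c \<Longrightarrow> t \<in> Poly_Mapping.keys e \<Longrightarrow> F s t = zs \<longleftrightarrow> T \<and> s = p \<and> t = q"
  shows "Poly_Mapping.lookup (bilin_ext (\<lambda>s t. Poly_Mapping.single (F s t) 1) c e) zs =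
    (if T then Poly_Mapping.lookup c p * Poly_Mapping.lookup e q else (0::'k::{comm_ring,comm_monoid_mult}))"
proof -
  have "Poly_Mapping.lookup (bilin_ext (\<lambda>s t. Poly_Mapping.single (F s t) 1) c e) zs
    = (\<Sum>s\<in>Poly_Mapping.keys c. Poly_Mapping.lookup c s * (\<Sum>t\<in>Poly_Mapping.keys e. Poly_Mapping.lookup e t
        * (if T \<and> s = p \<and> t = q then 1 else 0)))"
    unfolding bilin_ext_def lookup_lin_ext using assms
    by (intro sum.cong refl arg_cong2[where f = "(*)"]) (auto simp: lookup_single when_def)
  also have "\<dots> = (\<Sum>s\<in>Poly_Mapping.keys c. if s = p then (if T then Poly_Mapping.lookup c s * Poly_Mapping.lookup e q else 0) else 0)"
  proof (intro sum.cong refl)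
    fix s
    have "(\<Sum>t\<in>Poly_Mapping.keys e. Poly_Mapping.lookup e t * (if T \<and> s = p \<and> t = q then 1 else 0))
      = (\<Sum>t\<in>Poly_Mapping.keys e. if t = q then if T \<and> s = p then Poly_Mapping.lookup e t else 0 else 0)"
      by (intro sum.cong) auto
    also have "\<dots> = (if T \<and> s = p then Poly_Mapping.lookup e q else 0)" by (simp add: in_keys_iff)
    finally show "Poly_Mapping.lookup c s * (\<Sum>t\<in>Poly_Mapping.keys e. Poly_Mapping.lookup e t * (if T \<and> s = p \<and> t = q then 1 else 0))
      = (if s = p then (if T then Poly_Mapping.lookup c s * Poly_Mapping.lookup e q else 0) else 0)" by simp
  qed
  also have "\<dots> = (if T then Poly_Mapping.lookup c p * Poly_Mapping.lookup e q else 0)"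
    by (auto simp: in_keys_iff)
  finally show ?thesis .
qed

text \<open>
  Common form of the Kuenneth and the concatenation morphism: a chain is cut at an element where
  the maps to the two factors \<open>r1\<close> and \<open>r2\<close>, defined below elements of \<open>\<alpha>\<close> and above elements of
  \<open>\<beta>\<close>, are maximal and minimal.
\<close>

locale cut =
  fixes r :: "'p rel" and r1 :: "'q rel" and r2 :: "'s rel" and \<alpha> \<beta> :: "'p \<Rightarrow> bool"
    and h1 :: "'p \<Rightarrow> 'q" and h2 :: "'p \<Rightarrow> 's" and F :: "'q list \<Rightarrow> 's list \<Rightarrow> 'p list"
  assumes r: "finite_poset r" and r1: "finite_poset r1" and r2: "finite_poset r2"
    and h1_mono: "\<lbrakk>(x, x') \<in> r; (x', y) \<in> r; \<alpha> y\<rbrakk> \<Longrightarrow> (h1 x, h1 x') \<in> r1"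
    and h2_mono: "\<lbrakk>(y, x) \<in> r; (x, x') \<in> r; \<beta> y\<rbrakk> \<Longrightarrow> (h2 x, h2 x') \<in> r2"
    and \<alpha>I: "\<lbrakk>\<beta> y; h2 y \<in> min_elems r2\<rbrakk> \<Longrightarrow> \<alpha> y"
    and \<beta>I: "\<lbrakk>\<alpha> y; h1 y \<in> max_elems r1\<rbrakk> \<Longrightarrow> \<beta> y"
    and \<alpha>_down: "\<lbrakk>\<alpha> y; (x, y) \<in> r; h1 x \<in> max_elems r1\<rbrakk> \<Longrightarrow> \<alpha> x"
    and \<beta>_up: "\<lbrakk>\<beta> y; (y, x) \<in> r; h2 x \<in> min_elems r2\<rbrakk> \<Longrightarrow> \<beta> x"
    and minI: "\<lbrakk>\<alpha> y; \<beta> y; h2 y \<in> min_elems r2; (x, y) \<in> r; h1 x \<in> min_elems r1\<rbrakk> \<Longrightarrow> x \<in> min_elems r"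
    and maxI: "\<lbrakk>\<alpha> y; \<beta> y; h1 y \<in> max_elems r1; (y, x) \<in> r; h2 x \<in> max_elems r2\<rbrakk> \<Longrightarrow> x \<in> max_elems r"
    and F_iff: "\<lbrakk>s \<in> end_chains r1; length s = Suc m; t \<in> end_chains r2; length t = Suc n\<rbrakk> \<Longrightarrow>
      F s t = zs \<longleftrightarrow> (wchain r zs \<and> length zs = Suc (m + n) \<and> \<alpha> (zs ! m) \<and> \<beta> (zs ! m)) \<and>
        s = map h1 (take (Suc m) zs) \<and> t = map h2 (drop m zs)"
begin

text \<open>Extension by zero. The map \<open>h1\<close> is only known to be monotone below entries
  satisfying \<alpha>, so pulling back along it makes sense on lists that end at such an
  entry.\<close>

definition lo :: "('q list \<Rightarrow> 'k) \<Rightarrow> 'p list \<Rightarrow> 'k::{comm_ring,comm_monoid_mult}" where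
  "lo f ws = (if \<alpha> (last ws) then f (map h1 ws) else 0)"

definition up :: "('s list \<Rightarrow> 'k) \<Rightarrow> 'p list \<Rightarrow> 'k::{comm_ring,comm_monoid_mult}" where
  "up g ws = (if \<beta> (hd ws) then g (map h2 ws) else 0)"

lemma wchain_h1:
  assumes "wchain r ws" "\<alpha> (last ws)" shows "wchain r1 (map h1 ws)"
  using assms by (intro wchain_map[OF assms(1) _ r]) (auto intro: h1_mono wchain_last[OF r])

lemma wchain_h2:
  assumes "wchain r ws" "\<beta> (hd ws)" shows "wchain r2 (map h2 ws)"
  using assms by (intro wchain_map[OF assms(1) _ r]) (auto intro: h2_mono wchain_hd[OF r])

lemma lo_nz:
  assumes "supported r1 N f" "wchain r ws" "length ws = N" "lo f ws \<noteq> 0"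
  shows "ws \<noteq> []" "\<alpha> (last ws)" "map h1 ws \<in> end_chains r1" "distinct ws" "h1 (hd ws) \<in> min_elems r1"
    "h1 (last ws) \<in> max_elems r1"
proof -
  show a: "\<alpha> (last ws)" using assms(4) by (auto simp: lo_def split: if_splits)
  show e: "map h1 ws \<in> end_chains r1"
    using assms wchain_h1[OF assms(2) a] by (auto simp: lo_def supported_def split: if_splits)
  then show "ws \<noteq> []" by (auto simp: end_chains_iff)
  then show "distinct ws" "h1 (hd ws) \<in> min_elems r1" "h1 (last ws) \<in> max_elems r1"
    using e by (auto simp: end_chains_iff distinct_map hd_map last_map)
qed

lemma up_nz:
  assumes "supported r2 N f" "wchain r ws" "length ws = N" "up f ws \<noteq> 0"
  shows "ws \<noteq> []" "\<beta> (hd ws)" "map h2 ws \<in> end_chains r2" "distinct ws" "h2 (hd ws) \<in> min_elems r2"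
    "h2 (last ws) \<in> max_elems r2"
proof -
  show a: "\<beta> (hd ws)" using assms(4) by (auto simp: up_def split: if_splits)
  show e: "map h2 ws \<in> end_chains r2"
    using assms wchain_h2[OF assms(2) a] by (auto simp: up_def supported_def split: if_splits)
  then show "ws \<noteq> []" by (auto simp: end_chains_iff)
  then show "distinct ws" "h2 (hd ws) \<in> min_elems r2" "h2 (last ws) \<in> max_elems r2"
    using e by (auto simp: end_chains_iff distinct_map hd_map last_map)
qed

text \<open>Deleting the last entry may destroy the condition \<alpha>. But if \<open>f\<close> is
  nonzero on the image of the remaining list, its new last entry has maximal image, and
  \<open>\<alpha>_down\<close> restores the condition.\<close>

lemma bd_lo:
  assumes f: "supported r1 (Suc m) f" and ws: "wchain r ws" "length ws = m + 2" "\<alpha> (last ws)"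
  shows "bd (lo f) ws = lo (bd f) ws"
proof -
  have "lo f (omit k ws) = f (map h1 (omit k ws))" if k: "k < length ws" for k
  proof (rule ccontr)
    assume *: "lo f (omit k ws) \<noteq> f (map h1 (omit k ws))"
    then have n: "\<not> \<alpha> (last (omit k ws))" "f (map h1 (omit k ws)) \<noteq> 0" by (auto simp: lo_def split: if_splits)
    have l: "length (omit k ws) = Suc m" using k ws by (simp add: length_omit)
    have w: "wchain r1 (map h1 (omit k ws))" using wchain_omit[OF r1 wchain_h1[OF ws(1,3)], of k] by (simp add: map_omit)
    have "omit k ws \<noteq> []" using l by auto
    then have "last (omit k ws) \<in> set ws" by (metis last_in_set omit_def in_set_dropD in_set_takeD set_append Un_iff)
    moreover have "map h1 (omit k ws) \<in> end_chains r1" using f w n l by (simp add: supported_def)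
    ultimately have "\<alpha> (last (omit k ws))" using \<open>omit k ws \<noteq> []\<close>
      by (intro \<alpha>_down[OF ws(3) wchain_last[OF r ws(1)]]) (auto simp: end_chains_iff last_map)
    then show False using n by blast
  qed
  then have "bd (lo f) ws = bd (\<lambda>ws. f (map h1 ws)) ws" by (intro bd_cong)
  then show ?thesis using ws(3) by (simp add: bd_map lo_def)
qed

lemma bd_up:
  assumes f: "supported r2 (Suc m) f" and ws: "wchain r ws" "length ws = m + 2" "\<beta> (hd ws)"
  shows "bd (up f) ws = up (bd f) ws"
proof -
  have "up f (omit k ws) = f (map h2 (omit k ws))" if k: "k < length ws" for k
  proof (rule ccontr)
    assume *: "up f (omit k ws) \<noteq> f (map h2 (omit k ws))"
    then have n: "\<not> \<beta> (hd (omit k ws))" "f (map h2 (omit k ws)) \<noteq> 0" by (auto simp: up_def split: if_splits)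
    have l: "length (omit k ws) = Suc m" using k ws by (simp add: length_omit)
    have w: "wchain r2 (map h2 (omit k ws))" using wchain_omit[OF r2 wchain_h2[OF ws(1,3)], of k] by (simp add: map_omit)
    have "omit k ws \<noteq> []" using l by auto
    then have "hd (omit k ws) \<in> set ws" by (metis hd_in_set omit_def in_set_dropD in_set_takeD set_append Un_iff)
    moreover have "map h2 (omit k ws) \<in> end_chains r2" using f w n l by (simp add: supported_def)
    ultimately have "\<beta> (hd (omit k ws))" using \<open>omit k ws \<noteq> []\<close>
      by (intro \<beta>_up[OF ws(3) wchain_hd[OF r ws(1)]]) (auto simp: end_chains_iff hd_map)
    then show False using n by blast
  qed
  then have "bd (up f) ws = bd (\<lambda>ws. f (map h2 ws)) ws" by (intro bd_cong)
  then show ?thesis using ws(3) by (simp add: bd_map up_def)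
qed

lemma supported_cut:
  assumes f: "supported r1 (Suc m) f" and g: "supported r2 (Suc n) g"
  shows "supported r (Suc (m + n)) (cup m (lo f) (up g))"
  unfolding supported_def
proof (intro allI impI)
  fix zs assume zs: "wchain r zs" "length zs = Suc (m + n)" "cup m (lo f) (up g) zs \<noteq> 0"
  have nz: "lo f (take (Suc m) zs) \<noteq> 0" "up g (drop m zs) \<noteq> 0" using zs(3) by (auto simp: cup_def)
  have len: "length (take (Suc m) zs) = Suc m" "length (drop m zs) = Suc n" using zs(2) by auto
  note l = lo_nz[OF f wchain_take[OF zs(1)] len(1) nz(1)] and u = up_nz[OF g wchain_drop[OF zs(1)] len(2) nz(2)]
  have ne: "zs \<noteq> []" using zs by auto
  then have e: "last (take (Suc m) zs) = zs ! m" "hd (drop m zs) = zs ! m" "hd zs = zs ! 0" "last zs = zs ! (m + n)"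
    "hd (take (Suc m) zs) = zs ! 0" "last (drop m zs) = zs ! (m + n)" "zs \<noteq> []"
    using zs last_slice[of 0 m zs] by (auto simp: hd_drop_conv_nth last_conv_nth hd_conv_nth last_drop)
  have "distinct zs" by (rule wchain_cup_distinct[OF r zs(1) l(4) u(4)])
  moreover have "(zs ! 0, zs ! m) \<in> r" "(zs ! m, zs ! (m + n)) \<in> r"
    using wchain_nth[OF r zs(1)] zs(2) by auto
  then have "hd zs \<in> min_elems r" "last zs \<in> max_elems r"
    using minI[of "zs ! m" "zs ! 0"] maxI[of "zs ! m" "zs ! (m + n)"] l(2,5,6) u(2,5,6) unfolding e by blast+
  ultimately show "zs \<in> end_chains r" using zs(1) ne by (simp add: end_chains_iff)
qed

text \<open>In each term of the Leibniz rule the other factor supplies the missing cut condition: a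
  nonzero \<open>up\<close> starts at an entry with minimal image, where \<open>\<alpha>I\<close>
  applies, and a nonzero \<open>lo\<close> ends at one with maximal image, where
  \<open>\<beta>I\<close> applies.\<close>

lemma bd_cut:
  assumes f: "supported r1 (Suc m) f" and g: "supported r2 (Suc n) g" and zs: "wchain r zs" "length zs = Suc (Suc (m + n))"
  shows "bd (cup m (lo f) (up g)) zs = cup (Suc m) (lo (bd f)) (up g) zs + (- 1) ^ m * cup m (lo f) (up (bd g)) zs"
proof -
  have e: "last (take (m + 2) zs) = hd (drop (m + 1) zs)" "last (take (m + 1) zs) = hd (drop m zs)"
    using zs last_slice[of 0 "Suc m" zs] last_slice[of 0 m zs] by (auto simp: hd_drop_conv_nth)
  have "bd (lo f) (take (m + 2) zs) * up g (drop (m + 1) zs) = lo (bd f) (take (m + 2) zs) * up g (drop (m + 1) zs)"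
  proof (cases "up g (drop (m + 1) zs) = 0")
    case False
    have "length (drop (m + 1) zs) = Suc n" using zs(2) by simp
    note u = up_nz[OF g wchain_drop[OF zs(1)] this False]
    then have "\<alpha> (last (take (m + 2) zs))" unfolding e by (intro \<alpha>I)
    then show ?thesis using bd_lo[OF f wchain_take[OF zs(1)]] zs(2) by simp
  qed simp
  moreover have "lo f (take (m + 1) zs) * bd (up g) (drop m zs) = lo f (take (m + 1) zs) * up (bd g) (drop m zs)"
  proof (cases "lo f (take (m + 1) zs) = 0")
    case False
    have "length (take (m + 1) zs) = Suc m" using zs(2) by simp
    note l = lo_nz[OF f wchain_take[OF zs(1)] this False]
    then have "\<beta> (hd (drop m zs))" unfolding e(2)[symmetric] by (intro \<beta>I)
    then show ?thesis using bd_up[OF g wchain_drop[OF zs(1)]] zs(2) by simp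
  qed simp
  ultimately show ?thesis using bd_cup[of m zs "lo f" "up g"] zs by (simp add: cup_def)
qed

lemma cut_zero_left:
  assumes f: "cocycle r1 m f" and zs: "wchain r zs" "length zs > Suc m"
  shows "cup (Suc m) (lo (bd f)) g zs = 0"
  using assms wchain_h1[OF wchain_take[OF zs(1)], of "Suc (Suc m)"] by (auto simp: cup_def lo_def cocycle_def)

lemma cut_zero_right:
  assumes g: "cocycle r2 n g" and zs: "wchain r zs" "length zs = m + n + 2"
  shows "cup m f (up (bd g)) zs = 0"
  using assms wchain_h2[OF wchain_drop[OF zs(1)], of m] by (auto simp: cup_def up_def cocycle_def)

lemma cocycle_cut:
  assumes f: "cocycle r1 m f" and g: "cocycle r2 n g"
  shows "cocycle r (m + n) (cup m (lo f) (up g))"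
proof -
  have f': "supported r1 (Suc m) f" and g': "supported r2 (Suc n) g" using f g by (auto simp: cocycle_def)
  have "bd (cup m (lo f) (up g)) zs = 0" if zs: "wchain r zs" "length zs = m + n + 2" for zs
    using bd_cut[OF f' g' zs(1)] cut_zero_left[OF f zs(1)] cut_zero_right[OF g zs] zs by simp
  then show ?thesis using supported_cut[OF f' g'] by (simp add: cocycle_def)
qed

lemma lo_add: "lo (\<lambda>xs. f xs + g xs) ws = lo f ws + lo g ws"
  by (simp add: lo_def)

lemma up_add: "up (\<lambda>xs. f xs + g xs) ws = up f ws + up g ws"
  by (simp add: up_def)

lemma bilin_coch:
  fixes f :: "'q list \<Rightarrow> 'k::{comm_ring,comm_monoid_mult}"
  assumes f: "supported r1 (Suc m) f" and g: "supported r2 (Suc n) g"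
  shows "bilin_ext (\<lambda>s t. Poly_Mapping.single (F s t) 1) (coch r1 m f) (coch r2 n g)
    = coch r (m + n) (cup m (lo f) (up g))"
proof (rule poly_mapping_eqI)
  fix zs
  let ?W = "wchain r zs \<and> length zs = Suc (m + n) \<and> \<alpha> (zs ! m) \<and> \<beta> (zs ! m)"
  have iff: "F s t = zs \<longleftrightarrow> ?W \<and> s = map h1 (take (Suc m) zs) \<and> t = map h2 (drop m zs)"
    if "s \<in> Poly_Mapping.keys (coch r1 m f)" "t \<in> Poly_Mapping.keys (coch r2 n g)" for s t
    by (rule F_iff) (use that keys_coch[OF r1] keys_coch[OF r2] in blast)+
  have e: "last (take (Suc m) zs) = zs ! m" "hd (drop m zs) = zs ! m" if "length zs = Suc (m + n)"
    using that last_slice[of 0 m zs] by (auto simp: hd_drop_conv_nth)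
  have L: "Poly_Mapping.lookup (bilin_ext (\<lambda>s t. Poly_Mapping.single (F s t) 1) (coch r1 m f) (coch r2 n g)) zs
    = (if ?W then Poly_Mapping.lookup (coch r1 m f) (map h1 (take (Suc m) zs)) *
        Poly_Mapping.lookup (coch r2 n g) (map h2 (drop m zs)) else 0)"
    by (rule bilin_single) (rule iff)
  show "Poly_Mapping.lookup (bilin_ext (\<lambda>s t. Poly_Mapping.single (F s t) 1) (coch r1 m f) (coch r2 n g)) zs
    = Poly_Mapping.lookup (coch r (m + n) (cup m (lo f) (up g))) zs"
  proof (cases ?W)
    case True
    have w: "wchain r1 (map h1 (take (Suc m) zs))" "wchain r2 (map h2 (drop m zs))"
      using True e by (auto intro!: wchain_h1 wchain_h2 wchain_take wchain_drop)
    have "cup m (lo f) (up g) zs = f (map h1 (take (Suc m) zs)) * g (map h2 (drop m zs))"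
      using True e by (simp add: cup_def lo_def up_def)
    then show ?thesis
      unfolding L lookup_coch[OF r]
      using True lookup_coch_supported[OF r1 f w(1)] lookup_coch_supported[OF r2 g w(2)] supported_cut[OF f g]
      by (auto simp: supported_def)
  next
    case False
    then have "cup m (lo f) (up g) zs = 0" if "zs \<in> end_chains r" "length zs = Suc (m + n)"
      using that e by (auto simp: cup_def lo_def up_def end_chains_iff)
    then show ?thesis
      unfolding L lookup_coch[OF r] using False by auto
  qed
qed

text \<open>Independence of representatives. Adding \<open>bd u\<close> to one factor adds the
  coboundary of the product with \<open>u\<close>, because the other factor is closed. In degree 0
  no such \<open>u\<close> of lower degree exists, but then adding \<open>bd u\<close> does not
  change the cochain.\<close>

lemma induced2_cut:
  fixes f :: "'q list \<Rightarrow> 'k::{comm_ring,comm_monoid_mult}"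
  assumes f: "cocycle r1 m f" and g: "cocycle r2 n g"
  shows "induced2 r (m + n) (bilin_ext (\<lambda>s t. Poly_Mapping.single (F s t) 1)) (cls r1 m f) (cls r2 n g)
    = cls r (m + n) (cup m (lo f) (up g))"
proof -
  let ?B = "bilin_ext (\<lambda>s t. Poly_Mapping.single (F s t) (1::'k))"
  let ?b = "\<lambda>m f g. cup m (lo f) (up g)"
  have f': "supported r1 (Suc m) f" and g': "supported r2 (Suc n) g" using f g by (auto simp: cocycle_def)
  have bd0: "coch R 0 (\<lambda>xs. f xs + bd u xs) = coch R 0 f" if "supported R 0 u" for R :: "'z rel" and f u :: "'z list \<Rightarrow> 'k"
  proof -
    have "u [] = 0" using that by (auto simp: supported_def wchain_def end_chains_iff)
    then show ?thesis by (intro coch_cong) (auto simp: bd_def omit_def length_Suc_conv)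
  qed
  \<comment> \<open>Stated for arbitrary factors, since it is applied after the second factor has
    already been altered by a coboundary.\<close>
  have left: "\<exists>v. supported r (m + n) v \<and> ?B (coch r1 m (\<lambda>xs. f xs + bd u xs)) (coch r2 n g) =
      coch r (m + n) (\<lambda>zs. ?b m f g zs + bd v zs)"
    if u: "supported r1 m u" and f: "cocycle r1 m f" and g: "cocycle r2 n g" for f g u
  proof -
    have f': "supported r1 (Suc m) f" and g': "supported r2 (Suc n) g" using f g by (auto simp: cocycle_def)
    show ?thesis
    proof (cases m)
      case 0
      then have "?B (coch r1 m (\<lambda>xs. f xs + bd u xs)) (coch r2 n g) = coch r (m + n) (?b m f g)"
        using bd0[of r1 u f] u bilin_coch[OF f' g'] by simp
      also have "\<dots> = coch r (m + n) (\<lambda>zs. ?b m f g zs + bd (\<lambda>_. 0) zs)" by (simp add: bd_zero)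
      finally show ?thesis by (intro exI[of _ "\<lambda>_. 0"]) (simp add: supported_def)
    next
      case (Suc m')
      have u': "supported r1 (Suc m') u" using u Suc by simp
      have "?B (coch r1 m (\<lambda>xs. f xs + bd u xs)) (coch r2 n g) = coch r (m + n) (?b m (\<lambda>xs. f xs + bd u xs) g)"
        by (intro bilin_coch g' supported_add f' supported_bd[OF r1 u])
      also have "\<dots> = coch r (m + n) (\<lambda>zs. ?b m f g zs + bd (?b m' u g) zs)"
      proof (rule coch_cong)
        fix zs assume zs: "zs \<in> end_chains r" "length zs = Suc (m + n)"
        then have w: "wchain r zs" by (simp add: end_chains_iff)
        have *: "bd (?b m' u g) zs = ?b (Suc m') (bd u) g zs"
          using bd_cut[OF u' g' w] cut_zero_right[OF g w, of m' "lo u"] zs Suc by simp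
        show "?b m (\<lambda>xs. f xs + bd u xs) g zs = ?b m f g zs + bd (?b m' u g) zs"
          unfolding * using Suc by (simp add: cup_def lo_add distrib_right)
      qed
      finally show ?thesis using supported_cut[OF u' g'] Suc by (intro exI[of _ "?b m' u g"]) auto
    qed
  qed
  have right: "\<exists>v. supported r (m + n) v \<and> coch r (m + n) (?b m f (\<lambda>xs. g xs + bd u xs)) =
      coch r (m + n) (\<lambda>zs. ?b m f g zs + bd v zs)" if u: "supported r2 n u" for u
  proof (cases n)
    case 0
    have "coch r (m + n) (?b m f (\<lambda>xs. g xs + bd u xs)) = ?B (coch r1 m f) (coch r2 n (\<lambda>xs. g xs + bd u xs))"
      by (intro bilin_coch[symmetric] f' supported_add g' supported_bd[OF r2 u])
    also have "\<dots> = coch r (m + n) (?b m f g)" using 0 u bd0[of r2 u g] bilin_coch[OF f' g'] by simp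
    also have "\<dots> = coch r (m + n) (\<lambda>zs. ?b m f g zs + bd (\<lambda>_. 0) zs)" by (simp add: bd_zero)
    finally show ?thesis by (intro exI[of _ "\<lambda>_. 0"]) (simp add: supported_def)
  next
    case (Suc n')
    have u': "supported r2 (Suc n') u" using u Suc by simp
    \<comment> \<open>The sign in the primitive compensates the sign with which \<open>bd\<close>
      passes \<open>f\<close>.\<close>
    have "coch r (m + n) (?b m f (\<lambda>xs. g xs + bd u xs)) =
        coch r (m + n) (\<lambda>zs. ?b m f g zs + bd (\<lambda>zs. (- 1) ^ m * ?b m f u zs) zs)"
    proof (rule coch_cong)
      fix zs assume zs: "zs \<in> end_chains r" "length zs = Suc (m + n)"
      then have w: "wchain r zs" by (simp add: end_chains_iff)
      have "bd (?b m f u) zs = (- 1) ^ m * ?b m f (bd u) zs"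
        using bd_cut[OF f' u' w] cut_zero_left[OF f w, of "up u"] zs Suc by simp
      then have *: "bd (\<lambda>zs. (- 1) ^ m * ?b m f u zs) zs = ?b m f (bd u) zs"
        by (simp add: bd_scale minus_one_cancel)
      show "?b m f (\<lambda>xs. g xs + bd u xs) zs = ?b m f g zs + bd (\<lambda>zs. (- 1) ^ m * ?b m f u zs) zs"
        unfolding * by (simp add: cup_def up_add distrib_left)
    qed
    then show ?thesis using supported_scale[OF supported_cut[OF f' u']] Suc by auto
  qed
  show ?thesis
  proof (intro equalityI subsetI)
    fix c assume "c \<in> induced2 r (m + n) ?B (cls r1 m f) (cls r2 n g)"
    then obtain u u' w where u: "supported r1 m u" "supported r2 n u'" "supported r (m + n) w"
      "c = ?B (coch r1 m (\<lambda>xs. f xs + bd u xs)) (coch r2 n (\<lambda>xs. g xs + bd u' xs)) + coch r (m + n) (bd w)"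
      by (auto simp: induced2_def coboundaries_eq[OF r] cls_mem[OF r1] cls_mem[OF r2])
    obtain v where v: "supported r (m + n) v" "?B (coch r1 m (\<lambda>xs. f xs + bd u xs)) (coch r2 n (\<lambda>xs. g xs + bd u' xs))
        = coch r (m + n) (\<lambda>zs. ?b m f (\<lambda>xs. g xs + bd u' xs) zs + bd v zs)"
      using left[OF u(1) f cocycle_add[OF g cocycle_bd[OF r2 u(2)]]] by blast
    obtain v' where v': "supported r (m + n) v'" "coch r (m + n) (?b m f (\<lambda>xs. g xs + bd u' xs)) =
      coch r (m + n) (\<lambda>zs. ?b m f g zs + bd v' zs)" using right[OF u(2)] by blast
    have "c = coch r (m + n) (?b m f (\<lambda>xs. g xs + bd u' xs)) + coch r (m + n) (bd v) + coch r (m + n) (bd w)"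
      unfolding u(4) v(2) by (simp add: coch_add[OF r])
    also have "\<dots> = coch r (m + n) (\<lambda>zs. ?b m f g zs + bd (\<lambda>zs. v' zs + v zs + w zs) zs)"
      unfolding v'(2) coch_add[OF r] by (rule coch_cong) (simp add: bd_add algebra_simps)
    finally show "c \<in> cls r (m + n) (?b m f g)"
      unfolding cls_mem[OF r] using supported_add[OF supported_add[OF v'(1) v(1)] u(3)] by blast
  next
    fix c assume "c \<in> cls r (m + n) (?b m f g)"
    then obtain w where w: "supported r (m + n) w" "c = coch r (m + n) (\<lambda>zs. ?b m f g zs + bd w zs)"
      by (auto simp: cls_mem[OF r])
    have self: "coch R k u \<in> cls R k u" if "finite_poset R" for R :: "'z rel" and k and u :: "'z list \<Rightarrow> 'k"
      unfolding cls_mem[OF that] by (intro exI[of _ "\<lambda>_. 0"] conjI coch_cong) (auto simp: supported_def bd_zero)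
    have "c = ?B (coch r1 m f) (coch r2 n g) + coch r (m + n) (bd w)"
      unfolding w(2) bilin_coch[OF f' g'] coch_add[OF r] ..
    then show "c \<in> induced2 r (m + n) ?B (cls r1 m f) (cls r2 n g)"
      unfolding induced2_def coboundaries_eq[OF r] using w(1) self[OF r1] self[OF r2] by blast
  qed
qed

end

section \<open>Lower and upper intervals and the concatenation morphism\<close>

lemma fp_I:
  assumes "finite (Field r)" "\<And>x. x \<in> Field r \<Longrightarrow> (x, x) \<in> r"
    "\<And>x y z. (x, y) \<in> r \<Longrightarrow> (y, z) \<in> r \<Longrightarrow> (x, z) \<in> r" "\<And>x y. (x, y) \<in> r \<Longrightarrow> (y, x) \<in> r \<Longrightarrow> x = y"
  shows "finite_poset r"
  using assms unfolding finite_poset_def partial_order_on_def preorder_on_def refl_on_def trans_def antisym_def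
  by (auto intro: FieldI1 FieldI2)

lemma down_rel_iff: "(y, z) \<in> down_rel r x \<longleftrightarrow> (y, z) \<in> r \<and> (y, x) \<in> r \<and> (z, x) \<in> r"
  by (auto simp: down_rel_def)

lemma up_rel_iff: "(y, z) \<in> up_rel r x \<longleftrightarrow> (y, z) \<in> r \<and> (x, y) \<in> r \<and> (x, z) \<in> r"
  by (auto simp: up_rel_def)

context
  fixes r :: "'p rel" and x :: 'p
  assumes r: "finite_poset r" and x: "x \<in> Field r"
begin

lemma Field_down_rel: "Field (down_rel r x) = {y. (y, x) \<in> r}"
  using fp_refl[OF r] by (fastforce simp: Field_def down_rel_iff)

lemma Field_up_rel: "Field (up_rel r x) = {y. (x, y) \<in> r}"
  using fp_refl[OF r] by (fastforce simp: Field_def up_rel_iff)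

lemma finite_poset_down_rel: "finite_poset (down_rel r x)"
proof (rule fp_I)
  show "finite (Field (down_rel r x))" unfolding Field_down_rel
    by (rule finite_subset[OF _ fp_finite[OF r]]) (auto intro: FieldI1)
qed (auto simp: Field_down_rel down_rel_iff intro: FieldI1 fp_refl[OF r] fp_trans[OF r] fp_antisym[OF r])

lemma finite_poset_up_rel: "finite_poset (up_rel r x)"
proof (rule fp_I)
  show "finite (Field (up_rel r x))" unfolding Field_up_rel
    by (rule finite_subset[OF _ fp_finite[OF r]]) (auto intro: FieldI2)
qed (auto simp: Field_up_rel up_rel_iff intro: FieldI2 fp_refl[OF r] fp_trans[OF r] fp_antisym[OF r])

lemma min_elems_down_rel: "min_elems (down_rel r x) = {y \<in> min_elems r. (y, x) \<in> r}"
  using fp_trans[OF r] unfolding min_elems_def Field_down_rel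
  by (auto simp: down_rel_iff intro: FieldI1)

lemma max_elems_down_rel: "max_elems (down_rel r x) = {x}"
  using fp_antisym[OF r] fp_refl[OF r x] unfolding max_elems_def Field_down_rel
  by (auto simp: down_rel_iff)

lemma max_elems_up_rel: "max_elems (up_rel r x) = {y \<in> max_elems r. (x, y) \<in> r}"
  using fp_trans[OF r] unfolding max_elems_def Field_up_rel
  by (auto simp: up_rel_iff intro: FieldI2)

lemma min_elems_up_rel: "min_elems (up_rel r x) = {x}"
  using fp_antisym[OF r] fp_refl[OF r x] unfolding min_elems_def Field_up_rel
  by (auto simp: up_rel_iff)

lemma wchain_down_rel: "wchain (down_rel r x) ws \<longleftrightarrow> wchain r ws \<and> (\<forall>z\<in>set ws. (z, x) \<in> r)"
  unfolding wchain_def Field_down_rel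
  by (auto simp: down_rel_iff intro: FieldI1 sorted_wrt_mono_rel[rotated])

lemma wchain_up_rel: "wchain (up_rel r x) ws \<longleftrightarrow> wchain r ws \<and> (\<forall>z\<in>set ws. (x, z) \<in> r)"
  unfolding wchain_def Field_up_rel
  by (auto simp: up_rel_iff intro: FieldI2 sorted_wrt_mono_rel[rotated])

text \<open>The only cut is at \<open>x\<close>, which is the unique maximal element of the lower
  interval and the unique minimal element of the upper one. The two parts of a chain therefore
  automatically meet at \<open>x\<close>.\<close>

lemma cut_concat:
  "cut r (down_rel r x) (up_rel r x) (\<lambda>y. y = x) (\<lambda>y. y = x) (\<lambda>z. z) (\<lambda>z. z) (\<lambda>s t. s @ tl t)"
proof
  fix s t zs :: "'p list" and m n
  assume s: "s \<in> end_chains (down_rel r x)" "length s = Suc m" and t: "t \<in> end_chains (up_rel r x)" "length t = Suc n"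
  have s': "wchain r s" "\<forall>z\<in>set s. (z, x) \<in> r" "last s = x"
    using s by (auto simp: end_chains_iff wchain_down_rel max_elems_down_rel)
  have t': "wchain r t" "\<forall>z\<in>set t. (x, z) \<in> r" "hd t = x" "t = x # tl t"
    using t by (auto simp: end_chains_iff wchain_up_rel min_elems_up_rel)
  show "s @ tl t = zs \<longleftrightarrow> (wchain r zs \<and> length zs = Suc (m + n) \<and> zs ! m = x \<and> zs ! m = x) \<and>
     s = map (\<lambda>z. z) (take (Suc m) zs) \<and> t = map (\<lambda>z. z) (drop m zs)"
  proof
    assume zs: "s @ tl t = zs"
    have "wchain r zs" unfolding zs[symmetric] wchain_def sorted_wrt_append
    proof (intro conjI ballI)
      show "set (s @ tl t) \<subseteq> Field r" "sorted_wrt (\<lambda>x y. (x, y) \<in> r) s" "sorted_wrt (\<lambda>x y. (x, y) \<in> r) (tl t)"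
        using s'(1) wchain_drop[OF t'(1), of 1] by (auto simp: wchain_def drop_Suc)
      fix u v assume "u \<in> set s" "v \<in> set (tl t)"
      then show "(u, v) \<in> r" using s'(2) t'(2,4) fp_trans[OF r] by (metis list.set_intros(2))
    qed
    moreover have "zs ! m = x" using s' s(2) unfolding zs[symmetric] by (simp add: nth_append last_conv_nth split: if_splits)
      (metis diff_Suc_1 last_conv_nth list.size(3) nat.distinct(1))
    moreover have "drop m zs = t"
    proof -
      have "s = take m s @ [x]" using s'(3) s(2) by (metis append_butlast_last_id butlast_conv_take diff_Suc_1 list.size(3) nat.distinct(1))
      then have "drop m s = [x]" using s(2) by (metis append_eq_conv_conj length_take min.absorb2 le_SucI order_refl)
      then show ?thesis using s(2) t'(4) unfolding zs[symmetric] by simp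
    qed
    moreover have "take (Suc m) zs = s" using s(2) unfolding zs[symmetric] by simp
    moreover have "length zs = Suc (m + n)" using s(2) t(2) unfolding zs[symmetric] by simp
    ultimately show "(wchain r zs \<and> length zs = Suc (m + n) \<and> zs ! m = x \<and> zs ! m = x) \<and>
      s = map (\<lambda>z. z) (take (Suc m) zs) \<and> t = map (\<lambda>z. z) (drop m zs)" by simp
  next
    assume "(wchain r zs \<and> length zs = Suc (m + n) \<and> zs ! m = x \<and> zs ! m = x) \<and>
      s = map (\<lambda>z. z) (take (Suc m) zs) \<and> t = map (\<lambda>z. z) (drop m zs)"
    then show "s @ tl t = zs" by (simp add: drop_Suc[symmetric] tl_drop)
  qed
qed (use r x in \<open>auto simp: finite_poset_down_rel finite_poset_up_rel down_rel_iff up_rel_iff min_elems_up_rel max_elems_down_rel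
      min_elems_down_rel max_elems_up_rel intro: fp_trans[OF r]\<close>)

lemma concat_cls:
  fixes f g :: "'p list \<Rightarrow> 'k::{comm_ring,comm_monoid_mult}"
  assumes "cocycle (down_rel r x) m f" "cocycle (up_rel r x) n g"
  defines "b \<equiv> cup m (\<lambda>ws. if last ws = x then f ws else 0) (\<lambda>ws. if hd ws = x then g ws else 0)"
  shows "concat_mor r m n (cls (down_rel r x) m f) (cls (up_rel r x) n g) = cls r (m + n) b" "cocycle r (m + n) b"
proof -
  interpret cut r "down_rel r x" "up_rel r x" "\<lambda>y. y = x" "\<lambda>y. y = x" "\<lambda>z. z" "\<lambda>z. z" "\<lambda>s t. s @ tl t"
    by (rule cut_concat)
  have b: "b = cup m (lo f) (up g)" by (simp add: b_def lo_def up_def fun_eq_iff cup_def)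
  show "concat_mor r m n (cls (down_rel r x) m f) (cls (up_rel r x) n g) = cls r (m + n) b" "cocycle r (m + n) b"
    unfolding b concat_mor_def using induced2_cut[OF assms(1,2)] cocycle_cut[OF assms(1,2)] by auto
qed

end

section \<open>Products of two posets and the binary Kuenneth morphism\<close>

lemma Field_prod_rel2: "finite_poset r \<Longrightarrow> finite_poset s \<Longrightarrow> Field (prod_rel2 r s) = Field r \<times> Field s"
  using fp_refl[of r] fp_refl[of s] by (fastforce simp: Field_def prod_rel2_def)

lemma finite_poset_prod_rel2:
  assumes "finite_poset r" "finite_poset s" shows "finite_poset (prod_rel2 r s)"
proof (rule fp_I)
  show "finite (Field (prod_rel2 r s))" using assms by (simp add: Field_prod_rel2 fp_finite)
qed (use assms in \<open>auto simp: Field_prod_rel2, auto simp: prod_rel2_def intro: fp_refl fp_trans fp_antisym\<close>)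

lemma min_elems_prod_rel2:
  assumes "finite_poset r" "finite_poset s"
  shows "min_elems (prod_rel2 r s) = min_elems r \<times> min_elems s"
proof -
  note R = fp_refl[OF assms(1)] fp_refl[OF assms(2)]
  have "x \<in> min_elems r \<and> y \<in> min_elems s" if xy: "(x, y) \<in> min_elems (prod_rel2 r s)" for x y
  proof -
    have F: "x \<in> Field r" "y \<in> Field s" using xy by (auto simp: min_elems_def Field_prod_rel2[OF assms])
    have "x' = x" if "(x', x) \<in> r" for x'
      using min_elemsD[OF xy, of "(x', y)"] that R F by (auto simp: prod_rel2_def)
    moreover have "y' = y" if "(y', y) \<in> s" for y'
      using min_elemsD[OF xy, of "(x, y')"] that R F by (auto simp: prod_rel2_def)
    ultimately show ?thesis using F by (auto simp: min_elems_def)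
  qed
  moreover have "(x, y) \<in> min_elems (prod_rel2 r s)" if "x \<in> min_elems r" "y \<in> min_elems s" for x y
    using that min_elemsD unfolding min_elems_def Field_prod_rel2[OF assms] by (auto simp: prod_rel2_def)
  ultimately show ?thesis by auto
qed

lemma max_elems_prod_rel2:
  assumes "finite_poset r" "finite_poset s"
  shows "max_elems (prod_rel2 r s) = max_elems r \<times> max_elems s"
proof -
  note R = fp_refl[OF assms(1)] fp_refl[OF assms(2)]
  have "x \<in> max_elems r \<and> y \<in> max_elems s" if xy: "(x, y) \<in> max_elems (prod_rel2 r s)" for x y
  proof -
    have F: "x \<in> Field r" "y \<in> Field s" using xy by (auto simp: max_elems_def Field_prod_rel2[OF assms])
    have "x' = x" if "(x, x') \<in> r" for x'
      using max_elemsD[OF xy, of "(x', y)"] that R F by (auto simp: prod_rel2_def)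
    moreover have "y' = y" if "(y, y') \<in> s" for y'
      using max_elemsD[OF xy, of "(x, y')"] that R F by (auto simp: prod_rel2_def)
    ultimately show ?thesis using F by (auto simp: max_elems_def)
  qed
  moreover have "(x, y) \<in> max_elems (prod_rel2 r s)" if "x \<in> max_elems r" "y \<in> max_elems s" for x y
    using that max_elemsD unfolding max_elems_def Field_prod_rel2[OF assms] by (auto simp: prod_rel2_def)
  ultimately show ?thesis by auto
qed

text \<open>Here every element may serve as a cut, since the projections are monotone everywhere.
  The path that first moves in one coordinate and then in the other is recovered from its two
  projections because these end at a maximal and start at a minimal element.\<close>

lemma cut_kunneth2:
  assumes r: "finite_poset r" and s: "finite_poset s"
  shows "cut (prod_rel2 r s) r s (\<lambda>_. True) (\<lambda>_. True) fst snd
    (\<lambda>xs ys. map (\<lambda>x. (x, hd ys)) xs @ map (\<lambda>y. (last xs, y)) (tl ys))"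
proof
  fix xs ys zs m n
  assume xs: "xs \<in> end_chains r" "length xs = Suc m" and ys: "ys \<in> end_chains s" "length ys = Suc n"
  let ?zs = "map (\<lambda>x. (x, hd ys)) xs @ map (\<lambda>y. (last xs, y)) (tl ys)"
  have X: "wchain r xs" "last xs \<in> max_elems r" and Y: "wchain s ys" "hd ys \<in> min_elems s"
    using xs ys by (auto simp: end_chains_iff)
  have ys': "ys = hd ys # tl ys" using ys(2) by (cases ys) auto
  note pf = finite_poset_prod_rel2[OF r s]
  show "?zs = zs \<longleftrightarrow> (wchain (prod_rel2 r s) zs \<and> length zs = Suc (m + n) \<and> True \<and> True) \<and>
     xs = map fst (take (Suc m) zs) \<and> ys = map snd (drop m zs)"
  proof
    assume zs: "?zs = zs"
    have hF: "hd ys \<in> Field s" "last xs \<in> Field r" using X Y by (auto simp: min_elems_def max_elems_def)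
    have ms: "last xs \<in> set xs" using xs(2) by (intro last_in_set) auto
    have "wchain (prod_rel2 r s) ?zs" unfolding wchain_def sorted_wrt_append Field_prod_rel2[OF r s]
    proof (intro conjI ballI)
      show "set ?zs \<subseteq> Field r \<times> Field s"
        using X Y hF wchain_drop[OF Y(1), of 1] by (auto simp: wchain_def drop_Suc)
      show "sorted_wrt (\<lambda>x y. (x, y) \<in> prod_rel2 r s) (map (\<lambda>x. (x, hd ys)) xs)"
        using X(1) fp_refl[OF s hF(1)] by (auto simp: sorted_wrt_map prod_rel2_def wchain_def)
      show "sorted_wrt (\<lambda>x y. (x, y) \<in> prod_rel2 r s) (map (\<lambda>y. (last xs, y)) (tl ys))"
        using wchain_drop[OF Y(1), of 1] fp_refl[OF r hF(2)] by (auto simp: sorted_wrt_map prod_rel2_def wchain_def drop_Suc)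
      fix u v assume uv: "u \<in> set (map (\<lambda>x. (x, hd ys)) xs)" "v \<in> set (map (\<lambda>y. (last xs, y)) (tl ys))"
      then obtain x y where "u = (x, hd ys)" "v = (last xs, y)" "x \<in> set xs" "y \<in> set (tl ys)" by auto
      moreover have "y \<in> set ys" using calculation ys' by (metis list.set_intros(2))
      ultimately show "(u, v) \<in> prod_rel2 r s"
        using wchain_last[OF r X(1)] wchain_hd[OF s Y(1)] by (auto simp: prod_rel2_def)
    qed
    moreover have "take (Suc m) ?zs = map (\<lambda>x. (x, hd ys)) xs" using xs(2) by simp
    moreover have "drop m ?zs = (last xs, hd ys) # map (\<lambda>y. (last xs, y)) (tl ys)"
    proof -
      obtain us where "xs = us @ [last xs]" "length us = m" using xs(2)
        by (metis append_butlast_last_id diff_Suc_1 length_butlast list.size(3) nat.distinct(1))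
      then have "drop m xs = [last xs]" by (metis append_eq_conv_conj)
      then show ?thesis using xs(2) by (simp add: drop_map)
    qed
    ultimately show "(wchain (prod_rel2 r s) zs \<and> length zs = Suc (m + n) \<and> True \<and> True) \<and>
       xs = map fst (take (Suc m) zs) \<and> ys = map snd (drop m zs)"
      using xs(2) ys(2) ys' unfolding zs[symmetric] by (auto simp: comp_def)
  next
    assume "(wchain (prod_rel2 r s) zs \<and> length zs = Suc (m + n) \<and> True \<and> True) \<and>
       xs = map fst (take (Suc m) zs) \<and> ys = map snd (drop m zs)"
    then have w: "wchain (prod_rel2 r s) zs" "length zs = Suc (m + n)" and e: "xs = map fst (take (Suc m) zs)" "ys = map snd (drop m zs)"
      by auto
    have h: "hd ys = snd (zs ! m)" "last xs = fst (zs ! m)"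
    proof -
      have "take (Suc m) zs \<noteq> []" "drop m zs \<noteq> []" using w(2) by auto
      then show "hd ys = snd (zs ! m)" "last xs = fst (zs ! m)"
        using w(2) last_slice[of 0 m zs] unfolding e by (simp_all add: hd_map last_map hd_drop_conv_nth del: take_Suc)
    qed
    \<comment> \<open>Up to the cut the second coordinate lies below a minimal element, so it is
      constant; from the cut on the first coordinate lies above a maximal one.\<close>
    have 1: "snd (zs ! i) = snd (zs ! m)" if "i \<le> m" for i
      using wchain_nth[OF pf w(1) that] w(2) min_elemsD[OF Y(2), of "snd (zs ! i)"] h by (auto simp: prod_rel2_def)
    have 2: "fst (zs ! i) = fst (zs ! m)" if "m \<le> i" "i < length zs" for i
      using wchain_nth[OF pf w(1) that] w(2) max_elemsD[OF X(2), of "fst (zs ! i)"] h by (auto simp: prod_rel2_def)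
    have "map (\<lambda>x. (x, hd ys)) xs = take (Suc m) zs"
    proof (rule nth_equalityI)
      show "length (map (\<lambda>x. (x, hd ys)) xs) = length (take (Suc m) zs)" using e(1) by simp
      fix i assume "i < length (map (\<lambda>x. (x, hd ys)) xs)"
      then have "i \<le> m" "xs ! i = fst (zs ! i)" using xs(2) e(1) by auto
      then show "map (\<lambda>x. (x, hd ys)) xs ! i = take (Suc m) zs ! i"
        using 1[of i] xs(2) h(1) by (simp add: prod_eq_iff)
    qed
    moreover have "map (\<lambda>y. (last xs, y)) (tl ys) = drop (Suc m) zs"
    proof (rule nth_equalityI)
      show "length (map (\<lambda>y. (last xs, y)) (tl ys)) = length (drop (Suc m) zs)" using ys(2) w(2) by simp
      fix i assume "i < length (map (\<lambda>y. (last xs, y)) (tl ys))"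
      then have i: "i < n" using ys(2) by simp
      then have "tl ys ! i = snd (zs ! (Suc m + i))" using ys(2) w(2) e(2) by (simp add: nth_tl)
      then show "map (\<lambda>y. (last xs, y)) (tl ys) ! i = drop (Suc m) zs ! i"
        using 2[of "Suc m + i"] i ys(2) w(2) h(2) by (simp add: prod_eq_iff)
    qed
    ultimately show "?zs = zs" by simp
  qed
next
  fix x x' y assume "(x, x') \<in> prod_rel2 r s" "(x', y) \<in> prod_rel2 r s"
  then show "(fst x, fst x') \<in> r" by (auto simp: prod_rel2_def)
next
  fix x x' y assume "(y, x) \<in> prod_rel2 r s" "(x, x') \<in> prod_rel2 r s"
  then show "(snd x, snd x') \<in> s" by (auto simp: prod_rel2_def)
next
  fix x y assume "snd y \<in> min_elems s" "(x, y) \<in> prod_rel2 r s" "fst x \<in> min_elems r"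
  then show "x \<in> min_elems (prod_rel2 r s)" unfolding min_elems_prod_rel2[OF r s]
    by (cases x; cases y) (auto simp: prod_rel2_def dest: min_elemsD)
next
  fix x y assume "fst y \<in> max_elems r" "(y, x) \<in> prod_rel2 r s" "snd x \<in> max_elems s"
  then show "x \<in> max_elems (prod_rel2 r s)" unfolding max_elems_prod_rel2[OF r s]
    by (cases x; cases y) (auto simp: prod_rel2_def dest: max_elemsD)
qed (use r s finite_poset_prod_rel2 in auto)

lemma kunneth2_cls:
  fixes f :: "'p list \<Rightarrow> 'k::{comm_ring,comm_monoid_mult}" and g :: "'q list \<Rightarrow> 'k"
  assumes r: "finite_poset r" and s: "finite_poset s" and fg: "cocycle r m f" "cocycle s n g"
  defines "b \<equiv> cup m (\<lambda>ws. f (map fst ws)) (\<lambda>ws. g (map snd ws))"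
  shows "kunneth2 r s m n (cls r m f) (cls s n g) = cls (prod_rel2 r s) (m + n) b" "cocycle (prod_rel2 r s) (m + n) b"
proof -
  interpret cut "prod_rel2 r s" r s "\<lambda>_. True" "\<lambda>_. True" fst snd
    "\<lambda>xs ys. map (\<lambda>x. (x, hd ys)) xs @ map (\<lambda>y. (last xs, y)) (tl ys)" by (rule cut_kunneth2[OF r s])
  have b: "b = cup m (lo f) (up g)" by (simp add: b_def lo_def up_def fun_eq_iff cup_def)
  show "kunneth2 r s m n (cls r m f) (cls s n g) = cls (prod_rel2 r s) (m + n) b" "cocycle (prod_rel2 r s) (m + n) b"
    unfolding b kunneth2_def using induced2_cut[OF fg] cocycle_cut[OF fg] by auto
qed

section \<open>Finite products and the iterated Kuenneth morphism\<close>

lemma prod_family_iff: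
  "(g, h) \<in> prod_family P I \<longleftrightarrow> g \<in> (\<Pi>\<^sub>E i\<in>I. Field (P i)) \<and> h \<in> (\<Pi>\<^sub>E i\<in>I. Field (P i)) \<and> (\<forall>i\<in>I. (g i, h i) \<in> P i)"
  by (simp add: prod_family_def)

context
  fixes P :: "'i \<Rightarrow> 'p rel" and I :: "'i set"
  assumes I: "finite I" and P: "\<And>i. i \<in> I \<Longrightarrow> finite_poset (P i)"
begin

lemma Field_prod_family: "Field (prod_family P I) = (\<Pi>\<^sub>E i\<in>I. Field (P i))"
proof -
  have "(g, g) \<in> prod_family P I" if "g \<in> (\<Pi>\<^sub>E i\<in>I. Field (P i))" for g
    using that P by (auto simp: prod_family_iff intro!: fp_refl)
  moreover have "g \<in> Field (prod_family P I) \<longleftrightarrow> (\<exists>h. (g, h) \<in> prod_family P I \<or> (h, g) \<in> prod_family P I)" for g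
    by (auto simp: Field_def)
  moreover have "g \<in> (\<Pi>\<^sub>E i\<in>I. Field (P i))" if "(g, h) \<in> prod_family P I \<or> (h, g) \<in> prod_family P I" for g h
    using that unfolding prod_family_iff by (elim disjE conjE)
  ultimately have "g \<in> Field (prod_family P I) \<longleftrightarrow> g \<in> (\<Pi>\<^sub>E i\<in>I. Field (P i))" for g by metis
  then show ?thesis by blast
qed

lemma finite_poset_prod_family: "finite_poset (prod_family P I)"
proof (rule fp_I)
  show "finite (Field (prod_family P I))" unfolding Field_prod_family
    using I P by (intro finite_PiE) (auto simp: fp_finite)
  show "(g, g) \<in> prod_family P I" if "g \<in> Field (prod_family P I)" for g
    using that P unfolding Field_prod_family by (auto simp: prod_family_iff intro!: fp_refl)
  show "(g, k) \<in> prod_family P I" if "(g, h) \<in> prod_family P I" "(h, k) \<in> prod_family P I" for g h k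
    using that P unfolding prod_family_iff by (meson fp_trans)
  show "g = h" if gh: "(g, h) \<in> prod_family P I" "(h, g) \<in> prod_family P I" for g h
  proof (rule PiE_ext)
    show "g \<in> (\<Pi>\<^sub>E i\<in>I. Field (P i))" "h \<in> (\<Pi>\<^sub>E i\<in>I. Field (P i))" using gh by (auto simp: prod_family_iff)
    show "g i = h i" if "i \<in> I" for i using gh that P[OF that] fp_antisym unfolding prod_family_iff by metis
  qed
qed

lemma min_elems_prod_family:
  "g \<in> min_elems (prod_family P I) \<longleftrightarrow> g \<in> (\<Pi>\<^sub>E i\<in>I. Field (P i)) \<and> (\<forall>i\<in>I. g i \<in> min_elems (P i))"
proof (intro iffI conjI ballI)
  assume g: "g \<in> min_elems (prod_family P I)"
  then show gF: "g \<in> (\<Pi>\<^sub>E i\<in>I. Field (P i))" by (auto simp: min_elems_def Field_prod_family)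
  fix i assume i: "i \<in> I"
  have "y = g i" if y: "(y, g i) \<in> P i" for y
  proof -
    have "(g(i := y), g) \<in> prod_family P I"
      using gF i y P FieldI1[OF y] by (auto simp: prod_family_iff PiE_iff extensional_def intro!: fp_refl)
    then have "g(i := y) = g" by (rule min_elemsD[OF g])
    then show ?thesis by (metis fun_upd_same)
  qed
  then show "g i \<in> min_elems (P i)" using gF i by (auto simp: min_elems_def)
next
  assume g: "g \<in> (\<Pi>\<^sub>E i\<in>I. Field (P i)) \<and> (\<forall>i\<in>I. g i \<in> min_elems (P i))"
  have "h = g" if h: "(h, g) \<in> prod_family P I" for h
  proof (rule PiE_ext)
    show "h \<in> (\<Pi>\<^sub>E i\<in>I. Field (P i))" "g \<in> (\<Pi>\<^sub>E i\<in>I. Field (P i))" using h g by (auto simp: prod_family_iff)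
    show "h i = g i" if "i \<in> I" for i using h g that unfolding prod_family_iff by (meson min_elemsD)
  qed
  then show "g \<in> min_elems (prod_family P I)" using g by (auto simp: min_elems_def Field_prod_family)
qed

lemma max_elems_prod_family:
  "g \<in> max_elems (prod_family P I) \<longleftrightarrow> g \<in> (\<Pi>\<^sub>E i\<in>I. Field (P i)) \<and> (\<forall>i\<in>I. g i \<in> max_elems (P i))"
proof (intro iffI conjI ballI)
  assume g: "g \<in> max_elems (prod_family P I)"
  then show gF: "g \<in> (\<Pi>\<^sub>E i\<in>I. Field (P i))" by (auto simp: max_elems_def Field_prod_family)
  fix i assume i: "i \<in> I"
  have "y = g i" if y: "(g i, y) \<in> P i" for y
  proof -
    have "(g, g(i := y)) \<in> prod_family P I"
      using gF i y P FieldI2[OF y] by (auto simp: prod_family_iff PiE_iff extensional_def intro!: fp_refl)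
    then have "g = g(i := y)" by (rule max_elemsD[OF g])
    then show ?thesis by (metis fun_upd_same)
  qed
  then show "g i \<in> max_elems (P i)" using gF i by (auto simp: max_elems_def)
next
  assume g: "g \<in> (\<Pi>\<^sub>E i\<in>I. Field (P i)) \<and> (\<forall>i\<in>I. g i \<in> max_elems (P i))"
  have "h = g" if h: "(g, h) \<in> prod_family P I" for h
  proof (rule PiE_ext)
    show "h \<in> (\<Pi>\<^sub>E i\<in>I. Field (P i))" "g \<in> (\<Pi>\<^sub>E i\<in>I. Field (P i))" using h g by (auto simp: prod_family_iff)
    show "h i = g i" if "i \<in> I" for i using h g that unfolding prod_family_iff by (metis max_elemsD)
  qed
  then show "g \<in> max_elems (prod_family P I)" using g by (auto simp: max_elems_def Field_prod_family)
qed

end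

text \<open>Each factor is pulled back along the projection to its coordinate. In this form the
  iterated Kuenneth product is an iterated cup product on the whole product poset, and reordering
  the factors no longer changes the poset.\<close>

definition pieces :: "('t \<times> nat \<times> ('p list \<Rightarrow> 'k)) list \<Rightarrow> (nat \<times> (('t \<Rightarrow> 'p) list \<Rightarrow> 'k)) list" where
  "pieces zs = map (\<lambda>(T, d, y). (d, \<lambda>ws. y (map (\<lambda>g. g T) ws))) zs"

definition to_cls :: "('t \<Rightarrow> 'p rel) \<Rightarrow> ('t \<times> nat \<times> ('p list \<Rightarrow> 'k)) list
    \<Rightarrow> ('t \<times> nat \<times> ('p list \<Rightarrow>\<^sub>0 'k::{comm_ring,comm_monoid_mult}) set) list" where
  "to_cls P zs = map (\<lambda>(T, d, y). (T, d, cls (P T) d y)) zs"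

lemma pieces_simps [simp]:
  "pieces [] = []" "pieces ((T, d, y) # zs) = (d, \<lambda>ws. y (map (\<lambda>g. g T) ws)) # pieces zs"
  "pieces (zs @ ws) = pieces zs @ pieces ws"
  by (auto simp: pieces_def)

lemma to_cls_simps [simp]:
  "to_cls P [] = []" "to_cls P ((T, d, y) # zs) = (T, d, cls (P T) d y) # to_cls P zs"
  "to_cls P (zs @ ws) = to_cls P zs @ to_cls P ws"
  by (auto simp: to_cls_def)

lemma deg_simps [simp]: "deg [] = 0" "deg ((T, d, y) # zs) = d + deg zs" "deg (zs @ ws) = deg zs + deg ws"
  by (auto simp: deg_def)

lemma tdeg_pieces: "tdeg (pieces zs) = deg zs"
  by (induction zs) auto

lemma deg_to_cls: "deg (to_cls P zs) = deg zs"
  by (induction zs) auto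

lemma map_fst_to_cls: "map fst (to_cls P zs) = map fst zs"
  by (induction zs) auto

text \<open>The product only reads the coordinates listed in \<open>zs\<close>, so tuples may be
  altered or restricted elsewhere.\<close>

lemma mcup_pieces_map:
  assumes "\<And>T w. T \<in> set (map fst zs) \<Longrightarrow> h w T = h' w T"
  shows "mcup (pieces zs) (map h ws) = mcup (pieces zs) (map h' ws)"
  using assms
proof (induction zs arbitrary: ws)
  case (Cons z zs)
  obtain T d y where z: "z = (T, d, y)" by (cases z)
  have 1: "map (\<lambda>g. g T) (map h us) = map (\<lambda>g. g T) (map h' us)" for us using Cons.prems[of T] z by simp
  have "mcup (pieces zs) (map h (drop d ws)) = mcup (pieces zs) (map h' (drop d ws))"
    using Cons.prems by (intro Cons.IH) auto
  then show ?case unfolding z pieces_simps mcup.simps take_map drop_map 1 by simp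
qed simp

lemma pullback_admissible_split:
  assumes I: "finite I" and fpI: "\<And>i. i \<in> insert T I \<Longrightarrow> finite_poset (P i)"
  shows "pullback_admissible (prod_family P (insert T I)) (prod_rel2 (P T) (prod_family P I)) (\<lambda>g. (g T, restrict g I))"
    (is "pullback_admissible ?Q (prod_rel2 _ ?R) ?h")
  unfolding pullback_admissible_def
proof (intro conjI subsetI)
  have T: "finite_poset (P T)" using fpI by auto
  have fR: "finite_poset ?R" using I fpI by (intro finite_poset_prod_family) auto
  have fin: "finite (insert T I)" using I by simp
  have F: "Field ?Q = (\<Pi>\<^sub>E i\<in>insert T I. Field (P i))" using fin fpI by (rule Field_prod_family)
  have m1: "g \<in> min_elems ?Q \<longleftrightarrow> g \<in> (\<Pi>\<^sub>E i\<in>insert T I. Field (P i)) \<and> (\<forall>i\<in>insert T I. g i \<in> min_elems (P i))"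
    "g \<in> max_elems ?Q \<longleftrightarrow> g \<in> (\<Pi>\<^sub>E i\<in>insert T I. Field (P i)) \<and> (\<forall>i\<in>insert T I. g i \<in> max_elems (P i))" for g
    using fin fpI by (intro min_elems_prod_family max_elems_prod_family; simp)+
  have m2: "g \<in> min_elems ?R \<longleftrightarrow> g \<in> (\<Pi>\<^sub>E i\<in>I. Field (P i)) \<and> (\<forall>i\<in>I. g i \<in> min_elems (P i))"
    "g \<in> max_elems ?R \<longleftrightarrow> g \<in> (\<Pi>\<^sub>E i\<in>I. Field (P i)) \<and> (\<forall>i\<in>I. g i \<in> max_elems (P i))" for g
    using I fpI by (intro min_elems_prod_family max_elems_prod_family; simp)+
  have hF: "restrict g I \<in> (\<Pi>\<^sub>E i\<in>I. Field (P i))" if "g \<in> (\<Pi>\<^sub>E i\<in>insert T I. Field (P i))" for g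
    using that by (auto simp: PiE_iff)
  show "poset_hom ?Q (prod_rel2 (P T) ?R) ?h"
    unfolding poset_hom_def
  proof clarify
    fix g h assume "(g, h) \<in> ?Q"
    then have gh: "g \<in> (\<Pi>\<^sub>E i\<in>insert T I. Field (P i))" "h \<in> (\<Pi>\<^sub>E i\<in>insert T I. Field (P i))"
      "\<And>i. i \<in> insert T I \<Longrightarrow> (g i, h i) \<in> P i" unfolding prod_family_iff by blast+
    show "(?h g, ?h h) \<in> prod_rel2 (P T) ?R"
      using hF[OF gh(1)] hF[OF gh(2)] gh(3) by (simp add: prod_rel2_def prod_family_iff)
  qed
  show "g \<in> min_elems ?Q" if "g \<in> {x \<in> Field ?Q. ?h x \<in> min_elems (prod_rel2 (P T) ?R)}" for g
    using that m2[of "restrict g I"] by (simp add: F m1 min_elems_prod_rel2[OF T fR])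
  show "g \<in> max_elems ?Q" if "g \<in> {x \<in> Field ?Q. ?h x \<in> max_elems (prod_rel2 (P T) ?R)}" for g
    using that m2[of "restrict g I"] by (simp add: F m1 max_elems_prod_rel2[OF T fR])
qed

lemma kunneth_cls:
  fixes zs :: "('t \<times> nat \<times> ('p list \<Rightarrow> 'k::{comm_ring,comm_monoid_mult})) list"
  assumes "distinct (map fst zs)" "\<And>T d y. (T, d, y) \<in> set zs \<Longrightarrow> finite_poset (P T) \<and> cocycle (P T) d y"
  shows "kunneth P (to_cls P zs) = cls (prod_family P (set (map fst zs))) (deg zs) (mcup (pieces zs)) \<and>
    cocycle (prod_family P (set (map fst zs))) (deg zs) (mcup (pieces zs))"
  using assms
proof (induction zs)
  case Nil
  let ?R = "prod_family P {}" and ?u = "\<lambda>t::'t. undefined :: 'p"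
  have R: "finite_poset ?R" by (rule finite_poset_prod_family) auto
  \<comment> \<open>The empty product is a point: the only extensional function on the empty index
    set is constantly \<open>undefined\<close>. Its unit class is represented by the constant
    1.\<close>
  have F: "Field ?R = {?u}" by (subst Field_prod_family) auto
  have m: "?u \<in> min_elems ?R" "?u \<in> max_elems ?R"
    unfolding min_elems_def max_elems_def F by (auto simp: prod_family_iff)
  have e: "xs \<in> end_chains ?R \<and> length xs = Suc 0 \<longleftrightarrow> xs = [?u]" for xs
    using m by (auto simp: end_chains_iff wchain_def F length_Suc_conv)
  have "coch ?R 0 (mcup []) = Poly_Mapping.single [?u] (1::'k)"
    by (rule poly_mapping_eqI) (auto simp: lookup_coch[OF R] lookup_single when_def e)
  moreover have "cocycle ?R 0 (mcup [] :: ('t \<Rightarrow> 'p) list \<Rightarrow> 'k)"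
    unfolding cocycle_def
  proof (intro conjI allI impI)
    show "supported ?R (Suc 0) (mcup [] :: ('t \<Rightarrow> 'p) list \<Rightarrow> 'k)"
      unfolding supported_def using e[of "[?u]"] by (auto simp: wchain_def F length_Suc_conv)
    show "bd (mcup [] :: ('t \<Rightarrow> 'p) list \<Rightarrow> 'k) zs = 0" if "length zs = 0 + 2" for zs
      by (rule bd_mcup[where C = UNIV]) (use that in auto)
  qed
  ultimately show ?case by (simp add: cls_def del: mcup.simps)
next
  case (Cons z zs)
  obtain T d y where z: "z = (T, d, y)" by (cases z)
  let ?I = "set (map fst zs)" and ?h = "\<lambda>I g. (g T, restrict g I)"
  let ?Q = "prod_family P (insert T ?I)" and ?R = "prod_family P ?I"
  have T: "T \<notin> ?I" "finite_poset (P T)" "cocycle (P T) d y" using Cons.prems z by auto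
  have fpI: "finite_poset (P i)" if i: "i \<in> insert T ?I" for i
  proof -
    have "i \<in> fst ` set (z # zs)" using i z by auto
    then obtain e where "e \<in> set (z # zs)" "i = fst e" by blast
    then show ?thesis using Cons.prems(2)[of i "fst (snd e)" "snd (snd e)"] by simp
  qed
  have fR: "finite_poset ?R" using fpI by (intro finite_poset_prod_family) auto
  have fQ: "finite_poset ?Q" using fpI by (intro finite_poset_prod_family) auto
  have IH: "kunneth P (to_cls P zs) = cls ?R (deg zs) (mcup (pieces zs))" "cocycle ?R (deg zs) (mcup (pieces zs))"
    using Cons by auto
  note K = kunneth2_cls[OF T(2) fR T(3) IH(2)]
  have adm: "pullback_admissible ?Q (prod_rel2 (P T) ?R) (?h ?I)"
    using fpI by (intro pullback_admissible_split) auto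
  \<comment> \<open>The recursive definition restricts tuples to the remaining blocks, which the
    remaining factors cannot detect.\<close>
  have fn: "cup d (\<lambda>ws. y (map fst ws)) (\<lambda>ws. mcup (pieces zs) (map snd ws)) (map (?h ?I) ws) = mcup (pieces (z # zs)) ws" for ws
    using mcup_pieces_map[of zs "\<lambda>g. restrict g ?I" "\<lambda>g. g" "drop d ws"]
    unfolding z by (simp add: cup_def take_map drop_map comp_def)
  have "kunneth P (to_cls P (z # zs)) = pullback ?Q (?h ?I) (d + deg zs)
      (kunneth2 (P T) ?R d (deg zs) (cls (P T) d y) (kunneth P (to_cls P zs)))"
    unfolding z by (simp add: Let_def deg_to_cls map_fst_to_cls[unfolded set_map] flip: set_map)
  also have "\<dots> = cls ?Q (d + deg zs) (mcup (pieces (z # zs)))"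
    unfolding IH(1) K(1) pullback_cls[OF fQ finite_poset_prod_rel2[OF T(2) fR] adm K(2)] fn ..
  finally show ?case
    using cocycle_pullback[OF fQ adm K(2), unfolded fn] unfolding z by (simp del: mcup.simps)
qed

section \<open>Composition as a cup product\<close>

lemma elts_blk: "finite T \<Longrightarrow> elts (blk T) = T"
  by (simp add: blk_def Abs_fset_inverse)

lemma inj_on_blk: "(\<And>T. T \<in> A \<Longrightarrow> finite T) \<Longrightarrow> inj_on blk A"
  by (rule inj_on_inverseI[where g = elts]) (simp add: elts_blk)

lemma finite_partition: "fin_obj S \<Longrightarrow> partition_on S \<pi> \<Longrightarrow> finite \<pi>"
  using finite_elements by (auto simp: fin_obj_def)

lemma fin_obj_block: "\<lbrakk>fin_obj S; partition_on S \<pi>; T \<in> \<pi>\<rbrakk> \<Longrightarrow> fin_obj T"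
  unfolding fin_obj_def by (metis Union_upper finite_subset partition_onD1 partition_onD3)

lemma fin_obj_partition: "\<lbrakk>fin_obj S; partition_on S \<pi>\<rbrakk> \<Longrightarrow> fin_obj (blk ` \<pi>)"
  using finite_partition[of S \<pi>] partition_onD1[of S \<pi>] by (auto simp: fin_obj_def)

lemma Field_partition_poset: "\<alpha> \<in> Field (partition_poset S) \<longleftrightarrow> partition_on S \<alpha>"
  by (auto simp: Field_def partition_poset_def refines_def)

lemma partition_single_iff: "partition_on S \<alpha> \<Longrightarrow> S \<in> \<alpha> \<Longrightarrow> \<alpha> = {S}"
  by (auto simp: partition_on_def disjoint_def) (metis Int_absorb2 Union_upper)+

lemma min_partition_poset:
  assumes "fin_obj S" shows "min_elems (partition_poset S) = {{S}}"
proof -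
  have p: "partition_on S {S}" using assms by (auto simp: fin_obj_def partition_on_space)
  have 1: "\<alpha> = {S}" if "(\<alpha>, {S}) \<in> partition_poset S" for \<alpha>
  proof -
    have "partition_on S \<alpha>" "\<exists>Y\<in>\<alpha>. S \<subseteq> Y" using that by (auto simp: partition_poset_def refines_def)
    then show ?thesis using partition_single_iff by (metis Union_upper partition_onD1 subset_antisym)
  qed
  show ?thesis
  proof (intro equalityI subsetI)
    fix \<alpha> assume m: "\<alpha> \<in> min_elems (partition_poset S)"
    have \<alpha>: "partition_on S \<alpha>" using min_elems_Field[OF m] by (simp add: Field_partition_poset)
    have "\<forall>T\<in>\<alpha>. T \<subseteq> S" using partition_onD1[OF \<alpha>] by blast
    then have "({S}, \<alpha>) \<in> partition_poset S" using p \<alpha> by (simp add: partition_poset_def refines_def)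
    then show "\<alpha> \<in> {{S}}" using min_elemsD[OF m] by blast
  next
    fix \<alpha> :: "'a set set" assume "\<alpha> \<in> {{S}}"
    then show "\<alpha> \<in> min_elems (partition_poset S)"
      unfolding min_elems_def Field_partition_poset using p 1 by blast
  qed
qed

lemma max_partition_posetD:
  assumes "\<alpha> \<in> max_elems (partition_poset S)" shows "\<alpha> = (\<lambda>s. {s}) ` S"
proof -
  have \<alpha>: "partition_on S \<alpha>" using assms by (auto simp: max_elems_def Field_partition_poset)
  have "partition_on S ((\<lambda>s. {s}) ` S)" by (auto simp: partition_on_def disjoint_def)
  moreover have "\<exists>T\<in>\<alpha>. s \<in> T" if "s \<in> S" for s using that partition_onD1[OF \<alpha>] by blast
  ultimately have "(\<alpha>, (\<lambda>s. {s}) ` S) \<in> partition_poset S"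
    using \<alpha> by (simp add: partition_poset_def refines_def)
  then show ?thesis by (rule max_elemsD[OF assms])
qed

lemma restr_self: "partition_on S \<pi> \<Longrightarrow> T \<in> \<pi> \<Longrightarrow> restr \<pi> T = {T}"
  unfolding restr_def partition_on_def disjoint_def by (auto; metis Int_absorb2)

lemma cocycle_supported: "cocycle r n f \<Longrightarrow> supported r (Suc n) f"
  by (simp add: cocycle_def)

locale normalised_species = operadic_poset_species P pmap a phi psi
  for P :: "'a hfs set \<Rightarrow> 'p rel"
    and pmap :: "'a hfs set \<Rightarrow> ('a hfs \<Rightarrow> 'a hfs) \<Rightarrow> 'p \<Rightarrow> 'p"
    and a :: "'a hfs set \<Rightarrow> 'p \<Rightarrow> 'a hfs set set"
    and phi :: "'a hfs set \<Rightarrow> 'p \<Rightarrow> 'p \<Rightarrow> 'p"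
    and psi :: "'a hfs set \<Rightarrow> 'p \<Rightarrow> 'p \<Rightarrow> ('a hfs set \<Rightarrow> 'p)" +
  assumes pb: "pullbacks_defined P a phi psi"
    and un: "unit_normalised P pmap phi psi"
begin

section \<open>Fibres of the map to partitions and the two factors of a composition\<close>

lemma a_refines: "fin_obj S \<Longrightarrow> (x, y) \<in> P S \<Longrightarrow> refines S (a S y) (a S x)"
  using a_hom by (fastforce simp: poset_hom_def partition_poset_def)

lemma a_partition: "fin_obj S \<Longrightarrow> x \<in> Field (P S) \<Longrightarrow> partition_on S (a S x)"
  using a_refines[of S x x] fp_refl[OF P_poset] by (auto simp: refines_def)

lemma adm_phi:
  "\<lbrakk>fin_obj S; x \<in> Field (P S)\<rbrakk> \<Longrightarrow> pullback_admissible (down_rel (P S) x) (P (blk ` a S x)) (phi S x)"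
  using pb by (auto simp: pullbacks_defined_def)

lemma adm_psi:
  "\<lbrakk>fin_obj S; x \<in> Field (P S)\<rbrakk> \<Longrightarrow> pullback_admissible (up_rel (P S) x) (prod_family P (a S x)) (psi S x)"
  using pb by (auto simp: pullbacks_defined_def)

lemma block_poset: "\<lbrakk>fin_obj S; partition_on S \<pi>; T \<in> \<pi>\<rbrakk> \<Longrightarrow> finite_poset (P T)"
  by (rule P_poset[OF fin_obj_block])

lemma finite_poset_family:
  assumes "fin_obj S" "partition_on S \<pi>"
  shows "finite_poset (prod_family P \<pi>)"
  using finite_partition[OF assms] block_poset[OF assms] by (rule finite_poset_prod_family)

lemma min_family:
  assumes "fin_obj S" "partition_on S \<pi>"
  shows "g \<in> min_elems (prod_family P \<pi>) \<longleftrightarrow> g \<in> (\<Pi>\<^sub>E T\<in>\<pi>. Field (P T)) \<and> (\<forall>T\<in>\<pi>. g T \<in> min_elems (P T))"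
  using finite_partition[OF assms] block_poset[OF assms] by (rule min_elems_prod_family)

lemma max_family:
  assumes "fin_obj S" "partition_on S \<pi>"
  shows "g \<in> max_elems (prod_family P \<pi>) \<longleftrightarrow> g \<in> (\<Pi>\<^sub>E T\<in>\<pi>. Field (P T)) \<and> (\<forall>T\<in>\<pi>. g T \<in> max_elems (P T))"
  using finite_partition[OF assms] block_poset[OF assms] by (rule max_elems_prod_family)

lemma Field_family:
  assumes "fin_obj S" "partition_on S \<pi>"
  shows "Field (prod_family P \<pi>) = (\<Pi>\<^sub>E T\<in>\<pi>. Field (P T))"
  using finite_partition[OF assms] block_poset[OF assms] by (rule Field_prod_family)

lemma psi_family: "\<lbrakk>fin_obj S; (x, y) \<in> P S\<rbrakk> \<Longrightarrow> psi S x y \<in> (\<Pi>\<^sub>E T\<in>a S x. Field (P T))"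
proof -
  assume S: "fin_obj S" and xy: "(x, y) \<in> P S"
  then have F: "x \<in> Field (P S)" "y \<in> Field (P S)" by (auto intro: FieldI1 FieldI2)
  have "(y, y) \<in> up_rel (P S) x" using xy fp_refl[OF P_poset[OF S] F(2)] by (simp add: up_rel_iff)
  then have "(psi S x y, psi S x y) \<in> prod_family P (a S x)"
    using psi_hom[OF S F(1)] by (auto simp: poset_hom_def)
  then show ?thesis by (simp add: prod_family_iff)
qed

text \<open>
  If \<open>y \<ge> x\<close> lies in the same fibre of \<open>a\<close>, then \<open>\<psi>\<^sub>x y\<close> is minimal, hence so is \<open>y\<close> in \<open>P\<^sub>\<ge>\<^sub>x\<close>, as
  \<open>\<psi>\<^sub>x\<close> admits a pullback.
\<close>

lemma a_inj_on_chains: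
  assumes S: "fin_obj S" and xy: "(x, y) \<in> P S" and eq: "a S x = a S y"
  shows "x = y"
proof -
  have F: "x \<in> Field (P S)" "y \<in> Field (P S)" using xy by (auto intro: FieldI1 FieldI2)
  note part = a_partition[OF S F(1)]
  have "psi S x y T \<in> min_elems (P T)" if T: "T \<in> a S x" for T
  proof -
    have fT: "fin_obj T" by (rule fin_obj_block[OF S part T])
    have "a T (psi S x y T) = restr (a S y) T"
      using fun_cong[OF a_psi[OF S xy], of T] T by (simp add: psi_part_def)
    then have "a T (psi S x y T) \<in> min_elems (partition_poset T)"
      using restr_self[OF part T] eq min_partition_poset[OF fT] by simp
    moreover have "psi S x y T \<in> Field (P T)" using psi_family[OF S xy] T by (rule PiE_mem)
    ultimately show ?thesis using a_min[OF fT] by blast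
  qed
  then have "psi S x y \<in> min_elems (prod_family P (a S x))"
    using psi_family[OF S xy] min_family[OF S part] by blast
  then have "y \<in> min_elems (up_rel (P S) x)"
    using adm_psi[OF S F(1)] xy Field_up_rel[OF P_poset[OF S] F(1)] by (auto simp: pullback_admissible_def)
  then show ?thesis using min_elems_up_rel[OF P_poset[OF S] F(1)] by simp
qed

text \<open>The element \<open>x\<close> at which a chain is cut is not a parameter: it is read off
  as the last entry of the lower part (for \<open>rear\<close>, the first entry of the upper part).
  In this way the sum over the fibre of \<open>a\<close> is absorbed into a single cup
  product.\<close>

definition front :: "'a hfs set \<Rightarrow> 'a hfs set set \<Rightarrow> ('p list \<Rightarrow> 'k) \<Rightarrow> 'p list \<Rightarrow> 'k::{comm_ring,comm_monoid_mult}" where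
  "front S \<pi> p ws = (if a S (last ws) = \<pi> then p (map (phi S (last ws)) ws) else 0)"

definition rear :: "'a hfs set \<Rightarrow> 'a hfs set set \<Rightarrow> (('a hfs set \<Rightarrow> 'p) list \<Rightarrow> 'k) \<Rightarrow> 'p list
    \<Rightarrow> 'k::{comm_ring,comm_monoid_mult}" where
  "rear S \<pi> g ws = (if a S (hd ws) = \<pi> then g (map (psi S (hd ws)) ws) else 0)"

lemma front_nz:
  assumes S: "fin_obj S" and p: "cocycle (P (blk ` \<pi>)) m p"
    and ws: "wchain (P S) ws" "length ws = Suc m" "front S \<pi> p ws \<noteq> 0"
  shows "a S (last ws) = \<pi>" "distinct ws" "hd ws \<in> min_elems (P S)"
proof -
  let ?v = "last ws"
  show \<pi>: "a S ?v = \<pi>" using ws(3) by (auto simp: front_def split: if_splits)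
  have ne: "ws \<noteq> []" using ws(2) by auto
  then have v: "?v \<in> Field (P S)" using ws(1) by (auto simp: wchain_def)
  note r = P_poset[OF S] and d = finite_poset_down_rel[OF P_poset[OF S] v]
  have "supported (down_rel (P S) ?v) (Suc m) (\<lambda>ws. p (map (phi S ?v) ws))"
    using supported_pullback[OF d adm_phi[OF S v, unfolded \<pi>] cocycle_supported[OF p]] .
  moreover have "wchain (down_rel (P S) ?v) ws"
    using ws(1) wchain_last[OF r ws(1)] by (simp add: wchain_down_rel[OF r v])
  moreover have "p (map (phi S ?v) ws) \<noteq> 0" using ws(3) by (auto simp: front_def split: if_splits)
  ultimately have "ws \<in> end_chains (down_rel (P S) ?v)" using ws(2) by (simp add: supported_def)
  then show "distinct ws" "hd ws \<in> min_elems (P S)"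
    using min_elems_down_rel[OF r v] by (auto simp: end_chains_iff)
qed

lemma rear_nz:
  assumes S: "fin_obj S" and g: "cocycle (prod_family P \<pi>) m g"
    and ws: "wchain (P S) ws" "length ws = Suc m" "rear S \<pi> g ws \<noteq> 0"
  shows "a S (hd ws) = \<pi>" "distinct ws" "last ws \<in> max_elems (P S)"
proof -
  let ?v = "hd ws"
  show \<pi>: "a S ?v = \<pi>" using ws(3) by (auto simp: rear_def split: if_splits)
  have ne: "ws \<noteq> []" using ws(2) by auto
  then have v: "?v \<in> Field (P S)" using ws(1) by (auto simp: wchain_def)
  note r = P_poset[OF S] and d = finite_poset_up_rel[OF P_poset[OF S] v]
  have "supported (up_rel (P S) ?v) (Suc m) (\<lambda>ws. g (map (psi S ?v) ws))"
    using supported_pullback[OF d adm_psi[OF S v, unfolded \<pi>] cocycle_supported[OF g]] .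
  moreover have "wchain (up_rel (P S) ?v) ws"
    using ws(1) wchain_hd[OF r ws(1)] by (simp add: wchain_up_rel[OF r v])
  moreover have "g (map (psi S ?v) ws) \<noteq> 0" using ws(3) by (auto simp: rear_def split: if_splits)
  ultimately have "ws \<in> end_chains (up_rel (P S) ?v)" using ws(2) by (simp add: supported_def)
  then show "distinct ws" "last ws \<in> max_elems (P S)"
    using max_elems_up_rel[OF r v] by (auto simp: end_chains_iff)
qed

text \<open>Deleting the last entry changes the element at which \<open>phi\<close> is taken. If the
  list ends at \<open>v\<close>, a face not ending at \<open>v\<close> counts on neither side: it
  does not end in the fibre, which the chain meets only at \<open>v\<close>, and \<open>p\<close>
  after \<open>phi S v\<close> is supported on lists ending at \<open>v\<close>. If the list ends
  strictly below \<open>v\<close>, no face ends in the fibre and every term is zero.\<close>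

lemma bd_front:
  fixes p :: "'p list \<Rightarrow> 'k::{comm_ring,comm_monoid_mult}"
  assumes S: "fin_obj S" and p: "cocycle (P (blk ` \<pi>)) m p"
    and ws: "wchain (P S) ws" "length ws = m + 2" "(last ws, v) \<in> P S" "a S v = \<pi>"
  shows "bd (front S \<pi> p) ws = 0"
proof (cases "last ws = v")
  case False
  note r = P_poset[OF S]
  have "front S \<pi> p (omit k ws) = 0" if k: "k < length ws" for k
  proof (rule ccontr)
    assume n: "front S \<pi> p (omit k ws) \<noteq> 0"
    have l: "length (omit k ws) = Suc m" using k ws(2) by (simp add: length_omit)
    note f = front_nz[OF S p wchain_omit[OF r ws(1)] l n]
    have "omit k ws \<noteq> []" using l by auto
    then have "last (omit k ws) \<in> set (omit k ws)" by simp
    then have m: "last (omit k ws) \<in> set ws" by (auto simp: omit_def dest: in_set_takeD in_set_dropD)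
    have le: "(last (omit k ws), last ws) \<in> P S" by (rule wchain_last[OF r ws(1) m])
    then have "last (omit k ws) = v" using a_inj_on_chains[OF S fp_trans[OF r le ws(3)]] f(1) ws(4) by simp
    then have "last ws = v" using le ws(3) fp_antisym[OF r] by metis
    then show False using False by simp
  qed
  then show ?thesis by (rule bd_zero)
next
  case True
  note r = P_poset[OF S]
  have v: "v \<in> Field (P S)" using ws(3) by (rule FieldI2)
  note d = finite_poset_down_rel[OF r v]
  let ?f = "\<lambda>ws. p (map (phi S v) ws)"
  have cocycle: "cocycle (down_rel (P S) v) m ?f" using cocycle_pullback[OF d adm_phi[OF S v]] p ws(4) by simp
  have w: "wchain (down_rel (P S) v) ws"
    using ws(1) wchain_last[OF r ws(1)] True by (auto simp: wchain_down_rel[OF r v])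
  have "front S \<pi> p (omit k ws) = ?f (omit k ws)" if k: "k < length ws" for k
  proof (cases "last (omit k ws) = v")
    case True
    then show ?thesis using ws(4) by (simp add: front_def)
  next
    case False
    have l: "length (omit k ws) = Suc m" using k ws(2) by (simp add: length_omit)
    have "omit k ws \<notin> end_chains (down_rel (P S) v)"
      using False max_elems_down_rel[OF r v] by (auto simp: end_chains_iff)
    then have "?f (omit k ws) = 0" using cocycle wchain_omit[OF d w] l by (auto simp: cocycle_def supported_def)
    moreover have "a S (last (omit k ws)) \<noteq> \<pi>"
    proof
      assume e: "a S (last (omit k ws)) = \<pi>"
      have "omit k ws \<noteq> []" using l by auto
      then have "last (omit k ws) \<in> set (omit k ws)" by simp
      then have m: "last (omit k ws) \<in> set ws" by (auto simp: omit_def dest: in_set_takeD in_set_dropD)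
      have "(last (omit k ws), v) \<in> P S" using wchain_last[OF r ws(1) m] \<open>last ws = v\<close> by simp
      then show False using a_inj_on_chains[OF S] e ws(4) False by metis
    qed
    ultimately show ?thesis by (simp add: front_def)
  qed
  then have "bd (front S \<pi> p) ws = bd ?f ws" by (rule bd_cong)
  also have "\<dots> = 0" using cocycle w ws(2) by (simp add: cocycle_def)
  finally show ?thesis .
qed

text \<open>Dual to \<open>bd_front\<close>, with the first entry above an element \<open>v\<close>
  of the fibre.\<close>

lemma bd_rear:
  fixes g :: "('a hfs set \<Rightarrow> 'p) list \<Rightarrow> 'k::{comm_ring,comm_monoid_mult}"
  assumes S: "fin_obj S" and g: "cocycle (prod_family P \<pi>) m g" and \<pi>: "partition_on S \<pi>"
    and ws: "wchain (P S) ws" "length ws = m + 2" "(v, hd ws) \<in> P S" "a S v = \<pi>"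
  shows "bd (rear S \<pi> g) ws = 0"
proof (cases "hd ws = v")
  case False
  note r = P_poset[OF S]
  have "rear S \<pi> g (omit k ws) = 0" if k: "k < length ws" for k
  proof (rule ccontr)
    assume n: "rear S \<pi> g (omit k ws) \<noteq> 0"
    have l: "length (omit k ws) = Suc m" using k ws(2) by (simp add: length_omit)
    note f = rear_nz[OF S g wchain_omit[OF r ws(1)] l n]
    have "omit k ws \<noteq> []" using l by auto
    then have "hd (omit k ws) \<in> set (omit k ws)" by simp
    then have m: "hd (omit k ws) \<in> set ws" by (auto simp: omit_def dest: in_set_takeD in_set_dropD)
    have le: "(hd ws, hd (omit k ws)) \<in> P S" by (rule wchain_hd[OF r ws(1) m])
    then have "hd (omit k ws) = v" using a_inj_on_chains[OF S fp_trans[OF r ws(3) le]] f(1) ws(4) by simp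
    then have "hd ws = v" using le ws(3) fp_antisym[OF r] by metis
    then show False using False by simp
  qed
  then show ?thesis by (rule bd_zero)
next
  case True
  note r = P_poset[OF S]
  have v: "v \<in> Field (P S)" using ws(3) by (rule FieldI1)
  note d = finite_poset_up_rel[OF r v]
  let ?f = "\<lambda>ws. g (map (psi S v) ws)"
  have cocycle: "cocycle (up_rel (P S) v) m ?f" using cocycle_pullback[OF d adm_psi[OF S v]] g ws(4) by simp
  have w: "wchain (up_rel (P S) v) ws"
    using ws(1) wchain_hd[OF r ws(1)] True by (auto simp: wchain_up_rel[OF r v])
  have "rear S \<pi> g (omit k ws) = ?f (omit k ws)" if k: "k < length ws" for k
  proof (cases "hd (omit k ws) = v")
    case True
    then show ?thesis using ws(4) by (simp add: rear_def)
  next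
    case False
    have l: "length (omit k ws) = Suc m" using k ws(2) by (simp add: length_omit)
    have "omit k ws \<notin> end_chains (up_rel (P S) v)"
      using False min_elems_up_rel[OF r v] by (auto simp: end_chains_iff)
    then have "?f (omit k ws) = 0" using cocycle wchain_omit[OF d w] l by (auto simp: cocycle_def supported_def)
    moreover have "a S (hd (omit k ws)) \<noteq> \<pi>"
    proof
      assume e: "a S (hd (omit k ws)) = \<pi>"
      have "omit k ws \<noteq> []" using l by auto
      then have "hd (omit k ws) \<in> set (omit k ws)" by simp
      then have m: "hd (omit k ws) \<in> set ws" by (auto simp: omit_def dest: in_set_takeD in_set_dropD)
      have "(v, hd (omit k ws)) \<in> P S" using wchain_hd[OF r ws(1) m] \<open>hd ws = v\<close> by simp
      then show False using a_inj_on_chains[OF S] e ws(4) False by metis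
    qed
    ultimately show ?thesis by (simp add: rear_def)
  qed
  then have "bd (rear S \<pi> g) ws = bd ?f ws" by (rule bd_cong)
  also have "\<dots> = 0" using cocycle w ws(2) by (simp add: cocycle_def)
  finally show ?thesis .
qed

definition rhof where
  "rhof S m \<pi> p g = cup m (front S \<pi> p) (rear S \<pi> g)"

lemma cocycle_rhof:
  assumes S: "fin_obj S" and \<pi>: "partition_on S \<pi>" and p: "cocycle (P (blk ` \<pi>)) m p" and g: "cocycle (prod_family P \<pi>) n g"
  shows "cocycle (P S) (m + n) (rhof S m \<pi> p g)"
  unfolding rhof_def
\<comment> \<open>The admissible cut points are the elements of the fibre over \<pi>, where
  \<open>bd_front\<close> and \<open>bd_rear\<close> apply.\<close>
proof (rule cocycle_cup(2)[OF P_poset[OF S], where Y = "{x \<in> Field (P S). a S x = \<pi>}"])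
  have F: "hd ws \<in> Field (P S)" "last ws \<in> Field (P S)" if "wchain (P S) ws" "ws \<noteq> []" for ws
    using that by (auto simp: wchain_def)
  fix ws assume ws: "wchain (P S) ws"
  show "distinct ws \<and> hd ws \<in> min_elems (P S) \<and> last ws \<in> {x \<in> Field (P S). a S x = \<pi>}"
    if "length ws = Suc m" "front S \<pi> p ws \<noteq> 0"
  proof -
    have "ws \<noteq> []" using that by auto
    then show ?thesis using F[OF ws] front_nz[OF S p ws that] by simp
  qed
  show "distinct ws \<and> hd ws \<in> {x \<in> Field (P S). a S x = \<pi>} \<and> last ws \<in> max_elems (P S)"
    if "length ws = Suc n" "rear S \<pi> g ws \<noteq> 0"
  proof -
    have "ws \<noteq> []" using that by auto
    then show ?thesis using F[OF ws] rear_nz[OF S g ws that] by simp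
  qed
  show "bd (front S \<pi> p) ws = 0" if "length ws = m + 2" "last ws \<in> {x \<in> Field (P S). a S x = \<pi>}"
    using that fp_refl[OF P_poset[OF S]] by (intro bd_front[OF S p ws that(1), of "last ws"]) auto
  show "bd (rear S \<pi> g) ws = 0" if "length ws = n + 2" "hd ws \<in> {x \<in> Field (P S). a S x = \<pi>}"
    using that fp_refl[OF P_poset[OF S]] by (intro bd_rear[OF S g \<pi> ws that(1), of "hd ws"]) auto
qed

lemma rho_cls:
  fixes p :: "'p list \<Rightarrow> 'k::{comm_ring,comm_monoid_mult}"
  assumes S: "fin_obj S" and \<pi>: "partition_on S \<pi>" and p: "cocycle (P (blk ` \<pi>)) m p" and g: "cocycle (prod_family P \<pi>) (deg zs) g"
    and zs: "kunneth P zs = cls (prod_family P \<pi>) (deg zs) g" "set (map fst zs) = \<pi>"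
  shows "coh_rho P a phi psi S m (cls (P (blk ` \<pi>)) m p) zs = cls (P S) (m + deg zs) (rhof S m \<pi> p g)"
proof -
  let ?n = "deg zs" and ?A = "{x \<in> Field (P S). a S x = \<pi>}"
  note r = P_poset[OF S]
  let ?b = "\<lambda>x. cup m (\<lambda>ws. if last ws = x then p (map (phi S x) ws) else 0)
      (\<lambda>ws. if hd ws = x then g (map (psi S x) ws) else 0)"
  have b: "concat_mor (P S) m ?n (pullback (down_rel (P S) x) (phi S x) m (cls (P (blk ` \<pi>)) m p))
      (pullback (up_rel (P S) x) (psi S x) ?n (kunneth P zs)) = cls (P S) (m + ?n) (?b x) \<and> cocycle (P S) (m + ?n) (?b x)"
    if x: "x \<in> ?A" for x
  proof -
    have x': "x \<in> Field (P S)" "a S x = \<pi>" using x by auto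
    note d = finite_poset_down_rel[OF r x'(1)] and u = finite_poset_up_rel[OF r x'(1)]
    note ap = adm_phi[OF S x'(1), unfolded x'(2)] and aq = adm_psi[OF S x'(1), unfolded x'(2)]
    have P\<pi>: "finite_poset (P (blk ` \<pi>))" by (rule P_poset[OF fin_obj_partition[OF S \<pi>]])
    show ?thesis
      unfolding zs(1) pullback_cls[OF d P\<pi> ap p] pullback_cls[OF u finite_poset_family[OF S \<pi>] aq g]
      using concat_cls[OF r x'(1) cocycle_pullback[OF d ap p] cocycle_pullback[OF u aq g]] by simp
  qed
  have fin: "finite ?A" by (rule finite_subset[OF _ fp_finite[OF r]]) auto
  interpret M: module coeff_ring "cohom (P S) (m + ?n) :: ('k, ('p list \<Rightarrow>\<^sub>0 'k) set) module" by (rule cohom_module[OF r])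
  have "coh_rho P a phi psi S m (cls (P (blk ` \<pi>)) m p) zs = finsum (cohom (P S) (m + ?n)) (\<lambda>x. cls (P S) (m + ?n) (?b x)) ?A"
    unfolding coh_rho_def zs(2) using b
    by (intro M.finsum_cong') (auto simp: cls_carrier[OF r])
  also have "\<dots> = cls (P S) (m + ?n) (\<lambda>ws. \<Sum>x\<in>?A. ?b x ws)"
    using b by (intro finsum_cls[OF r fin]) auto
  also have "\<dots> = cls (P S) (m + ?n) (rhof S m \<pi> p g)"
  proof (rule cls_cong[OF r])
    fix ws assume ws: "ws \<in> end_chains (P S)" "length ws = Suc (m + ?n)"
    let ?z = "ws ! m"
    have z: "?z \<in> Field (P S)" using ws by (auto simp: end_chains_iff wchain_def)
    have e: "last (take (Suc m) ws) = ?z" "hd (drop m ws) = ?z"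
      using ws(2) last_slice[of 0 m ws] by (auto simp: hd_drop_conv_nth)
    \<comment> \<open>The degrees fix the cut position \<open>m\<close>, so only the summand with
      \<open>x = ws ! m\<close> can be nonzero.\<close>
    have "(\<Sum>x\<in>?A. ?b x ws) = (\<Sum>x\<in>?A. if ?z = x then p (map (phi S x) (take (Suc m) ws)) * g (map (psi S x) (drop m ws)) else 0)"
      by (intro sum.cong) (auto simp: cup_def e)
    also have "\<dots> = (if ?z \<in> ?A then p (map (phi S ?z) (take (Suc m) ws)) * g (map (psi S ?z) (drop m ws)) else 0)"
      by (rule sum.delta'[OF fin])
    also have "\<dots> = rhof S m \<pi> p g ws" using z by (simp add: rhof_def cup_def front_def rear_def e)
    finally show "(\<Sum>x\<in>?A. ?b x ws) = rhof S m \<pi> p g ws" .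
  qed
  finally show ?thesis .
qed

end

section \<open>Linearity and the action of bijections\<close>

lemma mod_hom_clsI:
  fixes G :: "('p list \<Rightarrow> 'k) \<Rightarrow> 'q list \<Rightarrow> 'k::{comm_ring,comm_monoid_mult}"
  assumes r: "finite_poset r" and s: "finite_poset s"
    and F: "\<And>f. cocycle r n f \<Longrightarrow> F (cls r n f) = cls s m (G f) \<and> cocycle s m (G f)"
    and add: "\<And>f g ws. G (\<lambda>x. f x + g x) ws = G f ws + G g ws"
    and scale: "\<And>f k ws. G (\<lambda>x. k * f x) ws = k * G f ws"
  shows "F \<in> mod_hom (cohom r n) (cohom s m)"
  unfolding mod_hom_def
proof (intro CollectI conjI funcsetI ballI allI)
  have add': "G (\<lambda>x. f x + g x) = (\<lambda>ws. G f ws + G g ws)" and scale': "G (\<lambda>x. k * f x) = (\<lambda>ws. k * G f ws)"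
    for f g k by (simp_all add: fun_eq_iff add scale)
  fix X :: "('p list \<Rightarrow>\<^sub>0 'k) set" assume "X \<in> carrier (cohom r n)"
  then obtain f where f: "cocycle r n f" "X = cls r n f" using carrier_cohom_iff[OF r] by blast
  show "F X \<in> carrier (cohom s m)" using F[OF f(1)] f(2) cls_carrier[OF s, of m "G f"] by simp
  show "F (k \<odot>\<^bsub>cohom r n\<^esub> X) = k \<odot>\<^bsub>cohom s m\<^esub> F X" for k
    using F[OF f(1)] F[OF cocycle_scale[OF f(1), of k]] by (simp add: f(2) cls_smult[OF r] cls_smult[OF s] scale')
  fix Y :: "('p list \<Rightarrow>\<^sub>0 'k) set" assume "Y \<in> carrier (cohom r n)"
  then obtain g where g: "cocycle r n g" "Y = cls r n g" using carrier_cohom_iff[OF r] by blast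
  show "F (X \<oplus>\<^bsub>cohom r n\<^esub> Y) = F X \<oplus>\<^bsub>cohom s m\<^esub> F Y"
    using F[OF f(1)] F[OF g(1)] F[OF cocycle_add[OF f(1) g(1)]] by (simp add: f(2) g(2) cls_add[OF r] cls_add[OF s] add')
qed

context normalised_species
begin

lemma inv_into_image:
  assumes "inj_on f S"
  shows "inj_on (inv_into S f) (f ` S)" "inv_into S f ` f ` S = S"
  using assms by (auto simp: inj_on_inv_into image_comp intro!: image_eqI)

lemma fin_obj_image: "fin_obj S \<Longrightarrow> fin_obj (f ` S)"
  by (simp add: fin_obj_def)

lemma pmap_Field: "\<lbrakk>fin_obj S; inj_on f S; x \<in> Field (P S)\<rbrakk> \<Longrightarrow> pmap S f x \<in> Field (P (f ` S))"
  using pmap_hom[of S f] fp_refl[OF P_poset] by (fastforce simp: poset_hom_def intro: FieldI1)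

lemma pmap_inv_left:
  assumes "fin_obj S" "inj_on f S" "x \<in> Field (P S)"
  shows "pmap (f ` S) (inv_into S f) (pmap S f x) = x"
proof -
  have "pmap (f ` S) (inv_into S f) (pmap S f x) = pmap S (inv_into S f \<circ> f) x"
    using assms inv_into_image by (intro pmap_comp[symmetric]) auto
  also have "\<dots> = pmap S (\<lambda>s. s) x"
    using assms inv_into_image(1)[of f S] by (intro pmap_cong comp_inj_on) auto
  finally show ?thesis using assms pmap_id by simp
qed

lemma pmap_inv_Field:
  assumes "fin_obj S" "inj_on f S" "x \<in> Field (P (f ` S))"
  shows "pmap (f ` S) (inv_into S f) x \<in> Field (P S)"
  using pmap_Field[OF fin_obj_image[OF assms(1)] inv_into_image(1)[OF assms(2)] assms(3)]
  by (simp add: inv_into_image(2)[OF assms(2)])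

lemma pmap_inv_right:
  assumes "fin_obj S" "inj_on f S" "x \<in> Field (P (f ` S))"
  shows "pmap S f (pmap (f ` S) (inv_into S f) x) = x"
proof -
  note i = inv_into_image[OF assms(2)]
  have "pmap S f (pmap (f ` S) (inv_into S f) x) = pmap (f ` S) (f \<circ> inv_into S f) x"
    using pmap_comp[OF fin_obj_image[OF assms(1)] i(1), of f x] assms i by simp
  also have "\<dots> = pmap (f ` S) (\<lambda>s. s) x"
    using assms i by (intro pmap_cong fin_obj_image comp_inj_on) (auto simp: f_inv_into_f)
  finally show ?thesis using assms pmap_id[OF fin_obj_image] by simp
qed

text \<open>A monotone injection reflects extremal elements, and the induced map is injective
  because relabelling back undoes it.\<close>

lemma pullback_admissible_pmap:
  assumes S: "fin_obj S" and f: "inj_on f S"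
  shows "pullback_admissible (P (f ` S)) (P S) (pmap (f ` S) (inv_into S f))"
    (is "pullback_admissible _ _ ?h")
  unfolding pullback_admissible_def
proof (intro conjI subsetI)
  show hom: "poset_hom (P (f ` S)) (P S) ?h"
    using pmap_hom[OF fin_obj_image[OF S] inv_into_image(1)[OF f]] by (simp add: inv_into_image(2)[OF f])
  have inj: "x = y" if "x \<in> Field (P (f ` S))" "y \<in> Field (P (f ` S))" "?h x = ?h y" for x y
    using that pmap_inv_right[OF S f] by metis
  fix x
  show "x \<in> min_elems (P (f ` S))" if "x \<in> {x \<in> Field (P (f ` S)). ?h x \<in> min_elems (P S)}"
  proof -
    have x: "x \<in> Field (P (f ` S))" "?h x \<in> min_elems (P S)" using that by auto
    have "y = x" if y: "(y, x) \<in> P (f ` S)" for y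
    proof -
      have "(?h y, ?h x) \<in> P S" using hom y by (auto simp: poset_hom_def)
      then show ?thesis using min_elemsD[OF x(2)] inj FieldI1[OF y] x(1) by metis
    qed
    then show ?thesis using x(1) by (simp add: min_elems_def)
  qed
  show "x \<in> max_elems (P (f ` S))" if "x \<in> {x \<in> Field (P (f ` S)). ?h x \<in> max_elems (P S)}"
  proof -
    have x: "x \<in> Field (P (f ` S))" "?h x \<in> max_elems (P S)" using that by auto
    have "y = x" if y: "(x, y) \<in> P (f ` S)" for y
    proof -
      have "(?h x, ?h y) \<in> P S" using hom y by (auto simp: poset_hom_def)
      then show ?thesis using max_elemsD[OF x(2)] inj FieldI2[OF y] x(1) by metis
    qed
    then show ?thesis using x(1) by (simp add: max_elems_def)
  qed
qed

definition tr :: "'a hfs set \<Rightarrow> ('a hfs \<Rightarrow> 'a hfs) \<Rightarrow> ('p list \<Rightarrow> 'k) \<Rightarrow> 'p list \<Rightarrow> 'k::{comm_ring,comm_monoid_mult}" where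
  "tr S f u ws = u (map (pmap (f ` S) (inv_into S f)) ws)"

lemma act_cls:
  assumes S: "fin_obj S" and f: "inj_on f S" and u: "cocycle (P S) n u"
  shows "coh_act P pmap S f n (cls (P S) n u) = cls (P (f ` S)) n (tr S f u)" "cocycle (P (f ` S)) n (tr S f u)"
  using pullback_cls[OF P_poset[OF fin_obj_image[OF S]] P_poset[OF S] pullback_admissible_pmap[OF S f] u]
    cocycle_pullback[OF P_poset[OF fin_obj_image[OF S]] pullback_admissible_pmap[OF S f] u]
  unfolding coh_act_def tr_def[abs_def] by auto

lemma chain_Field: "ws \<in> end_chains r \<Longrightarrow> x \<in> set ws \<Longrightarrow> x \<in> Field r"
  by (auto simp: end_chains_def)

context
  fixes S :: "'a hfs set" and f :: "'a hfs \<Rightarrow> 'a hfs" and n :: nat and X :: "('p list \<Rightarrow>\<^sub>0 'k::{comm_ring,comm_monoid_mult}) set"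
  assumes S: "fin_obj S" and f: "inj_on f S" and X: "X \<in> carrier (coh_species P S n)"
begin

lemma act_rep: obtains u where "cocycle (P S) n u" "X = cls (P S) n u"
  using X carrier_cohom_iff[OF P_poset[OF S], of X n] by (auto simp: coh_species_def)

lemma act_ident: "coh_act P pmap S (\<lambda>s. s) n X = X"
proof -
  obtain u where u: "cocycle (P S) n u" "X = cls (P S) n u" by (rule act_rep)
  have "coh_act P pmap S (\<lambda>s. s) n X = cls (P S) n (tr S (\<lambda>s. s) u)"
    using act_cls(1)[OF S _ u(1), of "\<lambda>s. s"] u(2) by simp
  also have "\<dots> = X" unfolding u(2)
  proof (rule cls_cong[OF P_poset[OF S]])
    fix ws assume ws: "ws \<in> end_chains (P S)"
    have "pmap S (inv_into S (\<lambda>s. s)) x = x" if "x \<in> set ws" for x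
      using pmap_inv_left[OF S, of "\<lambda>s. s" x] pmap_id[OF S] chain_Field[OF ws that] by simp
    then show "tr S (\<lambda>s. s) u ws = u ws" by (simp add: tr_def map_idI)
  qed
  finally show ?thesis .
qed

lemma act_congr:
  assumes fg: "\<And>s. s \<in> S \<Longrightarrow> f s = g s"
  shows "coh_act P pmap S f n X = coh_act P pmap S g n X"
proof -
  obtain u where u: "cocycle (P S) n u" "X = cls (P S) n u" by (rule act_rep)
    have g: "inj_on g S" "g ` S = f ` S" using f fg by (auto simp: inj_on_def)
    have i: "inv_into S f s = inv_into S g s" if "s \<in> f ` S" for s
      using that f g fg by (metis f_inv_into_f inv_into_f_f inv_into_into)
    show ?thesis unfolding u(2) act_cls(1)[OF S f u(1)] act_cls(1)[OF S g(1) u(1)] g(2)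
    proof (rule cls_cong[OF P_poset[OF fin_obj_image[OF S]]])
      fix ws assume ws: "ws \<in> end_chains (P (f ` S))"
      have "pmap (f ` S) (inv_into S f) x = pmap (f ` S) (inv_into S g) x" if "x \<in> set ws" for x
        using i chain_Field[OF ws that] inv_into_image(1)[OF f] by (intro pmap_cong fin_obj_image S) auto
      then have e: "map (pmap (f ` S) (inv_into S f)) ws = map (pmap (f ` S) (inv_into S g)) ws" by simp
      show "tr S f u ws = tr S g u ws" unfolding tr_def g(2) e by (rule refl)
    qed
qed

lemma act_comp':
  assumes g: "inj_on g (f ` S)"
  shows "coh_act P pmap S (g \<circ> f) n X = coh_act P pmap (f ` S) g n (coh_act P pmap S f n X)"
proof -
  obtain u where u: "cocycle (P S) n u" "X = cls (P S) n u" by (rule act_rep)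
    note fS = fin_obj_image[OF S, of f] and gfS = fin_obj_image[OF fin_obj_image[OF S, of f], of g]
    have gf: "inj_on (g \<circ> f) S" using f g by (rule comp_inj_on)
    show ?thesis
      unfolding u(2) act_cls(1)[OF S f u(1)] act_cls(1)[OF S gf u(1)] act_cls(1)[OF fS g act_cls(2)[OF S f u(1)]] image_comp[symmetric]
    proof (rule cls_cong[OF P_poset[OF gfS]])
      fix ws assume ws: "ws \<in> end_chains (P (g ` f ` S))"
      have "pmap (g ` f ` S) (inv_into S (g \<circ> f)) x = pmap (f ` S) (inv_into S f) (pmap (g ` f ` S) (inv_into (f ` S) g) x)"
        if "x \<in> set ws" for x
      proof -
        note x = chain_Field[OF ws that]
        have "pmap (g ` f ` S) (inv_into S (g \<circ> f)) x = pmap (g ` f ` S) (inv_into S f \<circ> inv_into (f ` S) g) x"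
        proof (rule pmap_cong[OF gfS _ _ x])
          show "inj_on (inv_into S (g \<circ> f)) (g ` f ` S)" using inv_into_image(1)[OF gf] by (simp add: image_comp)
          fix s assume "s \<in> g ` f ` S"
          then obtain t where t: "t \<in> S" "s = g (f t)" by blast
          then show "inv_into S (g \<circ> f) s = (inv_into S f \<circ> inv_into (f ` S) g) s"
            using inv_into_f_f[OF gf t(1)] inv_into_f_f[OF g, of "f t"] inv_into_f_f[OF f t(1)] by simp
        qed
        also have "\<dots> = pmap (inv_into (f ` S) g ` g ` f ` S) (inv_into S f) (pmap (g ` f ` S) (inv_into (f ` S) g) x)"
          using inv_into_image[OF g] inv_into_image(1)[OF f] by (intro pmap_comp gfS x) auto
        finally show ?thesis by (simp add: inv_into_image(2)[OF g])
      qed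
      then have e: "map (pmap (g ` f ` S) (inv_into S (g \<circ> f))) ws =
        map (pmap (f ` S) (inv_into S f)) (map (pmap (g ` f ` S) (inv_into (f ` S) g)) ws)" by simp
      show "tr S (g \<circ> f) u ws = tr (f ` S) g (tr S f u) ws" unfolding tr_def image_comp[symmetric] e by (rule refl)
    qed
qed

end

lemma act_mod_hom:
  assumes S: "fin_obj S" and f: "inj_on f S"
  shows "coh_act P pmap S f n \<in> mod_hom (coh_species P S n)
    (coh_species P (f ` S) n :: ('k::{comm_ring,comm_monoid_mult}, ('p list \<Rightarrow>\<^sub>0 'k) set) module)"
    unfolding coh_species_def using act_cls[OF S f]
    by (intro mod_hom_clsI[OF P_poset[OF S] P_poset[OF fin_obj_image[OF S, of f]], where G = "tr S f"]) (auto simp: tr_def)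

lemma species:
  "graded_linear_species (coh_species P :: 'a hfs set \<Rightarrow> nat \<Rightarrow>
     ('k::{comm_ring,comm_monoid_mult}, ('p list \<Rightarrow>\<^sub>0 'k) set) module) (coh_act P pmap)"
proof (rule graded_linear_species.intro, goal_cases)
  case (1 S n)
  then show ?case unfolding coh_species_def by (intro cohom_module P_poset)
next
  case (2 S f n)
  then show ?case by (rule act_mod_hom)
next
  case (3 S f g X n)
  show ?case by (rule act_congr[OF 3(1,2,4,3)])
next
  case (4 S X n)
  show ?case by (rule act_ident[OF 4(1) inj_on_id2 4(2)])
next
  case (5 S f g X n)
  show ?case by (rule act_comp'[OF 5(1,2,4,3)])
qed

section \<open>Pure tensors of cocycles and multilinearity of the composition\<close>

definition tens :: "'a hfs set set \<Rightarrow> ('a hfs set \<times> nat \<times> ('p list \<Rightarrow> 'k::{comm_ring,comm_monoid_mult})) list \<Rightarrow> bool" where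
  "tens \<pi> ys \<longleftrightarrow> distinct (map fst ys) \<and> set (map fst ys) = \<pi> \<and> (\<forall>(T, d, y)\<in>set ys. cocycle (P T) d y)"

lemma to_cls_exists:
  fixes zs :: "('a hfs set \<times> nat \<times> ('p list \<Rightarrow>\<^sub>0 'k::{comm_ring,comm_monoid_mult}) set) list"
  assumes "\<forall>(T, d, y)\<in>set zs. fin_obj T \<and> y \<in> carrier (coh_species P T d)"
  shows "\<exists>ys. zs = to_cls P ys \<and> (\<forall>(T, d, y)\<in>set ys. cocycle (P T) d y)"
  using assms
proof (induction zs)
  case Nil
  then show ?case by (intro exI[of _ "[]"]) simp
next
  case (Cons z zs)
  obtain T d Y where z: "z = (T, d, Y)" by (cases z)
  then obtain y where "cocycle (P T) d y" "Y = cls (P T) d y"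
    using Cons.prems carrier_cohom_iff[OF P_poset, of T Y d] by (auto simp: coh_species_def)
  moreover obtain ys where "zs = to_cls P ys" "\<forall>(T, d, y)\<in>set ys. cocycle (P T) d y" using Cons by auto
  ultimately show ?case by (intro exI[of _ "(T, d, y) # ys"]) (simp add: z)
qed

lemma tensor_reps:
  fixes zs :: "('a hfs set \<times> nat \<times> ('p list \<Rightarrow>\<^sub>0 'k::{comm_ring,comm_monoid_mult}) set) list"
  assumes "fin_obj S" "partition_on S \<pi>" "is_tensor (coh_species P) \<pi> zs"
  obtains ys where "zs = to_cls P ys" "tens \<pi> ys"
proof -
  have "fin_obj T" if "(T, d, y) \<in> set zs" for T d y
    using fin_obj_block[OF assms(1,2)] assms(3) image_eqI[OF _ that, of T fst] by (auto simp: is_tensor_def)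
  then have "\<forall>(T, d, y)\<in>set zs. fin_obj T \<and> y \<in> carrier (coh_species P T d)"
    using assms(3) by (auto simp: is_tensor_def)
  then obtain ys where "zs = to_cls P ys" "\<forall>(T, d, y)\<in>set ys. cocycle (P T) d y" using to_cls_exists by blast
  then show ?thesis using assms(3) map_fst_to_cls[of P ys] by (intro that) (auto simp: tens_def is_tensor_def)
qed

lemma kunneth_tens:
  fixes ys :: "('a hfs set \<times> nat \<times> ('p list \<Rightarrow> 'k::{comm_ring,comm_monoid_mult})) list"
  assumes "fin_obj S" "partition_on S \<pi>" "tens \<pi> ys"
  shows "kunneth P (to_cls P ys) = cls (prod_family P \<pi>) (deg ys) (mcup (pieces ys))"
    "cocycle (prod_family P \<pi>) (deg ys) (mcup (pieces ys))"
proof -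
  have "finite_poset (P T) \<and> cocycle (P T) d y" if "(T, d, y) \<in> set ys" for T d y
    using block_poset[OF assms(1,2)] assms(3) that image_eqI[OF _ that, of T fst] by (auto simp: tens_def)
  then show "kunneth P (to_cls P ys) = cls (prod_family P \<pi>) (deg ys) (mcup (pieces ys))"
    "cocycle (prod_family P \<pi>) (deg ys) (mcup (pieces ys))"
    using kunneth_cls[of ys P] assms(3) unfolding tens_def by auto
qed

lemma rho_tens:
  fixes ys :: "('a hfs set \<times> nat \<times> ('p list \<Rightarrow> 'k::{comm_ring,comm_monoid_mult})) list"
  assumes S: "fin_obj S" and \<pi>: "partition_on S \<pi>" and p: "cocycle (P (blk ` \<pi>)) m p" and ys: "tens \<pi> ys"
  shows "coh_rho P a phi psi S m (cls (P (blk ` \<pi>)) m p) (to_cls P ys) =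
      cls (P S) (m + deg ys) (rhof S m \<pi> p (mcup (pieces ys)))"
    "cocycle (P S) (m + deg ys) (rhof S m \<pi> p (mcup (pieces ys)))"
  using rho_cls[OF S \<pi> p, of "to_cls P ys"] kunneth_tens[OF S \<pi> ys] cocycle_rhof[OF S \<pi> p] ys
  by (auto simp: deg_to_cls map_fst_to_cls tens_def simp flip: set_map)

lemma rhof_add_left: "rhof S m \<pi> (\<lambda>x. f x + g x) h ws = rhof S m \<pi> f h ws + rhof S m \<pi> g h ws"
  by (simp add: rhof_def cup_def front_def distrib_right)

lemma rhof_scale_left: "rhof S m \<pi> (\<lambda>x. k * f x) h ws = k * rhof S m \<pi> f h ws"
  by (simp add: rhof_def cup_def front_def mult.assoc)

lemma rhof_scale_right: "rhof S m \<pi> f (\<lambda>x. k * h x) ws = k * rhof S m \<pi> f h ws"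
  by (simp add: rhof_def cup_def rear_def mult.left_commute)

lemma rho_left:
  assumes S: "fin_obj S" and \<pi>: "partition_on S \<pi>"
    and zs: "is_tensor (coh_species P :: 'a hfs set \<Rightarrow> nat \<Rightarrow>
     ('k::{comm_ring,comm_monoid_mult}, ('p list \<Rightarrow>\<^sub>0 'k) set) module) \<pi> zs"
  shows "(\<lambda>p. coh_rho P a phi psi S m p zs) \<in> mod_hom (coh_species P (blk ` \<pi>) m) (coh_species P S (m + deg zs))"
proof -
  obtain ys where ys: "zs = to_cls P ys" "tens \<pi> ys" using tensor_reps[OF S \<pi> zs] .
  show ?thesis unfolding coh_species_def ys(1) deg_to_cls
    by (rule mod_hom_clsI[OF P_poset[OF fin_obj_partition[OF S \<pi>]] P_poset[OF S],
          where G = "\<lambda>p. rhof S m \<pi> p (mcup (pieces ys))"])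
      (use rho_tens[OF S \<pi> _ ys(2)] in \<open>auto simp: rhof_add_left rhof_scale_left\<close>)
qed

lemma rho_right:
  assumes S: "fin_obj S" and \<pi>: "partition_on S \<pi>" and p: "p \<in> carrier (coh_species P (blk ` \<pi>) m)"
    and zs: "is_tensor (coh_species P :: 'a hfs set \<Rightarrow> nat \<Rightarrow>
     ('k::{comm_ring,comm_monoid_mult}, ('p list \<Rightarrow>\<^sub>0 'k) set) module) \<pi> (zs @ (T, d, y) # ws)"
  shows "(\<lambda>y. coh_rho P a phi psi S m p (zs @ (T, d, y) # ws))
    \<in> mod_hom (coh_species P T d) (coh_species P S (m + deg (zs @ (T, d, y) # ws)))"
proof -
  obtain p' where p': "cocycle (P (blk ` \<pi>)) m p'" "p = cls (P (blk ` \<pi>)) m p'"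
    using p carrier_cohom_iff[OF P_poset[OF fin_obj_partition[OF S \<pi>]], of p m] by (auto simp: coh_species_def)
  obtain xs where xs: "zs @ (T, d, y) # ws = to_cls P xs" "tens \<pi> xs" using tensor_reps[OF S \<pi> zs] .
  have T: "T \<in> \<pi>" using zs by (auto simp: is_tensor_def)
  obtain us v vs where uv: "xs = us @ v # vs" "zs = to_cls P us" "ws = to_cls P vs" "fst v = T"
    using xs(1)[symmetric] unfolding to_cls_def by (auto simp: map_eq_append_conv map_eq_Cons_conv split: prod.splits)
  obtain y' where "v = (T, d, y')" using uv xs(1) by (cases v) auto
  then have t: "tens \<pi> (us @ (T, d, f) # vs)" if "cocycle (P T) d f" for f
    using xs(2) uv(1) that by (auto simp: tens_def)
  have lin: "rhof S m \<pi> p' (mcup (pieces (us @ (T, d, \<lambda>x. f x + g x) # vs))) ws' =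
      rhof S m \<pi> p' (mcup (pieces (us @ (T, d, f) # vs))) ws' + rhof S m \<pi> p' (mcup (pieces (us @ (T, d, g) # vs))) ws'"
    "rhof S m \<pi> p' (mcup (pieces (us @ (T, d, \<lambda>x. k * f x) # vs))) ws' =
      k * rhof S m \<pi> p' (mcup (pieces (us @ (T, d, f) # vs))) ws'" for f g ws' k
    by (auto simp: rhof_def cup_def rear_def mcup_append distrib_left distrib_right mult_ac)
  show ?thesis unfolding coh_species_def uv p'(2)
    by (rule mod_hom_clsI[where G = "\<lambda>y. rhof S m \<pi> p' (mcup (pieces (us @ (T, d, y) # vs)))",
          OF block_poset[OF S \<pi> T] P_poset[OF S] _ lin])
      (use rho_tens[OF S \<pi> p'(1) t] in \<open>simp add: deg_to_cls\<close>)
qed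

section \<open>Interchange of factors on a product over blocks\<close>

lemma coord_wchain:
  assumes S: "fin_obj S" and \<pi>: "partition_on S \<pi>" and T: "T \<in> \<pi>" and ws: "wchain (prod_family P \<pi>) ws"
  shows "wchain (P T) (map (\<lambda>g. g T) ws)"
  using T by (intro wchain_map[OF ws _ finite_poset_family[OF S \<pi>]]) (simp add: prod_family_iff)

text \<open>A nonzero product has a window on which the factor of coordinate \<open>T\<close> is
  nonzero, and that coordinate starts in \<open>A\<close> there. The head of the whole list is below
  the head of the window, and \<open>A\<close> is closed downwards.\<close>

lemma mcup_pieces_hd:
  assumes S: "fin_obj S" and \<pi>: "partition_on S \<pi>"
    and ws: "wchain (prod_family P \<pi>) ws" "length ws = Suc (tdeg fs)" "mcup fs ws \<noteq> 0"
    and F: "(n, \<lambda>ws. F (map (\<lambda>g. g T) ws)) \<in> set fs" "T \<in> \<pi>"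
    and Fmin: "\<And>us. wchain (P T) us \<Longrightarrow> length us = Suc n \<Longrightarrow> F us \<noteq> 0 \<Longrightarrow> hd us \<in> A"
    and A: "\<And>x y. (x, y) \<in> P T \<Longrightarrow> y \<in> A \<Longrightarrow> x \<in> A"
  shows "hd ws T \<in> A"
proof -
  note Q = finite_poset_family[OF S \<pi>]
  obtain i where i: "i + n < length ws" "F (map (\<lambda>g. g T) (take (Suc n) (drop i ws))) \<noteq> 0"
    using mcup_slice[OF ws(3,2) F(1)] by blast
  have "hd (map (\<lambda>g. g T) (take (Suc n) (drop i ws))) \<in> A"
    using i by (intro Fmin coord_wchain[OF S \<pi> F(2)] wchain_take wchain_drop ws(1)) auto
  then have "(ws ! i) T \<in> A" using i(1) by (subst (asm) hd_map) (auto simp: hd_drop_conv_nth)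
  moreover have "(hd ws T, (ws ! i) T) \<in> P T"
    using wchain_hd[OF Q ws(1), of "ws ! i"] i(1) F(2) by (simp add: prod_family_iff)
  ultimately show ?thesis using A by blast
qed

lemma mcup_pieces_last:
  assumes S: "fin_obj S" and \<pi>: "partition_on S \<pi>"
    and ws: "wchain (prod_family P \<pi>) ws" "length ws = Suc (tdeg fs)" "mcup fs ws \<noteq> 0"
    and F: "(n, \<lambda>ws. F (map (\<lambda>g. g T) ws)) \<in> set fs" "T \<in> \<pi>"
    and Fmax: "\<And>us. wchain (P T) us \<Longrightarrow> length us = Suc n \<Longrightarrow> F us \<noteq> 0 \<Longrightarrow> last us \<in> A"
    and A: "\<And>x y. (x, y) \<in> P T \<Longrightarrow> x \<in> A \<Longrightarrow> y \<in> A"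
  shows "last ws T \<in> A"
proof -
  note Q = finite_poset_family[OF S \<pi>]
  obtain i where i: "i + n < length ws" "F (map (\<lambda>g. g T) (take (Suc n) (drop i ws))) \<noteq> 0"
    using mcup_slice[OF ws(3,2) F(1)] by blast
  have "last (map (\<lambda>g. g T) (take (Suc n) (drop i ws))) \<in> A"
    using i by (intro Fmax coord_wchain[OF S \<pi> F(2)] wchain_take wchain_drop ws(1)) auto
  moreover have "take (Suc n) (drop i ws) \<noteq> []" using i(1) by auto
  ultimately have "(ws ! (i + n)) T \<in> A" using last_slice[OF i(1)] by (simp add: last_map)
  moreover have "((ws ! (i + n)) T, last ws T) \<in> P T"
    using wchain_last[OF Q ws(1), of "ws ! (i + n)"] i(1) F(2) by (simp add: prod_family_iff)
  ultimately show ?thesis using A by blast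
qed

end

lemma pieces_mem: "(T, n, F) \<in> set L \<Longrightarrow> (n, \<lambda>ws. F (map (\<lambda>g. g T) ws)) \<in> set (pieces L)"
  unfolding pieces_def by force

context normalised_species
begin

lemma tens_mem:
  assumes "tens \<pi> ys" "(T, n, F) \<in> set ys"
  shows "T \<in> \<pi>" "cocycle (P T) n F"
proof -
  have "T \<in> fst ` set ys" using image_eqI[OF _ assms(2), of T fst] by simp
  then show "T \<in> \<pi>" using assms(1) by (simp add: tens_def)
  have "\<forall>z\<in>set ys. case z of (T, d, y) \<Rightarrow> cocycle (P T) d y" using assms(1) by (simp add: tens_def)
  then have "case (T, n, F) of (T, d, y) \<Rightarrow> cocycle (P T) d y" using assms(2) by (rule bspec)
  then show "cocycle (P T) n F" by simp
qed

lemma tens_ex: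
  assumes "tens \<pi> ys" "T \<in> \<pi>" shows "\<exists>n F. (T, n, F) \<in> set ys"
proof -
  have "T \<in> fst ` set ys" using assms by (simp add: tens_def)
  then obtain e where "e \<in> set ys" "T = fst e" by blast
  then show ?thesis by (intro exI[of _ "fst (snd e)"] exI[of _ "snd (snd e)"]) simp
qed

text \<open>Only one factor with the required property is asked for. After splitting, a block owns
  two factors, of which the lower one controls the start and the upper one the end of its
  coordinate.\<close>

definition hd_in where
  "hd_in L T A \<longleftrightarrow> (\<exists>n F. (T, n, F) \<in> set L \<and>
     (\<forall>us. wchain (P T) us \<longrightarrow> length us = Suc n \<longrightarrow> F us \<noteq> 0 \<longrightarrow> hd us \<in> A))"

definition last_in where
  "last_in L T A \<longleftrightarrow> (\<exists>n F. (T, n, F) \<in> set L \<and>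
     (\<forall>us. wchain (P T) us \<longrightarrow> length us = Suc n \<longrightarrow> F us \<noteq> 0 \<longrightarrow> last us \<in> A))"

lemma hd_in_append: "hd_in (L @ M) T A \<longleftrightarrow> hd_in L T A \<or> hd_in M T A"
  unfolding hd_in_def set_append Un_iff by blast

lemma last_in_append: "last_in (L @ M) T A \<longleftrightarrow> last_in L T A \<or> last_in M T A"
  unfolding last_in_def set_append Un_iff by blast

definition closed_on where
  "closed_on L X \<longleftrightarrow> (\<forall>T n F us. (T, n, F) \<in> set L \<longrightarrow> wchain (P T) us \<longrightarrow> length us = n + 2 \<longrightarrow> X T us \<longrightarrow> bd F us = 0)"

context
  fixes S :: "'a hfs set" and \<pi> :: "'a hfs set set"
  assumes S: "fin_obj S" and \<pi>: "partition_on S \<pi>"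
begin

lemma hd_in_mcup:
  assumes "hd_in L T A" "T \<in> \<pi>" "\<And>x y. (x, y) \<in> P T \<Longrightarrow> y \<in> A \<Longrightarrow> x \<in> A"
    and "wchain (prod_family P \<pi>) ws" "length ws = Suc (deg L)" "mcup (pieces L) ws \<noteq> 0"
  shows "hd ws T \<in> A"
proof -
  obtain n F where F: "(T, n, F) \<in> set L" "\<And>us. wchain (P T) us \<Longrightarrow> length us = Suc n \<Longrightarrow> F us \<noteq> 0 \<Longrightarrow> hd us \<in> A"
    using assms(1) unfolding hd_in_def by blast
  show ?thesis
    by (rule mcup_pieces_hd[OF S \<pi> assms(4) _ assms(6) pieces_mem[OF F(1)] assms(2) F(2) assms(3)])
      (simp_all add: tdeg_pieces assms(5))
qed

lemma last_in_mcup: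
  assumes "last_in L T A" "T \<in> \<pi>" "\<And>x y. (x, y) \<in> P T \<Longrightarrow> x \<in> A \<Longrightarrow> y \<in> A"
    and "wchain (prod_family P \<pi>) ws" "length ws = Suc (deg L)" "mcup (pieces L) ws \<noteq> 0"
  shows "last ws T \<in> A"
proof -
  obtain n F where F: "(T, n, F) \<in> set L" "\<And>us. wchain (P T) us \<Longrightarrow> length us = Suc n \<Longrightarrow> F us \<noteq> 0 \<Longrightarrow> last us \<in> A"
    using assms(1) unfolding last_in_def by blast
  show ?thesis
    by (rule mcup_pieces_last[OF S \<pi> assms(4) _ assms(6) pieces_mem[OF F(1)] assms(2) F(2) assms(3)])
      (simp_all add: tdeg_pieces assms(5))
qed

text \<open>The side condition is required for all nonempty lists of entries of \<open>ws\<close>,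
  because the factors are evaluated on windows of \<open>ws\<close>.\<close>

lemma closed_on_mcup:
  assumes cl: "closed_on L X" and L: "\<And>T n F. (T, n, F) \<in> set L \<Longrightarrow> T \<in> \<pi>"
    and ws: "wchain (prod_family P \<pi>) ws" "length ws = deg L + 2"
    and X: "\<And>T us. T \<in> \<pi> \<Longrightarrow> us \<noteq> [] \<Longrightarrow> set us \<subseteq> set ws \<Longrightarrow> X T (map (\<lambda>g. g T) us)"
  shows "bd (mcup (pieces L)) ws = 0"
proof (rule bd_mcup[where C = "{us. wchain (prod_family P \<pi>) us \<and> set us \<subseteq> set ws}"])
  fix n G us assume "(n, G) \<in> set (pieces L)" and us: "us \<in> {us. wchain (prod_family P \<pi>) us \<and> set us \<subseteq> set ws}" "length us = n + 2"
  then obtain T F where F: "(T, n, F) \<in> set L" "G = (\<lambda>ws. F (map (\<lambda>g. g T) ws))" by (auto simp: pieces_def)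
  have T: "T \<in> \<pi>" by (rule L[OF F(1)])
  have "wchain (P T) (map (\<lambda>g. g T) us)" using us by (intro coord_wchain[OF S \<pi> T]) auto
  moreover have "us \<noteq> []" using us(2) by auto
  then have "X T (map (\<lambda>g. g T) us)" using us(1) by (intro X[OF T]) auto
  ultimately have "bd F (map (\<lambda>g. g T) us) = 0" using cl F(1) us(2) unfolding closed_on_def by simp
  then show "bd G us = 0" unfolding F(2) bd_map .
next
  fix us n assume "us \<in> {us. wchain (prod_family P \<pi>) us \<and> set us \<subseteq> set ws}"
  then show "take n us \<in> {us. wchain (prod_family P \<pi>) us \<and> set us \<subseteq> set ws} \<and>
      drop n us \<in> {us. wchain (prod_family P \<pi>) us \<and> set us \<subseteq> set ws}"
    using set_take_subset[of n us] set_drop_subset[of n us] by (auto intro: wchain_take wchain_drop)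
qed (use ws in \<open>simp_all add: tdeg_pieces\<close>)

lemma coord_le: "(g, h) \<in> prod_family P \<pi> \<Longrightarrow> T \<in> \<pi> \<Longrightarrow> (g T, h T) \<in> P T"
  by (simp add: prod_family_iff)

text \<open>An instance of \<open>cup_swap\<close> in which the regions are cut out coordinatewise
  by \<open>D\<close> and \<open>U\<close>. The blocks in \<open>\<Theta>A\<close> link
  \<open>L1\<close> to \<open>LA\<close>, and those in \<open>\<Theta>B\<close> link
  \<open>LB\<close> to \<open>L4\<close>: factors on one side of such a link are closed only where
  the other side is nonzero. With both sets empty the groups are closed unconditionally, which is
  the case needed for symmetry.\<close>

lemma pieces_swap:
  fixes L1 LA LB L4 :: "('a hfs set \<times> nat \<times> ('p list \<Rightarrow> 'k::{comm_ring,comm_monoid_mult})) list"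
    and D U :: "'a hfs set \<Rightarrow> 'p set" and \<Theta>A \<Theta>B :: "'a hfs set set"
  defines "L \<equiv> L1 @ LA @ LB @ L4"
  assumes L: "\<And>T n F. (T, n, F) \<in> set L \<Longrightarrow> T \<in> \<pi>" and \<Theta>: "\<Theta>A \<subseteq> \<pi>" "\<Theta>B \<subseteq> \<pi>"
    and D: "\<And>T x y. (x, y) \<in> P T \<Longrightarrow> y \<in> D T \<Longrightarrow> x \<in> D T" and U: "\<And>T x y. (x, y) \<in> P T \<Longrightarrow> x \<in> U T \<Longrightarrow> y \<in> U T"
    and L1: "closed_on L1 (\<lambda>T us. T \<in> \<Theta>A \<longrightarrow> last us \<in> D T)" "\<And>T. T \<in> \<Theta>A \<Longrightarrow> last_in L1 T (U T)"
    and LA: "closed_on LA (\<lambda>T us. T \<in> \<Theta>A \<longrightarrow> hd us \<in> U T)" "\<And>T. T \<in> \<Theta>A \<Longrightarrow> hd_in LA T (D T)"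
    and LB: "closed_on LB (\<lambda>T us. T \<in> \<Theta>B \<longrightarrow> last us \<in> D T)" "\<And>T. T \<in> \<Theta>B \<Longrightarrow> last_in LB T (U T)"
    and L4: "closed_on L4 (\<lambda>T us. T \<in> \<Theta>B \<longrightarrow> hd us \<in> U T)" "\<And>T. T \<in> \<Theta>B \<Longrightarrow> hd_in L4 T (D T)"
    and mn: "\<And>T. T \<in> \<pi> \<Longrightarrow> hd_in L T (min_elems (P T))" and mx: "\<And>T. T \<in> \<pi> \<Longrightarrow> last_in L T (max_elems (P T))"
  shows "cohomologous (prod_family P \<pi>) (deg L) (mcup (pieces L))
    (\<lambda>ws. (- 1) ^ (deg LA * deg LB) * mcup (pieces (L1 @ LB @ LA @ L4)) ws)"
proof -
  let ?Q = "prod_family P \<pi>"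
  let ?D = "\<lambda>\<Theta>. {g. \<forall>T\<in>\<Theta>. g T \<in> D T}" and ?U = "\<lambda>\<Theta>. {g. \<forall>T\<in>\<Theta>. g T \<in> U T}"
  note Q = finite_poset_family[OF S \<pi>]
  have L': "\<And>T n F. (T, n, F) \<in> set L1 \<Longrightarrow> T \<in> \<pi>" "\<And>T n F. (T, n, F) \<in> set LA \<Longrightarrow> T \<in> \<pi>"
    "\<And>T n F. (T, n, F) \<in> set LB \<Longrightarrow> T \<in> \<pi>" "\<And>T n F. (T, n, F) \<in> set L4 \<Longrightarrow> T \<in> \<pi>"
    using L unfolding L_def by auto
  have D\<Theta>: "x \<in> ?D \<Theta>" if "(x, y) \<in> ?Q" "y \<in> ?D \<Theta>" "\<Theta> \<subseteq> \<pi>" for x y \<Theta>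
    using that D coord_le[OF that(1)] by blast
  have U\<Theta>: "y \<in> ?U \<Theta>" if "(x, y) \<in> ?Q" "x \<in> ?U \<Theta>" "\<Theta> \<subseteq> \<pi>" for x y \<Theta>
    using that U coord_le[OF that(1)] by blast
  have low: "last (map (\<lambda>g. g T) us) \<in> D T" if "wchain ?Q ws" "last ws \<in> ?D \<Theta>" "\<Theta> \<subseteq> \<pi>" "T \<in> \<Theta>" "us \<noteq> []" "set us \<subseteq> set ws"
    for ws us \<Theta> T
  proof -
    have "last us \<in> set ws" using that by auto
    then have "last us \<in> ?D \<Theta>" using D\<Theta>[OF wchain_last[OF Q that(1)] that(2,3)] by blast
    then show ?thesis using that by (simp add: last_map)
  qed
  have high: "hd (map (\<lambda>g. g T) us) \<in> U T" if "wchain ?Q ws" "hd ws \<in> ?U \<Theta>" "\<Theta> \<subseteq> \<pi>" "T \<in> \<Theta>" "us \<noteq> []" "set us \<subseteq> set ws"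
    for ws us \<Theta> T
  proof -
    have "hd us \<in> set ws" using that by auto
    then have "hd us \<in> ?U \<Theta>" using U\<Theta>[OF wchain_hd[OF Q that(1)] that(2,3)] by blast
    then show ?thesis using that by (simp add: hd_map)
  qed
  have "cohomologous ?Q (deg L1 + deg LA + deg LB + deg L4)
      (cup (deg L1) (mcup (pieces L1)) (cup (deg LA) (mcup (pieces LA)) (cup (deg LB) (mcup (pieces LB)) (mcup (pieces L4)))))
      (\<lambda>ws. (- 1) ^ (deg LA * deg LB) * cup (deg L1) (mcup (pieces L1)) (cup (deg LB) (mcup (pieces LB)) (cup (deg LA) (mcup (pieces LA)) (mcup (pieces L4)))) ws)"
  proof (rule cup_swap[OF Q, where LA = "?D \<Theta>A" and UA = "?U \<Theta>A" and LB = "?D \<Theta>B" and UB = "?U \<Theta>B"])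
    fix ws assume ws: "wchain ?Q ws"
    show "bd (mcup (pieces L1)) ws = 0" if "length ws = deg L1 + 2" "last ws \<in> ?D \<Theta>A"
      by (rule closed_on_mcup[OF L1(1) L'(1) ws that(1)]) (use low[OF ws that(2) \<Theta>(1)] in blast)+
    show "bd (mcup (pieces LA)) ws = 0" if "length ws = deg LA + 2" "hd ws \<in> ?U \<Theta>A"
      by (rule closed_on_mcup[OF LA(1) L'(2) ws that(1)]) (use high[OF ws that(2) \<Theta>(1)] in blast)+
    show "bd (mcup (pieces LB)) ws = 0" if "length ws = deg LB + 2" "last ws \<in> ?D \<Theta>B"
      by (rule closed_on_mcup[OF LB(1) L'(3) ws that(1)]) (use low[OF ws that(2) \<Theta>(2)] in blast)+
    show "bd (mcup (pieces L4)) ws = 0" if "length ws = deg L4 + 2" "hd ws \<in> ?U \<Theta>B"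
      by (rule closed_on_mcup[OF L4(1) L'(4) ws that(1)]) (use high[OF ws that(2) \<Theta>(2)] in blast)+
    show "last ws \<in> ?U \<Theta>A" if "length ws = Suc (deg L1)" "mcup (pieces L1) ws \<noteq> 0"
    proof (intro CollectI ballI)
      fix T assume T: "T \<in> \<Theta>A"
      then have "T \<in> \<pi>" using \<Theta> by blast
      then show "last ws T \<in> U T" by (rule last_in_mcup[OF L1(2)[OF T] _ U ws that])
    qed
    show "hd ws \<in> ?D \<Theta>A" if "length ws = Suc (deg LA)" "mcup (pieces LA) ws \<noteq> 0"
    proof (intro CollectI ballI)
      fix T assume T: "T \<in> \<Theta>A"
      then have "T \<in> \<pi>" using \<Theta> by blast
      then show "hd ws T \<in> D T" by (rule hd_in_mcup[OF LA(2)[OF T] _ D ws that])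
    qed
    show "last ws \<in> ?U \<Theta>B" if "length ws = Suc (deg LB)" "mcup (pieces LB) ws \<noteq> 0"
    proof (intro CollectI ballI)
      fix T assume T: "T \<in> \<Theta>B"
      then have "T \<in> \<pi>" using \<Theta> by blast
      then show "last ws T \<in> U T" by (rule last_in_mcup[OF LB(2)[OF T] _ U ws that])
    qed
    show "hd ws \<in> ?D \<Theta>B" if "length ws = Suc (deg L4)" "mcup (pieces L4) ws \<noteq> 0"
    proof (intro CollectI ballI)
      fix T assume T: "T \<in> \<Theta>B"
      then have "T \<in> \<pi>" using \<Theta> by blast
      then show "hd ws T \<in> D T" by (rule hd_in_mcup[OF L4(2)[OF T] _ D ws that])
    qed
  next
    fix x y assume "(x, y) \<in> ?Q"
    show "x \<in> ?D \<Theta>B" if "y \<in> ?D \<Theta>B" by (rule D\<Theta>[OF \<open>(x, y) \<in> ?Q\<close> that \<Theta>(2)])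
    show "y \<in> ?U \<Theta>B" if "x \<in> ?U \<Theta>B" by (rule U\<Theta>[OF \<open>(x, y) \<in> ?Q\<close> that \<Theta>(2)])
  next
    fix w1 w2 w3 w4
    assume w: "wchain ?Q w1" "length w1 = Suc (deg L1)" "mcup (pieces L1) w1 \<noteq> 0"
      "wchain ?Q w2" "length w2 = Suc (deg LA)" "mcup (pieces LA) w2 \<noteq> 0"
      "wchain ?Q w3" "length w3 = Suc (deg LB)" "mcup (pieces LB) w3 \<noteq> 0"
      "wchain ?Q w4" "length w4 = Suc (deg L4)" "mcup (pieces L4) w4 \<noteq> 0"
    have ne: "w1 \<noteq> []" "w4 \<noteq> []" using w by auto
    have Dm: "x \<in> min_elems (P T)" if "(x, y) \<in> P T" "y \<in> min_elems (P T)" for x y T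
      using min_elemsD[OF that(2,1)] that(2) by simp
    have Um: "y \<in> max_elems (P T)" if "(x, y) \<in> P T" "x \<in> max_elems (P T)" for x y T
      using max_elemsD[OF that(2,1)] that(2) by simp
    show "hd w1 \<in> min_elems ?Q" if le: "(hd w1, hd w2) \<in> ?Q" "(hd w1, hd w3) \<in> ?Q" "(hd w1, hd w4) \<in> ?Q"
    proof -
      have "hd w1 T \<in> min_elems (P T)" if T: "T \<in> \<pi>" for T
      proof -
        \<comment> \<open>Minimality in coordinate \<open>T\<close> is witnessed by a factor in one
          of the four groups, and the head of the first list lies below the head of that group's
          list.\<close>
        consider "hd_in L1 T (min_elems (P T))" | "hd_in LA T (min_elems (P T))" | "hd_in LB T (min_elems (P T))" | "hd_in L4 T (min_elems (P T))"
          using mn[OF T] unfolding L_def hd_in_append by blast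
        then show ?thesis
        proof cases
          case 1
          then show ?thesis by (rule hd_in_mcup[OF _ T Dm w(1-3)])
        next
          case 2
          then have "hd w2 T \<in> min_elems (P T)" by (rule hd_in_mcup[OF _ T Dm w(4-6)])
          then show ?thesis by (rule Dm[OF coord_le[OF le(1) T]])
        next
          case 3
          then have "hd w3 T \<in> min_elems (P T)" by (rule hd_in_mcup[OF _ T Dm w(7-9)])
          then show ?thesis by (rule Dm[OF coord_le[OF le(2) T]])
        next
          case 4
          then have "hd w4 T \<in> min_elems (P T)" by (rule hd_in_mcup[OF _ T Dm w(10-12)])
          then show ?thesis by (rule Dm[OF coord_le[OF le(3) T]])
        qed
      qed
      moreover have "hd w1 \<in> Field ?Q" using w(1) ne by (auto simp: wchain_def)
      ultimately show ?thesis unfolding min_family[OF S \<pi>] Field_family[OF S \<pi>] by blast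
    qed
    show "last w4 \<in> max_elems ?Q" if le: "(last w1, last w4) \<in> ?Q" "(last w2, last w4) \<in> ?Q" "(last w3, last w4) \<in> ?Q"
    proof -
      have "last w4 T \<in> max_elems (P T)" if T: "T \<in> \<pi>" for T
      proof -
        consider "last_in L1 T (max_elems (P T))" | "last_in LA T (max_elems (P T))" | "last_in LB T (max_elems (P T))" | "last_in L4 T (max_elems (P T))"
          using mx[OF T] unfolding L_def last_in_append by blast
        then show ?thesis
        proof cases
          case 4
          then show ?thesis by (rule last_in_mcup[OF _ T Um w(10-12)])
        next
          case 2
          then have "last w2 T \<in> max_elems (P T)" by (rule last_in_mcup[OF _ T Um w(4-6)])
          then show ?thesis by (rule Um[OF coord_le[OF le(2) T]])
        next
          case 3
          then have "last w3 T \<in> max_elems (P T)" by (rule last_in_mcup[OF _ T Um w(7-9)])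
          then show ?thesis by (rule Um[OF coord_le[OF le(3) T]])
        next
          case 1
          then have "last w1 T \<in> max_elems (P T)" by (rule last_in_mcup[OF _ T Um w(1-3)])
          then show ?thesis by (rule Um[OF coord_le[OF le(1) T]])
        qed
      qed
      moreover have "last w4 \<in> Field ?Q" using w(10) ne by (auto simp: wchain_def)
      ultimately show ?thesis unfolding max_family[OF S \<pi>] Field_family[OF S \<pi>] by blast
    qed
  qed
  then show ?thesis unfolding L_def pieces_simps mcup_append tdeg_pieces deg_simps by (simp add: add.assoc)
qed

end

lemma cocycle_ends:
  assumes "cocycle r n f" "wchain r us" "length us = Suc n" "f us \<noteq> 0"
  shows "hd us \<in> min_elems r" "last us \<in> max_elems r"
  using assms by (auto simp: cocycle_def supported_def end_chains_iff)

text \<open>Carries a sign found on the product over the blocks through \<rho>.\<close>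

lemma rho_scaled:
  fixes p :: "'p list \<Rightarrow> 'k::{comm_ring,comm_monoid_mult}"
  assumes S: "fin_obj S" and \<pi>: "partition_on S \<pi>" and p: "cocycle (P (blk ` \<pi>)) m p" and g: "cocycle (prod_family P \<pi>) (deg zs) g"
    and zs: "kunneth P zs = cls (prod_family P \<pi>) (deg zs) (\<lambda>ws. k * g ws)" "set (map fst zs) = \<pi>"
  shows "coh_rho P a phi psi S m (cls (P (blk ` \<pi>)) m p) zs
    = k \<odot>\<^bsub>cohom (P S) (m + deg zs)\<^esub> cls (P S) (m + deg zs) (rhof S m \<pi> p g)"
  unfolding rho_cls[OF S \<pi> p cocycle_scale[OF g] zs] cls_smult[OF P_poset[OF S]]
  by (rule cls_cong[OF P_poset[OF S]]) (rule rhof_scale_right)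

lemma rho_symm:
  assumes S: "fin_obj S" and \<pi>: "partition_on S \<pi>" and p: "p \<in> carrier (coh_species P (blk ` \<pi>) m)"
    and zs: "is_tensor (coh_species P :: 'a hfs set \<Rightarrow> nat \<Rightarrow>
     ('k::{comm_ring,comm_monoid_mult}, ('p list \<Rightarrow>\<^sub>0 'k) set) module) \<pi> (zs @ (T, d, y) # (U, e, z) # ws)"
  shows "coh_rho P a phi psi S m p (zs @ (U, e, z) # (T, d, y) # ws) =
    (- 1) ^ (d * e) \<odot>\<^bsub>coh_species P S (m + deg (zs @ (T, d, y) # (U, e, z) # ws))\<^esub>
      coh_rho P a phi psi S m p (zs @ (T, d, y) # (U, e, z) # ws)"
proof -
  obtain p' where p': "cocycle (P (blk ` \<pi>)) m p'" "p = cls (P (blk ` \<pi>)) m p'"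
    using p carrier_cohom_iff[OF P_poset[OF fin_obj_partition[OF S \<pi>]], of p m] by (auto simp: coh_species_def)
  obtain xs where xs: "zs @ (T, d, y) # (U, e, z) # ws = to_cls P xs" "tens \<pi> xs" using tensor_reps[OF S \<pi> zs] .
  obtain us y' z' vs where uv: "xs = us @ (T, d, y') # (U, e, z') # vs" "zs = to_cls P us" "ws = to_cls P vs"
    "y = cls (P T) d y'" "z = cls (P U) e z'"
    using xs(1)[symmetric] unfolding to_cls_def by (auto simp: map_eq_append_conv map_eq_Cons_conv split: prod.splits)
  let ?x1 = "us @ (T, d, y') # (U, e, z') # vs" and ?x2 = "us @ (U, e, z') # (T, d, y') # vs"
  have t1: "tens \<pi> ?x1" using xs(2) uv(1) by simp
  have t2: "tens \<pi> ?x2" using t1 unfolding tens_def by auto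
  note mem = tens_mem[OF t2]
  have cl: "closed_on L X" if "set L \<subseteq> set ?x2" for L X
    unfolding closed_on_def
  proof (intro allI impI)
    fix R n F us' assume "(R, n, F) \<in> set L" and us': "wchain (P R) us'" "length us' = n + 2"
    then have "cocycle (P R) n F" using mem(2) \<open>set L \<subseteq> set ?x2\<close> by blast
    then show "bd F us' = 0" using us' by (simp add: cocycle_def)
  qed
  have ex: "\<exists>n F. (R, n, F) \<in> set ?x2" if "R \<in> \<pi>" for R
    by (rule tens_ex[OF t2 that])
  let ?L = "us @ [(U, e, z')] @ [(T, d, y')] @ vs"
  have "cohomologous (prod_family P \<pi>) (deg ?L) (mcup (pieces ?L))
      (\<lambda>ws. (- 1) ^ (deg [(U, e, z')] * deg [(T, d, y')]) * mcup (pieces (us @ [(T, d, y')] @ [(U, e, z')] @ vs)) ws)"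
  \<comment> \<open>All factors are genuine cocycles here, so no coordinate is constrained.\<close>
  proof (rule pieces_swap[OF S \<pi>, where \<Theta>A = "{}" and \<Theta>B = "{}" and D = "\<lambda>_. UNIV" and U = "\<lambda>_. UNIV"])
    show "hd_in ?L R (min_elems (P R))" if "R \<in> \<pi>" for R
      using ex[OF that] mem(2) cocycle_ends(1) unfolding hd_in_def append.simps by blast
    show "last_in ?L R (max_elems (P R))" if "R \<in> \<pi>" for R
      using ex[OF that] mem(2) cocycle_ends(2) unfolding last_in_def append.simps by blast
    show "R \<in> \<pi>" if "(R, n, F) \<in> set ?L" for R n F using mem(1) that unfolding append.simps by blast
  qed (auto intro!: cl)
  then have "kunneth P (to_cls P ?x2) = cls (prod_family P \<pi>) (deg ?x1) (\<lambda>ws. (- 1) ^ (d * e) * mcup (pieces ?x1) ws)"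
    using kunneth_tens(1)[OF S \<pi> t2] cls_eqI[OF finite_poset_family[OF S \<pi>]] by (simp add: mult.commute add_ac del: mcup.simps)
  moreover have dg: "deg (to_cls P ?x2) = deg ?x1" by (simp add: deg_to_cls)
  ultimately have "coh_rho P a phi psi S m p (to_cls P ?x2) =
      (- 1) ^ (d * e) \<odot>\<^bsub>cohom (P S) (m + deg ?x1)\<^esub> cls (P S) (m + deg ?x1) (rhof S m \<pi> p' (mcup (pieces ?x1)))"
    using rho_scaled[OF S \<pi> p'(1), of "to_cls P ?x2" "mcup (pieces ?x1)" "(- 1) ^ (d * e)"] kunneth_tens(2)[OF S \<pi> t1] t2
    unfolding dg p'(2) map_fst_to_cls tens_def by blast
  then show ?thesis
    using rho_tens(1)[OF S \<pi> p'(1) t1] unfolding coh_species_def uv(2-5) p'(2) by (simp add: deg_to_cls del: mcup.simps)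
qed

end

section \<open>Equivariance of the composition\<close>

lemma blk_map_blk: "finite T \<Longrightarrow> blk_map f (blk T) = blk (f ` T)"
  by (simp add: blk_map_def elts_blk)

lemma mcup_const_one: "(\<And>n F. (n, F) \<in> set fs \<Longrightarrow> F = (\<lambda>_. 1)) \<Longrightarrow> mcup fs ws = 1"
proof (induction fs arbitrary: ws)
  case (Cons z fs)
  obtain n F where z: "z = (n, F)" by (cases z)
  have "F = (\<lambda>_. 1)" using Cons.prems[of n F] z by simp
  moreover have "mcup fs (drop n ws) = 1"
  proof (rule Cons.IH)
    fix m G assume "(m, G) \<in> set fs"
    then show "G = (\<lambda>_. 1)" using Cons.prems[of m G] by simp
  qed
  ultimately show ?case by (simp add: z)
qed simp

context normalised_species
begin

lemma phi_Field: "\<lbrakk>fin_obj S; (y, x) \<in> P S\<rbrakk> \<Longrightarrow> phi S x y \<in> Field (P (blk ` a S x))"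
proof -
  assume S: "fin_obj S" and xy: "(y, x) \<in> P S"
  have F: "x \<in> Field (P S)" "y \<in> Field (P S)" using xy by (auto intro: FieldI1 FieldI2)
  have "(y, y) \<in> down_rel (P S) x" using xy fp_refl[OF P_poset[OF S] F(2)] by (simp add: down_rel_iff)
  then have "(phi S x y, phi S x y) \<in> P (blk ` a S x)"
    using phi_hom[OF S F(1)] by (auto simp: poset_hom_def)
  then show ?thesis by (rule FieldI1)
qed

lemma mcup_pieces_tr:
  assumes "\<And>T u. T \<in> set (map fst ys) \<Longrightarrow> u \<in> set us \<Longrightarrow> pmap (f ` T) (inv_into T f) (A u (f ` T)) = B u T"
  shows "mcup (pieces (map (\<lambda>(T, d, y). (f ` T, d, tr T f y)) ys)) (map A us) = mcup (pieces ys) (map B us)"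
  using assms
proof (induction ys arbitrary: us)
  case (Cons z ys)
  obtain T d y where z: "z = (T, d, y)" by (cases z)
  have "map (pmap (f ` T) (inv_into T f)) (map (\<lambda>g. g (f ` T)) (map A (take (Suc d) us))) = map (\<lambda>g. g T) (map B (take (Suc d) us))"
    using Cons.prems[of T] z set_take_subset[of "Suc d" us] by (simp add: subset_iff)
  then have 1: "tr T f y (map (\<lambda>g. g (f ` T)) (map A (take (Suc d) us))) = y (map (\<lambda>g. g T) (map B (take (Suc d) us)))"
    unfolding tr_def by (rule arg_cong)
  have 2: "mcup (pieces (map (\<lambda>(T, d, y). (f ` T, d, tr T f y)) ys)) (map A (drop d us)) = mcup (pieces ys) (map B (drop d us))"
  proof (rule Cons.IH)
    fix T' u assume "T' \<in> set (map fst ys)" "u \<in> set (drop d us)"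
    then show "pmap (f ` T') (inv_into T' f) (A u (f ` T')) = B u T'"
      using set_drop_subset[of d us] by (intro Cons.prems) auto
  qed
  show ?case unfolding z using 1 2 by (simp only: list.map case_prod_conv pieces_simps mcup.simps take_map drop_map)
qed simp

lemma rho_equi:
  assumes S: "fin_obj S" and f: "inj_on f S" and \<pi>: "partition_on S \<pi>" and p: "p \<in> carrier (coh_species P (blk ` \<pi>) m)"
    and zs: "is_tensor (coh_species P :: 'a hfs set \<Rightarrow> nat \<Rightarrow>
     ('k::{comm_ring,comm_monoid_mult}, ('p list \<Rightarrow>\<^sub>0 'k) set) module) \<pi> zs"
  shows "coh_act P pmap S f (m + deg zs) (coh_rho P a phi psi S m p zs) =
    coh_rho P a phi psi (f ` S) m (coh_act P pmap (blk ` \<pi>) (blk_map f) m p)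
      (map (\<lambda>(T, d, y). (f ` T, d, coh_act P pmap T f d y)) zs)"
proof -
  let ?B = "blk ` \<pi>" and ?\<pi>' = "(`) f ` \<pi>" and ?h = "pmap (f ` S) (inv_into S f)"
  note fB = fin_obj_partition[OF S \<pi>] and fS = fin_obj_image[OF S, of f]
  obtain p' where p': "cocycle (P ?B) m p'" "p = cls (P ?B) m p'"
    using p carrier_cohom_iff[OF P_poset[OF fB], of p m] by (auto simp: coh_species_def)
  obtain ys where ys: "zs = to_cls P ys" "tens \<pi> ys" using tensor_reps[OF S \<pi> zs] .
  have sub: "T \<subseteq> S" if "T \<in> \<pi>" for T using that partition_onD1[OF \<pi>] by blast
  have fT: "fin_obj T" "inj_on f T" "finite T" if "T \<in> \<pi>" for T
    using fin_obj_block[OF S \<pi> that] sub[OF that] f by (auto simp: fin_obj_def intro: inj_on_subset)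
  have inj_im: "inj_on ((`) f) (Pow S)" using f by (rule inj_on_image_Pow)
  have \<pi>Pow: "\<pi> \<subseteq> Pow S" using sub by blast
  have im\<pi>: "inj_on ((`) f) \<pi>" using inj_im \<pi>Pow by (rule inj_on_subset)
  have \<pi>': "partition_on (f ` S) ?\<pi>'"
    using partition_on_inj_image[OF \<pi> f] partition_onD3[OF \<pi>] by (simp add: image_iff)
  have bm: "blk_map f ` ?B = blk ` ?\<pi>'" using fT(3) by (force simp: blk_map_blk image_iff)
  have binj: "inj_on (blk_map f) ?B"
  proof (rule inj_onI)
    fix u v assume "u \<in> ?B" "v \<in> ?B" and e: "blk_map f u = blk_map f v"
    then obtain T U where TU: "T \<in> \<pi>" "u = blk T" "U \<in> \<pi>" "v = blk U" by blast
    then have "blk (f ` T) = blk (f ` U)" using e fT(3) by (simp add: blk_map_blk)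
    then have "f ` T = f ` U" using fT(3) TU by (metis elts_blk finite_imageI)
    then show "u = v" using inj_onD[OF im\<pi>] TU by blast
  qed
  let ?ys = "map (\<lambda>(T, d, y). (f ` T, d, tr T f y)) ys"
  have mf: "map fst ?ys = map ((`) f) (map fst ys)" by auto
  have tys: "tens ?\<pi>' ?ys"
    unfolding tens_def
  proof (intro conjI)
    show "distinct (map fst ?ys)" unfolding mf using ys(2) im\<pi> by (auto simp: tens_def distinct_map simp del: map_map)
    show "set (map fst ?ys) = ?\<pi>'"
      unfolding mf using ys(2) unfolding tens_def by (simp only: set_map)
    show "\<forall>(T, d, y)\<in>set ?ys. cocycle (P T) d y"
    proof (intro ballI)
      fix e assume "e \<in> set ?ys"
      then obtain T d y where e: "(T, d, y) \<in> set ys" "e = (f ` T, d, tr T f y)" by auto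
      show "case e of (T, d, y) \<Rightarrow> cocycle (P T) d y"
        using act_cls(2)[OF fT(1,2) tens_mem(2)[OF ys(2) e(1)]] tens_mem(1)[OF ys(2) e(1)] by (simp add: e(2))
    qed
  qed
  have tc: "map (\<lambda>(T, d, y). (f ` T, d, coh_act P pmap T f d y)) zs = to_cls P ?ys"
  proof -
    have "(case (T, d, cls (P T) d y) of (T, d, y) \<Rightarrow> (f ` T, d, coh_act P pmap T f d y)) = (f ` T, d, cls (P (f ` T)) d (tr T f y))"
      if "(T, d, y) \<in> set ys" for T d y
      using act_cls(1)[OF fT(1,2) tens_mem(2)[OF ys(2) that]] tens_mem(1)[OF ys(2) that] by simp
    then show ?thesis unfolding ys(1) to_cls_def by auto
  qed
  have dg: "deg ?ys = deg ys" unfolding deg_def by (induction ys) auto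
  have actp: "coh_act P pmap ?B (blk_map f) m p = cls (P (blk ` ?\<pi>')) m (tr ?B (blk_map f) p')"
    "cocycle (P (blk ` ?\<pi>')) m (tr ?B (blk_map f) p')"
    using act_cls[OF fB binj p'(1)] unfolding bm p'(2) by auto
  note L = rho_tens[OF S \<pi> p'(1) ys(2)] and R = rho_tens[OF fS \<pi>' actp(2) tys]
  \<comment> \<open>Taking images under \<open>f\<close> is injective on families of subsets of
    \<open>S\<close>, so the two fibres correspond to each other.\<close>
  have aeq: "a (f ` S) (pmap S f x) = ?\<pi>' \<longleftrightarrow> a S x = \<pi>" if x: "x \<in> Field (P S)" for x
  proof -
    have "a S x \<subseteq> Pow S" using partition_onD1[OF a_partition[OF S x]] by blast
    then show ?thesis using a_natural[OF S f x] inj_on_image_eq_iff[OF inj_im _ \<pi>Pow] by simp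
  qed
  have props: "?h u \<in> Field (P S)" "pmap S f (?h u) = u" if "u \<in> Field (P (f ` S))" for u
    using pmap_inv_Field[OF S f that] pmap_inv_right[OF S f that] by auto
  have mono: "(?h u, ?h v) \<in> P S" if "(u, v) \<in> P (f ` S)" for u v
    using pullback_admissible_pmap[OF S f] that by (auto simp: pullback_admissible_def poset_hom_def)
  have fr: "front S \<pi> p' (map ?h us) = front (f ` S) ?\<pi>' (tr ?B (blk_map f) p') us"
    if us: "wchain (P (f ` S)) us" "us \<noteq> []" for us
  proof -
    let ?v = "last us" and ?x = "?h (last us)"
    have v: "?v \<in> Field (P (f ` S))" using us by (auto simp: wchain_def)
    note x = props[OF v]
    show ?thesis
    proof (cases "a S ?x = \<pi>")
      case True
      have "pmap (blk_map f ` ?B) (inv_into ?B (blk_map f)) (phi (f ` S) ?v u) = phi S ?x (?h u)" if u: "u \<in> set us" for u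
      proof -
        have uF: "u \<in> Field (P (f ` S))" using u us by (auto simp: wchain_def)
        have le: "(?h u, ?x) \<in> P S" by (rule mono[OF wchain_last[OF P_poset[OF fS] us(1) u]])
        have "phi (f ` S) ?v u = pmap ?B (blk_map f) (phi S ?x (?h u))"
          using equivariance_phi[OF S f le] True props(2)[OF uF] x(2) by simp
        then show ?thesis using pmap_inv_left[OF fB binj, of "phi S ?x (?h u)"] phi_Field[OF S le] True by simp
      qed
      then have "map (pmap (blk_map f ` ?B) (inv_into ?B (blk_map f))) (map (phi (f ` S) ?v) us) = map (phi S ?x) (map ?h us)"
        by simp
      then have "tr ?B (blk_map f) p' (map (phi (f ` S) ?v) us) = p' (map (phi S ?x) (map ?h us))"
        unfolding tr_def by (rule arg_cong)
      then show ?thesis using True aeq[OF x(1)] x(2) us(2) by (simp add: front_def last_map del: map_map)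
    next
      case False
      then show ?thesis using aeq[OF x(1)] x(2) us(2) by (simp add: front_def last_map)
    qed
  qed
  have re: "rear S \<pi> (mcup (pieces ys)) (map ?h us) = rear (f ` S) ?\<pi>' (mcup (pieces ?ys)) us"
    if us: "wchain (P (f ` S)) us" "us \<noteq> []" for us
  proof -
    let ?v = "hd us" and ?x = "?h (hd us)"
    have v: "?v \<in> Field (P (f ` S))" using us by (auto simp: wchain_def)
    note x = props[OF v]
    show ?thesis
    proof (cases "a S ?x = \<pi>")
      case True
      have "mcup (pieces ?ys) (map (psi (f ` S) ?v) us) = mcup (pieces ys) (map (\<lambda>u. psi S ?x (?h u)) us)"
      proof (rule mcup_pieces_tr)
        fix T u assume T: "T \<in> set (map fst ys)" and u: "u \<in> set us"
        have T\<pi>: "T \<in> \<pi>" using T ys(2) by (simp add: tens_def)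
        have uF: "u \<in> Field (P (f ` S))" using u us by (auto simp: wchain_def)
        have le: "(?x, ?h u) \<in> P S" by (rule mono[OF wchain_hd[OF P_poset[OF fS] us(1) u]])
        have "psi (f ` S) ?v u (f ` T) = pmap T f (psi S ?x (?h u) T)"
          using equivariance_psi[OF S f le] True props(2)[OF uF] x(2) T\<pi> by simp
        moreover have "psi S ?x (?h u) T \<in> Field (P T)" using PiE_mem[OF psi_family[OF S le], of T] T\<pi> True by simp
        ultimately show "pmap (f ` T) (inv_into T f) (psi (f ` S) ?v u (f ` T)) = psi S ?x (?h u) T"
          using pmap_inv_left[OF fT(1,2)[OF T\<pi>]] by simp
      qed
      then show ?thesis using True aeq[OF x(1)] x(2) us(2) by (simp add: rear_def hd_map comp_def)
    next
      case False
      then show ?thesis using aeq[OF x(1)] x(2) us(2) by (simp add: rear_def hd_map)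
    qed
  qed
  have "cls (P (f ` S)) (m + deg ys) (tr S f (rhof S m \<pi> p' (mcup (pieces ys)))) =
    cls (P (f ` S)) (m + deg ys) (rhof (f ` S) m ?\<pi>' (tr ?B (blk_map f) p') (mcup (pieces ?ys)))"
  proof (rule cls_cong[OF P_poset[OF fS]])
    fix ws assume ws: "ws \<in> end_chains (P (f ` S))" "length ws = Suc (m + deg ys)"
    then have w: "wchain (P (f ` S)) ws" by (simp add: end_chains_iff)
    have "take (Suc m) ws \<noteq> []" "drop m ws \<noteq> []" using ws(2) by auto
    then show "tr S f (rhof S m \<pi> p' (mcup (pieces ys))) ws = rhof (f ` S) m ?\<pi>' (tr ?B (blk_map f) p') (mcup (pieces ?ys)) ws"
      unfolding rhof_def tr_def[of S f] cup_def take_map drop_map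
      using fr[OF wchain_take[OF w]] re[OF wchain_drop[OF w]] by simp
  qed
  then show ?thesis
    unfolding tc actp(1) R(1) unfolding ys(1) p'(2) L(1) deg_to_cls act_cls(1)[OF S f L(2)] dg .
qed

section \<open>Units\<close>

lemma unit_cls:
  "coh_unit P s = cls (P {s}) 0 (\<lambda>_. 1 :: 'k::{comm_ring,comm_monoid_mult})" "cocycle (P {s}) 0 (\<lambda>_. 1 :: 'k)"
proof -
  have fs: "fin_obj {s}" by (simp add: fin_obj_def)
  note r = P_poset[OF fs]
  obtain z where z: "Field (P {s}) = {z}" using unitality by blast
  have m: "z \<in> min_elems (P {s})" "z \<in> max_elems (P {s})"
    using z by (auto simp: min_elems_def max_elems_def dest: FieldI1 FieldI2)
  have e: "xs \<in> end_chains (P {s}) \<and> length xs = Suc 0 \<longleftrightarrow> xs = [z]" for xs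
  proof
    assume xs: "xs \<in> end_chains (P {s}) \<and> length xs = Suc 0"
    then obtain x where "xs = [x]" by (auto simp: length_Suc_conv)
    moreover have "x \<in> Field (P {s})" using xs calculation by (simp add: end_chains_def)
    ultimately show "xs = [z]" using z by simp
  next
    assume "xs = [z]"
    then show "xs \<in> end_chains (P {s}) \<and> length xs = Suc 0" using m by (simp add: end_chains_def z)
  qed
  have "(THE z. z \<in> Field (P {s})) = z" using z by auto
  moreover have "coch (P {s}) 0 (\<lambda>_. 1) = Poly_Mapping.single [z] (1::'k)"
    by (rule poly_mapping_eqI) (auto simp: lookup_coch[OF r] lookup_single when_def e)
  ultimately show "coh_unit P s = cls (P {s}) 0 (\<lambda>_. 1 :: 'k)" by (simp add: coh_unit_def cls_def)
  show "cocycle (P {s}) 0 (\<lambda>_. 1 :: 'k)"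
    unfolding cocycle_def
  proof (intro conjI allI impI)
    show "supported (P {s}) (Suc 0) (\<lambda>_. 1 :: 'k)"
      unfolding supported_def
    proof (intro allI impI)
      fix zs assume "wchain (P {s}) zs" "length zs = Suc 0"
      then have "zs = [z]" by (auto simp: wchain_def z length_Suc_conv)
      then show "zs \<in> end_chains (P {s})" using e by blast
    qed
    show "bd (\<lambda>_. 1 :: 'k) zs = 0" if "length zs = 0 + 2" for zs :: "'p list"
      using that by (simp add: bd_def numeral_2_eq_2)
  qed
qed

lemma unit_equi: "coh_act P pmap {s} f 0 (coh_unit P s) = (coh_unit P (f s) :: ('p list \<Rightarrow>\<^sub>0 'k::{comm_ring,comm_monoid_mult}) set)"
proof -
  have fs: "fin_obj {s}" by (simp add: fin_obj_def)
  have "coh_act P pmap {s} f 0 (cls (P {s}) 0 (\<lambda>_. 1 :: 'k)) = cls (P (f ` {s})) 0 (tr {s} f (\<lambda>_. 1))"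
    by (rule act_cls(1)[OF fs _ unit_cls(2)]) simp
  also have "tr {s} f (\<lambda>_. 1) = (\<lambda>_. 1)" by (simp add: tr_def fun_eq_iff)
  finally show ?thesis unfolding unit_cls(1) by simp
qed

text \<open>The chain is cut at its first entry. This is minimal, hence lies over
  \<open>{S}\<close>, and there \<open>unit_normalised\<close> makes \<open>psi\<close> the
  identity.\<close>

lemma unit_l:
  assumes S: "fin_obj S" and y: "y \<in> carrier (coh_species P S d :: ('k::{comm_ring,comm_monoid_mult}, ('p list \<Rightarrow>\<^sub>0 'k) set) module)"
  shows "coh_rho P a phi psi S 0 (coh_unit P (blk S)) [(S, d, y)] = y"
proof -
  note r = P_poset[OF S]
  obtain y' where y': "cocycle (P S) d y'" "y = cls (P S) d y'"
    using y carrier_cohom_iff[OF r, of y d] by (auto simp: coh_species_def)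
  have \<pi>: "partition_on S {S}" using S by (auto simp: fin_obj_def partition_on_space)
  have t: "tens {S} [(S, d, y')]" using y'(1) by (simp add: tens_def)
  have u: "cocycle (P (blk ` {S})) 0 (\<lambda>_. 1 :: 'k)" using unit_cls(2)[of "blk S"] by simp
  have "coh_rho P a phi psi S 0 (coh_unit P (blk S)) [(S, d, y)] =
      cls (P S) (0 + deg [(S, d, y')]) (rhof S 0 {S} (\<lambda>_. 1) (mcup (pieces [(S, d, y')])))"
    using rho_tens(1)[OF S \<pi> u t] y'(2) unit_cls(1)[of "blk S", where 'k = 'k] by (simp del: mcup.simps)
  also have "0 + deg [(S, d, y')] = d" by simp
  also have "cls (P S) d (rhof S 0 {S} (\<lambda>_. 1) (mcup (pieces [(S, d, y')]))) = y" unfolding y'(2)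
  proof (rule cls_cong[OF r])
    fix ws assume ws: "ws \<in> end_chains (P S)" "length ws = Suc d"
    then have w: "wchain (P S) ws" "hd ws \<in> min_elems (P S)" "ws \<noteq> []" by (auto simp: end_chains_iff)
    have "a S (hd ws) \<in> min_elems (partition_poset S)" using a_min[OF S] w(2) by blast
    then have a: "a S (hd ws) = {S}" using min_partition_poset[OF S] by simp
    have "psi S (hd ws) x S = x" if "x \<in> set ws" for x
      using un S w(2) wchain_hd[OF r w(1) that] by (auto simp: unit_normalised_def)
    then have "map (\<lambda>g. g S) (map (psi S (hd ws)) ws) = ws" by (simp add: map_idI)
    moreover have "take (Suc 0) ws = [hd ws]" using w(3) by (cases ws) auto
    ultimately show "rhof S 0 {S} (\<lambda>_. 1) (mcup (pieces [(S, d, y')])) ws = y' ws"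
      using a ws(2) by (simp add: rhof_def cup_def front_def rear_def)
  qed
  finally show ?thesis .
qed

text \<open>The chain is cut at its last entry. This is maximal, hence lies over the partition into
  singletons, and there \<open>phi\<close> is the relabelling by \<open>blk_sing\<close>, which the
  action on \<open>p\<close> undoes.\<close>

lemma unit_r:
  assumes S: "fin_obj S" and p: "p \<in> carrier (coh_species P S m :: ('k::{comm_ring,comm_monoid_mult}, ('p list \<Rightarrow>\<^sub>0 'k) set) module)"
    and ss: "distinct ss" "set ss = S"
  shows "coh_rho P a phi psi S m (coh_act P pmap S blk_sing m p) (map (\<lambda>s. ({s}, 0, coh_unit P s)) ss) = p"
proof -
  note r = P_poset[OF S]
  obtain u where u: "cocycle (P S) m u" "p = cls (P S) m u"
    using p carrier_cohom_iff[OF r, of p m] by (auto simp: coh_species_def)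
  let ?\<pi> = "(\<lambda>s. {s}) ` S" and ?ys = "map (\<lambda>s. ({s}, 0, \<lambda>_ :: 'p list. 1 :: 'k)) ss"
  have \<pi>: "partition_on S ?\<pi>" by (auto simp: partition_on_def disjoint_def)
  have t: "tens ?\<pi> ?ys" using ss unit_cls(2) by (auto simp: tens_def distinct_map inj_on_def comp_def)
  have tc: "map (\<lambda>s. ({s}, 0, coh_unit P s)) ss = to_cls P ?ys" by (simp add: to_cls_def unit_cls(1))
  have inj: "inj_on blk_sing S"
  proof (rule inj_onI)
    fix s t assume "blk_sing s = blk_sing t"
    then have "elts (blk {s}) = elts (blk {t})" by (simp add: blk_sing_def)
    then show "s = t" by (simp add: elts_blk)
  qed
  have im: "blk_sing ` S = blk ` ?\<pi>" by (auto simp: blk_sing_def)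
  have dg: "deg ?ys = 0" by (simp add: deg_def comp_def)
  note ac = act_cls[OF S inj u(1), unfolded im]
  have "coh_rho P a phi psi S m (coh_act P pmap S blk_sing m p) (to_cls P ?ys) =
      cls (P S) m (rhof S m ?\<pi> (tr S blk_sing u) (mcup (pieces ?ys)))"
    unfolding u(2) ac(1) rho_tens(1)[OF S \<pi> ac(2) t] dg by simp
  also have "\<dots> = p" unfolding u(2)
  proof (rule cls_cong[OF r])
    fix ws assume ws: "ws \<in> end_chains (P S)" "length ws = Suc m"
    then have w: "wchain (P S) ws" "last ws \<in> max_elems (P S)" "ws \<noteq> []" by (auto simp: end_chains_iff)
    have "a S (last ws) \<in> max_elems (partition_poset S)" using a_max[OF S] w(2) by blast
    then have a: "a S (last ws) = ?\<pi>" by (rule max_partition_posetD)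
    have "pmap (blk_sing ` S) (inv_into S blk_sing) (phi S (last ws) x) = x" if "x \<in> set ws" for x
    proof -
      have "phi S (last ws) x = pmap S blk_sing x"
        using un S w(2) wchain_last[OF r w(1) that] by (auto simp: unit_normalised_def)
      then show ?thesis using pmap_inv_left[OF S inj] w(1) that by (auto simp: wchain_def)
    qed
    then have "map (pmap (blk_sing ` S) (inv_into S blk_sing)) (map (phi S (last ws)) ws) = ws" by (simp add: map_idI)
    then have 1: "tr S blk_sing u (map (phi S (last ws)) ws) = u ws" unfolding tr_def by (rule arg_cong)
    have "last ws = ws ! m" using ws(2) w(3) by (simp add: last_conv_nth)
    then have "drop m ws = [last ws]" using ws(2) by (simp add: Cons_nth_drop_Suc[symmetric])
    moreover have "mcup (pieces ?ys) vs = 1" for vs :: "('a hfs set \<Rightarrow> 'p) list"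
      by (rule mcup_const_one) (auto simp: pieces_def)
    ultimately show "rhof S m ?\<pi> (tr S blk_sing u) (mcup (pieces ?ys)) ws = u ws"
      using a 1 ws(2) by (simp add: rhof_def cup_def front_def rear_def)
  qed
  finally show ?thesis unfolding tc .
qed

end

section \<open>Associativity\<close>

text \<open>Two products over different posets are compared factor by factor along one list:
  \<open>A\<close> and \<open>B\<close> are the maps to the two posets, and agreement is needed only
  on the windows of that list.\<close>

lemma mcup_all2:
  assumes "list_all2 (\<lambda>(n, f) (m, g). n = m \<and> (\<forall>us\<in>C. length us = Suc n \<longrightarrow> f (map A us) = g (map B us))) fs gs"
    and "\<And>us n. us \<in> C \<Longrightarrow> take n us \<in> C \<and> drop n us \<in> C"
    and "ws \<in> C" "length ws = Suc (tdeg fs)"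
  shows "mcup fs (map A ws) = mcup gs (map B ws)"
  using assms(1,3,4)
proof (induction fs gs arbitrary: ws rule: list_all2_induct)
  case (Cons x fs y gs)
  obtain n f g where xy: "x = (n, f)" "y = (n, g)" "\<And>us. us \<in> C \<Longrightarrow> length us = Suc n \<Longrightarrow> f (map A us) = g (map B us)"
    using Cons.hyps(1) by (cases x; cases y) auto
  have C: "take (Suc n) ws \<in> C" "drop n ws \<in> C" using assms(2)[OF Cons.prems(1)] by blast+
  have "f (map A (take (Suc n) ws)) = g (map B (take (Suc n) ws))"
    using Cons.prems(2) xy by (intro xy(3)[OF C(1)]) simp
  moreover have "mcup fs (map A (drop n ws)) = mcup gs (map B (drop n ws))"
    using Cons.prems(2) xy by (intro Cons.IH[OF C(2)]) simp
  ultimately show ?case unfolding xy mcup.simps take_map drop_map by simp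
qed simp

lemma mcup_concat: "mcup (concat fss) ws = mcup (map (\<lambda>fs. (tdeg fs, mcup fs)) fss) ws"
proof (induction fss arbitrary: ws)
  case (Cons fs fss)
  then show ?case by (simp add: mcup_append cup_def)
qed simp

lemma pieces_concat: "pieces (concat yss) = concat (map pieces yss)"
  by (induction yss) auto

text \<open>Supported functions vanish off the end chains, so the relation between \<open>f\<close>
  and \<open>g\<close> extends to all weakly increasing lists of the right length, and then
  \<open>bd_bd\<close> applies.\<close>

lemma cocycle_cohomologous:
  assumes r: "finite_poset r" and fg: "cohomologous r n f g" and f: "cocycle r n f" and g: "supported r (Suc n) g"
  shows "cocycle r n g"
proof -
  obtain h where h: "supported r n h" "\<And>zs. zs \<in> end_chains r \<Longrightarrow> length zs = Suc n \<Longrightarrow> f zs = g zs + bd h zs"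
    using fg by (auto simp: cohomologous_def)
  have eq: "g ws = f ws - bd h ws" if ws: "wchain r ws" "length ws = Suc n" for ws
  proof (cases "ws \<in> end_chains r")
    case True
    then show ?thesis using h(2)[OF True ws(2)] by simp
  next
    case False
    have z: "u ws = 0" if "supported r (Suc n) u" for u :: "'a list \<Rightarrow> 'b" using that ws False by (auto simp: supported_def)
    show ?thesis using z[OF g] z[OF cocycle_supported[OF f]] z[OF supported_bd[OF r h(1)]] by simp
  qed
  have "bd g ws = 0" if ws: "wchain r ws" "length ws = n + 2" for ws
  proof -
    have "bd g ws = bd (\<lambda>ws. f ws - bd h ws) ws"
      by (rule bd_cong) (use ws wchain_omit[OF r ws(1)] in \<open>simp add: eq length_omit\<close>)
    then show ?thesis using f ws by (simp add: bd_diff bd_bd cocycle_def)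
  qed
  then show ?thesis using g by (simp add: cocycle_def)
qed

lemma cls_eqD:
  assumes r: "finite_poset r" and e: "cls r n f = cls r n g"
  shows "cohomologous r n f g"
proof -
  have "coch r n f \<in> cls r n f" unfolding cls_mem[OF r]
    by (intro exI[of _ "\<lambda>_. 0"] conjI coch_cong) (auto simp: supported_def bd_zero)
  then obtain h where h: "supported r n h" "coch r n f = coch r n (\<lambda>xs. g xs + bd h xs)"
    unfolding e cls_mem[OF r] by blast
  have "f zs = g zs + bd h zs" if "zs \<in> end_chains r" "length zs = Suc n" for zs
    using arg_cong[OF h(2), of "\<lambda>c. Poly_Mapping.lookup c zs"] that by (simp add: lookup_coch[OF r])
  then show ?thesis using h(1) by (auto simp: cohomologous_def)
qed

section \<open>Refinements and the induced partition of the set of blocks\<close>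

lemma refines_partition: "(\<pi>, \<pi>') \<in> partition_poset S \<Longrightarrow> partition_on S \<pi>" "(\<pi>, \<pi>') \<in> partition_poset S \<Longrightarrow> partition_on S \<pi>'"
  by (auto simp: partition_poset_def refines_def)

lemma restr_partition:
  assumes "(\<pi>, \<pi>') \<in> partition_poset S" "T \<in> \<pi>"
  shows "partition_on T (restr \<pi>' T)"
proof -
  have p: "partition_on S \<pi>" "partition_on S \<pi>'" and ref: "\<forall>U\<in>\<pi>'. \<exists>T\<in>\<pi>. U \<subseteq> T"
    using assms(1) by (auto simp: partition_poset_def refines_def)
  have "T \<subseteq> \<Union>(restr \<pi>' T)"
  proof
    fix t assume t: "t \<in> T"
    then have "t \<in> S" using assms(2) partition_onD1[OF p(1)] by blast
    then obtain U where U: "U \<in> \<pi>'" "t \<in> U" using partition_onD1[OF p(2)] by blast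
    then obtain T' where T': "T' \<in> \<pi>" "U \<subseteq> T'" using ref by blast
    have "T' \<inter> T \<noteq> {}" using t U T' by blast
    then have "T' = T" using T'(1) assms(2) disjointD[OF partition_onD2[OF p(1)]] by blast
    then show "t \<in> \<Union>(restr \<pi>' T)" using U T' by (auto simp: restr_def)
  qed
  then show ?thesis using p(2) by (auto simp: partition_on_def disjoint_def restr_def)
qed

lemma refines_restr_eq:
  assumes "(\<pi>, \<alpha>) \<in> partition_poset S" "(\<pi>, \<beta>) \<in> partition_poset S" "\<And>T. T \<in> \<pi> \<Longrightarrow> restr \<alpha> T = restr \<beta> T"
  shows "\<alpha> = \<beta>"
proof -
  have "\<gamma> = (\<Union>T\<in>\<pi>. restr \<gamma> T)" if "(\<pi>, \<gamma>) \<in> partition_poset S" for \<gamma>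
    using that by (fastforce simp: partition_poset_def refines_def restr_def)
  then show ?thesis using assms by (metis (no_types, lifting) SUP_cong)
qed

lemma list_all2_mapI: "(\<And>e. e \<in> set L \<Longrightarrow> R (f e) (g e)) \<Longrightarrow> list_all2 R (map f L) (map g L)"
  by (induction L) auto

lemma wchain_closed:
  "us \<in> {us. wchain r us \<and> set us \<subseteq> X} \<Longrightarrow> take n us \<in> {us. wchain r us \<and> set us \<subseteq> X} \<and> drop n us \<in> {us. wchain r us \<and> set us \<subseteq> X}"
  using set_take_subset[of n us] set_drop_subset[of n us] by (auto intro: wchain_take wchain_drop)

lemma Union_restr: "\<lbrakk>(\<pi>, \<pi>') \<in> partition_poset S; T \<in> \<pi>\<rbrakk> \<Longrightarrow> \<Union>(restr \<pi>' T) = T"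
  using restr_partition partition_onD1 by metis

lemma inj_on_blk_image:
  assumes S: "fin_obj S" and \<pi>': "partition_on S \<pi>'" and AB: "A \<subseteq> \<pi>'" "B \<subseteq> \<pi>'" "blk ` A = blk ` B"
  shows "A = B"
proof -
  have "inj_on blk \<pi>'" using fin_obj_block[OF S \<pi>'] by (intro inj_on_blk) (simp add: fin_obj_def)
  then show ?thesis using AB inj_on_image_eq_iff by blast
qed

lemma restr_subset: "restr \<pi> T \<subseteq> \<pi>"
  by (auto simp: restr_def)

lemma blk_restr_blk: "finite T \<Longrightarrow> blk_restr \<pi>' (blk T) = blk (blk ` restr \<pi>' T)"
  by (simp add: blk_restr_def elts_blk)

text \<open>A block of a coarser partition is the union of the blocks of \<pi>' inside it. Two
  coarser partitions are allowed because the value of \<open>a\<close> at a chain element is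
  compared with \<pi> before the two are known to be equal.\<close>

lemma blk_restr_inj:
  assumes S: "fin_obj S" and "(\<alpha>, \<pi>') \<in> partition_poset S" "(\<beta>, \<pi>') \<in> partition_poset S"
    and "T \<in> \<alpha>" "U \<in> \<beta>" "blk ` restr \<pi>' T = blk ` restr \<pi>' U"
  shows "T = U"
proof -
  note refines_partition(2)[OF assms(2)]
  then have "restr \<pi>' T = restr \<pi>' U" using inj_on_blk_image[OF S _ restr_subset restr_subset assms(6)] by blast
  then show ?thesis using Union_restr[OF assms(2,4)] Union_restr[OF assms(3,5)] by metis
qed

lemma inj_blk_restr:
  assumes S: "fin_obj S" and ref: "(\<pi>, \<pi>') \<in> partition_poset S"
  shows "inj_on (blk_restr \<pi>') (blk ` \<pi>)"
proof (rule inj_onI)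
  note p = refines_partition[OF ref]
  fix u v assume "u \<in> blk ` \<pi>" "v \<in> blk ` \<pi>" and e: "blk_restr \<pi>' u = blk_restr \<pi>' v"
  then obtain T U where TU: "T \<in> \<pi>" "u = blk T" "U \<in> \<pi>" "v = blk U" by blast
  have fin: "finite T" "finite U" using fin_obj_block[OF S p(1)] TU by (auto simp: fin_obj_def)
  have "finite (blk ` restr \<pi>' A)" for A
    using finite_subset[OF restr_subset finite_partition[OF S p(2)]] by blast
  moreover have "blk (blk ` restr \<pi>' T) = blk (blk ` restr \<pi>' U)" using e TU fin by (simp add: blk_restr_blk)
  ultimately have "blk ` restr \<pi>' T = blk ` restr \<pi>' U" by (metis elts_blk)
  then show "u = v" using blk_restr_inj[OF S ref ref TU(1,3)] TU by simp
qed

lemma restr_disjoint: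
  assumes "(\<pi>, \<pi>') \<in> partition_poset S" "T \<in> \<pi>" "U \<in> \<pi>" "T \<noteq> U"
  shows "restr \<pi>' T \<inter> restr \<pi>' U = {}"
proof (rule ccontr)
  note p = refines_partition[OF assms(1)]
  assume "restr \<pi>' T \<inter> restr \<pi>' U \<noteq> {}"
  then obtain V where V: "V \<in> \<pi>'" "V \<subseteq> T" "V \<subseteq> U" unfolding restr_def by blast
  moreover have "T \<inter> U = {}" using assms(2-4) disjointD[OF partition_onD2[OF p(1)]] by blast
  ultimately have "V = {}" by blast
  then show False using V(1) partition_onD3[OF p(2)] by simp
qed

lemma Union_restr_image:
  assumes "(\<pi>, \<pi>') \<in> partition_poset S"
  shows "(\<Union>T\<in>\<pi>. restr \<pi>' T) = \<pi>'"
proof -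
  have "\<forall>U\<in>\<pi>'. \<exists>T\<in>\<pi>. U \<subseteq> T" using assms by (auto simp: partition_poset_def refines_def)
  then show ?thesis unfolding restr_def by blast
qed

lemma partition_on_blk_restr:
  assumes S: "fin_obj S" and ref: "(\<pi>, \<pi>') \<in> partition_poset S"
  shows "partition_on (blk ` \<pi>') ((\<lambda>T. blk ` restr \<pi>' T) ` \<pi>)"
proof (rule partition_onI)
  note p = refines_partition[OF ref]
  show "\<Union>((\<lambda>T. blk ` restr \<pi>' T) ` \<pi>) = blk ` \<pi>'" using Union_restr_image[OF ref] by (metis image_UN)
  show "{} \<notin> (\<lambda>T. blk ` restr \<pi>' T) ` \<pi>"
  proof
    assume "{} \<in> (\<lambda>T. blk ` restr \<pi>' T) ` \<pi>"
    then obtain T where T: "T \<in> \<pi>" "restr \<pi>' T = {}" by auto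
    then show False using Union_restr[OF ref T(1)] partition_onD3[OF p(1)] by simp
  qed
  show "disjnt q q'" if qq: "q \<in> (\<lambda>T. blk ` restr \<pi>' T) ` \<pi>" "q' \<in> (\<lambda>T. blk ` restr \<pi>' T) ` \<pi>" "q \<noteq> q'" for q q'
  proof -
    obtain T U where TU: "T \<in> \<pi>" "q = blk ` restr \<pi>' T" "U \<in> \<pi>" "q' = blk ` restr \<pi>' U" using qq by blast
    then have "restr \<pi>' T \<inter> restr \<pi>' U = {}" using restr_disjoint[OF ref] qq(3) by blast
    moreover have "inj_on blk \<pi>'" using fin_obj_block[OF S p(2)] by (intro inj_on_blk) (simp add: fin_obj_def)
    ultimately show ?thesis using TU(2,4) inj_on_image_Int[of blk \<pi>' "restr \<pi>' T" "restr \<pi>' U"] restr_subset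
      unfolding disjnt_def by (metis image_empty)
  qed
qed

section \<open>Splitting composites into lower and upper factors\<close>

context normalised_species
begin

text \<open>Replaces the varying last entry by a fixed \<open>v\<close> above it. If the two differ,
  both sides are zero, as the chain meets the fibre only at \<open>v\<close>. In the associativity
  law \<open>v\<close> will be a coordinate of \<open>psi\<close>, while \<open>front\<close> looks
  at the end of its own window.\<close>

lemma front_eq:
  assumes S: "fin_obj S" and p: "cocycle (P (blk ` \<pi>)) m p"
    and ws: "wchain (P S) ws" "length ws = Suc m" "(last ws, v) \<in> P S" "a S v = \<pi>"
  shows "front S \<pi> p ws = p (map (phi S v) ws)"
proof (cases "last ws = v")
  case True
  then show ?thesis using ws(4) by (simp add: front_def)
next
  case False
  note r = P_poset[OF S]
  have v: "v \<in> Field (P S)" using ws(3) by (rule FieldI2)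
  note d = finite_poset_down_rel[OF r v]
  have cocycle: "cocycle (down_rel (P S) v) m (\<lambda>ws. p (map (phi S v) ws))" using cocycle_pullback[OF d adm_phi[OF S v]] p ws(4) by simp
  have w: "wchain (down_rel (P S) v) ws"
    using ws(1) fp_trans[OF r wchain_last[OF r ws(1)] ws(3)] by (auto simp: wchain_down_rel[OF r v])
  have "ws \<notin> end_chains (down_rel (P S) v)"
    using False max_elems_down_rel[OF r v] by (auto simp: end_chains_iff)
  then have "p (map (phi S v) ws) = 0" using cocycle_supported[OF cocycle] w ws(2) by (auto simp: supported_def)
  moreover have "a S (last ws) \<noteq> \<pi>" using a_inj_on_chains[OF S ws(3)] ws(4) False by blast
  ultimately show ?thesis by (simp add: front_def)
qed

lemma rear_eq:
  assumes S: "fin_obj S" and g: "cocycle (prod_family P \<pi>) m g"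
    and ws: "wchain (P S) ws" "length ws = Suc m" "(v, hd ws) \<in> P S" "a S v = \<pi>"
  shows "rear S \<pi> g ws = g (map (psi S v) ws)"
proof (cases "hd ws = v")
  case True
  then show ?thesis using ws(4) by (simp add: rear_def)
next
  case False
  note r = P_poset[OF S]
  have v: "v \<in> Field (P S)" using ws(3) by (rule FieldI1)
  note d = finite_poset_up_rel[OF r v]
  have cocycle: "cocycle (up_rel (P S) v) m (\<lambda>ws. g (map (psi S v) ws))" using cocycle_pullback[OF d adm_psi[OF S v]] g ws(4) by simp
  have w: "wchain (up_rel (P S) v) ws"
    using ws(1) fp_trans[OF r ws(3) wchain_hd[OF r ws(1)]] by (auto simp: wchain_up_rel[OF r v])
  have "ws \<notin> end_chains (up_rel (P S) v)"
    using False min_elems_up_rel[OF r v] by (auto simp: end_chains_iff)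
  then have "g (map (psi S v) ws) = 0" using cocycle_supported[OF cocycle] w ws(2) by (auto simp: supported_def)
  moreover have "a S (hd ws) \<noteq> \<pi>" using a_inj_on_chains[OF S ws(3)] ws(4) False by metis
  ultimately show ?thesis by (simp add: rear_def)
qed

text \<open>
  The entry \<open>(T, n, q, us)\<close> of the list in the associativity law gives rise to two factors on
  \<open>\<Prod>\<^bsub>T\<in>\<pi>\<^esub> P(T)\<close>, one for \<open>q\<close> and one for \<open>us\<close>, and to their product \<open>\<rho>(q; us)\<close>.
\<close>

definition fr where
  "fr \<pi>' e = (case e of (T, n, q, vs) \<Rightarrow> (T, n, front T (restr \<pi>' T) q))"

definition re where
  "re \<pi>' e = (case e of (T, n, q, vs) \<Rightarrow> (T, deg vs, rear T (restr \<pi>' T) (mcup (pieces vs))))"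

definition pa where
  "pa \<pi>' e = (case e of (T, n, q, vs) \<Rightarrow> (T, n + deg vs, rhof T n (restr \<pi>' T) q (mcup (pieces vs))))"

lemma mcup_pair: "mcup (pieces (L @ pa \<pi>' e # M)) ws = mcup (pieces (L @ [fr \<pi>' e] @ [re \<pi>' e] @ M)) ws"
proof -
  obtain T n q vs where e: "e = (T, n, q, vs)" by (cases e)
  have "mcup (pieces (pa \<pi>' e # M)) us = mcup (pieces (fr \<pi>' e # re \<pi>' e # M)) us" for us
    by (simp add: e pa_def fr_def re_def rhof_def cup_def take_map drop_map drop_take mult.assoc add.commute)
  then show ?thesis by (simp add: mcup_append cup_def)
qed

lemma deg_pair: "deg (pa \<pi>' e # M) = deg (fr \<pi>' e # re \<pi>' e # M)"
  by (cases e) (simp add: pa_def fr_def re_def)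

text \<open>The Koszul exponent of \<open>rho_assoc\<close>. Appending an entry adds its degree
  times the total degree of all earlier upper factors, which is the sign of one interchange.\<close>

definition \<sigma> where
  "\<sigma> K = (\<Sum>j<length K. \<Sum>i<j. fst (snd (K ! j)) * deg (snd (snd (snd (K ! i)))))"

lemma \<sigma>_snoc: "\<sigma> (K @ [(T, n, q, vs)]) = \<sigma> K + deg (map (re \<pi>') K) * n"
proof -
  have "deg (map (re \<pi>') K) = (\<Sum>i<length K. deg (snd (snd (snd (K ! i)))))"
  proof (induction K rule: rev_induct)
    case (snoc e K)
    then show ?case by (cases e) (simp add: nth_append re_def)
  qed simp
  then have "(\<Sum>i<length K. n * deg (snd (snd (snd (K ! i))))) = deg (map (re \<pi>') K) * n"
    by (simp add: sum_distrib_left mult.commute)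
  moreover have "\<sigma> (K @ [(T, n, q, vs)]) = \<sigma> K + (\<Sum>i<length K. n * deg (snd (snd (snd (K ! i)))))"
    unfolding \<sigma>_def length_append list.size add_0_right by (simp add: nth_append)
  ultimately show ?thesis by simp
qed

text \<open>On each window the coordinate that is read has no repetition, so the window has none
  either, and consecutive windows share an entry.\<close>

lemma mcup_pieces_distinct:
  assumes S: "fin_obj S" and \<pi>: "partition_on S \<pi>"
    and M: "\<And>T n F. (T, n, F) \<in> set M \<Longrightarrow> T \<in> \<pi> \<and> (\<forall>us. wchain (P T) us \<longrightarrow> length us = Suc n \<longrightarrow> F us \<noteq> 0 \<longrightarrow> distinct us)"
    and ws: "wchain (prod_family P \<pi>) ws" "length ws = Suc (deg M)" "mcup (pieces M) ws \<noteq> 0"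
  shows "distinct ws"
  using M ws
proof (induction M arbitrary: ws)
  case Nil
  then show ?case by (cases ws) auto
next
  case (Cons e M)
  obtain T n F where e: "e = (T, n, F)" by (cases e)
  note Q = finite_poset_family[OF S \<pi>]
  have T: "T \<in> \<pi>" and F: "\<And>us. wchain (P T) us \<Longrightarrow> length us = Suc n \<Longrightarrow> F us \<noteq> 0 \<Longrightarrow> distinct us"
    using Cons.prems(1)[of T n F] e by auto
  have nz: "F (map (\<lambda>g. g T) (take (Suc n) ws)) \<noteq> 0" "mcup (pieces M) (drop n ws) \<noteq> 0"
    using Cons.prems(4) e by auto
  have l: "length ws = Suc (n + deg M)" using Cons.prems(3) e by simp
  have "distinct (map (\<lambda>g. g T) (take (Suc n) ws))"
    using nz(1) l by (intro F coord_wchain[OF S \<pi> T] wchain_take Cons.prems(2)) auto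
  then have 1: "distinct (take (Suc n) ws)" by (rule distinct_map[THEN iffD1, THEN conjunct1])
  have 2: "distinct (drop n ws)"
  proof (rule Cons.IH)
    show "T' \<in> \<pi> \<and> (\<forall>us. wchain (P T') us \<longrightarrow> length us = Suc n' \<longrightarrow> F' us \<noteq> 0 \<longrightarrow> distinct us)"
      if "(T', n', F') \<in> set M" for T' n' F' using Cons.prems(1)[of T' n' F'] that by simp
  qed (use nz(2) l wchain_drop[OF Cons.prems(2)] in auto)
  show ?case by (rule wchain_cup_distinct[OF Q Cons.prems(2) 1 2])
qed

lemma psi_mono: "\<lbrakk>fin_obj S; (z, x) \<in> P S; (x, y) \<in> P S\<rbrakk> \<Longrightarrow> (psi S z x, psi S z y) \<in> prod_family P (a S z)"
proof -
  assume S: "fin_obj S" and zx: "(z, x) \<in> P S" "(x, y) \<in> P S"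
  have "(x, y) \<in> up_rel (P S) z" using zx fp_trans[OF P_poset[OF S]] by (auto simp: up_rel_iff)
  then show ?thesis using psi_hom[OF S FieldI1[OF zx(1)]] by (auto simp: poset_hom_def)
qed

definition bl where
  "bl \<pi>' e = (case e of (T, n, q, vs) \<Rightarrow> (blk ` restr \<pi>' T, n, q))"

context
  fixes S :: "'a hfs set" and \<pi> \<pi>' :: "'a hfs set set"
  assumes S: "fin_obj S" and ref: "(\<pi>, \<pi>') \<in> partition_poset S"
begin

lemmas part = refines_partition[OF ref]

definition good :: "('a hfs set \<times> nat \<times> ('p list \<Rightarrow> 'k::{comm_ring,comm_monoid_mult}) \<times> ('a hfs set \<times> nat \<times> ('p list \<Rightarrow> 'k)) list) list \<Rightarrow> bool"
  where "good L \<longleftrightarrow> (\<forall>T n q vs. (T, n, q, vs) \<in> set L \<longrightarrow> T \<in> \<pi> \<and> cocycle (P (blk ` restr \<pi>' T)) n q \<and> tens (restr \<pi>' T) vs)"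

text \<open>The elements below the fibre of \<open>a\<close> over the part of \<pi>' inside
  \<open>T\<close>; \<open>Up\<close> is the set of those above it. The guard makes both sets
  everything for sets that are not blocks of \<pi>, so that their closure properties hold for every
  \<open>T\<close>.\<close>

definition Dn :: "'a hfs set \<Rightarrow> 'p set" where
  "Dn T = {x. T \<in> \<pi> \<longrightarrow> (\<exists>v. (x, v) \<in> P T \<and> a T v = restr \<pi>' T)}"

definition Up :: "'a hfs set \<Rightarrow> 'p set" where
  "Up T = {x. T \<in> \<pi> \<longrightarrow> (\<exists>v. (v, x) \<in> P T \<and> a T v = restr \<pi>' T)}"

lemma Dn_down: "(x, y) \<in> P T \<Longrightarrow> y \<in> Dn T \<Longrightarrow> x \<in> Dn T"
  unfolding Dn_def using fp_trans[OF block_poset[OF S part(1)]] by blast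

lemma Up_up: "(x, y) \<in> P T \<Longrightarrow> x \<in> Up T \<Longrightarrow> y \<in> Up T"
  unfolding Up_def using fp_trans[OF block_poset[OF S part(1)]] by blast

text \<open>The two fibre elements bounding \<open>x\<close> are comparable, hence equal by
  \<open>a_inj_on_chains\<close>, and \<open>x\<close> is caught between them.\<close>

lemma Dn_Up:
  assumes "T \<in> \<pi>" "x \<in> Dn T" "x \<in> Up T" shows "a T x = restr \<pi>' T"
proof -
  obtain v w where vw: "(x, v) \<in> P T" "a T v = restr \<pi>' T" "(w, x) \<in> P T" "a T w = restr \<pi>' T"
    using assms by (auto simp: Dn_def Up_def)
  note r = block_poset[OF S part(1) assms(1)]
  have "w = v" using a_inj_on_chains[OF fin_obj_block[OF S part(1) assms(1)] fp_trans[OF r vw(3,1)]] vw by simp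
  then show ?thesis using fp_antisym[OF r vw(1)] vw by metis
qed

context
  fixes T :: "'a hfs set" and n :: nat and q :: "'p list \<Rightarrow> 'k::{comm_ring,comm_monoid_mult}"
    and vs :: "('a hfs set \<times> nat \<times> ('p list \<Rightarrow> 'k)) list"
  assumes T: "T \<in> \<pi>" and q: "cocycle (P (blk ` restr \<pi>' T)) n q" and vs: "tens (restr \<pi>' T) vs"
begin

lemma fT: "fin_obj T" and pT: "partition_on T (restr \<pi>' T)"
  using fin_obj_block[OF S part(1) T] restr_partition[OF ref T] by auto

lemma cocycle_mcup: "cocycle (prod_family P (restr \<pi>' T)) (deg vs) (mcup (pieces vs))"
  by (rule kunneth_tens(2)[OF fT pT vs])

lemma Field_ends: "wchain (P T) us \<Longrightarrow> length us = Suc k \<Longrightarrow> (hd us, hd us) \<in> P T \<and> (last us, last us) \<in> P T"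
  using wchain_hd[OF P_poset[OF fT]] by (cases "us = []") (auto simp: wchain_def intro!: fp_refl[OF P_poset[OF fT]])

lemma front_props:
  assumes us: "wchain (P T) us"
  shows "length us = Suc n \<Longrightarrow> front T (restr \<pi>' T) q us \<noteq> 0 \<Longrightarrow> last us \<in> Up T \<and> hd us \<in> min_elems (P T) \<and> distinct us"
    and "length us = n + 2 \<Longrightarrow> last us \<in> Dn T \<Longrightarrow> bd (front T (restr \<pi>' T) q) us = 0"
proof -
  show "last us \<in> Up T \<and> hd us \<in> min_elems (P T) \<and> distinct us" if l: "length us = Suc n" "front T (restr \<pi>' T) q us \<noteq> 0"
    using front_nz[OF fT q us l] Field_ends[OF us l(1)] by (auto simp: Up_def)
  show "bd (front T (restr \<pi>' T) q) us = 0" if l: "length us = n + 2" "last us \<in> Dn T"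
    using bd_front[OF fT q us l(1)] l(2) T by (auto simp: Dn_def)
qed

lemma rear_props:
  assumes us: "wchain (P T) us"
  shows "length us = Suc (deg vs) \<Longrightarrow> rear T (restr \<pi>' T) (mcup (pieces vs)) us \<noteq> 0 \<Longrightarrow>
      hd us \<in> Dn T \<and> last us \<in> max_elems (P T) \<and> distinct us"
    and "length us = deg vs + 2 \<Longrightarrow> hd us \<in> Up T \<Longrightarrow> bd (rear T (restr \<pi>' T) (mcup (pieces vs))) us = 0"
proof -
  show "hd us \<in> Dn T \<and> last us \<in> max_elems (P T) \<and> distinct us"
    if l: "length us = Suc (deg vs)" "rear T (restr \<pi>' T) (mcup (pieces vs)) us \<noteq> 0"
    using rear_nz[OF fT cocycle_mcup us l] Field_ends[OF us l(1)] by (auto simp: Dn_def)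
  show "bd (rear T (restr \<pi>' T) (mcup (pieces vs))) us = 0" if l: "length us = deg vs + 2" "hd us \<in> Up T"
    using bd_rear[OF fT cocycle_mcup pT us l(1)] l(2) T by (auto simp: Up_def)
qed

lemma cocycle_pair: "cocycle (P T) (n + deg vs) (rhof T n (restr \<pi>' T) q (mcup (pieces vs)))"
  by (rule cocycle_rhof[OF fT pT q cocycle_mcup])

end

lemma good_mem:
  assumes "good L" "(T, n, q, vs) \<in> set L"
  shows "T \<in> \<pi>" "cocycle (P (blk ` restr \<pi>' T)) n q" "tens (restr \<pi>' T) vs"
  using assms by (auto simp: good_def)

lemma fr_mem: "(T, n, F) \<in> set (map (fr \<pi>') K) \<Longrightarrow> \<exists>q vs. (T, n, q, vs) \<in> set K \<and> F = front T (restr \<pi>' T) q"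
  by (auto simp: fr_def)

lemma re_mem: "(T, n, F) \<in> set (map (re \<pi>') K) \<Longrightarrow>
    \<exists>k q vs. (T, k, q, vs) \<in> set K \<and> n = deg vs \<and> F = rear T (restr \<pi>' T) (mcup (pieces vs))"
  by (auto simp: re_def)

lemma pa_mem: "(T, n, F) \<in> set (map (pa \<pi>') K) \<Longrightarrow>
    \<exists>k q vs. (T, k, q, vs) \<in> set K \<and> n = k + deg vs \<and> F = rhof T k (restr \<pi>' T) q (mcup (pieces vs))"
  by (auto simp: pa_def)

lemma ex_mem: "T \<in> set (map fst K) \<Longrightarrow> \<exists>n q vs. (T, n, q, vs) \<in> set K"
proof -
  assume "T \<in> set (map fst K)"
  then have "T \<in> fst ` set K" by simp
  then obtain e where "e \<in> set K" "T = fst e" by blast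
  then show ?thesis
    by (intro exI[of _ "fst (snd e)"] exI[of _ "fst (snd (snd e))"] exI[of _ "snd (snd (snd e))"]) simp
qed

lemma mem_fr: "(T, n, q, vs) \<in> set K \<Longrightarrow> (T, n, front T (restr \<pi>' T) q) \<in> set (map (fr \<pi>') K)"
  by (force simp: fr_def)

lemma mem_re: "(T, n, q, vs) \<in> set K \<Longrightarrow> (T, deg vs, rear T (restr \<pi>' T) (mcup (pieces vs))) \<in> set (map (re \<pi>') K)"
  by (force simp: re_def)

lemma mem_pa: "(T, n, q, vs) \<in> set K \<Longrightarrow>
    (T, n + deg vs, rhof T n (restr \<pi>' T) q (mcup (pieces vs))) \<in> set (map (pa \<pi>') K)"
  by (force simp: pa_def)

lemma fr_conds:
  assumes "good K"
  shows "closed_on (map (fr \<pi>') K) (\<lambda>T us. T \<in> set (map fst K) \<longrightarrow> last us \<in> Dn T)"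
    and "T \<in> set (map fst K) \<Longrightarrow> last_in (map (fr \<pi>') K) T (Up T) \<and> hd_in (map (fr \<pi>') K) T (min_elems (P T))"
proof -
  show "closed_on (map (fr \<pi>') K) (\<lambda>T us. T \<in> set (map fst K) \<longrightarrow> last us \<in> Dn T)"
    unfolding closed_on_def
  proof (intro allI impI)
    fix T n F us assume F: "(T, n, F) \<in> set (map (fr \<pi>') K)" and us: "wchain (P T) us" "length us = n + 2"
      and D: "T \<in> set (map fst K) \<longrightarrow> last us \<in> Dn T"
    obtain q vs where e: "(T, n, q, vs) \<in> set K" "F = front T (restr \<pi>' T) q" using fr_mem[OF F] by blast
    have "T \<in> set (map fst K)" using image_eqI[OF _ e(1), of T fst] by simp
    then show "bd F us = 0" using front_props(2)[OF good_mem[OF assms e(1)] us] D e(2) by blast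
  qed
  assume T: "T \<in> set (map fst K)"
  obtain n q vs where e: "(T, n, q, vs) \<in> set K" using ex_mem[OF T] by blast
  show "last_in (map (fr \<pi>') K) T (Up T) \<and> hd_in (map (fr \<pi>') K) T (min_elems (P T))"
    unfolding last_in_def hd_in_def
    using mem_fr[OF e] front_props(1)[OF good_mem[OF assms e]] by blast
qed

lemma re_conds:
  assumes "good K"
  shows "closed_on (map (re \<pi>') K) (\<lambda>T us. T \<in> set (map fst K) \<longrightarrow> hd us \<in> Up T)"
    and "T \<in> set (map fst K) \<Longrightarrow> hd_in (map (re \<pi>') K) T (Dn T) \<and> last_in (map (re \<pi>') K) T (max_elems (P T))"
proof -
  show "closed_on (map (re \<pi>') K) (\<lambda>T us. T \<in> set (map fst K) \<longrightarrow> hd us \<in> Up T)"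
    unfolding closed_on_def
  proof (intro allI impI)
    fix T n F us assume F: "(T, n, F) \<in> set (map (re \<pi>') K)" and us: "wchain (P T) us" "length us = n + 2"
      and D: "T \<in> set (map fst K) \<longrightarrow> hd us \<in> Up T"
    obtain k q vs where e: "(T, k, q, vs) \<in> set K" "n = deg vs" "F = rear T (restr \<pi>' T) (mcup (pieces vs))"
      using re_mem[OF F] by blast
    have "T \<in> set (map fst K)" using image_eqI[OF _ e(1), of T fst] by simp
    then show "bd F us = 0" using rear_props(2)[OF good_mem[OF assms e(1)] us(1)] us(2) D e(2,3) by blast
  qed
  assume T: "T \<in> set (map fst K)"
  obtain n q vs where e: "(T, n, q, vs) \<in> set K" using ex_mem[OF T] by blast
  show "hd_in (map (re \<pi>') K) T (Dn T) \<and> last_in (map (re \<pi>') K) T (max_elems (P T))"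
    unfolding last_in_def hd_in_def
    using mem_re[OF e] rear_props(1)[OF good_mem[OF assms e]] by blast
qed

lemma pa_conds:
  assumes "good K"
  shows "closed_on (map (pa \<pi>') K) X"
    and "T \<in> set (map fst K) \<Longrightarrow> hd_in (map (pa \<pi>') K) T (min_elems (P T)) \<and> last_in (map (pa \<pi>') K) T (max_elems (P T))"
proof -
  show "closed_on (map (pa \<pi>') K) X"
    unfolding closed_on_def
  proof (intro allI impI)
    fix T n F us assume F: "(T, n, F) \<in> set (map (pa \<pi>') K)" and us: "wchain (P T) us" "length us = n + 2"
    obtain k q vs where e: "(T, k, q, vs) \<in> set K" "n = k + deg vs" "F = rhof T k (restr \<pi>' T) q (mcup (pieces vs))"
      using pa_mem[OF F] by blast
    then show "bd F us = 0" using cocycle_pair[OF good_mem[OF assms e(1)]] us by (simp add: cocycle_def)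
  qed
  assume T: "T \<in> set (map fst K)"
  obtain n q vs where e: "(T, n, q, vs) \<in> set K" using ex_mem[OF T] by blast
  show "hd_in (map (pa \<pi>') K) T (min_elems (P T)) \<and> last_in (map (pa \<pi>') K) T (max_elems (P T))"
    unfolding last_in_def hd_in_def
    using mem_pa[OF e] cocycle_ends[OF cocycle_pair[OF good_mem[OF assms e]]] by blast
qed

lemma closed_on_append: "closed_on L X \<Longrightarrow> closed_on M X \<Longrightarrow> closed_on (L @ M) X"
  unfolding closed_on_def set_append Un_iff by blast

text \<open>The blocks in \<open>K\<close> are already separated, \<open>e\<close> has just been
  opened and those in \<open>R\<close> are still composites. The upper factors of \<open>K\<close>
  are exchanged with the lower factor of \<open>e\<close>: the former rely on the lower factors of
  \<open>K\<close> to their left, the latter on the upper factor of \<open>e\<close> to its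
  right.\<close>

lemma swap_step:
  assumes g: "good (K @ e # R)" and cover: "set (map fst (K @ e # R)) = \<pi>"
  shows "cohomologous (prod_family P \<pi>) (deg (map (fr \<pi>') K @ map (re \<pi>') K @ [fr \<pi>' e] @ re \<pi>' e # map (pa \<pi>') R))
    (mcup (pieces (map (fr \<pi>') K @ map (re \<pi>') K @ [fr \<pi>' e] @ re \<pi>' e # map (pa \<pi>') R)))
    (\<lambda>ws. (- 1) ^ (deg (map (re \<pi>') K) * deg [fr \<pi>' e]) *
      mcup (pieces (map (fr \<pi>') K @ [fr \<pi>' e] @ map (re \<pi>') K @ re \<pi>' e # map (pa \<pi>') R)) ws)"
proof -
  have gK: "good K" and ge: "good [e]" and gR: "good R" using g by (auto simp: good_def)
  note fK = fr_conds[OF gK] and rK = re_conds[OF gK] and pR = pa_conds[OF gR]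
  note fe = fr_conds[OF ge] and re = re_conds[OF ge]
  have l4: "re \<pi>' e # map (pa \<pi>') R = map (re \<pi>') [e] @ map (pa \<pi>') R" and lb: "[fr \<pi>' e] = map (fr \<pi>') [e]" by auto
  have K\<pi>: "set (map fst K) \<subseteq> \<pi>" "set (map fst [e]) \<subseteq> \<pi>" using cover by auto
  show ?thesis unfolding l4 lb
  proof (rule pieces_swap[OF S part(1), where D = Dn and U = Up and \<Theta>A = "set (map fst K)" and \<Theta>B = "set (map fst [e])"])
    fix T n F assume "(T, n, F) \<in> set (map (fr \<pi>') K @ map (re \<pi>') K @ map (fr \<pi>') [e] @ map (re \<pi>') [e] @ map (pa \<pi>') R)"
    then consider "(T, n, F) \<in> set (map (fr \<pi>') K)" | "(T, n, F) \<in> set (map (re \<pi>') K)" | "(T, n, F) \<in> set (map (fr \<pi>') [e])"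
      | "(T, n, F) \<in> set (map (re \<pi>') [e])" | "(T, n, F) \<in> set (map (pa \<pi>') R)" unfolding set_append Un_iff by blast
    then show "T \<in> \<pi>"
    proof cases
      case 1 then show ?thesis using fr_mem[OF 1] good_mem(1)[OF gK] by blast
    next
      case 2 then show ?thesis using re_mem[OF 2] good_mem(1)[OF gK] by blast
    next
      case 3 then show ?thesis using fr_mem[OF 3] good_mem(1)[OF ge] by blast
    next
      case 4 then show ?thesis using re_mem[OF 4] good_mem(1)[OF ge] by blast
    next
      case 5 then show ?thesis using pa_mem[OF 5] good_mem(1)[OF gR] by blast
    qed
  next
    show "closed_on (map (re \<pi>') [e] @ map (pa \<pi>') R) (\<lambda>T us. T \<in> set (map fst [e]) \<longrightarrow> hd us \<in> Up T)"
      by (rule closed_on_append[OF re(1) pR(1)])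
  next
    fix T assume "T \<in> \<pi>"
    then consider "T \<in> set (map fst K)" | "T \<in> set (map fst [e])" | "T \<in> set (map fst R)" using cover by auto
    then show "hd_in (map (fr \<pi>') K @ map (re \<pi>') K @ map (fr \<pi>') [e] @ map (re \<pi>') [e] @ map (pa \<pi>') R) T (min_elems (P T))"
      "last_in (map (fr \<pi>') K @ map (re \<pi>') K @ map (fr \<pi>') [e] @ map (re \<pi>') [e] @ map (pa \<pi>') R) T (max_elems (P T))"
      unfolding hd_in_append last_in_append using fK(2) fe(2) rK(2) re(2) pR(2) by (cases; blast)+
  qed (use K\<pi> fK rK fe re Dn_down Up_up hd_in_append in blast)+
qed

text \<open>Each step opens the next composite in place and moves its lower factor to the left past
  the upper factors collected so far. \<open>R\<close> must vary in the induction since it loses its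
  first entry each time.\<close>

lemma swap_all:
  assumes g: "good (K @ R)" and cover: "set (map fst (K @ R)) = \<pi>"
  shows "deg (map (pa \<pi>') (K @ R)) = deg (map (fr \<pi>') K @ map (re \<pi>') K @ map (pa \<pi>') R) \<and>
    cls (prod_family P \<pi>) (deg (map (pa \<pi>') (K @ R))) (mcup (pieces (map (pa \<pi>') (K @ R)))) =
    cls (prod_family P \<pi>) (deg (map (pa \<pi>') (K @ R)))
      (\<lambda>ws. (- 1) ^ \<sigma> K * mcup (pieces (map (fr \<pi>') K @ map (re \<pi>') K @ map (pa \<pi>') R)) ws)"
  using assms
proof (induction K arbitrary: R rule: rev_induct)
  case Nil
  then show ?case by (simp add: \<sigma>_def)
next
  case (snoc e K)
  note Q = finite_poset_family[OF S part(1)]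
  let ?N = "deg (map (pa \<pi>') (K @ e # R))"
  let ?X = "pieces (map (fr \<pi>') K @ map (re \<pi>') K @ [fr \<pi>' e] @ re \<pi>' e # map (pa \<pi>') R)"
  let ?Y = "pieces (map (fr \<pi>') K @ [fr \<pi>' e] @ map (re \<pi>') K @ re \<pi>' e # map (pa \<pi>') R)"
  have IH: "?N = deg (map (fr \<pi>') K @ map (re \<pi>') K @ map (pa \<pi>') (e # R))"
    "cls (prod_family P \<pi>) ?N (mcup (pieces (map (pa \<pi>') (K @ e # R)))) = cls (prod_family P \<pi>) ?N
      (\<lambda>ws. (- 1) ^ \<sigma> K * mcup (pieces (map (fr \<pi>') K @ map (re \<pi>') K @ map (pa \<pi>') (e # R))) ws)"
    using snoc.IH[of "e # R"] snoc.prems by auto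
  have N: "?N = deg (map (fr \<pi>') K @ map (re \<pi>') K @ [fr \<pi>' e] @ re \<pi>' e # map (pa \<pi>') R)"
    unfolding IH(1) deg_simps list.map deg_pair by (cases e) (simp add: fr_def re_def)
  have X: "mcup (pieces (map (fr \<pi>') K @ map (re \<pi>') K @ map (pa \<pi>') (e # R))) = mcup ?X"
    using mcup_pair[of "map (fr \<pi>') K @ map (re \<pi>') K" \<pi>' e "map (pa \<pi>') R"] by (simp add: fun_eq_iff)
  obtain T n q vs where e: "e = (T, n, q, vs)" by (cases e)
  have d1: "deg [fr \<pi>' e] = n" by (simp add: e fr_def)
  have st: "cls (prod_family P \<pi>) ?N (mcup ?X) = cls (prod_family P \<pi>) ?N (\<lambda>ws. (- 1) ^ (deg (map (re \<pi>') K) * n) * mcup ?Y ws)"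
    unfolding N using swap_step[of K e R] snoc.prems unfolding d1 by (intro cls_eqI[OF Q]) auto
  have "cls (prod_family P \<pi>) ?N (\<lambda>ws. (- 1) ^ \<sigma> K * mcup ?X ws) =
      (- 1) ^ \<sigma> K \<odot>\<^bsub>cohom (prod_family P \<pi>) ?N\<^esub> cls (prod_family P \<pi>) ?N (mcup ?X)" by (simp add: cls_smult[OF Q])
  also have "\<dots> = cls (prod_family P \<pi>) ?N (\<lambda>ws. (- 1) ^ \<sigma> (K @ [e]) * mcup ?Y ws)"
    unfolding st unfolding cls_smult[OF Q] unfolding e \<sigma>_snoc[where \<pi>' = \<pi>'] by (simp add: power_add mult.assoc)
  finally have "cls (prod_family P \<pi>) ?N (mcup (pieces (map (pa \<pi>') (K @ e # R)))) =
      cls (prod_family P \<pi>) ?N (\<lambda>ws. (- 1) ^ \<sigma> (K @ [e]) * mcup ?Y ws)"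
    unfolding IH(2) X .
  moreover have "?N = deg (map (fr \<pi>') (K @ [e]) @ map (re \<pi>') (K @ [e]) @ map (pa \<pi>') R)"
    unfolding N by (cases e) (simp add: fr_def re_def)
  ultimately show ?case by simp
qed

text \<open>The factors are supported only at one end each: in every coordinate the lower one forces
  a minimal start and the upper one a maximal end.\<close>

lemma supported_split:
  assumes g: "good L" and c: "set (map fst L) = \<pi>"
  shows "supported (prod_family P \<pi>) (Suc (deg (map (fr \<pi>') L @ map (re \<pi>') L))) (mcup (pieces (map (fr \<pi>') L @ map (re \<pi>') L)))"
  unfolding supported_def
proof (intro allI impI)
  let ?M = "map (fr \<pi>') L @ map (re \<pi>') L"
  fix ws assume ws: "wchain (prod_family P \<pi>) ws" "length ws = Suc (deg ?M)" "mcup (pieces ?M) ws \<noteq> 0"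
  have "distinct ws"
  proof (rule mcup_pieces_distinct[OF S part(1) _ ws])
    fix T n F assume "(T, n, F) \<in> set ?M"
    then consider "(T, n, F) \<in> set (map (fr \<pi>') L)" | "(T, n, F) \<in> set (map (re \<pi>') L)" unfolding set_append Un_iff by blast
    then show "T \<in> \<pi> \<and> (\<forall>us. wchain (P T) us \<longrightarrow> length us = Suc n \<longrightarrow> F us \<noteq> 0 \<longrightarrow> distinct us)"
    proof cases
      case 1
      then obtain q vs where e: "(T, n, q, vs) \<in> set L" "F = front T (restr \<pi>' T) q" using fr_mem[OF 1] by blast
      show ?thesis using front_props(1)[OF good_mem[OF g e(1)]] good_mem(1)[OF g e(1)] e(2) by blast
    next
      case 2
      then obtain k q vs where e: "(T, k, q, vs) \<in> set L" "n = deg vs" "F = rear T (restr \<pi>' T) (mcup (pieces vs))"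
        using re_mem[OF 2] by blast
      show ?thesis using rear_props(1)[OF good_mem[OF g e(1)]] good_mem(1)[OF g e(1)] e(2,3) by blast
    qed
  qed
  moreover have "hd ws T \<in> min_elems (P T)" "last ws T \<in> max_elems (P T)" if T: "T \<in> \<pi>" for T
  proof -
    have h: "hd_in ?M T (min_elems (P T))" "last_in ?M T (max_elems (P T))"
      unfolding hd_in_append last_in_append
      using fr_conds(2)[OF g, of T] re_conds(2)[OF g, of T] T c by auto
    show "hd ws T \<in> min_elems (P T)"
      by (rule hd_in_mcup[OF S part(1) h(1) T _ ws]) (metis min_elemsD)
    show "last ws T \<in> max_elems (P T)"
      by (rule last_in_mcup[OF S part(1) h(2) T _ ws]) (metis max_elemsD)
  qed
  moreover have "ws \<noteq> []" using ws(2) by auto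
  moreover have "hd ws \<in> Field (prod_family P \<pi>)" "last ws \<in> Field (prod_family P \<pi>)"
    using ws(1) \<open>ws \<noteq> []\<close> by (auto simp: wchain_def)
  ultimately show "ws \<in> end_chains (prod_family P \<pi>)"
    unfolding end_chains_iff min_family[OF S part(1)] max_family[OF S part(1)] Field_family[OF S part(1)]
    using ws(1) by blast
qed

text \<open>That \<open>G\<close> is a cocycle is not visible from its factors. Up to a sign it is
  supported and cohomologous to the product of the composites, which is a cocycle; applying the sign
  once more removes it.\<close>

lemma split_cls:
  assumes g: "good L" and c: "set (map fst L) = \<pi>"
    and t: "tens \<pi> (map (pa \<pi>') L)"
  defines "N \<equiv> deg (map (pa \<pi>') L)" and "G \<equiv> mcup (pieces (map (fr \<pi>') L @ map (re \<pi>') L))"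
  shows "cls (prod_family P \<pi>) N (mcup (pieces (map (pa \<pi>') L))) = cls (prod_family P \<pi>) N (\<lambda>ws. (- 1) ^ \<sigma> L * G ws)"
    "cocycle (prod_family P \<pi>) N G" "N = deg (map (fr \<pi>') L) + deg (map (re \<pi>') L)"
proof -
  note Q = finite_poset_family[OF S part(1)]
  have sw: "N = deg (map (fr \<pi>') L @ map (re \<pi>') L)"
    "cls (prod_family P \<pi>) N (mcup (pieces (map (pa \<pi>') L))) = cls (prod_family P \<pi>) N (\<lambda>ws. (- 1) ^ \<sigma> L * G ws)"
    using swap_all[of L "[]"] g c unfolding N_def G_def by auto
  then show "cls (prod_family P \<pi>) N (mcup (pieces (map (pa \<pi>') L))) = cls (prod_family P \<pi>) N (\<lambda>ws. (- 1) ^ \<sigma> L * G ws)"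
    "N = deg (map (fr \<pi>') L) + deg (map (re \<pi>') L)" by auto
  have "supported (prod_family P \<pi>) (Suc N) (\<lambda>ws. (- 1) ^ \<sigma> L * G ws)"
    unfolding sw(1) G_def by (rule supported_scale[OF supported_split[OF g c]])
  then have "cocycle (prod_family P \<pi>) N (\<lambda>ws. (- 1) ^ \<sigma> L * G ws)"
    using cocycle_cohomologous[OF Q cls_eqD[OF Q sw(2)]] kunneth_tens(2)[OF S part(1) t] unfolding N_def by blast
  from cocycle_scale[OF this, of "(- 1) ^ \<sigma> L"] show "cocycle (prod_family P \<pi>) N G" by (simp add: minus_one_cancel)
qed

text \<open>Both sides cut the chain at the same two entries, \<open>z\<close> and \<open>w\<close>.
  The left side takes \<open>psi\<close> at \<open>z\<close> and cuts each coordinate afterwards;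
  the right side takes \<open>phi\<close> and \<open>psi\<close> at \<open>w\<close> first. The
  three associativity axioms match the three resulting segments.\<close>

lemma chain_level_assoc:
  fixes p :: "'p list \<Rightarrow> 'k::{comm_ring,comm_monoid_mult}"
  assumes g: "good L" and c: "set (map fst L) = \<pi>"
    and ws: "wchain (P S) ws" "length ws = Suc (m + deg (map (fr \<pi>') L) + deg (map (re \<pi>') L))"
  shows "rhof S m \<pi> p (mcup (pieces (map (fr \<pi>') L @ map (re \<pi>') L))) ws =
    rhof S (m + deg (map (fr \<pi>') L)) \<pi>'
      (rhof (blk ` \<pi>') m ((\<lambda>T. blk ` restr \<pi>' T) ` \<pi>) (tr (blk ` \<pi>) (blk_restr \<pi>') p) (mcup (pieces (map (bl \<pi>') L))))
      (mcup (pieces (concat (map (\<lambda>(T, n, q, vs). vs) L)))) ws"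
proof -
  let ?X = "blk ` \<pi>'" and ?\<rho> = "(\<lambda>T. blk ` restr \<pi>' T) ` \<pi>" and ?d = "deg (map (fr \<pi>') L)" and ?e = "deg (map (re \<pi>') L)"
  let ?M = "m + ?d"
  note r = P_poset[OF S]
  define z where "z = ws ! m"
  define w where "w = ws ! ?M"
  define f1 where "f1 = take (Suc m) ws"
  define seg where "seg = drop m (take (Suc ?M) ws)"
  define f3 where "f3 = drop ?M ws"
  have lens: "length f1 = Suc m" "length seg = Suc ?d" "length f3 = Suc ?e" using ws(2) by (auto simp: f1_def seg_def f3_def)
  have wc: "wchain (P S) f1" "wchain (P S) seg" "wchain (P S) f3"
    unfolding f1_def seg_def f3_def by (intro wchain_take wchain_drop ws(1))+
  have ends: "last f1 = z" "hd seg = z" "last seg = w" "hd f3 = w"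
    using ws(2) last_slice[of 0 m ws] last_slice[of m ?d ws] unfolding f1_def seg_def f3_def z_def w_def
    by (auto simp: hd_drop_conv_nth drop_take)
  have zw: "(z, w) \<in> P S" unfolding z_def w_def using ws(2) by (intro wchain_nth[OF r ws(1)]) auto
  have f1z: "(y, z) \<in> P S" if "y \<in> set f1" for y using wchain_last[OF r wc(1) that] ends by simp
  have segz: "(z, y) \<in> P S" "(y, w) \<in> P S" if "y \<in> set seg" for y
    using wchain_hd[OF r wc(2) that] wchain_last[OF r wc(2) that] ends by auto
  have f3w: "(w, y) \<in> P S" if "y \<in> set f3" for y using wchain_hd[OF r wc(3) that] ends by simp
  let ?F = "mcup (pieces (map (fr \<pi>') L))" and ?R = "mcup (pieces (map (re \<pi>') L))"
  have segs: "take (Suc ?d) (drop m ws) = seg" "drop ?d (drop m ws) = f3"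
    using ws(2) by (auto simp: seg_def f3_def drop_take add.commute)
  have nes: "f1 \<noteq> []" "seg \<noteq> []" "f3 \<noteq> []" using lens by auto
  have hdd: "hd (drop m ws) = z" using ws(2) by (simp add: z_def hd_drop_conv_nth)
  \<comment> \<open>Only the position of \<open>z\<close> is tested here; that \<open>w\<close> lies
    over \<pi>' has to be deduced from the factors.\<close>
  have LHS: "rhof S m \<pi> p (mcup (pieces (map (fr \<pi>') L @ map (re \<pi>') L))) ws =
      (if a S z = \<pi> then p (map (phi S z) f1) * (?F (map (psi S z) seg) * ?R (map (psi S z) f3)) else 0)"
    unfolding rhof_def cup_def[of m] front_def rear_def f1_def[symmetric] ends(1) hdd pieces_simps mcup_append tdeg_pieces
    unfolding cup_def take_map drop_map segs by simp
  have lM: "last (take (Suc ?M) ws) = w" using ws(2) last_slice[of 0 ?M ws] by (simp add: w_def)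
  have tf: "take (Suc m) (take (Suc ?M) ws) = f1" by (simp add: f1_def)
  have RHS: "rhof S ?M \<pi>' (rhof ?X m ?\<rho> (tr (blk ` \<pi>) (blk_restr \<pi>') p) (mcup (pieces (map (bl \<pi>') L)))) K ws =
      (if a S w = \<pi>' \<and> a ?X (phi S w z) = ?\<rho>
       then tr (blk ` \<pi>) (blk_restr \<pi>') p (map (phi ?X (phi S w z)) (map (phi S w) f1)) *
         (mcup (pieces (map (bl \<pi>') L)) (map (psi ?X (phi S w z)) (map (phi S w) seg)) * K (map (psi S w) f3)) else 0)"
    for K :: "('a hfs set \<Rightarrow> 'p) list \<Rightarrow> 'k"
    unfolding rhof_def cup_def[of ?M] front_def[of S] rear_def[of S] lM f3_def[symmetric] ends(4)
    unfolding cup_def take_map drop_map tf seg_def[symmetric] front_def rear_def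
    using nes by (simp add: last_map hd_map ends mult.assoc del: map_map)
  have a_z: "(a S z, a S w) \<in> partition_poset S" using a_refines[OF S zw] by (simp add: partition_poset_def)
  \<comment> \<open>The element \<open>phi S w z\<close> lies over the partition of \<pi>' induced
    by \<open>a S z\<close>, and this determines \<open>a S z\<close>.\<close>
  have iff: "a ?X (phi S w z) = ?\<rho> \<longleftrightarrow> a S z = \<pi>" if aw: "a S w = \<pi>'"
  proof -
    have e: "a ?X (phi S w z) = (\<lambda>T. blk ` restr \<pi>' T) ` a S z" using a_phi[OF S zw] aw by (simp add: phi_part_def)
    have sub: "\<alpha> \<subseteq> \<beta>" if ab: "(\<alpha>, \<pi>') \<in> partition_poset S" "(\<beta>, \<pi>') \<in> partition_poset S"
      "(\<lambda>T. blk ` restr \<pi>' T) ` \<alpha> = (\<lambda>T. blk ` restr \<pi>' T) ` \<beta>" for \<alpha> \<beta>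
    proof
      fix T assume T: "T \<in> \<alpha>"
      have "blk ` restr \<pi>' T \<in> (\<lambda>T. blk ` restr \<pi>' T) ` \<beta>" unfolding ab(3)[symmetric] using T by (rule imageI)
      then obtain U where U: "U \<in> \<beta>" "blk ` restr \<pi>' T = blk ` restr \<pi>' U" by (rule imageE)
      then show "T \<in> \<beta>" using blk_restr_inj[OF S ab(1,2) T U] by simp
    qed
    show ?thesis unfolding e
    proof
      assume h: "(\<lambda>T. blk ` restr \<pi>' T) ` a S z = ?\<rho>"
      show "a S z = \<pi>" by (rule equalityI[OF sub[OF a_z[unfolded aw] ref h] sub[OF ref a_z[unfolded aw] h[symmetric]]])
    qed simp
  qed
  show ?thesis
  proof (cases "a S z = \<pi>")
    case False
    then show ?thesis unfolding LHS RHS using iff by auto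
  next
    case az: True
    define C where "C = {us. wchain (P S) us \<and> set us \<subseteq> {y. (z, y) \<in> P S}}"
    have QC: "wchain (prod_family P \<pi>) (map (psi S z) us)" if "us \<in> C" for us
      using that psi_mono[OF S, of z] unfolding az[symmetric] C_def by (intro wchain_map[OF _ _ r]) auto
    have segC: "seg \<in> C" "f3 \<in> C" using wc segz f3w fp_trans[OF r zw] by (auto simp: C_def)
    have avT: "a T (psi S z w T) = restr (a S w) T" if "T \<in> \<pi>" for T
      using fun_cong[OF a_psi[OF S zw], of T] that az by (simp add: psi_part_def)
    show ?thesis
    proof (cases "a S w = \<pi>'")
      case False
      \<comment> \<open>If both factors were nonzero, the lower ones would put each coordinate of
        \<open>psi S z w\<close> above the fibre and the upper ones below it. By
        \<open>Dn_Up\<close> the partition \<open>a S w\<close> would then agree with \<pi>' inside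
        every block of \<pi>.\<close>
      have "?F (map (psi S z) seg) = 0 \<or> ?R (map (psi S z) f3) = 0"
      proof (rule ccontr)
        assume "\<not> ?thesis"
        then have nz: "?F (map (psi S z) seg) \<noteq> 0" "?R (map (psi S z) f3) \<noteq> 0" by auto
        have "restr (a S w) T = restr \<pi>' T" if T: "T \<in> \<pi>" for T
        proof -
          have li: "last_in (map (fr \<pi>') L) T (Up T)" and hi: "hd_in (map (re \<pi>') L) T (Dn T)"
            using fr_conds(2)[OF g, of T] re_conds(2)[OF g, of T] T c by auto
          have "last (map (psi S z) seg) T \<in> Up T"
            by (rule last_in_mcup[OF S part(1) li T Up_up QC[OF segC(1)] _ nz(1)]) (simp_all add: lens)
          moreover have "hd (map (psi S z) f3) T \<in> Dn T"
            by (rule hd_in_mcup[OF S part(1) hi T Dn_down QC[OF segC(2)] _ nz(2)]) (simp_all add: lens)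
          ultimately have "a T (psi S z w T) = restr \<pi>' T"
            using Dn_Up[OF T] nes ends by (simp add: last_map hd_map)
          then show ?thesis using avT[OF T] by simp
        qed
        then have "a S w = \<pi>'" using refines_restr_eq[OF a_z[unfolded az] ref] by blast
        then show False using False by simp
      qed
      then show ?thesis unfolding LHS RHS using False by auto
    next
      case aw: True
      have avT': "a T (psi S z w T) = restr \<pi>' T" if "T \<in> \<pi>" for T using avT[OF that] aw by simp
      have fT: "fin_obj T" if "T \<in> \<pi>" for T by (rule fin_obj_block[OF S part(1) that])
      have coord: "wchain (P T) (map (\<lambda>y. psi S z y T) us)" if "us \<in> C" "T \<in> \<pi>" for us T
        using coord_wchain[OF S part(1) that(2) QC[OF that(1)]] by (simp add: comp_def)
      \<comment> \<open>Segment below \<open>z\<close>: \<open>assoc_phi\<close>, with the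
        relabelling of blocks undone by \<open>tr\<close>.\<close>
      have p_eq: "tr (blk ` \<pi>) (blk_restr \<pi>') p (map (phi ?X (phi S w z)) (map (phi S w) f1)) = p (map (phi S z) f1)"
      proof -
        note inj = inj_blk_restr[OF S ref]
        have "pmap (blk_restr \<pi>' ` blk ` \<pi>) (inv_into (blk ` \<pi>) (blk_restr \<pi>')) (phi ?X (phi S w z) (phi S w y)) = phi S z y"
          if y: "y \<in> set f1" for y
        proof -
          have "phi ?X (phi S w z) (phi S w y) = pmap (blk ` \<pi>) (blk_restr \<pi>') (phi S z y)"
            using assoc_phi[OF S zw f1z[OF y]] az aw by simp
          then show ?thesis
            using pmap_inv_left[OF fin_obj_partition[OF S part(1)] inj] phi_Field[OF S f1z[OF y]] az by simp
        qed
        then have "map (pmap (blk_restr \<pi>' ` blk ` \<pi>) (inv_into (blk ` \<pi>) (blk_restr \<pi>')))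
            (map (phi ?X (phi S w z)) (map (phi S w) f1)) = map (phi S z) f1" by simp
        then show ?thesis unfolding tr_def by (rule arg_cong)
      qed
      \<comment> \<open>Segment between \<open>z\<close> and \<open>w\<close>:
        \<open>assoc_phi_psi\<close>, after \<open>front_eq\<close> has moved \<open>phi\<close> to
        the coordinate of \<open>psi S z w\<close>.\<close>
      have F_eq: "?F (map (psi S z) seg) = mcup (pieces (map (bl \<pi>') L)) (map (psi ?X (phi S w z)) (map (phi S w) seg))"
        unfolding map_map
      proof (rule mcup_all2[where C = "{us. wchain (P S) us \<and> set us \<subseteq> set seg}"])
        show "list_all2 (\<lambda>(n, f) (m, g). n = m \<and> (\<forall>us\<in>{us. wchain (P S) us \<and> set us \<subseteq> set seg}. length us = Suc n \<longrightarrow>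
            f (map (psi S z) us) = g (map (psi ?X (phi S w z) \<circ> phi S w) us))) (pieces (map (fr \<pi>') L)) (pieces (map (bl \<pi>') L))"
          unfolding pieces_def map_map
        proof (rule list_all2_mapI)
          fix e assume "e \<in> set L"
          moreover obtain T n q vs where e: "e = (T, n, q, vs)" by (cases e)
          ultimately have mem: "(T, n, q, vs) \<in> set L" by simp
          note gm = good_mem[OF g mem]
          have "front T (restr \<pi>' T) q (map (\<lambda>g. g T) (map (psi S z) us)) =
              q (map (\<lambda>g. g (blk ` restr \<pi>' T)) (map (psi ?X (phi S w z) \<circ> phi S w) us))"
            if us: "wchain (P S) us" "set us \<subseteq> set seg" "length us = Suc n" for us
          proof -
            have usC: "us \<in> C" using us segz by (auto simp: C_def)
            have ne: "us \<noteq> []" using us(3) by auto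
            have "last us \<in> set seg" using ne us(2) last_in_set by blast
            then have le: "(z, last us) \<in> P S" "(last us, w) \<in> P S" using segz by auto
            have "(psi S z (last us) T, psi S z w T) \<in> P T"
              using psi_mono[OF S le] az gm(1) by (simp add: prod_family_iff)
            then have "front T (restr \<pi>' T) q (map (\<lambda>y. psi S z y T) us) = q (map (phi T (psi S z w T)) (map (\<lambda>y. psi S z y T) us))"
              using us(3) ne by (intro front_eq[OF fT[OF gm(1)] gm(2) coord[OF usC gm(1)] _ _ avT'[OF gm(1)]]) (simp_all add: last_map)
            also have "\<dots> = q (map (\<lambda>g. g (blk ` restr \<pi>' T)) (map (psi ?X (phi S w z) \<circ> phi S w) us))"
            proof (rule arg_cong[where f = q], unfold map_map, rule map_cong[OF refl])
              fix y assume "y \<in> set us"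
              then have y: "(z, y) \<in> P S" "(y, w) \<in> P S" using us(2) segz by auto
              show "(phi T (psi S z w T) \<circ> (\<lambda>y. psi S z y T)) y =
                  ((\<lambda>g. g (blk ` restr \<pi>' T)) \<circ> (psi ?X (phi S w z) \<circ> phi S w)) y"
                using assoc_phi_psi[OF S y, of T] gm(1) az aw by simp
            qed
            finally show ?thesis by (simp add: comp_def)
          qed
          then show "(case ((\<lambda>(T, d, y). (d, \<lambda>ws. y (map (\<lambda>g. g T) ws))) \<circ> fr \<pi>') e of (n, f) \<Rightarrow>
              \<lambda>(m, g). n = m \<and> (\<forall>us\<in>{us. wchain (P S) us \<and> set us \<subseteq> set seg}. length us = Suc n \<longrightarrow>
              f (map (psi S z) us) = g (map (psi ?X (phi S w z) \<circ> phi S w) us)))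
              (((\<lambda>(T, d, y). (d, \<lambda>ws. y (map (\<lambda>g. g T) ws))) \<circ> bl \<pi>') e)"
            by (simp add: e fr_def bl_def)
        qed
      next
        show "seg \<in> {us. wchain (P S) us \<and> set us \<subseteq> set seg}" using wc(2) by simp
        show "length seg = Suc (tdeg (pieces (map (fr \<pi>') L)))" unfolding tdeg_pieces by (rule lens(2))
      qed (rule wchain_closed)
      \<comment> \<open>Segment above \<open>w\<close>: \<open>assoc_psi\<close>, after
        \<open>rear_eq\<close>. The factors are grouped by the blocks of \<pi> on the left and form
        one long list on the right.\<close>
      have R_eq: "?R (map (psi S z) f3) = mcup (pieces (concat (map (\<lambda>(T, n, q, vs). vs) L))) (map (psi S w) f3)"
        unfolding pieces_concat mcup_concat map_map
      proof (rule mcup_all2[where C = "{us. wchain (P S) us \<and> set us \<subseteq> set f3}"])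
        show "list_all2 (\<lambda>(n, f) (m, g). n = m \<and> (\<forall>us\<in>{us. wchain (P S) us \<and> set us \<subseteq> set f3}. length us = Suc n \<longrightarrow>
            f (map (psi S z) us) = g (map (psi S w) us))) (pieces (map (re \<pi>') L))
            (map ((\<lambda>fs. (tdeg fs, mcup fs)) \<circ> (pieces \<circ> (\<lambda>(T, n, q, vs). vs))) L)"
          unfolding pieces_def[of "map (re \<pi>') L"] map_map
        proof (rule list_all2_mapI)
          fix e assume "e \<in> set L"
          moreover obtain T n q vs where e: "e = (T, n, q, vs)" by (cases e)
          ultimately have mem: "(T, n, q, vs) \<in> set L" by simp
          note gm = good_mem[OF g mem]
          have "rear T (restr \<pi>' T) (mcup (pieces vs)) (map (\<lambda>g. g T) (map (psi S z) us)) = mcup (pieces vs) (map (psi S w) us)"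
            if us: "wchain (P S) us" "set us \<subseteq> set f3" "length us = Suc (deg vs)" for us
          proof -
            have usw: "(w, y) \<in> P S" if "y \<in> set us" for y using that us(2) f3w by auto
            then have usC: "us \<in> C" using us(1) fp_trans[OF r zw] by (auto simp: C_def)
            have ne: "us \<noteq> []" using us(3) by auto
            then have le: "(w, hd us) \<in> P S" using usw by simp
            have "(psi S z w T, psi S z (hd us) T) \<in> P T"
              using psi_mono[OF S zw le] az gm(1) by (simp add: prod_family_iff)
            then have "rear T (restr \<pi>' T) (mcup (pieces vs)) (map (\<lambda>y. psi S z y T) us) =
                mcup (pieces vs) (map (psi T (psi S z w T)) (map (\<lambda>y. psi S z y T) us))"
              using us(3) ne
              by (intro rear_eq[OF fT[OF gm(1)] cocycle_mcup[OF gm] coord[OF usC gm(1)] _ _ avT'[OF gm(1)]]) (simp_all add: hd_map)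
            also have "\<dots> = mcup (pieces vs) (map (\<lambda>y. psi T (psi S z w T) (psi S z y T)) us)" by (simp add: comp_def)
            also have "\<dots> = mcup (pieces vs) (map (psi S w) us)"
            proof -
              \<comment> \<open>The axiom only speaks of blocks inside \<open>T\<close>; restricting
                both tuples to these is harmless, as the factors in \<open>vs\<close> read no
                others.\<close>
              have "map (\<lambda>y. restrict (psi T (psi S z w T) (psi S z y T)) (restr \<pi>' T)) us =
                  map (\<lambda>y. restrict (psi S w y) (restr \<pi>' T)) us"
              proof (rule map_cong[OF refl])
                fix y assume y: "y \<in> set us"
                show "restrict (psi T (psi S z w T) (psi S z y T)) (restr \<pi>' T) = restrict (psi S w y) (restr \<pi>' T)"
                  by (rule restrict_ext) (use assoc_psi[OF S zw usw[OF y], of T] gm(1) az aw in simp)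
              qed
              moreover have "mcup (pieces vs) (map h us) = mcup (pieces vs) (map (\<lambda>y. restrict (h y) (restr \<pi>' T)) us)" for h
                using gm(3) by (intro mcup_pieces_map) (auto simp: tens_def)
              ultimately show ?thesis by metis
            qed
            finally show ?thesis by (simp add: comp_def)
          qed
          then show "(case ((\<lambda>(T, d, y). (d, \<lambda>ws. y (map (\<lambda>g. g T) ws))) \<circ> re \<pi>') e of (n, f) \<Rightarrow>
              \<lambda>(m, g). n = m \<and> (\<forall>us\<in>{us. wchain (P S) us \<and> set us \<subseteq> set f3}. length us = Suc n \<longrightarrow>
              f (map (psi S z) us) = g (map (psi S w) us)))
              (((\<lambda>fs. (tdeg fs, mcup fs)) \<circ> (pieces \<circ> (\<lambda>(T, n, q, vs). vs))) e)"
            by (simp add: e re_def tdeg_pieces)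
        qed
      next
        show "f3 \<in> {us. wchain (P S) us \<and> set us \<subseteq> set f3}" using wc(3) by simp
        show "length f3 = Suc (tdeg (pieces (map (re \<pi>') L)))" unfolding tdeg_pieces by (rule lens(3))
      qed (rule wchain_closed)
      show ?thesis unfolding LHS RHS using az aw iff p_eq F_eq R_eq by simp
    qed
  qed
qed

end

section \<open>Associativity in cohomology\<close>

definition to_rep where
  "to_rep \<pi>' e = (case e of (T, n, q, vs) \<Rightarrow> (T, n, cls (P (blk ` restr \<pi>' T)) n q, to_cls P vs))"

lemma to_rep_sel:
  "fst (to_rep \<pi>' e) = fst e" "fst (snd (to_rep \<pi>' e)) = fst (snd e)"
  "deg (snd (snd (snd (to_rep \<pi>' e)))) = deg (snd (snd (snd e)))"
  by (cases e; simp add: to_rep_def deg_to_cls)+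

lemma assoc_reps:
  assumes S: "fin_obj S" and ref: "(\<pi>, \<pi>') \<in> partition_poset S"
    and L: "\<And>T n q us. (T, n, q, us) \<in> set L \<Longrightarrow> T \<in> \<pi> \<and>
      q \<in> carrier (coh_species P (blk ` restr \<pi>' T) n :: ('k::{comm_ring,comm_monoid_mult}, ('p list \<Rightarrow>\<^sub>0 'k) set) module) \<and>
      is_tensor (coh_species P) (restr \<pi>' T) us"
  shows "\<exists>K. L = map (to_rep \<pi>') K \<and> good \<pi> \<pi>' K"
  using L
proof (induction L)
  case Nil
  then show ?case by (simp add: good_def[OF S ref])
next
  case (Cons e L)
  obtain T n q us where e: "e = (T, n, q, us)" by (cases e)
  obtain K where K: "L = map (to_rep \<pi>') K" "good \<pi> \<pi>' K"
    using Cons.IH Cons.prems by (meson list.set_intros(2))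
  have h: "T \<in> \<pi>" "q \<in> carrier (coh_species P (blk ` restr \<pi>' T) n)" "is_tensor (coh_species P) (restr \<pi>' T) us"
    using Cons.prems[of T n q us] e by auto
  note fT = fin_obj_block[OF S refines_partition(1)[OF ref] h(1)]
  note pT = restr_partition[OF ref h(1)]
  obtain u where u: "cocycle (P (blk ` restr \<pi>' T)) n u" "q = cls (P (blk ` restr \<pi>' T)) n u"
    using h(2) carrier_cohom_iff[OF P_poset[OF fin_obj_partition[OF fT pT]], of q n] by (auto simp: coh_species_def)
  obtain vs where vs: "us = to_cls P vs" "tens (restr \<pi>' T) vs" using tensor_reps[OF fT pT h(3)] .
  have "e # L = map (to_rep \<pi>') ((T, n, u, vs) # K)" by (simp add: e K(1) to_rep_def u(2) vs(1))
  moreover have "good \<pi> \<pi>' ((T, n, u, vs) # K)" using K(2) h(1) u(1) vs(2) by (auto simp: good_def[OF S ref])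
  ultimately show ?case by (intro exI conjI)
qed

lemma deg_re_concat: "deg (concat (map (\<lambda>(T, n, q, vs). vs) K)) = deg (map (re \<pi>') K)"
proof (induction K)
  case (Cons e K)
  then show ?case by (cases e) (simp add: re_def)
qed simp

lemma deg_bl: "deg (map (bl \<pi>') K) = deg (map (fr \<pi>') K)"
proof (induction K)
  case (Cons e K)
  then show ?case by (cases e) (simp add: bl_def fr_def)
qed simp

lemma tens_concat:
  assumes S: "fin_obj S" and ref: "(\<pi>, \<pi>') \<in> partition_poset S"
    and g: "good \<pi> \<pi>' K" and K: "distinct (map fst K)" "set (map fst K) = \<pi>"
  shows "tens \<pi>' (concat (map (\<lambda>(T, n, q, vs). vs) K))"
proof -
  have gm: "T \<in> \<pi>" "tens (restr \<pi>' T) vs" if "(T, n, q, vs) \<in> set K" for T n q vs using good_mem[OF S ref g that] by auto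
  have "distinct (map fst (concat (map (\<lambda>(T, n, q, vs). vs) K))) \<and>
      set (map fst (concat (map (\<lambda>(T, n, q, vs). vs) K))) = (\<Union>T\<in>set (map fst K). restr \<pi>' T)"
    using gm K(1)
  proof (induction K)
    case (Cons e K)
    obtain T n q vs where e: "e = (T, n, q, vs)" by (cases e)
    have IH: "distinct (map fst (concat (map (\<lambda>(T, n, q, vs). vs) K))) \<and>
        set (map fst (concat (map (\<lambda>(T, n, q, vs). vs) K))) = (\<Union>T\<in>set (map fst K). restr \<pi>' T)"
    proof (rule Cons.IH)
      fix T n q vs assume k: "(T, n, q, vs) \<in> set K"
      show "T \<in> \<pi>" "tens (restr \<pi>' T) vs" using Cons.prems(1,2)[OF list.set_intros(2)[OF k]] by blast+
    qed (use Cons.prems(3) in simp)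
    have h: "T \<in> \<pi>" "distinct (map fst vs)" "set (map fst vs) = restr \<pi>' T"
      using Cons.prems(1,2)[of T n q vs] e by (auto simp: tens_def)
    have "restr \<pi>' T \<inter> restr \<pi>' U = {}" if U: "U \<in> set (map fst K)" for U
    proof (rule restr_disjoint[OF ref h(1)])
      show "T \<noteq> U" using Cons.prems(3) U e by auto
      obtain k u us where "(U, k, u, us) \<in> set K" using ex_mem[OF S ref U] by blast
      then show "U \<in> \<pi>" using Cons.prems(1)[of U k u us] by simp
    qed
    then have "restr \<pi>' T \<inter> (\<Union>T\<in>set (map fst K). restr \<pi>' T) = {}" by blast
    then show ?case using h(2,3) IH unfolding e list.map concat.simps prod.case map_append distinct_append set_append fst_conv list.set
      by simp
  qed simp
  moreover have "\<forall>(T, d, y)\<in>set (concat (map (\<lambda>(T, n, q, vs). vs) K)). cocycle (P T) d y"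
  proof
    fix x assume "x \<in> set (concat (map (\<lambda>(T, n, q, vs). vs) K))"
    then obtain T n q vs where k: "(T, n, q, vs) \<in> set K" "x \<in> set vs" by auto
    then show "case x of (T, d, y) \<Rightarrow> cocycle (P T) d y" using gm(2)[OF k(1)] unfolding tens_def by blast
  qed
  ultimately show ?thesis unfolding tens_def K(2) Union_restr_image[OF ref] by blast
qed

text \<open>The interchange takes place on the product over the blocks of \<pi>, inside the Kuenneth
  class on the left-hand side, and its sign is carried out by \<open>rho_scaled\<close>. What is
  left is compared chain by chain.\<close>

lemma rho_associative:
  assumes S: "fin_obj S" and ref: "(\<pi>, \<pi>') \<in> partition_poset S"
    and p: "p \<in> carrier (coh_species P (blk ` \<pi>) m :: ('k::{comm_ring,comm_monoid_mult}, ('p list \<Rightarrow>\<^sub>0 'k) set) module)"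
    and L: "distinct (map fst L)" "set (map fst L) = \<pi>"
    and mem: "\<And>T n q us. (T, n, q, us) \<in> set L \<Longrightarrow>
      q \<in> carrier (coh_species P (blk ` restr \<pi>' T) n) \<and> is_tensor (coh_species P) (restr \<pi>' T) us"
  shows "coh_rho P a phi psi S m p (map (\<lambda>(T, n, q, us). (T, n + deg us, coh_rho P a phi psi T n q us)) L) =
    (- 1) ^ (\<Sum>j<length L. \<Sum>i<j. fst (snd (L ! j)) * deg (snd (snd (snd (L ! i)))))
      \<odot>\<^bsub>coh_species P S (m + (\<Sum>(T, n, q, us)\<leftarrow>L. n + deg us))\<^esub>
      coh_rho P a phi psi S (m + (\<Sum>(T, n, q, us)\<leftarrow>L. n))
        (coh_rho P a phi psi (blk ` \<pi>') m (coh_act P pmap (blk ` \<pi>) (blk_restr \<pi>') m p)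
          (map (\<lambda>(T, n, q, us). (blk ` restr \<pi>' T, n, q)) L))
        (concat (map (\<lambda>(T, n, q, us). us) L))"
proof -
  note pt = refines_partition[OF ref]
  note r = P_poset[OF S]
  note fB = fin_obj_partition[OF S pt(1)] and fB' = fin_obj_partition[OF S pt(2)]
  let ?\<rho> = "(\<lambda>T. blk ` restr \<pi>' T) ` \<pi>"
  have "T \<in> \<pi>" if "(T, n, q, us) \<in> set L" for T n q us using L(2) image_eqI[OF _ that, of T fst] by simp
  then obtain K where K: "L = map (to_rep \<pi>') K" "good \<pi> \<pi>' K" using assoc_reps[OF S ref, of L] mem by blast
  have fst_eq: "map fst L = map fst K" by (simp add: K(1) to_rep_sel(1))
  note dist = L(1)[unfolded fst_eq] and cover = L(2)[unfolded fst_eq]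
  obtain p' where p': "cocycle (P (blk ` \<pi>)) m p'" "p = cls (P (blk ` \<pi>)) m p'"
    using p carrier_cohom_iff[OF P_poset[OF fB], of p m] by (auto simp: coh_species_def)
  note gm = good_mem[OF S ref K(2)]
  have memT: "T \<in> \<pi>" "fin_obj T" "partition_on T (restr \<pi>' T)" "cocycle (P (blk ` restr \<pi>' T)) n q" "tens (restr \<pi>' T) vs"
    if "(T, n, q, vs) \<in> set K" for T n q vs
    using gm[OF that] fin_obj_block[OF S pt(1)] restr_partition[OF ref] by auto
  let ?F = "map (fr \<pi>') K" and ?R = "map (re \<pi>') K"
  let ?G = "mcup (pieces (?F @ ?R))" and ?N = "deg (map (pa \<pi>') K)"

  have Lout: "map (\<lambda>(T, n, q, us). (T, n + deg us, coh_rho P a phi psi T n q us)) L = to_cls P (map (pa \<pi>') K)"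
    unfolding K(1) to_cls_def map_map
  proof (rule map_cong[OF refl])
    fix e assume "e \<in> set K"
    moreover obtain T n q vs where e: "e = (T, n, q, vs)" by (cases e)
    ultimately have k: "(T, n, q, vs) \<in> set K" by simp
    show "((\<lambda>(T, n, q, us). (T, n + deg us, coh_rho P a phi psi T n q us)) \<circ> to_rep \<pi>') e =
        ((\<lambda>(T, d, y). (T, d, cls (P T) d y)) \<circ> pa \<pi>') e"
      using rho_tens(1)[OF memT(2,3,4,5)[OF k]] by (simp add: e to_rep_def pa_def deg_to_cls)
  qed
  have tpa: "tens \<pi> (map (pa \<pi>') K)"
    unfolding tens_def
  proof (intro conjI)
    have "map fst (map (pa \<pi>') K) = map fst K" by (simp add: pa_def split_def)
    then show "distinct (map fst (map (pa \<pi>') K))" "set (map fst (map (pa \<pi>') K)) = \<pi>"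
      using dist cover by (simp_all del: map_map set_map)
    show "\<forall>(T, d, y)\<in>set (map (pa \<pi>') K). cocycle (P T) d y"
    proof
      fix e assume "e \<in> set (map (pa \<pi>') K)"
      then obtain T n q vs where k: "(T, n, q, vs) \<in> set K" "e = pa \<pi>' (T, n, q, vs)" by auto
      then show "case e of (T, d, y) \<Rightarrow> cocycle (P T) d y" using cocycle_pair[OF S ref gm[OF k(1)]] by (simp add: pa_def)
    qed
  qed
  note sp = split_cls[OF S ref K(2) cover tpa]
  have "kunneth P (to_cls P (map (pa \<pi>') K)) = cls (prod_family P \<pi>) ?N (\<lambda>ws. (- 1) ^ \<sigma> K * ?G ws)"
    using kunneth_tens(1)[OF S pt(1) tpa] sp(1) by simp
  then have LHS: "coh_rho P a phi psi S m p (to_cls P (map (pa \<pi>') K)) =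
      (- 1) ^ \<sigma> K \<odot>\<^bsub>cohom (P S) (m + ?N)\<^esub> cls (P S) (m + ?N) (rhof S m \<pi> p' ?G)"
    unfolding p'(2)
    using rho_scaled[OF S pt(1) p'(1), of "to_cls P (map (pa \<pi>') K)" ?G "(- 1) ^ \<sigma> K"] sp(2) tpa
    by (simp add: deg_to_cls map_fst_to_cls tens_def del: set_map)

  have Lin: "map (\<lambda>(T, n, q, us). (blk ` restr \<pi>' T, n, q)) L = to_cls P (map (bl \<pi>') K)"
    unfolding K(1) to_cls_def map_map
    by (rule map_cong[OF refl]) (simp add: to_rep_def bl_def split_def)
  have tbl: "tens ?\<rho> (map (bl \<pi>') K)"
    unfolding tens_def
  proof (intro conjI)
    have m: "map fst (map (bl \<pi>') K) = map (\<lambda>T. blk ` restr \<pi>' T) (map fst K)" by (simp add: bl_def split_def)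
    have "inj_on (\<lambda>T. blk ` restr \<pi>' T) \<pi>" by (rule inj_onI) (rule blk_restr_inj[OF S ref ref])
    then show "distinct (map fst (map (bl \<pi>') K))" unfolding m using dist cover by (simp add: distinct_map del: map_map set_map)
    show "set (map fst (map (bl \<pi>') K)) = ?\<rho>" unfolding m using cover by (simp only: set_map)
    show "\<forall>(T, d, y)\<in>set (map (bl \<pi>') K). cocycle (P T) d y"
    proof
      fix e assume "e \<in> set (map (bl \<pi>') K)"
      then obtain T n q vs where k: "(T, n, q, vs) \<in> set K" "e = bl \<pi>' (T, n, q, vs)" by auto
      then show "case e of (T, d, y) \<Rightarrow> cocycle (P T) d y" using gm(2)[OF k(1)] by (simp add: bl_def)
    qed
  qed
  have im: "blk_restr \<pi>' ` blk ` \<pi> = blk ` ?\<rho>"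
  proof -
    have "blk_restr \<pi>' (blk T) = blk (blk ` restr \<pi>' T)" if "T \<in> \<pi>" for T
      using fin_obj_block[OF S pt(1) that] by (intro blk_restr_blk) (simp add: fin_obj_def)
    then show ?thesis unfolding image_image by (rule image_cong[OF refl])
  qed
  note ac = act_cls[OF fB inj_blk_restr[OF S ref] p'(1), unfolded im]
  note inner = rho_tens[OF fB' partition_on_blk_restr[OF S ref] ac(2) tbl]
  have Lcat: "concat (map (\<lambda>(T, n, q, us). us) L) = to_cls P (concat (map (\<lambda>(T, n, q, vs). vs) K))"
    unfolding K(1) to_cls_def map_concat map_map
    by (rule arg_cong[where f = concat], rule map_cong[OF refl]) (simp add: to_rep_def to_cls_def split_def)
  have tcat: "tens \<pi>' (concat (map (\<lambda>(T, n, q, vs). vs) K))"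
    using tens_concat[OF S ref K(2) dist cover] .
  note outer = rho_tens[OF S pt(2) inner(2) tcat]
  have RHS: "coh_rho P a phi psi S (m + deg (map (bl \<pi>') K))
      (coh_rho P a phi psi (blk ` \<pi>') m (coh_act P pmap (blk ` \<pi>) (blk_restr \<pi>') m p) (to_cls P (map (bl \<pi>') K)))
      (to_cls P (concat (map (\<lambda>(T, n, q, vs). vs) K))) = cls (P S) (m + ?N) (rhof S m \<pi> p' ?G)"
    unfolding p'(2) ac(1) inner(1) unfolding outer(1)
    \<comment> \<open>The two sides record the total degree in different groupings; they have to
      coincide before the classes can be compared in one module.\<close>
    unfolding deg_bl[of \<pi>' K] deg_re_concat[of K \<pi>'] sp(3) add.assoc
  proof (rule cls_cong[OF r])
    fix ws assume ws: "ws \<in> end_chains (P S)" "length ws = Suc (m + (deg ?F + deg ?R))"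
    then show "rhof S (m + deg ?F) \<pi>' (rhof (blk ` \<pi>') m ?\<rho> (tr (blk ` \<pi>) (blk_restr \<pi>') p') (mcup (pieces (map (bl \<pi>') K))))
        (mcup (pieces (concat (map (\<lambda>(T, n, q, vs). vs) K)))) ws = rhof S m \<pi> p' ?G ws"
      using chain_level_assoc[OF S ref K(2) cover, of ws m p'] by (simp add: end_chains_iff add.assoc)
  qed

  have d1: "(\<Sum>(T, n, q, us)\<leftarrow>L. n) = deg (map (bl \<pi>') K)"
    unfolding K(1) deg_def map_map by (rule arg_cong[where f = sum_list]) (simp add: to_rep_def bl_def split_def)
  have d2: "(\<Sum>(T, n, q, us)\<leftarrow>L. n + deg us) = ?N"
    unfolding K(1) deg_def[of "map (pa \<pi>') K"] map_map
    by (rule arg_cong[where f = sum_list]) (simp add: to_rep_def pa_def deg_to_cls split_def)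
  have d3: "(\<Sum>j<length L. \<Sum>i<j. fst (snd (L ! j)) * deg (snd (snd (snd (L ! i))))) = \<sigma> K"
    unfolding \<sigma>_def K(1) by (intro sum.cong refl) (auto simp: to_rep_sel)
  show ?thesis unfolding Lout Lin Lcat d1 d2 d3 LHS RHS coh_species_def ..
qed

lemma operad:
  "graded_operad (coh_species P :: 'a hfs set \<Rightarrow> nat \<Rightarrow> ('k::{comm_ring,comm_monoid_mult}, ('p list \<Rightarrow>\<^sub>0 'k) set) module)
    (coh_act P pmap) (coh_rho P a phi psi) (coh_unit P)"
proof (rule graded_operad.intro[OF species], unfold_locales)
  fix s :: "'a hfs"
  have fs: "fin_obj {s}" by (simp add: fin_obj_def)
  show "coh_unit P s \<in> carrier (coh_species P {s} 0 :: ('k, ('p list \<Rightarrow>\<^sub>0 'k) set) module)"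
    unfolding coh_species_def unit_cls(1) by (rule cls_carrier[OF P_poset[OF fs] unit_cls(2)])
qed (fact rho_left rho_right rho_symm rho_equi unit_equi unit_l unit_r | (rule rho_associative; assumption))+

end

theorem theorem2p8:
  fixes P :: "'a hfs set \<Rightarrow> 'p rel"
    and pmap :: "'a hfs set \<Rightarrow> ('a hfs \<Rightarrow> 'a hfs) \<Rightarrow> 'p \<Rightarrow> 'p"
    and a :: "'a hfs set \<Rightarrow> 'p \<Rightarrow> 'a hfs set set"
    and phi :: "'a hfs set \<Rightarrow> 'p \<Rightarrow> 'p \<Rightarrow> 'p"
    and psi :: "'a hfs set \<Rightarrow> 'p \<Rightarrow> 'p \<Rightarrow> ('a hfs set \<Rightarrow> 'p)"
  assumes "operadic_poset_species P pmap a phi psi"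
    and "pullbacks_defined P a phi psi"
    and "unit_normalised P pmap phi psi"
  shows "graded_operad
    (coh_species P :: 'a hfs set \<Rightarrow> nat \<Rightarrow>
       ('k::{comm_ring,comm_monoid_mult}, ('p list \<Rightarrow>\<^sub>0 'k) set) module)
    (coh_act P pmap) (coh_rho P a phi psi) (coh_unit P)"
proof -
  interpret normalised_species P pmap a phi psi
    using assms by (intro normalised_species.intro normalised_species_axioms.intro)
  show ?thesis by (rule operad)
qed

end
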